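(* Assume that $H$ is self-adjoint with its natural domain and that (A1), (A2) (see context) hold. Let $\mu$ be the spectral measure of $H$ at $P_0\Upsilon_0$ and let $\nu$ be the point measure defined in the context. (i) Suppose for some $p>1$ and $[a,b]\subset\mathbb R$ one finds measurable functions $\lambda\mapsto T^\lambda_{0,n}\in\mathbb T^\lambda_{0,n}$ and $\lambda\mapsto u_n(\lambda)\in\mathbb C$ ($\lambda\in[a,b]$) such that $$\liminf_{n\to\infty}\int_a^b\left\|T^\lambda_{0,n}\begin{pmatrix}u_n(\lambda)\\1\end{pmatrix}\right\|^{2p}d\lambda<\infty .$$ Then the positive measure $\mu-\nu$ restricted to $(a,b)$ is purely absolutely continuous with a density in $L^p(a,b)$. Hence $\mu$ is purely absolutely continuous in $(a,b)\setminus\liminf_nA^1_{0,n}$. (ii) Suppose for some $p>1$ and $[a,b]\subset\mathbb R$ one finds measurable functions $\lambda\mapsto T^\lambda_{0,n}\in\mathbb T^\lambda_{0,n}$ ($\lambda\in[a,b]$) such that $$\liminf_{n\to\infty}\int_a^b\|T^\lambda_{0,n}\|^{2p}\,d\lambda<\infty .$$ Then $[a,b]\subset\operatorname{supp}\mu_{ac}\subset\operatorname{spec}_{ac}(H)$ and the measure $\mu-\nu$ is purely absolutely continuous in $(a,b)$ with an $L^p$ density. Hence $\mu$ is purely absolutely continuous in $(a,b)\setminus\liminf_nA^1_{0,n}$ (and there is spectrum there).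
   Context: Setting. $\mathbb G$ is a countable set partitioned into finite nonempty shells, $\mathbb G=\bigsqcup_{n=0}^\infty S_n$, $s_n=\#S_n$. $H$ is a (possibly unbounded) symmetric operator on $\ell^2(\mathbb G)$ with locally finite hopping: it is given by a Hermitian matrix $\langle\delta_x,H\delta_y\rangle$ ($x,y\in\mathbb G$) with finitely many nonzero entries in each row, hence acts on all of $\mathbb C^{\mathbb G}$; moreover $\langle\delta_x,H\delta_y\rangle=0$ if $x\in S_j,\ y\in S_k$, $|j-k|\ge2$. The graph on $\mathbb G$ joining $x\ne y$ whenever $\langle\delta_x,H\delta_y\rangle\neq0$ is connected. Identify $\ell^2(S_n)=\mathbb C^{s_n}$. $V_n$ is the (Hermitian) $s_n\times s_n$ diagonal block of $H$ on $S_n$; for $n\ge1$, $W_n$ is the $s_n\times s_{n-1}$ block of $H$ from $\ell^2(S_{n-1})$ to $\ell^2(S_n)$ and $r_n=\operatorname{rank}W_n$. Fix factorizations $W_n=-\Upsilon_n\Phi_{n-1}^*$ with $\Upsilon_n\in\mathbb C^{s_n\times r_n}$, $\Phi_{n-1}\in\mathbb C^{s_{n-1}\times r_n}$ of full rank; set $r_0=1$ and fix a nonzero vector $\Upsilon_0\in\mathbb C^{s_0}$. $P_0:\ell^2(S_0)\hookrightarrow\ell^2(\mathbb G)$ is the canonical embedding. Boundary resolvent data. For $m\le n$ let $\mathbb G_{m,n}=\bigsqcup_{j=m}^nS_j$ and let $H_{m,n}$ be the compression of $H$ to $\ell^2(\mathbb G_{m,n})$. Let $\hat\Upsilon_m$,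 $\hat\Phi_n$ be $\Upsilon_m,\Phi_n$ with columns regarded (extended by zero) as vectors in $\ell^2(\mathbb G_{m,n})$. Set $$R^z_{m,n}=\begin{pmatrix}\hat\Upsilon_m^*\\ \hat\Phi_n^*\end{pmatrix}(H_{m,n}-z)^{-1}\begin{pmatrix}\hat\Upsilon_m&\hat\Phi_n\end{pmatrix}=\begin{pmatrix}\alpha^z_{m,n}&\beta^z_{m,n}\\ \gamma^z_{m,n}&\delta^z_{m,n}\end{pmatrix},$$ blocks of sizes $r_m\times r_m$, $r_m\times r_{n+1}$, $r_{n+1}\times r_m$, $r_{n+1}\times r_{n+1}$. This is a rational function of $z$, extended analytically across removable singularities; $A^1_{m,n}\subset\mathbb R$ is the (finite) set of points where it is not defined even after analytic extension; $\liminf_nA^1_{0,n}=\bigcup_{m\ge0}\bigcap_{n\ge m}A^1_{0,n}$. Put $\beta^z_n=\beta^z_{n,n}$. Assumptions. (A1): $r_{n+1}\ge r_n$ for all $n$. (A2): for all $n\ge0$ and almost all $\lambda\in\mathbb R$, the $r_n\times r_{n+1}$ matrix $\beta^\lambda_n$ has full rank $r_n$. Transfer matrices. $A_{m,n}=A^1_{m,n}\cup\{z\in\mathbb C:\operatorname{rank}\beta^z_{m,n}<r_m\}$ (a finite set). For $z\notin A_{m,n}$: $$\mathbb T^z_{m,n}=\left\{\begin{pmatrix}B&-b\\ \delta^z_{m,n}B&\gamma^z_{m,n}-\delta^z_{m,n}b\end{pmatrix}:B,b\in\mathbb C^{r_{n+1}\times r_m},\ \beta^z_{m,n}B=\mathbf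 1_{r_m},\ \beta^z_{m,n}b=\alpha^z_{m,n}\right\}.$$ Functions $\lambda\mapsto T^\lambda_{0,n}\in\mathbb T^\lambda_{0,n}$ are understood to be defined off the finite set $A_{0,n}$. Self-adjointness. $H$ is self-adjoint with its natural domain if the restriction $H_{min}$ of $H$ to finitely supported vectors is essentially self-adjoint; then $H$ denotes $H_{min}^*$, with domain $\{\psi\in\ell^2(\mathbb G):H\psi\in\ell^2(\mathbb G)\}$. The spectral measure $\mu$ is defined by $\int f\,d\mu=\langle P_0\Upsilon_0,f(H)P_0\Upsilon_0\rangle$; $\mu_{ac}$ is its absolutely continuous part; $\operatorname{spec}_{ac}(H)$ is the absolutely continuous spectrum as a closed set. The measure $\nu$: the point measure on $\mathbb R$ with $\nu(\{\lambda_0\})=\|\mathbb P_{\lambda_0}P_0\Upsilon_0\|^2$ for each $\lambda_0\in\mathbb R$, where $\mathbb P_{\lambda_0}$ is the orthogonal projection of $\ell^2(\mathbb G)$ onto the closure of the space of finitely supported $\psi$ with $H\psi=\lambda_0\psi$. It is supported on $\liminf_nA^1_{0,n}$, and $\mu-\nu$ is the weak limit as $n\to\infty$ of the measures $\frac1\pi\|(\mathbf 1+(\delta^\lambda_{0,n})^2)^{-1/2}\gamma^\lambda_{0,n}\|^2d\lambda$. *)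

theory Defs
  imports
    "HOL-Complex_Analysis.Complex_Analysis"
    "Jordan_Normal_Form.Schur_Decomposition"
    "Jordan_Normal_Form.DL_Rank"
begin

section \<open>Matrices\<close>

definition mrank :: "complex mat \<Rightarrow> nat" where
  "mrank A = vec_space.rank (dim_row A) A"

definition vec_l2norm :: "complex vec \<Rightarrow> real" where
  "vec_l2norm v = sqrt (\<Sum>i<dim_vec v. (cmod (vec_index v i))\<^sup>2)"

definition mat_opnorm :: "complex mat \<Rightarrow> real" where
  "mat_opnorm A =
    Sup {vec_l2norm (A *\<^sub>v v) | v. v \<in> carrier_vec (dim_col A) \<and> vec_l2norm v \<le> 1}"


section \<open>The Hilbert space of square-summable functions and its operators\<close>

definition ell2 :: "('a \<Rightarrow> complex) set" where
  "ell2 = {\<psi>. (\<lambda>x. (cmod (\<psi> x))\<^sup>2) summable_on UNIV}"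

definition ell2_inner :: "('a \<Rightarrow> complex) \<Rightarrow> ('a \<Rightarrow> complex) \<Rightarrow> complex" where
  "ell2_inner \<phi> \<psi> = (\<Sum>\<^sub>\<infinity>x. cnj (\<phi> x) * \<psi> x)"

definition ell2_norm :: "('a \<Rightarrow> complex) \<Rightarrow> real" where
  "ell2_norm \<psi> = sqrt (\<Sum>\<^sub>\<infinity>x. (cmod (\<psi> x))\<^sup>2)"

definition ell2_closure :: "('a \<Rightarrow> complex) set \<Rightarrow> ('a \<Rightarrow> complex) set" where
  "ell2_closure K =
    {\<psi> \<in> ell2. \<forall>\<epsilon>>0. \<exists>\<phi>\<in>K. ell2_norm (\<lambda>x. \<psi> x - \<phi> x) < \<epsilon>}"

definition ell2_proj :: "('a \<Rightarrow> complex) set \<Rightarrow> ('a \<Rightarrow> complex) \<Rightarrow> ('a \<Rightarrow> complex)" where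
  "ell2_proj K v = (THE w. w \<in> K \<and> (\<forall>k\<in>K. ell2_inner k (\<lambda>x. v x - w x) = 0))"

text \<open>Unbounded operators are represented by their graphs.\<close>

type_synonym 'a operator = "(('a \<Rightarrow> complex) \<times> ('a \<Rightarrow> complex)) set"

definition op_adjoint :: "'a operator \<Rightarrow> 'a operator" where
  "op_adjoint T =
    {(\<phi>, \<eta>). \<phi> \<in> ell2 \<and> \<eta> \<in> ell2 \<and>
      (\<forall>(\<psi>, \<xi>)\<in>T. ell2_inner \<phi> \<xi> = ell2_inner \<eta> \<psi>)}"

definition op_closure :: "'a operator \<Rightarrow> 'a operator" where
  "op_closure T =
    {(\<phi>, \<eta>). \<phi> \<in> ell2 \<and> \<eta> \<in> ell2 \<and>
      (\<forall>\<epsilon>>0. \<exists>(\<psi>, \<xi>)\<in>T.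
        ell2_norm (\<lambda>x. \<phi> x - \<psi> x) < \<epsilon> \<and> ell2_norm (\<lambda>x. \<eta> x - \<xi> x) < \<epsilon>)}"

definition essentially_self_adjoint :: "'a operator \<Rightarrow> bool" where
  "essentially_self_adjoint T \<longleftrightarrow> op_adjoint (op_closure T) = op_closure T"

text \<open>The spectrum of the part of \<open>T\<close> in the closed subspace \<open>K\<close>, that is, of the operator
  in \<open>K\<close> whose graph is \<open>T \<inter> K \<times> K\<close>; it is empty for the zero subspace.\<close>

definition op_spectrum :: "('a \<Rightarrow> complex) set \<Rightarrow> 'a operator \<Rightarrow> complex set" where
  "op_spectrum K T =
    {z. \<not> ((\<forall>\<eta>\<in>K. \<exists>!\<psi>. (\<psi>, \<lambda>x. \<eta> x + z * \<psi> x) \<in> T \<inter> K \<times> K) \<and>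
           (\<exists>C. \<forall>(\<psi>, \<xi>)\<in>T \<inter> K \<times> K.
              ell2_norm \<psi> \<le> C * ell2_norm (\<lambda>x. \<xi> x - z * \<psi> x)))}"

definition real_spectrum :: "'a operator \<Rightarrow> real set" where
  "real_spectrum T = {l. complex_of_real l \<in> op_spectrum ell2 T}"


section \<open>Spectral resolutions and spectral measures\<close>

definition ell2_projection :: "(('a \<Rightarrow> complex) \<Rightarrow> ('a \<Rightarrow> complex)) \<Rightarrow> bool" where
  "ell2_projection P \<longleftrightarrow>
    (\<forall>\<psi>\<in>ell2. P \<psi> \<in> ell2 \<and> P (P \<psi>) = P \<psi>) \<and>
    (\<forall>\<phi>\<in>ell2. \<forall>\<psi>\<in>ell2. \<forall>c. P (\<lambda>x. c * \<phi> x + \<psi> x) = (\<lambda>x. c * P \<phi> x + P \<psi> x)) \<and>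
    (\<forall>\<phi>\<in>ell2. \<forall>\<psi>\<in>ell2. ell2_inner (P \<phi>) \<psi> = ell2_inner \<phi> (P \<psi>))"

definition projection_valued_measure ::
    "(real set \<Rightarrow> ('a \<Rightarrow> complex) \<Rightarrow> ('a \<Rightarrow> complex)) \<Rightarrow> bool" where
  "projection_valued_measure E \<longleftrightarrow>
    (\<forall>B\<in>sets borel. ell2_projection (E B)) \<and>
    (\<forall>\<psi>\<in>ell2. E UNIV \<psi> = \<psi>) \<and>
    (\<forall>B :: nat \<Rightarrow> real set. range B \<subseteq> sets borel \<longrightarrow> disjoint_family B \<longrightarrow>
      (\<forall>\<psi>\<in>ell2.
        (\<lambda>n. ell2_norm (\<lambda>x. E (\<Union>i. B i) \<psi> x - (\<Sum>i<n. E (B i) \<psi> x))) \<longlonglongrightarrow> 0))"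

definition spectral_measure ::
    "(real set \<Rightarrow> ('a \<Rightarrow> complex) \<Rightarrow> ('a \<Rightarrow> complex)) \<Rightarrow> ('a \<Rightarrow> complex) \<Rightarrow> real measure" where
  "spectral_measure E \<psi> =
    measure_of UNIV (sets borel) (\<lambda>B. ennreal (Re (ell2_inner \<psi> (E B \<psi>))))"

text \<open>\<open>spectral_resolution T E\<close> states that \<open>T\<close> is the integral of the identity function with
  respect to the projection-valued measure \<open>E\<close>: the domains agree, and so do the quadratic
  forms, which by polarization determine the operators on the common dense domain. By the
  spectral theorem a self-adjoint \<open>T\<close> has exactly one such \<open>E\<close> on Borel sets. The functional
  calculus is \<open>f(T) = \<integral> f dE\<close>, so that \<open>\<langle>\<psi>, f(T) \<psi>\<rangle>\<close> is the integral of \<open>f\<close> with respect to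
  \<open>spectral_measure E \<psi>\<close>.\<close>

definition spectral_resolution ::
    "'a operator \<Rightarrow> (real set \<Rightarrow> ('a \<Rightarrow> complex) \<Rightarrow> ('a \<Rightarrow> complex)) \<Rightarrow> bool" where
  "spectral_resolution T E \<longleftrightarrow>
    projection_valued_measure E \<and>
    Domain T = {\<psi> \<in> ell2. (\<integral>\<^sup>+ l. ennreal (l\<^sup>2) \<partial>spectral_measure E \<psi>) < \<infinity>} \<and>
    (\<forall>(\<psi>, \<eta>)\<in>T. ell2_inner \<psi> \<eta> = complex_of_real (\<integral> l. l \<partial>spectral_measure E \<psi>))"

definition ac_subspace ::
    "(real set \<Rightarrow> ('a \<Rightarrow> complex) \<Rightarrow> ('a \<Rightarrow> complex)) \<Rightarrow> ('a \<Rightarrow> complex) set" where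
  "ac_subspace E = {\<psi> \<in> ell2. absolutely_continuous lborel (spectral_measure E \<psi>)}"

definition ac_spectrum ::
    "'a operator \<Rightarrow> (real set \<Rightarrow> ('a \<Rightarrow> complex) \<Rightarrow> ('a \<Rightarrow> complex)) \<Rightarrow> real set" where
  "ac_spectrum T E = {l. complex_of_real l \<in> op_spectrum (ac_subspace E) T}"


section \<open>Measures on the real line\<close>

definition singular_lborel :: "real measure \<Rightarrow> bool" where
  "singular_lborel M \<longleftrightarrow> (\<exists>N\<in>null_sets lborel. emeasure M (UNIV - N) = 0)"

text \<open>The absolutely continuous part in the Lebesgue decomposition.\<close>

definition ac_part :: "real measure \<Rightarrow> real measure" where
  "ac_part M =
    (THE K. sets K = sets borel \<and> absolutely_continuous lborel K \<and>
      (\<exists>L. sets L = sets borel \<and> singular_lborel L \<and>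
        (\<forall>B\<in>sets borel. emeasure M B = emeasure K B + emeasure L B)))"

definition measure_support :: "real measure \<Rightarrow> real set" where
  "measure_support M = {x. \<forall>U. open U \<and> x \<in> U \<longrightarrow> emeasure M U > 0}"

definition purely_ac_on :: "real set \<Rightarrow> real measure \<Rightarrow> bool" where
  "purely_ac_on X M \<longleftrightarrow>
    (\<forall>B\<in>sets borel. B \<subseteq> X \<longrightarrow> emeasure lborel B = 0 \<longrightarrow> emeasure M B = 0)"

definition has_Lp_density_on :: "real \<Rightarrow> real set \<Rightarrow> real measure \<Rightarrow> bool" where
  "has_Lp_density_on p X M \<longleftrightarrow>
    (\<exists>f :: real \<Rightarrow> real. f \<in> borel_measurable borel \<and> (\<forall>x. 0 \<le> f x) \<and>
      (\<integral>\<^sup>+ x\<in>X. ennreal (f x powr p) \<partial>lborel) < \<infinity> \<and>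
      (\<forall>B\<in>sets borel. B \<subseteq> X \<longrightarrow> emeasure M B = (\<integral>\<^sup>+ x\<in>B. ennreal (f x) \<partial>lborel)))"


section \<open>Hopping operators with shells\<close>

text \<open>The countable set is the type \<open>'a\<close>. The \<open>n\<close>-th shell is \<open>set (shell n)\<close>; the order of the
  list \<open>shell n\<close> is the identification of the functions on the shell with column vectors. The
  matrix element at \<open>x\<close>, \<open>y\<close> is \<open>h x y\<close>.\<close>

locale shell_hopping =
  fixes shell :: "nat \<Rightarrow> 'a list" and h :: "'a \<Rightarrow> 'a \<Rightarrow> complex"
  assumes shell_nonempty: "shell n \<noteq> []"
    and shell_distinct: "distinct (shell n)"
    and shell_disjoint: "m \<noteq> n \<Longrightarrow> set (shell m) \<inter> set (shell n) = {}"
    and shell_cover: "(\<Union>n. set (shell n)) = UNIV"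
    and hermitian: "h x y = cnj (h y x)"
    and locally_finite: "finite {y. h x y \<noteq> 0}"
    and shell_range: "x \<in> set (shell j) \<Longrightarrow> y \<in> set (shell k) \<Longrightarrow> j + 2 \<le> k \<or> k + 2 \<le> j \<Longrightarrow> h x y = 0"
    and connected: "(x, y) \<in> {(u, v). u \<noteq> v \<and> h u v \<noteq> 0}\<^sup>*"

definition hop :: "('a \<Rightarrow> 'a \<Rightarrow> complex) \<Rightarrow> ('a \<Rightarrow> complex) \<Rightarrow> ('a \<Rightarrow> complex)" where
  "hop h \<psi> x = (\<Sum>y | h x y \<noteq> 0. h x y * \<psi> y)"

definition hop_min :: "('a \<Rightarrow> 'a \<Rightarrow> complex) \<Rightarrow> 'a operator" where
  "hop_min h = {(\<psi>, hop h \<psi>) | \<psi>. finite {x. \<psi> x \<noteq> 0}}"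

definition hop_op :: "('a \<Rightarrow> 'a \<Rightarrow> complex) \<Rightarrow> 'a operator" where
  "hop_op h = op_adjoint (hop_min h)"

abbreviation shell_size :: "(nat \<Rightarrow> 'a list) \<Rightarrow> nat \<Rightarrow> nat" where
  "shell_size shell n \<equiv> length (shell n)"

text \<open>\<open>hop_down shell h n\<close> is the block from shell \<open>n\<close> to shell \<open>Suc n\<close>.\<close>

definition hop_down :: "(nat \<Rightarrow> 'a list) \<Rightarrow> ('a \<Rightarrow> 'a \<Rightarrow> complex) \<Rightarrow> nat \<Rightarrow> complex mat" where
  "hop_down shell h n =
    mat (shell_size shell (Suc n)) (shell_size shell n)
      (\<lambda>(i, j). h (shell (Suc n) ! i) (shell n ! j))"

definition hop_rank :: "(nat \<Rightarrow> 'a list) \<Rightarrow> ('a \<Rightarrow> 'a \<Rightarrow> complex) \<Rightarrow> nat \<Rightarrow> nat" where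
  "hop_rank shell h n = (case n of 0 \<Rightarrow> 1 | Suc k \<Rightarrow> mrank (hop_down shell h k))"

definition hop_factorization ::
    "(nat \<Rightarrow> 'a list) \<Rightarrow> ('a \<Rightarrow> 'a \<Rightarrow> complex) \<Rightarrow> (nat \<Rightarrow> complex mat) \<Rightarrow> (nat \<Rightarrow> complex mat) \<Rightarrow> bool"
  where
  "hop_factorization shell h \<Upsilon> \<Phi> \<longleftrightarrow>
    (\<forall>n. \<Upsilon> n \<in> carrier_mat (shell_size shell n) (hop_rank shell h n)) \<and>
    (\<forall>n. \<Phi> n \<in> carrier_mat (shell_size shell n) (hop_rank shell h (Suc n))) \<and>
    (\<forall>n. mrank (\<Upsilon> (Suc n)) = hop_rank shell h (Suc n)) \<and>
    (\<forall>n. mrank (\<Phi> n) = hop_rank shell h (Suc n)) \<and>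
    (\<forall>n. hop_down shell h n = - (\<Upsilon> (Suc n) * mat_adjoint (\<Phi> n))) \<and>
    \<Upsilon> 0 \<noteq> 0\<^sub>m (shell_size shell 0) 1"

text \<open>\<open>embed_root shell v\<close> is the extension by zero of a vector on shell \<open>0\<close>.\<close>

definition embed_root :: "(nat \<Rightarrow> 'a list) \<Rightarrow> complex vec \<Rightarrow> ('a \<Rightarrow> complex)" where
  "embed_root shell v x =
    (\<Sum>i<shell_size shell 0. if shell 0 ! i = x then vec_index v i else 0)"

definition root_vector :: "(nat \<Rightarrow> 'a list) \<Rightarrow> (nat \<Rightarrow> complex mat) \<Rightarrow> ('a \<Rightarrow> complex)" where
  "root_vector shell \<Upsilon> = embed_root shell (col (\<Upsilon> 0) 0)"


section \<open>Boundary resolvent data\<close>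

definition sites :: "(nat \<Rightarrow> 'a list) \<Rightarrow> nat \<Rightarrow> nat \<Rightarrow> 'a list" where
  "sites shell m n = concat (map shell [m..<Suc n])"

definition hop_compression ::
    "(nat \<Rightarrow> 'a list) \<Rightarrow> ('a \<Rightarrow> 'a \<Rightarrow> complex) \<Rightarrow> nat \<Rightarrow> nat \<Rightarrow> complex mat" where
  "hop_compression shell h m n =
    (let xs = sites shell m n in
      mat (length xs) (length xs) (\<lambda>(i, j). h (xs ! i) (xs ! j)))"

text \<open>The columns of \<open>\<Upsilon> m\<close> and of \<open>\<Phi> n\<close>, extended by zero to the shells \<open>m\<close> to \<open>n\<close>: shell \<open>m\<close> comes
  first in \<open>sites shell m n\<close> and shell \<open>n\<close> comes last.\<close>

definition boundary_cols ::
    "(nat \<Rightarrow> 'a list) \<Rightarrow> (nat \<Rightarrow> complex mat) \<Rightarrow> (nat \<Rightarrow> complex mat) \<Rightarrow> nat \<Rightarrow> nat \<Rightarrow> complex mat" where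
  "boundary_cols shell \<Upsilon> \<Phi> m n =
    (let N = length (sites shell m n) in
      mat_of_cols N
        (cols (\<Upsilon> m @\<^sub>r 0\<^sub>m (N - shell_size shell m) (dim_col (\<Upsilon> m))) @
         cols (0\<^sub>m (N - shell_size shell n) (dim_col (\<Phi> n)) @\<^sub>r \<Phi> n)))"

text \<open>Before analytic extension; the value is unspecified when \<open>z\<close> is an eigenvalue of the
  compression.\<close>

definition boundary_resolvent_raw ::
    "(nat \<Rightarrow> 'a list) \<Rightarrow> ('a \<Rightarrow> 'a \<Rightarrow> complex) \<Rightarrow> (nat \<Rightarrow> complex mat) \<Rightarrow> (nat \<Rightarrow> complex mat) \<Rightarrow>
      nat \<Rightarrow> nat \<Rightarrow> complex \<Rightarrow> complex mat" where
  "boundary_resolvent_raw shell h \<Upsilon> \<Phi> m n z =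
    (let N = length (sites shell m n); F = boundary_cols shell \<Upsilon> \<Phi> m n in
      mat_adjoint F * the (mat_inverse (hop_compression shell h m n - z \<cdot>\<^sub>m 1\<^sub>m N)) * F)"

definition boundary_resolvent ::
    "(nat \<Rightarrow> 'a list) \<Rightarrow> ('a \<Rightarrow> 'a \<Rightarrow> complex) \<Rightarrow> (nat \<Rightarrow> complex mat) \<Rightarrow> (nat \<Rightarrow> complex mat) \<Rightarrow>
      nat \<Rightarrow> nat \<Rightarrow> complex \<Rightarrow> complex mat" where
  "boundary_resolvent shell h \<Upsilon> \<Phi> m n z =
    (let d = hop_rank shell h m + hop_rank shell h (Suc n) in
      mat d d (\<lambda>(i, j).
        remove_sings (\<lambda>w. boundary_resolvent_raw shell h \<Upsilon> \<Phi> m n w $$ (i, j)) z))"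

definition alpha ::
    "(nat \<Rightarrow> 'a list) \<Rightarrow> ('a \<Rightarrow> 'a \<Rightarrow> complex) \<Rightarrow> (nat \<Rightarrow> complex mat) \<Rightarrow> (nat \<Rightarrow> complex mat) \<Rightarrow>
      nat \<Rightarrow> nat \<Rightarrow> complex \<Rightarrow> complex mat" where
  "alpha shell h \<Upsilon> \<Phi> m n z =
    mat (hop_rank shell h m) (hop_rank shell h m)
      (\<lambda>(i, j). boundary_resolvent shell h \<Upsilon> \<Phi> m n z $$ (i, j))"

definition beta ::
    "(nat \<Rightarrow> 'a list) \<Rightarrow> ('a \<Rightarrow> 'a \<Rightarrow> complex) \<Rightarrow> (nat \<Rightarrow> complex mat) \<Rightarrow> (nat \<Rightarrow> complex mat) \<Rightarrow>
      nat \<Rightarrow> nat \<Rightarrow> complex \<Rightarrow> complex mat" where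
  "beta shell h \<Upsilon> \<Phi> m n z =
    mat (hop_rank shell h m) (hop_rank shell h (Suc n))
      (\<lambda>(i, j). boundary_resolvent shell h \<Upsilon> \<Phi> m n z $$ (i, hop_rank shell h m + j))"

definition gamma ::
    "(nat \<Rightarrow> 'a list) \<Rightarrow> ('a \<Rightarrow> 'a \<Rightarrow> complex) \<Rightarrow> (nat \<Rightarrow> complex mat) \<Rightarrow> (nat \<Rightarrow> complex mat) \<Rightarrow>
      nat \<Rightarrow> nat \<Rightarrow> complex \<Rightarrow> complex mat" where
  "gamma shell h \<Upsilon> \<Phi> m n z =
    mat (hop_rank shell h (Suc n)) (hop_rank shell h m)
      (\<lambda>(i, j). boundary_resolvent shell h \<Upsilon> \<Phi> m n z $$ (hop_rank shell h m + i, j))"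

definition delta ::
    "(nat \<Rightarrow> 'a list) \<Rightarrow> ('a \<Rightarrow> 'a \<Rightarrow> complex) \<Rightarrow> (nat \<Rightarrow> complex mat) \<Rightarrow> (nat \<Rightarrow> complex mat) \<Rightarrow>
      nat \<Rightarrow> nat \<Rightarrow> complex \<Rightarrow> complex mat" where
  "delta shell h \<Upsilon> \<Phi> m n z =
    mat (hop_rank shell h (Suc n)) (hop_rank shell h (Suc n))
      (\<lambda>(i, j). boundary_resolvent shell h \<Upsilon> \<Phi> m n z $$
        (hop_rank shell h m + i, hop_rank shell h m + j))"

text \<open>The non-removable singularities: \<open>remove_sings\<close> takes the value \<open>0\<close> at a pole, and is not
  analytic there. They are eigenvalues of a Hermitian matrix, hence real.\<close>

definition singular_set ::
    "(nat \<Rightarrow> 'a list) \<Rightarrow> ('a \<Rightarrow> 'a \<Rightarrow> complex) \<Rightarrow> (nat \<Rightarrow> complex mat) \<Rightarrow> (nat \<Rightarrow> complex mat) \<Rightarrow>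
      nat \<Rightarrow> nat \<Rightarrow> complex set" where
  "singular_set shell h \<Upsilon> \<Phi> m n =
    (let d = hop_rank shell h m + hop_rank shell h (Suc n) in
      {z. \<exists>i<d. \<exists>j<d.
        \<not> (\<lambda>w. boundary_resolvent shell h \<Upsilon> \<Phi> m n w $$ (i, j)) analytic_on {z}})"

definition liminf_singular_set ::
    "(nat \<Rightarrow> 'a list) \<Rightarrow> ('a \<Rightarrow> 'a \<Rightarrow> complex) \<Rightarrow> (nat \<Rightarrow> complex mat) \<Rightarrow> (nat \<Rightarrow> complex mat) \<Rightarrow>
      real set" where
  "liminf_singular_set shell h \<Upsilon> \<Phi> =
    (\<Union>m. \<Inter>n\<in>{m..}. {l. complex_of_real l \<in> singular_set shell h \<Upsilon> \<Phi> 0 n})"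


section \<open>Transfer matrices\<close>

definition exceptional_set ::
    "(nat \<Rightarrow> 'a list) \<Rightarrow> ('a \<Rightarrow> 'a \<Rightarrow> complex) \<Rightarrow> (nat \<Rightarrow> complex mat) \<Rightarrow> (nat \<Rightarrow> complex mat) \<Rightarrow>
      nat \<Rightarrow> nat \<Rightarrow> complex set" where
  "exceptional_set shell h \<Upsilon> \<Phi> m n =
    singular_set shell h \<Upsilon> \<Phi> m n \<union>
    {z. mrank (beta shell h \<Upsilon> \<Phi> m n z) < hop_rank shell h m}"

definition transfer_set ::
    "(nat \<Rightarrow> 'a list) \<Rightarrow> ('a \<Rightarrow> 'a \<Rightarrow> complex) \<Rightarrow> (nat \<Rightarrow> complex mat) \<Rightarrow> (nat \<Rightarrow> complex mat) \<Rightarrow>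
      nat \<Rightarrow> nat \<Rightarrow> complex \<Rightarrow> complex mat set" where
  "transfer_set shell h \<Upsilon> \<Phi> m n z =
    {four_block_mat
        B                                  (- b)
        (delta shell h \<Upsilon> \<Phi> m n z * B)      (gamma shell h \<Upsilon> \<Phi> m n z - delta shell h \<Upsilon> \<Phi> m n z * b)
     | B b.
        B \<in> carrier_mat (hop_rank shell h (Suc n)) (hop_rank shell h m) \<and>
        b \<in> carrier_mat (hop_rank shell h (Suc n)) (hop_rank shell h m) \<and>
        beta shell h \<Upsilon> \<Phi> m n z * B = 1\<^sub>m (hop_rank shell h m) \<and>
        beta shell h \<Upsilon> \<Phi> m n z * b = alpha shell h \<Upsilon> \<Phi> m n z}"

definition regular_points ::
    "(nat \<Rightarrow> 'a list) \<Rightarrow> ('a \<Rightarrow> 'a \<Rightarrow> complex) \<Rightarrow> (nat \<Rightarrow> complex mat) \<Rightarrow> (nat \<Rightarrow> complex mat) \<Rightarrow>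
      real \<Rightarrow> real \<Rightarrow> nat \<Rightarrow> real set" where
  "regular_points shell h \<Upsilon> \<Phi> a b n =
    {l \<in> {a..b}. complex_of_real l \<notin> exceptional_set shell h \<Upsilon> \<Phi> 0 n}"

definition transfer_selection ::
    "(nat \<Rightarrow> 'a list) \<Rightarrow> ('a \<Rightarrow> 'a \<Rightarrow> complex) \<Rightarrow> (nat \<Rightarrow> complex mat) \<Rightarrow> (nat \<Rightarrow> complex mat) \<Rightarrow>
      real \<Rightarrow> real \<Rightarrow> (nat \<Rightarrow> real \<Rightarrow> complex mat) \<Rightarrow> bool" where
  "transfer_selection shell h \<Upsilon> \<Phi> a b T \<longleftrightarrow>
    (\<forall>n. \<forall>l\<in>regular_points shell h \<Upsilon> \<Phi> a b n.
      T n l \<in> transfer_set shell h \<Upsilon> \<Phi> 0 n (complex_of_real l)) \<and>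
    (\<forall>n. \<forall>i < 2 * hop_rank shell h (Suc n). \<forall>j < 2.
      (\<lambda>l. T n l $$ (i, j)) \<in>
        borel_measurable (restrict_space lebesgue (regular_points shell h \<Upsilon> \<Phi> a b n)))"


section \<open>The point measure of finitely supported eigenfunctions\<close>

definition finite_eigenvectors :: "('a \<Rightarrow> 'a \<Rightarrow> complex) \<Rightarrow> real \<Rightarrow> ('a \<Rightarrow> complex) set" where
  "finite_eigenvectors h l =
    {\<psi>. finite {x. \<psi> x \<noteq> 0} \<and> hop h \<psi> = (\<lambda>x. complex_of_real l * \<psi> x)}"

definition finite_point_measure :: "('a \<Rightarrow> 'a \<Rightarrow> complex) \<Rightarrow> ('a \<Rightarrow> complex) \<Rightarrow> real measure" where
  "finite_point_measure h v =
    distr (point_measure UNIV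
        (\<lambda>l. ennreal ((ell2_norm (ell2_proj (ell2_closure (finite_eigenvectors h l)) v))\<^sup>2)))
      borel (\<lambda>l. l)"

end

theory Submission
  imports Defs "HOL-Real_Asymp.Real_Asymp"
begin

text \<open>
  Truncate to the first \<open>n + 1\<close> shells and couple the last shell to free channels, which replaces
  \<open>H\<^sub>0\<^sub>,\<^sub>n\<close> by \<open>A = H\<^sub>0\<^sub>,\<^sub>n - i \<Phi> \<Phi>\<^sup>*\<close>. The kernel of the coupling among the eigenvectors of \<open>H\<^sub>0\<^sub>,\<^sub>n\<close> consists
  of finitely supported eigenvectors of \<open>H\<close>; on the orthogonal complement the resolvent of \<open>A\<close> is
  regular on the real line, and the imaginary part of its matrix element at the root vector is
  the squared norm \<open>hn n\<close> of the outgoing amplitudes. As \<open>n\<close> grows the resolvents converge to that of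
  \<open>H\<close> because finitely supported vectors form a core, so Poisson integrals of \<open>hn n / pi\<close> converge
  to those of \<open>\<mu> - \<nu>\<close>, and hence the measures converge vaguely.

  Writing the transfer matrix in terms of the Cayley transform of \<open>\<delta>\<close> bounds \<open>hn n\<close> from above by
  \<open>\<parallel>T (u, 1)\<parallel>\<^sup>2\<close> and from below by \<open>1 / (2 \<parallel>T\<parallel>\<^sup>2)\<close>. The upper bound gives a uniform \<open>L\<^sup>p\<close> estimate that
  survives the vague limit by duality. For the lower bound, \<open>2 m - m\<^sup>2 / x \<le> x\<close> turns integrability
  of \<open>\<parallel>T\<parallel>\<^sup>2\<^sup>p\<close> into an estimate that is linear in \<open>hn n\<close>, which also passes to the limit and makes
  \<open>\<mu> - \<nu>\<close> charge every subinterval. The spectral inclusions follow from approximate eigenvectors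
  obtained by localising the root vector with the spectral projections.
\<close>

text \<open>On the operator side the obstacle is that \<open>spectral_resolution\<close> ties
  \<open>E\<close> to the operator only through domains and quadratic forms. Commutation with the
  projections, and the fact that \<open>T - z\<close> multiplies spectral measures by the density
  \<open>|t - z|^2\<close>, have to be extracted from the forms before any resolvent can be compared
  with a measure. The coupling \<open>\<Phi> \<Phi>^*\<close> is chosen because the outgoing
  amplitudes then solve \<open>(1 - i \<delta>) x0 = \<gamma>\<close>. Since
  \<open>1 - i \<delta>\<close> is normal with modulus \<open>(1 + \<delta>^2)^(1/2)\<close>, the
  energy lost to the channels is exactly the density of the approximating measure. A finite
  \<open>liminf\<close> gives bounds for infinitely many \<open>n\<close> only, with no control
  along the other indices. Every estimate is therefore first made linear in the density; it can then
  be combined with convergence along the whole sequence. Assumption (A2) enters shell by shell: it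
  keeps \<open>\<gamma>\<close> from vanishing at almost every energy, so that the exceptional
  energies, where the integral hypotheses say nothing, form a null set.\<close>

hide_const (open) VectorSpace.subspace

section \<open>The Hilbert space of square-summable functions\<close>

lemma ell2_summable: "f \<in> ell2 \<Longrightarrow> (\<lambda>x. (cmod (f x))\<^sup>2) summable_on UNIV"
  by (simp add: ell2_def)

text \<open>Bounds on finite sums are stable under pointwise estimates and pointwise limits, so
  sums, restrictions and limits of members of \<open>ell2\<close> need no summability
  argument.\<close>

lemma ell2_iff_bounded:
  "f \<in> ell2 \<longleftrightarrow> (\<exists>C. \<forall>F. finite F \<longrightarrow> (\<Sum>x\<in>F. (cmod (f x))\<^sup>2) \<le> C)"
proof
  assume "f \<in> ell2"
  then have s: "(\<lambda>x. (cmod (f x))\<^sup>2) summable_on UNIV" by (simp add: ell2_def)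
  have "(\<Sum>x\<in>F. (cmod (f x))\<^sup>2) \<le> (\<Sum>\<^sub>\<infinity>x. (cmod (f x))\<^sup>2)" if "finite F" for F
    by (rule finite_sum_le_infsum[OF s that]) auto
  then show "\<exists>C. \<forall>F. finite F \<longrightarrow> (\<Sum>x\<in>F. (cmod (f x))\<^sup>2) \<le> C" by blast
next
  assume "\<exists>C. \<forall>F. finite F \<longrightarrow> (\<Sum>x\<in>F. (cmod (f x))\<^sup>2) \<le> C"
  then show "f \<in> ell2" unfolding ell2_def mem_Collect_eq
    by (intro nonneg_bdd_above_summable_on) (auto simp: bdd_above_def)
qed

lemma ell2_mult_summable:
  assumes "f \<in> ell2" "g \<in> ell2"
  shows "(\<lambda>x. cnj (f x) * g x) summable_on UNIV"
proof (rule Infinite_Sum.abs_summable_summable, rule Infinite_Sum.abs_summable_on_comparison_test)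
  have "(\<lambda>x. (cmod (f x))\<^sup>2 + (cmod (g x))\<^sup>2) summable_on UNIV"
    using assms by (intro summable_on_add ell2_summable)
  then show "(\<lambda>x. norm ((cmod (f x))\<^sup>2 + (cmod (g x))\<^sup>2)) summable_on UNIV" by simp
  fix x
  have "2 * (cmod (f x) * cmod (g x)) \<le> (cmod (f x))\<^sup>2 + (cmod (g x))\<^sup>2"
    using sum_squares_bound[of "cmod (f x)" "cmod (g x)"] by simp
  moreover have "0 \<le> cmod (f x) * cmod (g x)" by simp
  ultimately have "cmod (f x) * cmod (g x) \<le> (cmod (f x))\<^sup>2 + (cmod (g x))\<^sup>2" by linarith
  then show "norm (cnj (f x) * g x) \<le> norm ((cmod (f x))\<^sup>2 + (cmod (g x))\<^sup>2)"
    by (simp add: norm_mult)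
qed

lemma ell2_add: assumes "f \<in> ell2" "g \<in> ell2" shows "(\<lambda>x. f x + g x) \<in> ell2"
proof -
  obtain C D where C: "\<And>F. finite F \<Longrightarrow> (\<Sum>x\<in>F. (cmod (f x))\<^sup>2) \<le> C"
    and D: "\<And>F. finite F \<Longrightarrow> (\<Sum>x\<in>F. (cmod (g x))\<^sup>2) \<le> D"
    using assms unfolding ell2_iff_bounded by blast
  have "(cmod (f x + g x))\<^sup>2 \<le> 2 * (cmod (f x))\<^sup>2 + 2 * (cmod (g x))\<^sup>2" for x
  proof -
    have "(cmod (f x + g x))\<^sup>2 \<le> (cmod (f x) + cmod (g x))\<^sup>2"
      by (intro power_mono norm_triangle_ineq) auto
    also have "\<dots> \<le> 2 * (cmod (f x))\<^sup>2 + 2 * (cmod (g x))\<^sup>2"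
      using sum_squares_bound[of "cmod (f x)" "cmod (g x)"] by (simp add: power2_sum)
    finally show ?thesis .
  qed
  then have "(\<Sum>x\<in>F. (cmod (f x + g x))\<^sup>2) \<le> 2 * (\<Sum>x\<in>F. (cmod (f x))\<^sup>2) + 2 * (\<Sum>x\<in>F. (cmod (g x))\<^sup>2)" for F
    unfolding sum_distrib_left sum.distrib[symmetric] by (intro sum_mono)
  then have "(\<Sum>x\<in>F. (cmod (f x + g x))\<^sup>2) \<le> 2 * C + 2 * D" if "finite F" for F
    using C[OF that] D[OF that] by (smt (verit, best))
  then show ?thesis unfolding ell2_iff_bounded by blast
qed

lemma ell2_scale: assumes "f \<in> ell2" shows "(\<lambda>x. c * f x) \<in> ell2"
  using assms unfolding ell2_def by (auto simp: norm_mult power_mult_distrib intro!: summable_on_cmult_right)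

lemma ell2_finite: "finite {x. f x \<noteq> 0} \<Longrightarrow> f \<in> ell2"
  unfolding ell2_def mem_Collect_eq
  by (subst summable_on_cong_neutral[of "{x. f x \<noteq> 0}" _ _ "\<lambda>x. (cmod (f x))\<^sup>2"]) auto

text \<open>As a type the space can join \<open>real_inner\<close> and
  \<open>complete_space\<close>. Complex multiplication and the sesquilinear form, antilinear in its
  first argument, are carried alongside as \<open>scaleC\<close> and \<open>cinner\<close>, and
  \<open>inner\<close> is the real part of \<open>cinner\<close>.\<close>

typedef 'a l2 = "ell2 :: ('a \<Rightarrow> complex) set" morphisms fn mk
  by (rule exI[of _ "\<lambda>_. 0"]) (simp add: ell2_finite)

lemma fn_mk: "f \<in> ell2 \<Longrightarrow> fn (mk f) = f" by (rule mk_inverse)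
lemma fn_ell2 [simp]: "fn x \<in> ell2" by (rule fn)
lemma l2_eqI: "(\<And>a. fn x a = fn y a) \<Longrightarrow> x = y" by (metis ext fn_inject)

definition scaleC :: "complex \<Rightarrow> 'a l2 \<Rightarrow> 'a l2" where "scaleC c x = mk (\<lambda>a. c * fn x a)"
definition cinner :: "'a l2 \<Rightarrow> 'a l2 \<Rightarrow> complex" where "cinner x y = ell2_inner (fn x) (fn y)"

lemma fn_scaleC [simp]: "fn (scaleC c x) a = c * fn x a"
  by (simp add: scaleC_def fn_mk ell2_scale)

instantiation l2 :: (type) real_inner
begin
definition "0 = mk (\<lambda>_. 0)"
definition "x + y = mk (\<lambda>a. fn x a + fn y a)"
definition "- x = mk (\<lambda>a. (-1) * fn x a)"
definition "x - y = x + - (y :: 'a l2)"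
definition "scaleR r x = scaleC (complex_of_real r) x"
definition "inner x y = Re (cinner x y)"
definition "norm x = sqrt (inner x (x :: 'a l2))"
definition "sgn x = scaleR (inverse (norm x)) (x :: 'a l2)"
definition "dist x y = norm (x - y :: 'a l2)"
definition "uniformity = (INF e\<in>{0 <..}. principal {(x, y). dist x (y :: 'a l2) < e})"
definition "open U = (\<forall>x\<in>U. eventually (\<lambda>(x', y). x' = x \<longrightarrow> y \<in> U) (uniformity :: ('a l2 \<times> 'a l2) filter))"

lemma fn_zero [simp]: "fn 0 a = 0" by (simp add: zero_l2_def fn_mk ell2_finite)
lemma fn_add [simp]: "fn (x + y) a = fn x a + fn y a" by (simp add: plus_l2_def fn_mk ell2_add)
lemma fn_uminus [simp]: "fn (- x) a = - fn x a"
  using ell2_scale[OF fn_ell2, of "-1" x] by (simp add: uminus_l2_def fn_mk)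
lemma fn_minus [simp]: "fn (x - y) a = fn x a - fn y a" by (simp add: minus_l2_def)
lemma fn_scaleR [simp]: "fn (scaleR r x) a = complex_of_real r * fn x a" by (simp add: scaleR_l2_def)

lemma cinner_add_left: "cinner (x + y) z = cinner x z + cinner y z"
  unfolding cinner_def ell2_inner_def
  by (simp add: distrib_right infsum_add ell2_mult_summable)
lemma cinner_commute: "cinner x y = cnj (cinner y x)"
  unfolding cinner_def ell2_inner_def by (simp add: mult.commute flip: infsum_cnj)
lemma cinner_scaleC_left: "cinner (scaleC c x) y = cnj c * cinner x y"
  unfolding cinner_def ell2_inner_def by (simp add: mult.assoc infsum_cmult_right')
lemma cinner_self: "cinner x x = complex_of_real (\<Sum>\<^sub>\<infinity>a. (cmod (fn x a))\<^sup>2)"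
  unfolding cinner_def ell2_inner_def
proof -
  have "((\<lambda>a. complex_of_real ((cmod (fn x a))\<^sup>2)) has_sum complex_of_real (\<Sum>\<^sub>\<infinity>a. (cmod (fn x a))\<^sup>2)) UNIV"
    by (intro has_sum_of_real has_sum_infsum ell2_summable fn_ell2)
  moreover have "complex_of_real ((cmod (fn x a))\<^sup>2) = cnj (fn x a) * fn x a" for a
    by (simp only: complex_norm_square mult.commute)
  ultimately show "(\<Sum>\<^sub>\<infinity>a. cnj (fn x a) * fn x a) = complex_of_real (\<Sum>\<^sub>\<infinity>a. (cmod (fn x a))\<^sup>2)"
    by (simp add: infsumI)
qed

instance
proof
  fix x y z :: "'a l2" and a b r :: real
  show "inner x y = inner y x" unfolding inner_l2_def by (subst cinner_commute) simp
  show "inner (x + y) z = inner x z + inner y z" by (simp add: inner_l2_def cinner_add_left)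
  show "inner (scaleR r x) y = r * inner x y" by (simp add: inner_l2_def scaleR_l2_def cinner_scaleC_left)
  show "0 \<le> inner x x" by (simp add: inner_l2_def cinner_self infsum_nonneg)
  show "inner x x = 0 \<longleftrightarrow> x = 0"
  proof
    assume "inner x x = 0"
    then have "(\<Sum>\<^sub>\<infinity>a. (cmod (fn x a))\<^sup>2) = 0" by (simp add: inner_l2_def cinner_self)
    then have "(cmod (fn x a))\<^sup>2 = 0" for a
      using nonneg_infsum_le_0D[OF _ ell2_summable[OF fn_ell2, of x], of a] by simp
    then show "x = 0" by (intro l2_eqI) simp
  qed (simp add: inner_l2_def cinner_self)
qed (auto simp: norm_l2_def sgn_l2_def dist_l2_def uniformity_l2_def open_l2_def
      intro!: l2_eqI simp: algebra_simps)
end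

lemma cinner_add_right: "cinner z (x + y) = cinner z x + cinner z y"
  by (metis cinner_add_left cinner_commute complex_cnj_add)
lemma cinner_scaleC_right: "cinner x (scaleC c y) = c * cinner x y"
  by (metis cinner_scaleC_left cinner_commute complex_cnj_mult complex_cnj_cnj)
lemma uminus_l2_scaleC: "- (x :: 'a l2) = scaleC (-1) x" by (rule l2_eqI) simp
lemma cinner_minus_left: "cinner (- x) y = - cinner x y"
  by (simp add: uminus_l2_scaleC cinner_scaleC_left)
lemma cinner_minus_right: "cinner x (- y) = - cinner x y"
  by (simp add: uminus_l2_scaleC cinner_scaleC_right)
lemma cinner_diff_left: "cinner (x - y) z = cinner x z - cinner y z"
  by (metis cinner_add_left cinner_minus_left diff_conv_add_uminus)
lemma cinner_diff_right: "cinner z (x - y) = cinner z x - cinner z y"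
  by (metis cinner_add_right cinner_minus_right diff_conv_add_uminus)
lemma cinner_zero_left [simp]: "cinner 0 x = 0"
  by (metis cinner_diff_left diff_self)
lemma cinner_zero_right [simp]: "cinner x 0 = 0"
  by (metis cinner_diff_right diff_self)
lemma cinner_sum_right: "cinner x (sum f A) = (\<Sum>i\<in>A. cinner x (f i))"
  by (induction A rule: infinite_finite_induct) (auto simp: cinner_add_right)
lemma cinner_sum_left: "cinner (sum f A) x = (\<Sum>i\<in>A. cinner (f i) x)"
  by (induction A rule: infinite_finite_induct) (auto simp: cinner_add_left)
lemmas cinner_simps = cinner_add_left cinner_add_right cinner_diff_left cinner_diff_right
  cinner_scaleC_left cinner_scaleC_right cinner_minus_left cinner_minus_right
  cinner_sum_left cinner_sum_right

lemma scaleC_add_right: "scaleC c (x + y) = scaleC c x + scaleC c y"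
  by (rule l2_eqI) (simp add: algebra_simps)
lemma scaleC_diff_right: "scaleC c (x - y) = scaleC c x - scaleC c y"
  by (rule l2_eqI) (simp add: algebra_simps)
lemma scaleC_add_left: "scaleC (c + d) x = scaleC c x + scaleC d x"
  by (rule l2_eqI) (simp add: algebra_simps)
lemma scaleC_scaleC [simp]: "scaleC c (scaleC d x) = scaleC (c * d) x"
  by (rule l2_eqI) (simp add: algebra_simps)
lemma scaleC_zero [simp]: "scaleC 0 x = 0" "scaleC c 0 = 0" by (rule l2_eqI; simp)+
lemma scaleC_of_real: "scaleC (complex_of_real r) x = scaleR r x" by (simp add: scaleR_l2_def)
lemma scaleC_scaleR: "scaleC c (scaleR r x) = scaleR r (scaleC c x)"
  by (rule l2_eqI) (simp add: algebra_simps)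

lemma cinner_norm: "cinner x x = complex_of_real ((norm x)\<^sup>2)"
proof -
  have "(norm x)\<^sup>2 = Re (cinner x x)" by (simp add: power2_norm_eq_inner inner_l2_def)
  then show ?thesis by (simp add: cinner_self)
qed

lemma norm_ell2: "norm x = ell2_norm (fn x)"
  by (simp add: norm_l2_def inner_l2_def cinner_self ell2_norm_def)

lemma norm_scaleC [simp]: "norm (scaleC c x) = cmod c * norm x"
proof -
  have "complex_of_real ((norm (scaleC c x))\<^sup>2) = c * cnj c * cinner x x"
    unfolding cinner_norm[symmetric] by (simp add: cinner_simps)
  also have "\<dots> = complex_of_real ((cmod c * norm x)\<^sup>2)"
    unfolding cinner_norm power_mult_distrib of_real_mult complex_norm_square ..
  finally have "complex_of_real ((norm (scaleC c x))\<^sup>2) = complex_of_real ((cmod c * norm x)\<^sup>2)" .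
  then have "(norm (scaleC c x))\<^sup>2 = (cmod c * norm x)\<^sup>2" by (simp only: of_real_eq_iff)
  then show ?thesis by (simp add: power2_eq_iff_nonneg)
qed

lemma Re_cinner: "Re (cinner x y) = inner x y" by (simp add: inner_l2_def)

lemma Im_cinner: "Im (cinner x y) = inner (scaleC \<i> x) y"
  by (simp add: inner_l2_def cinner_simps)

lemma norm_cinner_le: "cmod (cinner x y) \<le> norm x * norm y"
proof (cases "cinner x y = 0")
  case False
  \<comment> \<open>The phase that turns \<open>cinner x y\<close> into its modulus, so that the
    real Cauchy-Schwarz inequality applies to \<open>scaleC c y\<close>.\<close>
  define c where "c = cnj (cinner x y) / cmod (cinner x y)"
  have c: "cmod c = 1" using False by (simp add: c_def norm_divide)
  have "cinner x (scaleC c y) = complex_of_real (cmod (cinner x y))"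
  proof -
    have "cinner x (scaleC c y) = (cinner x y * cnj (cinner x y)) / cmod (cinner x y)"
      by (simp add: cinner_simps c_def)
    also have "\<dots> = complex_of_real ((cmod (cinner x y))\<^sup>2) / cmod (cinner x y)"
      by (simp only: complex_norm_square)
    finally show ?thesis using False by (simp add: power2_eq_square)
  qed
  then have "cmod (cinner x y) = inner x (scaleC c y)" by (simp add: inner_l2_def)
  also have "\<dots> \<le> norm x * norm (scaleC c y)" by (rule norm_cauchy_schwarz)
  finally show ?thesis by (simp add: c)
qed simp

lemma continuous_cinner_right [continuous_intros]: "continuous_on S (cinner x)"
proof -
  have "bounded_linear (cinner x)"
  proof (rule bounded_linear_intro[where K = "norm x"])
    show "norm (cinner x y) \<le> norm y * norm x" for y using norm_cinner_le[of x y] by (simp add: mult.commute)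
  qed (simp_all add: cinner_add_right scaleR_l2_def cinner_scaleC_right scaleR_conv_of_real)
  then show ?thesis by (rule linear_continuous_on)
qed

lemma tendsto_cinner:
  fixes a b :: "'a l2"
  assumes "(f \<longlongrightarrow> a) F" "(g \<longlongrightarrow> b) F"
  shows "((\<lambda>n. cinner (f n) (g n)) \<longlongrightarrow> cinner a b) F"
proof -
  have b: "bounded_bilinear (cinner :: 'a l2 \<Rightarrow> 'a l2 \<Rightarrow> complex)"
  proof (rule bounded_bilinear.intro)
    show "\<exists>K. \<forall>a b. norm (cinner a b) \<le> norm a * norm b * K"
      by (intro exI[of _ 1]) (simp add: norm_cinner_le)
  qed (simp_all add: cinner_add_right cinner_add_left scaleR_l2_def cinner_scaleC_right
      cinner_scaleC_left scaleR_conv_of_real)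
  show ?thesis using bounded_bilinear.tendsto[OF b assms] .
qed

lemma bounded_linear_scaleC: "bounded_linear (scaleC c)"
  by (rule bounded_linear_intro[where K = "cmod c"])
    (auto simp: scaleC_add_right scaleC_scaleR mult.commute)

lemma tendsto_scaleC: "(f \<longlongrightarrow> a) F \<Longrightarrow> ((\<lambda>n. scaleC c (f n)) \<longlongrightarrow> scaleC c a) F"
  by (rule bounded_linear.tendsto[OF bounded_linear_scaleC])

lemma infsum_finite_support:
  fixes f :: "'a \<Rightarrow> 'b :: {t2_space, topological_comm_monoid_add}"
  assumes "finite F" "\<And>x. x \<notin> F \<Longrightarrow> f x = 0"
  shows "infsum f UNIV = sum f F"
  using assms by (subst infsum_cong_neutral[of F _ _ f]) auto

lemma cinner_finite_support:
  assumes "finite F" "\<And>a. a \<notin> F \<Longrightarrow> fn x a = 0 \<or> fn y a = 0"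
  shows "cinner x y = (\<Sum>a\<in>F. cnj (fn x a) * fn y a)"
  unfolding cinner_def ell2_inner_def using assms
  by (intro infsum_finite_support) fastforce+

definition delta_l2 :: "'a \<Rightarrow> 'a l2" where "delta_l2 a = mk (\<lambda>b. if b = a then 1 else 0)"

lemma fn_delta [simp]: "fn (delta_l2 a) b = (if b = a then 1 else 0)"
  by (simp add: delta_l2_def fn_mk ell2_finite)

lemma cinner_delta: "cinner (delta_l2 a) x = fn x a"
  by (subst cinner_finite_support[of "{a}"]) auto

lemma norm_delta [simp]: "norm (delta_l2 a) = 1"
proof -
  have "(norm (delta_l2 a))\<^sup>2 = 1\<^sup>2"
    using cinner_norm[of "delta_l2 a"] by (simp add: cinner_delta flip: of_real_power)
  then show ?thesis by (simp only: power2_eq_iff_nonneg norm_ge_zero zero_le_one)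
qed

lemma norm_fn_le: "cmod (fn x a) \<le> norm x"
  using norm_cinner_le[of "delta_l2 a" x] by (simp add: cinner_delta)

lemma continuous_fn: "continuous_on S (\<lambda>x. fn x a)"
  using continuous_cinner_right[of S "delta_l2 a"] by (simp add: cinner_delta)

definition restr :: "'a set \<Rightarrow> 'a l2 \<Rightarrow> 'a l2" where
  "restr G x = mk (\<lambda>a. if a \<in> G then fn x a else 0)"

lemma restr_ell2: "(\<lambda>a. if a \<in> G then fn x a else 0) \<in> ell2"
proof -
  obtain C where C: "\<And>F. finite F \<Longrightarrow> (\<Sum>a\<in>F. (cmod (fn x a))\<^sup>2) \<le> C"
    using fn_ell2[of x] unfolding ell2_iff_bounded by blast
  have "(\<Sum>a\<in>F. (cmod (if a \<in> G then fn x a else 0))\<^sup>2) \<le> (\<Sum>a\<in>F. (cmod (fn x a))\<^sup>2)" for F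
    by (rule sum_mono) auto
  then show ?thesis unfolding ell2_iff_bounded using C order_trans by blast
qed

lemma fn_restr [simp]: "fn (restr G x) a = (if a \<in> G then fn x a else 0)"
  by (simp add: restr_def fn_mk restr_ell2)

lemma norm_power2_ell2: "(norm x)\<^sup>2 = (\<Sum>\<^sub>\<infinity>a. (cmod (fn x a))\<^sup>2)"
  by (simp add: norm_ell2 ell2_norm_def infsum_nonneg)

text \<open>Coordinates converge, and the Cauchy bound on a finite set of coordinates survives the
  coordinatewise limit with a threshold independent of that set. This yields both membership of the
  limit in \<open>ell2\<close> and convergence in norm.\<close>

instance l2 :: (type) complete_space
proof
  fix X :: "nat \<Rightarrow> 'a l2" assume "Cauchy X"
  have "Cauchy (\<lambda>n. fn (X n) a)" for a
  proof (rule metric_CauchyI)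
    fix e :: real assume "e > 0"
    then obtain M where "\<forall>m\<ge>M. \<forall>n\<ge>M. dist (X m) (X n) < e"
      using metric_CauchyD[OF \<open>Cauchy X\<close>] by blast
    then show "\<exists>M. \<forall>m\<ge>M. \<forall>n\<ge>M. dist (fn (X m) a) (fn (X n) a) < e"
      by (metis dist_norm fn_minus norm_fn_le order_le_less_trans)
  qed
  then have "\<forall>a. \<exists>l. (\<lambda>n. fn (X n) a) \<longlonglongrightarrow> l"
    using Cauchy_convergent convergent_def by blast
  then obtain f where f: "\<And>a. (\<lambda>n. fn (X n) a) \<longlonglongrightarrow> f a" by metis
  have key: "\<exists>N. \<forall>n\<ge>N. \<forall>F. finite F \<longrightarrow> (\<Sum>a\<in>F. (cmod (fn (X n) a - f a))\<^sup>2) \<le> e\<^sup>2" if "e > 0" for e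
  proof -
    obtain N where N: "\<And>m n. m \<ge> N \<Longrightarrow> n \<ge> N \<Longrightarrow> dist (X m) (X n) < e"
      using metric_CauchyD[OF \<open>Cauchy X\<close> \<open>e > 0\<close>] by blast
    have "(\<Sum>a\<in>F. (cmod (fn (X n) a - f a))\<^sup>2) \<le> e\<^sup>2" if "n \<ge> N" "finite F" for n F
    proof (rule LIMSEQ_le_const2)
      show "(\<lambda>m. \<Sum>a\<in>F. (cmod (fn (X n) a - fn (X m) a))\<^sup>2) \<longlonglongrightarrow> (\<Sum>a\<in>F. (cmod (fn (X n) a - f a))\<^sup>2)"
        by (intro tendsto_intros f)
      have "(\<Sum>a\<in>F. (cmod (fn (X n) a - fn (X m) a))\<^sup>2) \<le> e\<^sup>2" if "m \<ge> N" for m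
      proof -
        have "(\<Sum>a\<in>F. (cmod (fn (X n - X m) a))\<^sup>2) \<le> (norm (X n - X m))\<^sup>2"
          unfolding norm_power2_ell2 using \<open>finite F\<close>
          by (intro finite_sum_le_infsum ell2_summable fn_ell2) simp_all
        also have "\<dots> \<le> e\<^sup>2"
        proof (rule power_mono)
          show "norm (X n - X m) \<le> e" using N[OF that \<open>n \<ge> N\<close>] by (simp add: dist_norm norm_minus_commute)
        qed simp
        finally show ?thesis by (simp only: fn_minus)
      qed
      then show "\<exists>N. \<forall>m\<ge>N. (\<Sum>a\<in>F. (cmod (fn (X n) a - fn (X m) a))\<^sup>2) \<le> e\<^sup>2" by blast
    qed
    then show ?thesis by blast
  qed
  obtain N where N: "\<And>F. finite F \<Longrightarrow> (\<Sum>a\<in>F. (cmod (fn (X N) a - f a))\<^sup>2) \<le> 1\<^sup>2"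
    using key[of 1] by auto
  then have "(\<lambda>a. fn (X N) a - f a) \<in> ell2" unfolding ell2_iff_bounded by blast
  then have "(\<lambda>a. fn (X N) a + (-1) * (fn (X N) a - f a)) \<in> ell2"
    by (intro ell2_add ell2_scale fn_ell2)
  then have fe: "f \<in> ell2" by simp
  have "X \<longlonglongrightarrow> mk f"
  proof (rule metric_LIMSEQ_I)
    fix r :: real assume "r > 0"
    then obtain N where N: "\<And>n F. n \<ge> N \<Longrightarrow> finite F \<Longrightarrow> (\<Sum>a\<in>F. (cmod (fn (X n) a - f a))\<^sup>2) \<le> (r/2)\<^sup>2"
      using key[of "r/2"] by auto
    have "dist (X n) (mk f) < r" if "n \<ge> N" for n
    proof -
      have "(norm (X n - mk f))\<^sup>2 \<le> (r/2)\<^sup>2" unfolding norm_power2_ell2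
        using N[OF that] by (intro infsum_le_finite_sums ell2_summable fn_ell2) (simp add: fn_mk fe)
      then have "norm (X n - mk f) \<le> r / 2" by (rule power2_le_imp_le) (use \<open>r > 0\<close> in simp)
      then show ?thesis using \<open>r > 0\<close> by (simp add: dist_norm)
    qed
    then show "\<exists>no. \<forall>n\<ge>no. dist (X n) (mk f) < r" by blast
  qed
  then show "convergent X" by (rule convergentI)
qed

subsection \<open>Orthogonal projections\<close>

text \<open>A minimising sequence for the distance is Cauchy: midpoints of its members stay in
  \<open>K\<close>, and the parallelogram identity bounds their mutual distance by the excess over
  the infimum. The residue at the minimiser is orthogonal to \<open>K\<close>.\<close>

lemma orthogonal_decomposition:
  fixes K :: "'b :: {real_inner, complete_space} set"
  assumes K: "subspace K" "closed K"
  shows "\<exists>q\<in>K. \<forall>k\<in>K. inner k (v - q) = 0"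
proof -
  define d where "d = (INF k\<in>K. (norm (v - k))\<^sup>2)"
  have K0: "0 \<in> K" using K(1) by (rule subspace_0)
  have bdd: "bdd_below ((\<lambda>k. (norm (v - k))\<^sup>2) ` K)" by (rule bdd_belowI[of _ 0]) auto
  have d_le: "d \<le> (norm (v - k))\<^sup>2" if "k \<in> K" for k
    unfolding d_def by (rule cINF_lower[OF bdd that])
  have "\<exists>k\<in>K. (norm (v - k))\<^sup>2 < d + e" if "e > 0" for e
    using cINF_less_iff[OF _ bdd, of "d + e"] K0 that unfolding d_def by auto
  then have "\<exists>k\<in>K. (norm (v - k))\<^sup>2 < d + 1 / real (Suc n)" for n by simp
  then obtain X where X: "\<And>n. X n \<in> K" "\<And>n. (norm (v - X n))\<^sup>2 < d + 1 / real (Suc n)" by metis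
  have par: "(norm (X m - X n))\<^sup>2 \<le> 2 * (1 / real (Suc m)) + 2 * (1 / real (Suc n))" for m n
  proof -
    have "scaleR (1/2) (X m + X n) \<in> K" using X(1) K(1) by (simp add: subspace_add subspace_scale)
    from d_le[OF this] have "4 * d \<le> (norm (scaleR 2 (v - scaleR (1/2) (X m + X n))))\<^sup>2" by (simp add: power_mult_distrib)
    also have "scaleR 2 (v - scaleR (1/2) (X m + X n)) = (v - X m) + (v - X n)"
      by (simp add: algebra_simps scaleR_2)
    finally have 1: "4 * d \<le> (norm ((v - X m) + (v - X n)))\<^sup>2" .
    have "(norm (X m - X n))\<^sup>2 = (norm ((v - X n) - (v - X m)))\<^sup>2" by simp
    also have "\<dots> = 2 * (norm (v - X m))\<^sup>2 + 2 * (norm (v - X n))\<^sup>2 - (norm ((v - X m) + (v - X n)))\<^sup>2"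
      unfolding power2_norm_eq_inner by (simp add: inner_simps inner_commute algebra_simps)
    finally show ?thesis using 1 X(2)[of m] X(2)[of n] by linarith
  qed
  have "Cauchy X"
  proof (rule metric_CauchyI)
    fix e :: real assume "e > 0"
    then have "e\<^sup>2 / 4 > 0" by simp
    then obtain N where N: "1 / real (Suc N) < e\<^sup>2 / 4" using nat_approx_posE by blast
    have "dist (X m) (X n) < e" if "m \<ge> N" "n \<ge> N" for m n
    proof -
      have "1 / real (Suc m) \<le> 1 / real (Suc N)" "1 / real (Suc n) \<le> 1 / real (Suc N)"
        using that by (auto intro!: divide_left_mono)
      then have "(norm (X m - X n))\<^sup>2 < e\<^sup>2" using par[of m n] N by linarith
      then show ?thesis using \<open>e > 0\<close> by (simp add: dist_norm power_less_imp_less_base)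
    qed
    then show "\<exists>M. \<forall>m\<ge>M. \<forall>n\<ge>M. dist (X m) (X n) < e" by blast
  qed
  then obtain q where q: "X \<longlonglongrightarrow> q" using Cauchy_convergent convergent_def by blast
  have qK: "q \<in> K" using K(2) X(1) q closed_sequentially by blast
  have "(norm (v - q))\<^sup>2 \<le> d"
  proof (rule LIMSEQ_le)
    show "(\<lambda>n. (norm (v - X n))\<^sup>2) \<longlonglongrightarrow> (norm (v - q))\<^sup>2" by (intro tendsto_intros q)
    show "(\<lambda>n. d + 1 / real (Suc n)) \<longlonglongrightarrow> d"
      using tendsto_add[OF tendsto_const LIMSEQ_inverse_real_of_nat, of d] by (simp add: inverse_eq_divide)
    show "\<exists>N. \<forall>n\<ge>N. (norm (v - X n))\<^sup>2 \<le> d + 1 / real (Suc n)" using X(2) less_imp_le by blast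
  qed
  then have min: "(norm (v - q))\<^sup>2 \<le> (norm (v - k))\<^sup>2" if "k \<in> K" for k
    using d_le[OF that] by linarith
  have "inner k (v - q) = 0" if "k \<in> K" for k
  proof (rule ccontr)
    assume ne: "inner k (v - q) \<noteq> 0"
    \<comment> \<open>The value that minimises the quadratic polynomial
      \<open>s \<mapsto> (norm (v - q - scaleR s k))^2\<close>.\<close>
    define s where "s = inner k (v - q) / inner k k"
    have kk: "inner k k > 0" using ne by auto
    have "q + scaleR s k \<in> K" using qK that K(1) by (simp add: subspace_add subspace_scale)
    from min[OF this] have "inner (v - q) (v - q) \<le> inner (v - q - scaleR s k) (v - q - scaleR s k)"
      by (simp add: power2_norm_eq_inner diff_diff_eq)
    also have "\<dots> = inner (v - q) (v - q) - 2 * s * inner k (v - q) + s * s * inner k k"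
      unfolding inner_diff_left[of "v - q" "scaleR s k"] inner_diff_right[of _ "v - q" "scaleR s k"]
      by (simp add: inner_commute algebra_simps)
    also have "\<dots> = inner (v - q) (v - q) - (inner k (v - q))\<^sup>2 / inner k k"
      using kk by (simp add: s_def power2_eq_square)
    finally show False using ne kk by (simp add: divide_le_0_iff)
  qed
  then show ?thesis using qK by blast
qed

definition csubspace :: "'a l2 set \<Rightarrow> bool" where
  "csubspace K \<longleftrightarrow> subspace K \<and> (\<forall>c. \<forall>x\<in>K. scaleC c x \<in> K)"

text \<open>A complex subspace contains \<open>scaleC \<i> k\<close> along with \<open>k\<close>;
  real orthogonality to these two vectors kills the imaginary and the real part of the form.\<close>

lemma csubspace_orth:
  assumes "csubspace K" "k \<in> K" "\<And>k. k \<in> K \<Longrightarrow> inner k v = 0"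
  shows "cinner k v = 0"
  using assms by (auto simp: complex_eq_iff Re_cinner Im_cinner csubspace_def)

lemma closure_subspace:
  fixes S :: "'b :: real_normed_vector set"
  assumes S: "subspace S"
  shows "subspace (closure S)"
  unfolding real_vector.subspace_def
proof (intro conjI ballI allI)
  show "0 \<in> closure S" using subspace_0[OF S] closure_subset by blast
  fix x assume "x \<in> closure S"
  then obtain X where X: "\<forall>n. X n \<in> S" "X \<longlonglongrightarrow> x" unfolding closure_sequential by blast
  show "scaleR c x \<in> closure S" for c unfolding closure_sequential
    by (rule exI[of _ "\<lambda>n. scaleR c (X n)"]) (use X S in \<open>auto intro!: tendsto_intros simp: subspace_scale\<close>)
  fix y assume "y \<in> closure S"
  then obtain Y where Y: "\<forall>n. Y n \<in> S" "Y \<longlonglongrightarrow> y" unfolding closure_sequential by blast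
  show "x + y \<in> closure S" unfolding closure_sequential
    by (rule exI[of _ "\<lambda>n. X n + Y n"]) (use X Y S in \<open>auto intro!: tendsto_intros simp: subspace_add\<close>)
qed

text \<open>\<open>span\<close> takes real combinations only; generators stable under complex
  multiples make its closure a complex subspace.\<close>

lemma csubspace_closure_span:
  assumes "\<And>c x. x \<in> S \<Longrightarrow> scaleC c x \<in> S"
  shows "csubspace (closure (span S))"
proof -
  have lin: "linear (scaleC c :: 'a l2 \<Rightarrow> 'a l2)" for c by (rule bounded_linear.linear[OF bounded_linear_scaleC])
  have sp: "scaleC c x \<in> span S" if "x \<in> span S" for c x
  proof -
    have "scaleC c x \<in> scaleC c ` span S" using that by blast
    also have "\<dots> = span (scaleC c ` S)" using linear_span_image[OF lin] by metis
    also have "\<dots> \<subseteq> span S" using assms by (intro span_mono) auto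
    finally show ?thesis .
  qed
  have "scaleC c x \<in> closure (span S)" if xc: "x \<in> closure (span S)" for c x
  proof -
    obtain X where "\<And>n. X n \<in> span S" "X \<longlonglongrightarrow> x" using xc unfolding closure_sequential by blast
    then have "(\<forall>n. scaleC c (X n) \<in> span S) \<and> (\<lambda>n. scaleC c (X n)) \<longlonglongrightarrow> scaleC c x"
      using sp tendsto_scaleC[of X x sequentially c] by blast
    then show ?thesis unfolding closure_sequential by (rule exI[of _ "\<lambda>n. scaleC c (X n)"])
  qed
  then show ?thesis unfolding csubspace_def by (simp add: closure_subspace)
qed

definition orth_proj :: "'a l2 set \<Rightarrow> 'a l2 \<Rightarrow> 'a l2" where
  "orth_proj K v = (SOME q. q \<in> K \<and> (\<forall>k\<in>K. cinner k (v - q) = 0))"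

lemma orth_proj:
  assumes "csubspace K" "closed K"
  shows "orth_proj K v \<in> K" "k \<in> K \<Longrightarrow> cinner k (v - orth_proj K v) = 0"
proof -
  have "\<exists>q. q \<in> K \<and> (\<forall>k\<in>K. cinner k (v - q) = 0)"
    using orthogonal_decomposition[of K v] csubspace_orth[of K] assms
    unfolding csubspace_def[of K] by blast
  from someI_ex[OF this] show "orth_proj K v \<in> K" "k \<in> K \<Longrightarrow> cinner k (v - orth_proj K v) = 0"
    unfolding orth_proj_def by blast+
qed

lemma orth_proj_unique:
  assumes "csubspace K" "closed K" "q \<in> K" "\<And>k. k \<in> K \<Longrightarrow> cinner k (v - q) = 0"
  shows "orth_proj K v = q"
proof -
  have "orth_proj K v - q \<in> K" using assms orth_proj(1)[of K v] by (simp add: csubspace_def subspace_diff)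
  then have "cinner (orth_proj K v - q) (v - q) - cinner (orth_proj K v - q) (v - orth_proj K v) = 0"
    using assms(4) orth_proj(2)[OF assms(1,2)] by simp
  then have "cinner (orth_proj K v - q) (orth_proj K v - q) = 0" by (simp only: cinner_diff_right[symmetric]) simp
  then show ?thesis by (simp add: cinner_norm)
qed

section \<open>Projection-valued measures\<close>

lemma norm_add_power2: "(norm (x + y :: 'b :: real_inner))\<^sup>2 = (norm x)\<^sup>2 + (norm y)\<^sup>2 + 2 * inner x y"
  unfolding power2_norm_eq_inner by (simp add: inner_simps inner_commute)

lemma norm_diff_power2: "(norm (x - y :: 'b :: real_inner))\<^sup>2 = (norm x)\<^sup>2 + (norm y)\<^sup>2 - 2 * inner x y"
  unfolding power2_norm_eq_inner by (simp add: inner_simps inner_commute)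

lemma cmod_real_diff_power2: "(cmod (complex_of_real r - c))\<^sup>2 = r\<^sup>2 + (cmod c)\<^sup>2 - 2 * (Re c * r)"
  unfolding cmod_power2 by (simp add: power2_eq_square algebra_simps)

text \<open>Additivity in the measure, checked on sets and extended by induction over measurable
  functions. It serves to integrate against the measure of a sum of two vectors when its cross term
  is itself a measure.\<close>

lemma nn_integral_add_measure:
  assumes s: "sets M1 = sets M" "sets M2 = sets M"
    and e: "\<And>A. A \<in> sets M \<Longrightarrow> emeasure M A = emeasure M1 A + emeasure M2 A"
    and f: "f \<in> borel_measurable M"
  shows "(\<integral>\<^sup>+x. f x \<partial>M) = (\<integral>\<^sup>+x. f x \<partial>M1) + (\<integral>\<^sup>+x. f x \<partial>M2)"
  using f
proof (induction rule: borel_measurable_induct)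
  case (cong f g)
  have "space M1 = space M" "space M2 = space M" by (rule sets_eq_imp_space_eq[OF s(1)], rule sets_eq_imp_space_eq[OF s(2)])
  then have "integral\<^sup>N M f = integral\<^sup>N M g" "integral\<^sup>N M1 f = integral\<^sup>N M1 g" "integral\<^sup>N M2 f = integral\<^sup>N M2 g"
    using cong(3) by (auto intro!: nn_integral_cong)
  with cong(4) show ?case by (simp only:)
next
  case (set A) then show ?case using s e by simp
next
  case (mult u c) then show ?case by (simp add: nn_integral_cmult distrib_left measurable_cong_sets[OF s(1)] measurable_cong_sets[OF s(2)])
next
  case (add u v) then show ?case by (simp add: nn_integral_add measurable_cong_sets[OF s(1)] measurable_cong_sets[OF s(2)] ac_simps)
next
  case (seq U)
  have m: "\<And>i. U i \<in> borel_measurable M1" "\<And>i. U i \<in> borel_measurable M2"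
    using seq by (simp_all add: measurable_cong_sets[OF s(1)] measurable_cong_sets[OF s(2)])
  have i1: "incseq (\<lambda>i. \<integral>\<^sup>+x. U i x \<partial>M1)" "incseq (\<lambda>i. \<integral>\<^sup>+x. U i x \<partial>M2)"
    using seq(3) by (auto simp: incseq_def le_fun_def intro!: nn_integral_mono)
  have "(\<integral>\<^sup>+x. (SUP i. U i x) \<partial>M) = (SUP i. (\<integral>\<^sup>+x. U i x \<partial>M1) + (\<integral>\<^sup>+x. U i x \<partial>M2))"
    using seq by (simp add: nn_integral_monotone_convergence_SUP)
  also have "\<dots> = (SUP i. \<integral>\<^sup>+x. U i x \<partial>M1) + (SUP i. \<integral>\<^sup>+x. U i x \<partial>M2)"
    by (rule ennreal_SUP_add[OF i1])
  also have "\<dots> = (\<integral>\<^sup>+x. (SUP i. U i x) \<partial>M1) + (\<integral>\<^sup>+x. (SUP i. U i x) \<partial>M2)"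
    using seq(3) m by (simp add: nn_integral_monotone_convergence_SUP)
  finally show ?case unfolding SUP_apply image_image .
qed

text \<open>Countable additivity is required in norm for each vector. That projections of disjoint
  sets annihilate each other is a consequence and not an axiom.\<close>

locale pvm =
  fixes P :: "real set \<Rightarrow> 'a l2 \<Rightarrow> 'a l2"
  assumes P_add: "B \<in> sets borel \<Longrightarrow> P B (x + y) = P B x + P B y"
    and P_scaleC: "B \<in> sets borel \<Longrightarrow> P B (scaleC c x) = scaleC c (P B x)"
    and P_idem: "B \<in> sets borel \<Longrightarrow> P B (P B x) = P B x"
    and P_sym: "B \<in> sets borel \<Longrightarrow> cinner (P B x) y = cinner x (P B y)"
    and P_UNIV: "P UNIV x = x"
    and P_sums: "range C \<subseteq> sets borel \<Longrightarrow> disjoint_family C \<Longrightarrow> (\<lambda>i :: nat. P (C i) x) sums P (\<Union>i. C i) x"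
begin

definition mu :: "'a l2 \<Rightarrow> real measure" where
  "mu x = measure_of UNIV (sets borel) (\<lambda>B. ennreal ((norm (P B x))\<^sup>2))"

lemma P_zero: "B \<in> sets borel \<Longrightarrow> P B 0 = 0" using P_scaleC[of B 0 0] by simp
lemma P_uminus: "B \<in> sets borel \<Longrightarrow> P B (- x) = - P B x"
  by (simp add: uminus_l2_scaleC P_scaleC)
lemma P_diff: "B \<in> sets borel \<Longrightarrow> P B (x - y) = P B x - P B y"
  by (metis P_add P_uminus diff_conv_add_uminus)

lemma P_empty: "P {} x = 0"
proof -
  have "(\<lambda>i :: nat. P {} x) sums P (\<Union>i :: nat. {}) x"
    using P_sums[of "\<lambda>_. {}"] by (simp add: disjoint_family_on_def)
  then have "(\<lambda>i :: nat. P {} x) \<longlonglongrightarrow> 0" by (intro summable_LIMSEQ_zero sums_summable)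
  then show ?thesis using LIMSEQ_const_iff by blast
qed

lemma P_Un:
  assumes "A \<in> sets borel" "B \<in> sets borel" "A \<inter> B = {}"
  shows "P (A \<union> B) x = P A x + P B x"
proof -
  let ?C = "binaryset A B"
  have "(\<lambda>i. P (?C i) x) sums P (\<Union>i. ?C i) x"
    using assms by (intro P_sums) (auto simp: binaryset_def disjoint_family_on_def)
  moreover have "(\<lambda>i. P (?C i) x) sums (\<Sum>i\<in>{0,1}. P (?C i) x)"
    by (rule sums_finite) (auto simp: binaryset_def P_empty)
  ultimately show ?thesis using sums_unique2 by (fastforce simp: UN_binaryset_eq binaryset_def)
qed

text \<open>Idempotence of \<open>P (A \<union> B)\<close> gives
  \<open>P A P B + P B P A = 0\<close>. Multiplying by \<open>P A\<close> from the left and from the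
  right shows that both products equal \<open>- P A P B P A\<close>; being equal and opposite, they
  vanish.\<close>

lemma P_disjoint:
  assumes A: "A \<in> sets borel" and B: "B \<in> sets borel" and d: "A \<inter> B = {}"
  shows "P A (P B x) = 0"
proof -
  have AB: "P A (P B x) + P B (P A x) = 0" for x
  proof -
    have "P (A \<union> B) (P (A \<union> B) x) = P (A \<union> B) x" using A B by (intro P_idem) auto
    then show ?thesis using A B d by (simp add: P_Un P_add P_idem algebra_simps)
  qed
  have "P A (P B (P A x)) + P B (P A x) = 0" using AB[of "P A x"] A by (simp add: P_idem)
  moreover have "P A (P B x) + P A (P B (P A x)) = 0"
    using arg_cong[OF AB[of x], of "P A"] A by (simp add: P_add P_idem P_zero)
  ultimately have "P A (P B x) = P B (P A x)" by (metis add.commute add_left_cancel)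
  with AB[of x] have "scaleR 2 (P A (P B x)) = 0" by (simp add: scaleR_2)
  then show ?thesis by simp
qed

lemma P_Int:
  assumes A: "A \<in> sets borel" and B: "B \<in> sets borel"
  shows "P A (P B x) = P (A \<inter> B) x"
proof -
  have "P B x = P ((A \<inter> B) \<union> (B - A)) x" by (rule arg_cong[of _ _ "\<lambda>X. P X x"]) auto
  also have "\<dots> = P (A \<inter> B) x + P (B - A) x" using A B by (intro P_Un) auto
  finally have "P A (P B x) = P A (P (A \<inter> B) x) + P A (P (B - A) x)" using A by (simp add: P_add)
  also have "P A (P (B - A) x) = 0" using A B by (intro P_disjoint) auto
  also have "P A (P (A \<inter> B) x) = P ((A \<inter> B) \<union> (A - B)) (P (A \<inter> B) x)"
    by (rule arg_cong[of _ _ "\<lambda>X. P X _"]) auto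
  also have "\<dots> = P (A \<inter> B) (P (A \<inter> B) x) + P (A - B) (P (A \<inter> B) x)" using A B by (intro P_Un) auto
  also have "P (A - B) (P (A \<inter> B) x) = 0" using A B by (intro P_disjoint) auto
  finally show ?thesis using A B by (simp add: P_idem)
qed

lemma P_split: assumes "B \<in> sets borel" shows "x = P B x + P (- B) x"
  using P_Un[of B "- B" x] assms by (simp add: P_UNIV borel_comp)

lemma P_inner: assumes "B \<in> sets borel" shows "inner (P B x) y = inner x (P B y)"
  using P_sym[OF assms, of x y] by (simp add: inner_l2_def)

lemma norm_P: "B \<in> sets borel \<Longrightarrow> (norm (P B x))\<^sup>2 = inner x (P B x)"
  unfolding power2_norm_eq_inner by (simp add: P_inner P_idem)

lemma sets_mu [simp, measurable_cong]: "sets (mu x) = sets borel"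
  unfolding mu_def by (simp add: sets.sigma_sets_eq[of borel, simplified])

lemma space_mu [simp]: "space (mu x) = UNIV" by (simp add: mu_def)

lemma emeasure_mu: assumes "B \<in> sets borel" shows "emeasure (mu x) B = ennreal ((norm (P B x))\<^sup>2)"
proof -
  have "countably_additive (sets borel) (\<lambda>B. ennreal ((norm (P B x))\<^sup>2))"
  proof (rule countably_additiveI)
    fix C :: "nat \<Rightarrow> real set" assume C: "range C \<subseteq> sets borel" "disjoint_family C"
    have "(\<lambda>i. inner x (P (C i) x)) sums inner x (P (\<Union>i. C i) x)"
      by (rule bounded_linear.sums[OF bounded_linear_inner_right P_sums[OF C]])
    then have "(\<lambda>i. (norm (P (C i) x))\<^sup>2) sums (norm (P (\<Union>i. C i) x))\<^sup>2"
      using C by (subst (1 2) norm_P) auto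
    then show "(\<Sum>i. ennreal ((norm (P (C i) x))\<^sup>2)) = ennreal ((norm (P (\<Union>i. C i) x))\<^sup>2)"
      by (intro suminf_ennreal_eq) auto
  qed
  then show ?thesis unfolding mu_def using assms
    by (subst emeasure_measure_of_sigma) (auto simp: positive_def P_empty sets.sigma_algebra_axioms[of borel, simplified])
qed

lemma finite_measure_mu [simp]: "finite_measure (mu x)"
  by (rule finite_measureI) (simp add: emeasure_mu)

lemma emeasure_mu_UNIV: "emeasure (mu x) UNIV = ennreal ((norm x)\<^sup>2)"
  by (simp add: emeasure_mu P_UNIV)

lemma measure_mu: "B \<in> sets borel \<Longrightarrow> measure (mu x) B = (norm (P B x))\<^sup>2"
  by (simp add: measure_def emeasure_mu)

lemma mu_P: assumes B: "B \<in> sets borel" shows "mu (P B x) = density (mu x) (indicator B)"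
proof (rule measure_eqI)
  fix A assume "A \<in> sets (mu (P B x))"
  then have A: "A \<in> sets borel" by simp
  have "emeasure (density (mu x) (indicator B)) A = (\<integral>\<^sup>+l. indicator (A \<inter> B) l \<partial>mu x)"
    using A B by (subst emeasure_density) (auto intro!: nn_integral_cong simp del: nn_integral_indicator split: split_indicator)
  then show "emeasure (mu (P B x)) A = emeasure (density (mu x) (indicator B)) A"
    using A B by (simp add: emeasure_mu P_Int)
qed simp

lemma P_eq_zero_iff: "B \<in> sets borel \<Longrightarrow> P B x = 0 \<longleftrightarrow> emeasure (mu x) B = 0"
  by (simp add: emeasure_mu)

end

section \<open>Operators linked to a projection-valued measure only by domain and quadratic
  form\<close>

locale spectral_op = pvm P for P :: "real set \<Rightarrow> 'a l2 \<Rightarrow> 'a l2" +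
  fixes D :: "'a l2 set" and T :: "'a l2 \<Rightarrow> 'a l2"
  assumes D_iff: "x \<in> D \<longleftrightarrow> (\<integral>\<^sup>+ l. ennreal (l\<^sup>2) \<partial>mu x) < \<infinity>"
    and D_add: "x \<in> D \<Longrightarrow> y \<in> D \<Longrightarrow> x + y \<in> D"
    and D_scaleC: "x \<in> D \<Longrightarrow> scaleC c x \<in> D"
    and T_add: "x \<in> D \<Longrightarrow> y \<in> D \<Longrightarrow> T (x + y) = T x + T y"
    and T_scaleC: "x \<in> D \<Longrightarrow> T (scaleC c x) = scaleC c (T x)"
    and T_sym: "x \<in> D \<Longrightarrow> y \<in> D \<Longrightarrow> cinner x (T y) = cinner (T x) y"
    and T_form: "x \<in> D \<Longrightarrow> cinner x (T x) = complex_of_real (\<integral>l. l \<partial>mu x)"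
    and D_dense: "(\<And>x. x \<in> D \<Longrightarrow> cinner x w = 0) \<Longrightarrow> w = 0"
begin

lemma P_D: assumes "x \<in> D" "B \<in> sets borel" shows "P B x \<in> D"
proof -
  have "(\<integral>\<^sup>+ l. ennreal (l\<^sup>2) \<partial>mu (P B x)) = (\<integral>\<^sup>+ l. indicator B l * ennreal (l\<^sup>2) \<partial>mu x)"
    using assms by (simp add: mu_P nn_integral_density)
  also have "\<dots> \<le> (\<integral>\<^sup>+ l. ennreal (l\<^sup>2) \<partial>mu x)" by (intro nn_integral_mono) (auto simp: indicator_def)
  also have "\<dots> < \<infinity>" using assms D_iff by blast
  finally show ?thesis using D_iff by blast
qed

lemma P_bounded_D: assumes "B \<in> sets borel" "B \<subseteq> {-M..M}" shows "P B x \<in> D"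
proof -
  have "(\<integral>\<^sup>+ l. ennreal (l\<^sup>2) \<partial>mu (P B x)) = (\<integral>\<^sup>+ l. indicator B l * ennreal (l\<^sup>2) \<partial>mu x)"
    using assms by (simp add: mu_P nn_integral_density)
  also have "\<dots> \<le> (\<integral>\<^sup>+ l. ennreal (M\<^sup>2) \<partial>mu x)"
  proof (intro nn_integral_mono)
    fix l
    have "\<bar>l\<bar> \<le> \<bar>M\<bar>" if "l \<in> B" using that assms(2) by fastforce
    then have "l \<in> B \<Longrightarrow> l\<^sup>2 \<le> M\<^sup>2" by (simp only: abs_le_square_iff)
    then show "indicator B l * ennreal (l\<^sup>2) \<le> ennreal (M\<^sup>2)" by (auto simp: indicator_def)
  qed
  also have "\<dots> < \<infinity>" by (simp add: emeasure_mu_UNIV ennreal_mult_less_top)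
  finally show ?thesis using D_iff by blast
qed

lemma integrable_id: assumes "x \<in> D" shows "integrable (mu x) (\<lambda>l. l)"
proof -
  interpret finite_measure "mu x" by simp
  have "integrable (mu x) (\<lambda>l. l\<^sup>2)"
    using assms D_iff by (intro integrableI_bounded) auto
  then have "integrable (mu x) (\<lambda>l. 1 + l\<^sup>2)" by simp
  then show ?thesis
  proof (rule Bochner_Integration.integrable_bound)
    have "\<bar>l\<bar> \<le> 1 + l\<^sup>2" for l :: real
      using sum_squares_bound[of "\<bar>l\<bar>" 1] by (simp add: power2_eq_square)
    then show "AE l in mu x. norm l \<le> norm (1 + l\<^sup>2)" by simp
  qed simp
qed

lemma integral_mu_P:
  fixes f :: "real \<Rightarrow> real"
  assumes "B \<in> sets borel" "f \<in> borel_measurable borel"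
  shows "(\<integral>l. f l \<partial>mu (P B x)) = (\<integral>l. indicator B l * f l \<partial>mu x)"
proof -
  have "mu (P B x) = density (mu x) (\<lambda>l. ennreal (indicator B l))"
    using assms by (simp add: mu_P ennreal_indicator)
  moreover have "f \<in> borel_measurable (mu x)" using assms(2) by (simp add: measurable_cong_sets[OF sets_mu refl])
  ultimately show ?thesis using assms(1) by (simp add: integral_density)
qed

text \<open>With \<open>f1\<close> in the range of \<open>P B\<close> and \<open>f2\<close> in that
  of \<open>P (- B)\<close>, the measure of \<open>f1 + f2\<close> is the sum of the two measures,
  so the form of \<open>T\<close> at \<open>f1 + f2\<close> has no cross term. This settles the real
  part; replacing \<open>x\<close> by \<open>scaleC \<i> x\<close> settles the imaginary
  part.\<close>

lemma offdiagonal: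
  assumes x: "x \<in> D" and y: "y \<in> D" and B: "B \<in> sets borel"
  shows "cinner (P B x) (T (P (- B) y)) = 0"
proof -
  have cB: "- B \<in> sets borel" using B by (rule borel_comp)
  have re: "Re (cinner (P B x) (T (P (- B) y))) = 0" if x: "x \<in> D" for x
  proof -
    define f1 where "f1 = P B x"
    define f2 where "f2 = P (- B) y"
    have D12: "f1 \<in> D" "f2 \<in> D" using x y B cB by (simp_all add: f1_def f2_def P_D)
    have P12: "P B (f1 + f2) = f1" "P (- B) (f1 + f2) = f2"
      using B cB by (simp_all add: f1_def f2_def P_add P_idem P_disjoint)
    have int: "integrable (mu (f1 + f2)) (\<lambda>l. l)" using D12 D_add integrable_id by blast
    have "(\<integral>l. l \<partial>mu (f1 + f2)) = (\<integral>l. indicator B l * l + indicator (- B) l * l \<partial>mu (f1 + f2))"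
      by (rule Bochner_Integration.integral_cong) (auto simp: indicator_def)
    also have "\<dots> = (\<integral>l. indicator B l * l \<partial>mu (f1 + f2)) + (\<integral>l. indicator (- B) l * l \<partial>mu (f1 + f2))"
      using B cB int by (intro Bochner_Integration.integral_add integrable_mult_indicator[where 'b=real, simplified]) auto
    also have "\<dots> = (\<integral>l. l \<partial>mu f1) + (\<integral>l. l \<partial>mu f2)"
      using B cB integral_mu_P[of B "\<lambda>l. l" "f1 + f2"] integral_mu_P[of "- B" "\<lambda>l. l" "f1 + f2"] P12 by simp
    finally have "cinner (f1 + f2) (T (f1 + f2)) = cinner f1 (T f1) + cinner f2 (T f2)"
      using D12 by (simp add: T_form D_add)
    then have "cinner f1 (T f2) + cinner f2 (T f1) = 0" using D12 by (simp add: T_add cinner_simps add.commute)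
    moreover have "cinner f2 (T f1) = cnj (cinner f1 (T f2))"
      using T_sym[of f2 f1] D12 cinner_commute[of f1 "T f2"] by (metis cinner_commute)
    ultimately have "2 * Re (cinner f1 (T f2)) = 0" by (simp add: complex_eq_iff)
    then show ?thesis by (simp add: f1_def f2_def)
  qed
  have "Re (cinner (P B (scaleC \<i> x)) (T (P (- B) y))) = 0" using re D_scaleC x by blast
  then have "Im (cinner (P B x) (T (P (- B) y))) = 0" using B by (simp add: P_scaleC cinner_simps)
  with re[OF x] show ?thesis by (simp add: complex_eq_iff)
qed

text \<open>The off-diagonal blocks of \<open>T\<close> with respect to \<open>P B\<close> and
  \<open>P (- B)\<close> are orthogonal to the dense set \<open>D\<close>, hence zero, so
  \<open>T\<close> maps each of the two ranges into itself.\<close>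

lemma commute: assumes y: "y \<in> D" and B: "B \<in> sets borel" shows "P B (T y) = T (P B y)"
proof -
  have cB: "- B \<in> sets borel" using B by (rule borel_comp)
  have z: "P C (T (P (- C) y)) = 0" if "C \<in> sets borel" for C
    by (rule D_dense) (metis P_sym offdiagonal that y)
  have "T y = T (P B y + P (- B) y)" using P_split[OF B] by metis
  also have "\<dots> = T (P B y) + T (P (- B) y)" using y B cB by (simp add: T_add P_D)
  finally have "P B (T y) = P B (T (P B y))" using z[OF B] B by (simp add: P_add)
  also have "\<dots> = P B (T (P B y)) + P (- B) (T (P B y))" using z[OF cB] by simp
  also have "\<dots> = T (P B y)" using P_split[OF B] by metis
  finally show ?thesis .
qed

text \<open>On a bounded spectral window \<open>S = T + M\<close> is positive, and the measure of \<open>y + S y\<close> is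
  that of \<open>y\<close> plus that of \<open>S y\<close> plus \<open>2 (l + M)\<close> times that of \<open>y\<close>; evaluating the form of \<open>S\<close>
  there gives the second moment without any partition of the line.\<close>

lemma shifted_norm:
  assumes y: "P B y = y" and B: "B \<in> sets borel" "B \<subseteq> {-M..M}"
  shows "(norm (T y + scaleR M y))\<^sup>2 = (\<integral>l. (indicator B l * (l + M))\<^sup>2 \<partial>mu y)"
    and "inner y (T y + scaleR M y) = (\<integral>l. indicator B l * (l + M) \<partial>mu y)"
proof -
  \<comment> \<open>Nonnegative because \<open>B\<close> lies in \<open>{-M..M}\<close>; this is
    what allows \<open>2 * g\<close> to act as the density of the cross term.\<close>
  define g where "g = (\<lambda>l :: real. indicator B l * (l + M))"
  have g0: "0 \<le> g l" for l using B by (auto simp: g_def indicator_def)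
  have [measurable]: "g \<in> borel_measurable borel" unfolding g_def using B by measurable
  define S where "S = T y + scaleR M y"
  have inD: "x \<in> D" if "P B x = x" for x using P_bounded_D[OF B, of x] that by simp
  have gb: "\<bar>g l\<bar> \<le> 2 * \<bar>M\<bar>" for l using B by (auto simp: g_def indicator_def)
  have igf: "integrable (mu x) g" for x
  proof -
    interpret finite_measure "mu x" by simp
    show ?thesis using gb by (intro integrable_const_bound[where B="2*\<bar>M\<bar>"]) auto
  qed
  have form: "Re (cinner x (T x + scaleR M x)) = (\<integral>l. g l \<partial>mu x)" if x: "P B x = x" for x
  proof -
    interpret finite_measure "mu x" by simp
    have "(\<integral>l. g l \<partial>mu x) = (\<integral>l. l + M \<partial>mu (P B x))"
      unfolding g_def using B by (subst integral_mu_P) auto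
    also have "\<dots> = (\<integral>l. l \<partial>mu x) + M * measure (mu x) UNIV"
      using integrable_id[OF inD[OF x]] x by simp
    also have "\<dots> = Re (cinner x (T x)) + M * (norm x)\<^sup>2"
      using T_form[OF inD[OF x]] by (simp add: measure_mu P_UNIV)
    finally show ?thesis by (simp add: cinner_simps scaleR_l2_def cinner_norm)
  qed
  have nnform: "(\<integral>\<^sup>+l. ennreal (g l) \<partial>mu x) = ennreal (Re (cinner x (T x + scaleR M x)))" if "P B x = x" for x
    unfolding form[OF that] using g0 igf by (intro nn_integral_eq_integral) auto
  have yD: "y \<in> D" by (rule inD[OF y])
  have PBS: "P B S = S" using commute[OF yD B(1)] y B(1)
    by (simp add: S_def P_add scaleR_l2_def P_scaleC)
  have PBy: "P B (y + S) = y + S" using y PBS B by (simp add: P_add)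
  have PAy: "P B (P A y) = P A y" if "A \<in> sets borel" for A
    using that B y by (metis P_Int Int_commute)
  have form0: "inner x (T x + scaleR M x) \<ge> 0" if "P B x = x" for x
    using form[OF that] g0 by (simp add: Re_cinner)
  have cross: "inner (P A y) S = (\<integral>l. indicator A l * g l \<partial>mu y)" if A: "A \<in> sets borel" for A
  proof -
    have "inner (P A y) S = inner (P A y) (P A S)" using A by (metis P_inner P_idem)
    also have "P A S = T (P A y) + scaleR M (P A y)"
      using commute[OF yD A] A by (simp add: S_def P_add scaleR_l2_def P_scaleC)
    also have "inner (P A y) \<dots> = (\<integral>l. g l \<partial>mu (P A y))"
      using form[OF PAy[OF A]] by (simp add: Re_cinner)
    finally show ?thesis using A by (simp add: integral_mu_P)
  qed
  have sum: "emeasure (mu (y + S)) A = emeasure (mu y) A + (emeasure (mu S) A + emeasure (density (mu y) (\<lambda>l. ennreal (2 * g l))) A)"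
    if A: "A \<in> sets borel" for A
  proof -
    have i: "integrable (mu y) (\<lambda>l. indicator A l * g l)"
      using integrable_mult_indicator[of A "mu y" g] A igf by simp
    have "emeasure (density (mu y) (\<lambda>l. ennreal (2 * g l))) A = (\<integral>\<^sup>+l. ennreal (2 * (indicator A l * g l)) \<partial>mu y)"
      using A by (subst emeasure_density) (auto simp: indicator_def intro!: nn_integral_cong)
    also have "\<dots> = ennreal (\<integral>l. 2 * (indicator A l * g l) \<partial>mu y)"
      using i g0 by (intro nn_integral_eq_integral) (auto simp: indicator_def)
    also have "\<dots> = ennreal (2 * inner (P A y) S)" using cross[OF A] by simp
    finally have e3: "emeasure (density (mu y) (\<lambda>l. ennreal (2 * g l))) A = ennreal (2 * inner (P A y) S)" .
    have "(norm (P A (y + S)))\<^sup>2 = (norm (P A y))\<^sup>2 + (norm (P A S))\<^sup>2 + 2 * inner (P A y) S"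
      using A by (simp add: P_add norm_add_power2) (metis P_inner P_idem)
    moreover have "0 \<le> inner (P A y) S" unfolding cross[OF A]
      by (intro integral_nonneg_AE AE_I2) (auto simp: indicator_def g0)
    ultimately show ?thesis unfolding e3 using A by (simp add: emeasure_mu flip: ennreal_plus)
  qed
  \<comment> \<open>The last two of the three measures are bundled so that
    \<open>nn_integral_add_measure\<close> can be applied twice.\<close>
  define N where "N = measure_of UNIV (sets borel) (\<lambda>A. emeasure (mu S) A + emeasure (density (mu y) (\<lambda>l. ennreal (2 * g l))) A)"
  have "countably_additive (sets borel) (\<lambda>A. emeasure (mu S) A + emeasure (density (mu y) (\<lambda>l. ennreal (2 * g l))) A)"
    by (rule countably_additiveI) (simp add: suminf_add[symmetric] suminf_emeasure)
  then have N: "A \<in> sets borel \<Longrightarrow> emeasure N A = emeasure (mu S) A + emeasure (density (mu y) (\<lambda>l. ennreal (2 * g l))) A" for A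
    unfolding N_def by (subst emeasure_measure_of_sigma) (auto simp: positive_def sets.sigma_algebra_axioms[of borel, simplified])
  have sN: "sets N = sets borel" unfolding N_def by (simp add: sets.sigma_sets_eq[of borel, simplified])
  have "(\<integral>\<^sup>+l. ennreal (g l) \<partial>mu (y + S)) = (\<integral>\<^sup>+l. ennreal (g l) \<partial>mu y) + (\<integral>\<^sup>+l. ennreal (g l) \<partial>N)"
    by (rule nn_integral_add_measure) (auto simp: sN N sum)
  also have "(\<integral>\<^sup>+l. ennreal (g l) \<partial>N) = (\<integral>\<^sup>+l. ennreal (g l) \<partial>mu S) + (\<integral>\<^sup>+l. ennreal (g l) \<partial>density (mu y) (\<lambda>l. ennreal (2 * g l)))"
    by (rule nn_integral_add_measure) (auto simp: sN N cong: measurable_cong_sets)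
  also have "(\<integral>\<^sup>+l. ennreal (g l) \<partial>density (mu y) (\<lambda>l. ennreal (2 * g l))) = (\<integral>\<^sup>+l. ennreal (2 * (g l)\<^sup>2) \<partial>mu y)"
    by (subst nn_integral_density) (auto simp: g0 power2_eq_square simp flip: ennreal_mult' intro!: nn_integral_cong)
  also have "\<dots> = ennreal (\<integral>l. 2 * (g l)\<^sup>2 \<partial>mu y)"
  proof (rule nn_integral_eq_integral)
    interpret finite_measure "mu y" by simp
    have "\<bar>g l\<bar>\<^sup>2 \<le> (2 * \<bar>M\<bar>)\<^sup>2" for l using gb by (intro power_mono) auto
    then show "integrable (mu y) (\<lambda>l. 2 * (g l)\<^sup>2)"
      by (intro integrable_const_bound[where B="2*(2*\<bar>M\<bar>)\<^sup>2"]) auto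
  qed auto
  finally have "ennreal (inner (y + S) (T (y + S) + scaleR M (y + S))) =
     ennreal (inner y (T y + scaleR M y)) + (ennreal (inner S (T S + scaleR M S)) + ennreal (\<integral>l. 2 * (g l)\<^sup>2 \<partial>mu y))"
    using nnform[OF y] nnform[OF PBS] nnform[OF PBy] by (simp add: Re_cinner)
  then have "inner (y + S) (T (y + S) + scaleR M (y + S)) = inner y (T y + scaleR M y) + (inner S (T S + scaleR M S) + (\<integral>l. 2 * (g l)\<^sup>2 \<partial>mu y))"
    using form0[OF y] form0[OF PBS] form0[OF PBy]
    by (simp flip: ennreal_plus) 
  \<comment> \<open>The form of \<open>T + M\<close> at \<open>y + S\<close> is its form at
    \<open>y\<close> plus its form at \<open>S\<close> plus two cross terms, each equal to
    \<open>inner S S\<close> because \<open>S = (T + M) y\<close> and \<open>T\<close> is symmetric.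
    Comparison with the integrated identity leaves only the second moment.\<close>
  moreover have "T (y + S) = T y + T S" using yD inD[OF PBS] by (simp add: T_add)
  moreover have "inner y (T S) = inner (T y) S" using T_sym[OF yD inD[OF PBS]] by (simp add: inner_l2_def)
  ultimately have "2 * inner S S = (\<integral>l. 2 * (g l)\<^sup>2 \<partial>mu y)"
    by (simp add: S_def inner_simps inner_commute algebra_simps)
  then show "(norm (T y + scaleR M y))\<^sup>2 = (\<integral>l. (indicator B l * (l + M))\<^sup>2 \<partial>mu y)"
    by (simp add: power2_norm_eq_inner S_def g_def)
  show "inner y (T y + scaleR M y) = (\<integral>l. indicator B l * (l + M) \<partial>mu y)"
    using form[OF y] by (simp add: g_def Re_cinner)
qed

text \<open>Writing \<open>T - z\<close> as \<open>(T + M) - (z + M)\<close> expands the squared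
  norm into the second moment, the first moment and the mass, all known from
  \<open>shifted_norm\<close>; on the integral side the same expansion is
  \<open>cmod_real_diff_power2\<close>.\<close>

lemma resolvent_norm_window:
  assumes y: "P B y = y" and B: "B \<in> sets borel" "B \<subseteq> {-M..M}"
  shows "ennreal ((norm (T y - scaleC z y))\<^sup>2) = (\<integral>\<^sup>+l. ennreal ((cmod (l - z))\<^sup>2) \<partial>mu y)"
proof -
  interpret finite_measure "mu y" by simp
  define g where "g = (\<lambda>l :: real. indicator B l * (l + M))"
  define S where "S = T y + scaleR M y"
  define c where "c = z + M"
  have [measurable]: "g \<in> borel_measurable borel" unfolding g_def using B by measurable
  have gb: "\<bar>g l\<bar> \<le> 2 * \<bar>M\<bar>" for l using B by (auto simp: g_def indicator_def)
  have ig: "integrable (mu y) g" using gb by (intro integrable_const_bound[where B="2*\<bar>M\<bar>"]) auto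
  have "\<bar>g l\<bar>\<^sup>2 \<le> (2 * \<bar>M\<bar>)\<^sup>2" for l using gb by (intro power_mono) auto
  then have ig2: "integrable (mu y) (\<lambda>l. (g l)\<^sup>2)"
    by (intro integrable_const_bound[where B="(2*\<bar>M\<bar>)\<^sup>2"]) auto
  have yD: "y \<in> D" using P_bounded_D[OF B, of y] y by simp
  have "T y - scaleC z y = S - scaleC c y"
    by (simp add: S_def c_def scaleC_add_left scaleC_of_real)
  then have "(norm (T y - scaleC z y))\<^sup>2 = (norm S)\<^sup>2 + (cmod c * norm y)\<^sup>2 - 2 * inner S (scaleC c y)"
    by (simp add: norm_diff_power2)
  also have "inner S (scaleC c y) = Re c * inner y S"
  proof -
    have "cnj (cinner S y) = cinner S y"
      using T_sym[OF yD yD] unfolding S_def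
      by (simp add: cinner_simps scaleR_l2_def) (metis cinner_commute)
    then have "cinner S y = complex_of_real (inner y S)"
      by (metis Re_cinner Reals_cnj_iff cinner_commute complex_is_Real_iff of_real_Re)
    then show ?thesis by (simp add: inner_l2_def cinner_simps)
  qed
  also have "(norm S)\<^sup>2 + (cmod c * norm y)\<^sup>2 - 2 * (Re c * inner y S) = (\<integral>l. (g l)\<^sup>2 + (cmod c)\<^sup>2 - 2 * (Re c * g l) \<partial>mu y)"
    using shifted_norm[OF y B] ig ig2 measure_mu[of UNIV y]
    by (simp add: S_def g_def P_UNIV power_mult_distrib mult.commute)
  also have "\<dots> = (\<integral>l. (cmod (g l - c))\<^sup>2 \<partial>mu y)"
    by (rule Bochner_Integration.integral_cong) (simp_all add: cmod_real_diff_power2)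
  finally have "ennreal ((norm (T y - scaleC z y))\<^sup>2) = ennreal (\<integral>l. (cmod (g l - c))\<^sup>2 \<partial>mu y)" by simp
  also have "\<dots> = (\<integral>\<^sup>+l. ennreal ((cmod (g l - c))\<^sup>2) \<partial>mu y)"
  proof (rule nn_integral_eq_integral[symmetric])
    have "(\<lambda>l. (cmod (g l - c))\<^sup>2) = (\<lambda>l. (g l)\<^sup>2 + (cmod c)\<^sup>2 - 2 * (Re c * g l))"
      by (rule ext) (simp_all add: cmod_real_diff_power2)
    then show "integrable (mu y) (\<lambda>l. (cmod (g l - c))\<^sup>2)" using ig ig2 by simp
  qed auto
  also have "\<dots> = (\<integral>\<^sup>+l. indicator B l * ennreal ((cmod (g l - c))\<^sup>2) \<partial>mu y)"
    using B y mu_P[of B y] nn_integral_density[of "indicator B" "mu y" "\<lambda>l. ennreal ((cmod (g l - c))\<^sup>2)"] by simp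
  also have "\<dots> = (\<integral>\<^sup>+l. indicator B l * ennreal ((cmod (l - z))\<^sup>2) \<partial>mu y)"
    by (rule nn_integral_cong) (auto simp: indicator_def g_def c_def)
  also have "\<dots> = (\<integral>\<^sup>+l. ennreal ((cmod (l - z))\<^sup>2) \<partial>mu y)"
    using B y mu_P[of B y] nn_integral_density[of "indicator B" "mu y" "\<lambda>l. ennreal ((cmod (l - z))\<^sup>2)"] by simp
  finally show ?thesis .
qed

text \<open>The identity through which the quadratic form determines the operator. On the bounded
  windows \<open>A \<inter> {-k..k}\<close> the projections commute with \<open>T\<close> and
  \<open>resolvent_norm_window\<close> applies; the windows then exhaust \<open>A\<close>. For
  \<open>z\<close> off the real axis the density cancels a Poisson kernel, for \<open>z\<close> an
  eigenvalue it concentrates the measure in one point.\<close>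

theorem mu_resolvent:
  assumes x: "x \<in> D"
  shows "mu (T x - scaleC z x) = density (mu x) (\<lambda>l. ennreal ((cmod (l - z))\<^sup>2))"
proof (rule measure_eqI)
  fix A assume "A \<in> sets (mu (T x - scaleC z x))"
  then have A: "A \<in> sets borel" by simp
  define C where "C = (\<lambda>k :: nat. A \<inter> {-real k..real k})"
  have C: "C k \<in> sets borel" "C k \<subseteq> {- real k..real k}" for k using A by (auto simp: C_def)
  have "incseq C" unfolding C_def by (auto simp: incseq_def)
  have UC: "(\<Union>k. C k) = A"
  proof -
    have "\<exists>k. l \<in> {- real k..real k}" for l
    proof -
      obtain k where "\<bar>l\<bar> \<le> real k" using real_arch_simple by blast
      then show ?thesis by (intro exI[of _ k]) auto
    qed
    then show ?thesis unfolding C_def by blast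
  qed
  have eq: "emeasure (mu (T x - scaleC z x)) (C k) = emeasure (density (mu x) (\<lambda>l. ennreal ((cmod (l - z))\<^sup>2))) (C k)" for k
  proof -
    have "P (C k) (T x - scaleC z x) = T (P (C k) x) - scaleC z (P (C k) x)"
      using C by (simp add: P_diff P_scaleC commute x)
    then have "emeasure (mu (T x - scaleC z x)) (C k) = (\<integral>\<^sup>+l. ennreal ((cmod (l - z))\<^sup>2) \<partial>mu (P (C k) x))"
      using C by (simp add: emeasure_mu resolvent_norm_window[OF P_idem[OF C(1)] C])
    also have "\<dots> = (\<integral>\<^sup>+l. indicator (C k) l * ennreal ((cmod (l - z))\<^sup>2) \<partial>mu x)"
      using C by (simp add: mu_P nn_integral_density)
    also have "\<dots> = emeasure (density (mu x) (\<lambda>l. ennreal ((cmod (l - z))\<^sup>2))) (C k)"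
      using C by (subst emeasure_density) (auto simp: mult.commute)
    finally show ?thesis .
  qed
  have "(\<lambda>k. emeasure (mu (T x - scaleC z x)) (C k)) \<longlonglongrightarrow> emeasure (mu (T x - scaleC z x)) A"
    using Lim_emeasure_incseq[of C "mu (T x - scaleC z x)"] C \<open>incseq C\<close> UC by auto
  moreover have "(\<lambda>k. emeasure (density (mu x) (\<lambda>l. ennreal ((cmod (l - z))\<^sup>2))) (C k)) \<longlonglongrightarrow>
      emeasure (density (mu x) (\<lambda>l. ennreal ((cmod (l - z))\<^sup>2))) A"
    using Lim_emeasure_incseq[of C "density (mu x) (\<lambda>l. ennreal ((cmod (l - z))\<^sup>2))"] C \<open>incseq C\<close> UC by auto
  ultimately show "emeasure (mu (T x - scaleC z x)) A = emeasure (density (mu x) (\<lambda>l. ennreal ((cmod (l - z))\<^sup>2))) A"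
    unfolding eq by (rule LIMSEQ_unique)
qed simp

end

section \<open>Poisson integrals\<close>

text \<open>The half-plane kernel without its factor \<open>1 / pi\<close>, so its total mass is
  \<open>pi\<close>.\<close>

definition poisson :: "real \<Rightarrow> real \<Rightarrow> real \<Rightarrow> real" where
  "poisson x y t = y / ((t - x)\<^sup>2 + y\<^sup>2)"

lemma poisson_denom_pos: "y > 0 \<Longrightarrow> (t - x)\<^sup>2 + y\<^sup>2 > (0 :: real)"
  by (simp add: add_nonneg_pos)

lemma poisson_nonneg: "y > 0 \<Longrightarrow> poisson x y t \<ge> 0"
  by (simp add: poisson_def)

lemma poisson_le: "y > 0 \<Longrightarrow> poisson x y t \<le> 1 / y"
proof -
  assume y: "y > 0"
  have "y / ((t - x)\<^sup>2 + y\<^sup>2) \<le> y / y\<^sup>2" using y by (intro divide_left_mono) (auto simp: add_nonneg_pos)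
  then show ?thesis using y by (simp add: poisson_def power2_eq_square)
qed

lemma poisson_sym: "poisson x y t = poisson t y x"
  by (simp add: poisson_def power2_commute)

lemma continuous_poisson: "y > 0 \<Longrightarrow> continuous_on S (poisson x y)"
  unfolding poisson_def by (intro continuous_intros) (auto dest: poisson_denom_pos[of y _ x] simp: less_imp_neq[symmetric])

lemma poisson_measurable [measurable]: "poisson x y \<in> borel_measurable borel"
  unfolding poisson_def by measurable

lemma poisson_has_integral:
  assumes "y > 0" "a \<le> b"
  shows "(poisson x y has_integral (arctan ((b - x) / y) - arctan ((a - x) / y))) {a..b}"
proof (rule fundamental_theorem_of_calculus)
  fix t assume "t \<in> {a..b}"
  have p: "(t - x)\<^sup>2 + y\<^sup>2 > 0" using assms by (intro poisson_denom_pos)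
  have "((\<lambda>t. arctan ((t - x) / y)) has_real_derivative (inverse (1 + ((t - x) / y)\<^sup>2) * (1 / y))) (at t within {a..b})"
    by (rule derivative_eq_intros refl | use assms in simp)+
  also have "inverse (1 + ((t - x) / y)\<^sup>2) * (1 / y) = poisson x y t"
    unfolding poisson_def using assms p by (simp add: field_simps power2_eq_square)
  finally show "((\<lambda>t. arctan ((t - x) / y)) has_vector_derivative poisson x y t) (at t within {a..b})"
    by (simp add: has_real_derivative_iff_has_vector_derivative)
qed (use assms in auto)

text \<open>Contour integration delivers integrals over \<open>{-k..k}\<close>; positivity and
  monotone convergence turn their limit into a Lebesgue integral over the whole line.\<close>

lemma nn_integral_lborel_limit:
  fixes f :: "real \<Rightarrow> real"
  assumes f: "continuous_on UNIV f" "\<And>t. f t \<ge> 0"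
    and lim: "(\<lambda>k :: nat. integral {- real k..real k} f) \<longlonglongrightarrow> c"
  shows "(\<integral>\<^sup>+t. ennreal (f t) \<partial>lborel) = ennreal c"
proof -
  have [measurable]: "f \<in> borel_measurable borel" using f(1) by (rule borel_measurable_continuous_onI)
  define u where "u = (\<lambda>(k :: nat) t. ennreal (indicator {- real k..real k} t * f t))"
  have int: "(\<integral>\<^sup>+t. u k t \<partial>lborel) = ennreal (integral {- real k..real k} f)" for k
  proof -
    have s: "set_integrable lborel {- real k..real k} f"
      using f(1) by (intro borel_integrable_atLeastAtMost') (auto intro: continuous_on_subset)
    have "(\<integral>\<^sup>+t. u k t \<partial>lborel) = ennreal (\<integral>t. indicator {- real k..real k} t * f t \<partial>lborel)"
      unfolding u_def using s f(2) by (intro nn_integral_eq_integral) (auto simp: set_integrable_def)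
    then show ?thesis using set_borel_integral_eq_integral(2)[OF s] by (simp add: set_lebesgue_integral_def)
  qed
  have inc: "incseq u" unfolding u_def incseq_def le_fun_def
    using f(2) by (auto intro!: ennreal_leI simp: indicator_def)
  have "(SUP k. u k t) = ennreal (f t)" for t
  proof (rule antisym)
    show "(SUP k. u k t) \<le> ennreal (f t)" using f(2) by (intro SUP_least) (auto simp: u_def indicator_def)
    obtain k where "\<bar>t\<bar> \<le> real k" using real_arch_simple by blast
    then have "ennreal (f t) = u k t" by (auto simp: u_def indicator_def)
    then show "ennreal (f t) \<le> (SUP k. u k t)" by (simp only:) (rule SUP_upper, simp)
  qed
  then have "(\<integral>\<^sup>+t. ennreal (f t) \<partial>lborel) = (\<integral>\<^sup>+t. (SUP k. u k t) \<partial>lborel)" by simp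
  also have "\<dots> = (SUP k. \<integral>\<^sup>+t. u k t \<partial>lborel)"
    by (rule nn_integral_monotone_convergence_SUP[OF inc]) (simp add: u_def)
  finally have eq: "(\<integral>\<^sup>+t. ennreal (f t) \<partial>lborel) = (SUP k. \<integral>\<^sup>+t. u k t \<partial>lborel)" .
  have "(\<lambda>k. \<integral>\<^sup>+t. u k t \<partial>lborel) \<longlonglongrightarrow> (SUP k. \<integral>\<^sup>+t. u k t \<partial>lborel)"
    using inc by (intro LIMSEQ_SUP) (auto simp: incseq_def le_fun_def intro!: nn_integral_mono)
  moreover have "(\<lambda>k. \<integral>\<^sup>+t. u k t \<partial>lborel) \<longlonglongrightarrow> ennreal c" unfolding int using lim by (rule tendsto_ennrealI)
  ultimately show ?thesis unfolding eq by (rule LIMSEQ_unique)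
qed

lemma poisson_integral_limit:
  assumes y: "y > 0"
  shows "(\<lambda>k :: nat. integral {- real k..real k} (poisson x y)) \<longlonglongrightarrow> pi"
proof -
  have "integral {- real k..real k} (poisson x y) = arctan ((real k - x) / y) - arctan ((- real k - x) / y)" for k
    using y by (intro integral_unique poisson_has_integral) auto
  moreover have "(\<lambda>k :: nat. arctan ((real k - x) / y) - arctan ((- real k - x) / y)) \<longlonglongrightarrow> pi / 2 - (- (pi / 2))"
  proof (rule tendsto_diff)
    have "filterlim (\<lambda>k :: nat. (real k - x) / y) at_top sequentially"
      using y by real_asymp
    show "(\<lambda>k :: nat. arctan ((real k - x) / y)) \<longlonglongrightarrow> pi / 2"
      using \<open>filterlim (\<lambda>k :: nat. (real k - x) / y) at_top sequentially\<close>
      by (rule filterlim_compose[OF tendsto_arctan_at_top])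
    show "(\<lambda>k :: nat. arctan ((- real k - x) / y)) \<longlonglongrightarrow> - (pi / 2)"
      by (rule filterlim_compose[OF tendsto_arctan_at_bot]) (use y in real_asymp)
  qed
  ultimately show ?thesis by simp
qed

lemma nn_integral_poisson: "y > 0 \<Longrightarrow> (\<integral>\<^sup>+t. ennreal (poisson x y t) \<partial>lborel) = ennreal pi"
  by (intro nn_integral_lborel_limit continuous_poisson poisson_nonneg poisson_integral_limit)

lemma integrable_poisson: "y > 0 \<Longrightarrow> integrable lborel (poisson x y)"
  by (intro integrableI_nn_integral_finite[where x = pi]) (auto simp: nn_integral_poisson poisson_nonneg)

lemma integral_poisson: "y > 0 \<Longrightarrow> (\<integral>t. poisson x y t \<partial>lborel) = pi"
  using nn_integral_eq_integral[OF integrable_poisson, of y x] nn_integral_poisson[of y x]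
  by (simp add: poisson_nonneg integral_nonneg_AE)

text \<open>\<open>F\<close> is merely bounded far out, so decay has to come from the kernel.
  Subtracting \<open>F z0\<close> removes the pole of the kernel at \<open>z0\<close>; what remains
  is holomorphic up to the real axis and of order \<open>R^-2\<close> on the arc of radius
  \<open>R\<close>, whose length is only \<open>R * pi\<close>.\<close>

lemma poisson_limit_half_plane:
  fixes F :: "complex \<Rightarrow> complex"
  assumes e: "e > 0" and F: "F holomorphic_on {w. Im w > - e}"
    and bnd: "\<And>w. Im w \<ge> 0 \<Longrightarrow> cmod w \<ge> R0 \<Longrightarrow> cmod (F w) \<le> B"
    and y: "y > 0"
  shows "(\<lambda>k :: nat. integral {- real k..real k} (\<lambda>t. (F (of_real t) - F (Complex x y)) * of_real (poisson x y t))) \<longlonglongrightarrow> 0"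
proof -
  define z0 where "z0 = Complex x y"
  \<comment> \<open>The minimum keeps the second pole \<open>cnj z0\<close>, of imaginary part
    \<open>- y\<close>, outside \<open>S\<close> while the real axis stays inside.\<close>
  define S where "S = {w. Im w > - min e y}"
  have S_conv: "convex S" unfolding S_def by (rule convex_halfspace_Im_gt)
  have S_open: "open S" unfolding S_def by (rule open_halfspace_Im_gt)
  have FS: "F holomorphic_on S" using F by (rule holomorphic_on_subset) (auto simp: S_def)
  have zS: "z0 \<in> interior S" using S_open y e by (simp add: interior_open S_def z0_def)
  \<comment> \<open>The difference quotient, with its removable singularity at \<open>z0\<close>
    filled in by the derivative.\<close>
  define G where "G = (\<lambda>w. if w = z0 then deriv F z0 else (F w - F z0) / (w - z0))"
  have "G holomorphic_on S" unfolding G_def by (rule pole_lemma[OF FS zS])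
  define K where "K = (\<lambda>w. G w * of_real y / (w - cnj z0))"
  have "w \<noteq> cnj z0" if "w \<in> S" for w using that by (auto simp: S_def z0_def)
  then have KS: "K holomorphic_on S" unfolding K_def using \<open>G holomorphic_on S\<close>
    by (intro holomorphic_intros) auto
  have Kt: "K (of_real t) = (F (of_real t) - F z0) * of_real (poisson x y t)" for t
  proof -
    have ne: "complex_of_real t \<noteq> z0" using y by (auto simp: z0_def complex_eq_iff)
    have "(of_real t - z0) * (of_real t - cnj z0) = of_real ((t - x)\<^sup>2 + y\<^sup>2)"
      by (simp add: complex_eq_iff z0_def power2_eq_square)
    then show ?thesis using ne unfolding K_def G_def poisson_def by simp
  qed
  have B0: "B \<ge> 0" 
  proof -
    have "cmod (F (of_real \<bar>R0\<bar>)) \<le> B" by (rule bnd) auto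
    then show ?thesis using norm_ge_zero order_trans by blast
  qed
  define A where "A = (B + cmod (F z0)) * y"
  have A0: "A \<ge> 0" using B0 y by (simp add: A_def)
  have main: "cmod (integral {- R..R} (\<lambda>t. K (of_real t))) \<le> A / (R - cmod z0)\<^sup>2 * R * pi"
    if R: "R > cmod z0" "R \<ge> R0" for R
  proof -
    have R0: "R > 0" using R(1) norm_ge_zero order_le_less_trans by blast
    define g where "g = linepath (- of_real R) (of_real R :: complex) +++ part_circlepath 0 R 0 pi"
    have vp: "valid_path g" and cl: "pathfinish g = pathstart g"
      unfolding g_def by (auto simp: exp_pi_i' mult.commute intro!: valid_path_join)
    have arc: "Im w \<ge> 0 \<and> cmod w = R" if wp: "w \<in> path_image (part_circlepath 0 R 0 pi)" for w
    proof -
      obtain u where "u \<in> {0..pi}" "w = of_real R * cis u"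
        using wp by (auto simp: path_image_part_circlepath' closed_segment_eq_real_ivl)
      then show ?thesis using R0 by (simp add: norm_mult sin_ge_zero)
    qed
    have line: "path_image (linepath (- of_real R) (of_real R :: complex)) \<subseteq> S"
      by (auto simp: path_image_linepath closed_segment_def S_def y e)
    have "path_image g \<subseteq> S" 
    proof
      fix w assume "w \<in> path_image g"
      then have "w \<in> path_image (linepath (- of_real R) (of_real R :: complex)) \<or> w \<in> path_image (part_circlepath 0 R 0 pi)"
        unfolding g_def using path_image_join_subset by blast
      then show "w \<in> S" using line arc[of w] y e by (auto simp: S_def)
    qed
    then have 0: "(K has_contour_integral 0) g"
      using Cauchy_theorem_convex_simple[OF KS S_conv vp _ cl] by blast
    have i1: "K contour_integrable_on linepath (- of_real R) (of_real R)"
      using line by (intro contour_integrable_holomorphic_simple[OF KS S_open]) auto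
    have i2: "K contour_integrable_on part_circlepath 0 R 0 pi"
      by (intro contour_integrable_holomorphic_simple[OF KS S_open]) (use arc y e in \<open>auto simp: S_def\<close>, use arc in fastforce)
    have "contour_integral g K = contour_integral (linepath (- of_real R) (of_real R)) K + contour_integral (part_circlepath 0 R 0 pi) K"
      unfolding g_def using i1 i2 by (intro contour_integral_join) auto
    then have "contour_integral (linepath (- of_real R) (of_real R)) K = - contour_integral (part_circlepath 0 R 0 pi) K"
      using 0 contour_integral_unique by (metis add_eq_0_iff2)
    moreover have "contour_integral (linepath (- of_real R) (of_real R)) K = integral {- R..R} (\<lambda>t. K (of_real t))"
      using contour_integral_linepath_Reals_eq[of "- of_real R" "of_real R" K] R0 by simp
    moreover have "cmod (contour_integral (part_circlepath 0 R 0 pi) K) \<le> A / (R - cmod z0)\<^sup>2 * R * (pi - 0)"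
    proof (rule has_contour_integral_bound_part_circlepath)
      show "(K has_contour_integral contour_integral (part_circlepath 0 R 0 pi) K) (part_circlepath 0 R 0 pi)"
        using i2 by (rule has_contour_integral_integral)
      fix w assume "w \<in> path_image (part_circlepath 0 R 0 pi)"
      then have w: "Im w \<ge> 0" "cmod w = R" using arc by blast+
      have wz: "w \<noteq> z0" using w R by auto
      have 1: "cmod (F w - F z0) \<le> B + cmod (F z0)"
        using norm_triangle_ineq4[of "F w" "F z0"] bnd[of w] w R by simp
      have 2: "R - cmod z0 \<le> cmod (w - z0)" using norm_triangle_ineq2[of w z0] w by simp
      have 3: "R - cmod z0 \<le> cmod (w - cnj z0)" using norm_triangle_ineq2[of w "cnj z0"] w by simp
      have "cmod (K w) = cmod (F w - F z0) * y / (cmod (w - z0) * cmod (w - cnj z0))"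
        using wz y by (simp add: K_def G_def norm_mult norm_divide)
      also have "\<dots> \<le> A / ((R - cmod z0) * (R - cmod z0))"
        unfolding A_def using 1 2 3 R y B0 by (intro frac_le mult_mono mult_right_mono mult_pos_pos) auto
      finally show "cmod (K w) \<le> A / (R - cmod z0)\<^sup>2" by (simp add: power2_eq_square)
    qed (use A0 R0 in auto)
    ultimately show ?thesis by simp
  qed
  have "(\<lambda>k :: nat. A / (real k - cmod z0)\<^sup>2 * real k * pi) \<longlonglongrightarrow> 0" by real_asymp
  moreover have "eventually (\<lambda>k :: nat. cmod (integral {- real k..real k} (\<lambda>t. K (of_real t))) \<le> A / (real k - cmod z0)\<^sup>2 * real k * pi) sequentially"
  proof -
    have "eventually (\<lambda>k :: nat. real k > cmod z0) sequentially" "eventually (\<lambda>k :: nat. real k \<ge> R0) sequentially"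
      by real_asymp+
    then show ?thesis by eventually_elim (rule main)
  qed
  ultimately have "(\<lambda>k :: nat. integral {- real k..real k} (\<lambda>t. K (of_real t))) \<longlonglongrightarrow> 0"
    by (rule Lim_null_comparison[rotated])
  then show ?thesis by (simp add: Kt z0_def)
qed

text \<open>Imaginary parts of \<open>poisson_limit_half_plane\<close>: the subtracted constant
  contributes \<open>Im (F z0)\<close> times the mass \<open>pi\<close> of the kernel.\<close>

theorem poisson_formula:
  fixes F :: "complex \<Rightarrow> complex"
  assumes e: "e > 0" and F: "F holomorphic_on {w. Im w > - e}"
    and bnd: "\<And>w. Im w \<ge> 0 \<Longrightarrow> cmod w \<ge> R0 \<Longrightarrow> cmod (F w) \<le> B"
    and pos: "\<And>t. Im (F (complex_of_real t)) \<ge> 0" and y: "y > 0"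
  shows "(\<integral>\<^sup>+t. ennreal (poisson x y t * Im (F (complex_of_real t))) \<partial>lborel) = ennreal (pi * Im (F (Complex x y)))"
proof (rule nn_integral_lborel_limit)
  have cF: "continuous_on UNIV (\<lambda>t. F (complex_of_real t))"
    using e by (intro continuous_on_compose2[OF holomorphic_on_imp_continuous_on[OF F]] continuous_intros) auto
  show "continuous_on UNIV (\<lambda>t. poisson x y t * Im (F (complex_of_real t)))"
    using cF y by (intro continuous_intros continuous_poisson)
  show "poisson x y t * Im (F (complex_of_real t)) \<ge> 0" for t using pos y by (simp add: poisson_nonneg)
  define z0 where "z0 = Complex x y"
  define K where "K = (\<lambda>t. (F (of_real t) - F z0) * of_real (poisson x y t))"
  have cK: "continuous_on UNIV K" unfolding K_def using cF y by (intro continuous_intros continuous_poisson)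
  have "(\<lambda>k :: nat. integral {- real k..real k} K) \<longlonglongrightarrow> 0"
    unfolding K_def z0_def by (rule poisson_limit_half_plane[OF e F bnd y])
  then have 1: "(\<lambda>k :: nat. Im (integral {- real k..real k} K)) \<longlonglongrightarrow> 0" using tendsto_Im by fastforce
  have 2: "(\<lambda>k :: nat. Im (F z0) * integral {- real k..real k} (poisson x y)) \<longlonglongrightarrow> Im (F z0) * pi"
    by (intro tendsto_intros poisson_integral_limit y)
  have "integral {- real k..real k} (\<lambda>t. poisson x y t * Im (F (complex_of_real t))) =
     Im (integral {- real k..real k} K) + Im (F z0) * integral {- real k..real k} (poisson x y)" for k
  proof -
    have iK: "K integrable_on {- real k..real k}"
      using cK by (intro integrable_continuous_interval) (auto intro: continuous_on_subset)
    have iP: "poisson x y integrable_on {- real k..real k}"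
      using y by (intro integrable_continuous_interval continuous_poisson)
    have "Im (integral {- real k..real k} K) = integral {- real k..real k} (\<lambda>t. Im (K t))"
      using integral_linear[OF iK bounded_linear_Im] by (simp add: o_def)
    moreover have "(\<lambda>t. Im (K t)) integrable_on {- real k..real k}"
      using integrable_linear[OF iK bounded_linear_Im] by (simp add: o_def)
    then have "integral {- real k..real k} (\<lambda>t. Im (K t)) + integral {- real k..real k} (\<lambda>t. Im (F z0) * poisson x y t) =
       integral {- real k..real k} (\<lambda>t. Im (K t) + Im (F z0) * poisson x y t)"
      using iP by (subst Henstock_Kurzweil_Integration.integral_add) (auto intro: integrable_on_mult_right)
    moreover have "Im (K t) + Im (F z0) * poisson x y t = poisson x y t * Im (F (complex_of_real t))" for t
      by (simp add: K_def algebra_simps)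
    ultimately show ?thesis by simp
  qed
  then show "(\<lambda>k :: nat. integral {- real k..real k} (\<lambda>t. poisson x y t * Im (F (complex_of_real t)))) \<longlonglongrightarrow> pi * Im (F (Complex x y))"
    using tendsto_add[OF 1 2] by (simp add: z0_def mult.commute)
qed

section \<open>Convergence of Poisson integrals implies vague convergence\<close>

lemma integrable_compact_support:
  fixes g :: "real \<Rightarrow> real"
  assumes g: "continuous_on UNIV g" "\<And>t. \<bar>t\<bar> > K \<Longrightarrow> g t = 0"
  shows "integrable lborel g" "\<exists>C\<ge>0. \<forall>t. \<bar>g t\<bar> \<le> C"
proof -
  have "set_integrable lborel {- K..K} g"
    using g(1) by (intro borel_integrable_atLeastAtMost') (auto intro: continuous_on_subset)
  moreover have "(\<lambda>t. indicator {- K..K} t *\<^sub>R g t) = g"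
  proof
    fix t show "indicator {- K..K} t *\<^sub>R g t = g t"
      using g(2)[of t] by (cases "\<bar>t\<bar> > K") (auto simp: indicator_def)
  qed
  ultimately show "integrable lborel g" by (simp add: set_integrable_def)
  have "compact (g ` {- K..K})" using g(1) by (intro compact_continuous_image compact_Icc) (auto intro: continuous_on_subset)
  then obtain C0 where C0: "\<And>t. t \<in> {- K..K} \<Longrightarrow> \<bar>g t\<bar> \<le> C0" using compact_imp_bounded bounded_real by fastforce
  have "\<bar>g t\<bar> \<le> max C0 0" for t
  proof (cases "\<bar>t\<bar> > K")
    case False
    then have "t \<in> {- K..K}" by auto
    from C0[OF this] show ?thesis by simp
  qed (use g(2) in simp)
  then show "\<exists>C\<ge>0. \<forall>t. \<bar>g t\<bar> \<le> C" by (intro exI[of _ "max C0 0"]) auto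
qed

text \<open>Far from the diagonal the kernel at height \<open>y\<close> is at most a multiple of
  \<open>y\<close> times the kernel at height \<open>1\<close>. This gives a single integrable
  majorant for all \<open>s\<close>, so the integral need not be split into near and far
  parts.\<close>

lemma poisson_smoothing_uniform:
  fixes g :: "real \<Rightarrow> real"
  assumes g: "continuous_on UNIV g" "\<And>t. \<bar>t\<bar> > K \<Longrightarrow> g t = 0" and e: "e > 0"
  shows "\<exists>y>0. \<forall>t. \<bar>(\<integral>s. g s * poisson s y t \<partial>lborel) / pi - g t\<bar> \<le> e"
proof -
  have [measurable]: "g \<in> borel_measurable borel" using g(1) by (rule borel_measurable_continuous_onI)
  obtain C where C: "\<And>t. \<bar>g t\<bar> \<le> C" "C \<ge> 0" using integrable_compact_support(2)[OF g] by blast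
  have "uniformly_continuous_on {- K - 1..K + 1} g"
    using g(1) by (intro compact_uniformly_continuous compact_Icc) (auto intro: continuous_on_subset)
  then obtain d0 where d0: "d0 > 0" "\<And>s t. s \<in> {- K - 1..K + 1} \<Longrightarrow> t \<in> {- K - 1..K + 1} \<Longrightarrow> \<bar>s - t\<bar> < d0 \<Longrightarrow> \<bar>g s - g t\<bar> < e / 2"
    using e unfolding uniformly_continuous_on_def dist_real_def by (metis half_gt_zero)
  define d where "d = min d0 1"
  have d: "d > 0" "\<And>s t. \<bar>s - t\<bar> < d \<Longrightarrow> \<bar>g s - g t\<bar> \<le> e / 2"
  proof -
    fix s t :: real assume st: "\<bar>s - t\<bar> < d"
    show "\<bar>g s - g t\<bar> \<le> e / 2"
    proof (cases "s \<in> {- K - 1..K + 1} \<and> t \<in> {- K - 1..K + 1}")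
      case True then show ?thesis using d0(2)[of s t] st by (auto simp: d_def)
    next
      case False then show ?thesis using g(2)[of s] g(2)[of t] st e by (auto simp: d_def)
    qed
  qed (use d0 in \<open>simp add: d_def\<close>)
  \<comment> \<open>\<open>2 * C\<close> bounds \<open>\<bar>g s - g t\<bar>\<close>, and for
    \<open>\<bar>s - t\<bar> \<ge> d\<close> one has
    \<open>(t - s)^2 + 1 \<le> (1 + 1 / d^2) * (t - s)^2\<close>.\<close>
  define A where "A = 2 * C * (1 + 1 / d\<^sup>2)"
  have A: "A \<ge> 0" using C by (simp add: A_def)
  \<comment> \<open>The far part then contributes \<open>A * y \<le> e / 2\<close>; the
    \<open>+ 1\<close> covers \<open>A = 0\<close>.\<close>
  define y where "y = e / (2 * (A + 1))"
  have y: "y > 0" "A * y \<le> e / 2" using A e by (auto simp: y_def field_simps)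
  have pw: "\<bar>(g s - g t) * poisson s y t\<bar> \<le> e / 2 * poisson s y t + A * y * poisson s 1 t" for s t
  proof (cases "\<bar>s - t\<bar> < d")
    case True
    have "\<bar>(g s - g t) * poisson s y t\<bar> = \<bar>g s - g t\<bar> * poisson s y t" using y by (simp add: abs_mult poisson_nonneg)
    also have "\<dots> \<le> e / 2 * poisson s y t" using True d(2) y by (intro mult_right_mono) (auto simp: poisson_nonneg)
    also have "\<dots> \<le> e / 2 * poisson s y t + A * y * poisson s 1 t" using A y by (simp add: poisson_nonneg)
    finally show ?thesis .
  next
    case False
    then have "d\<^sup>2 \<le> \<bar>s - t\<bar>\<^sup>2" using d(1) by (intro power_mono) auto
    then have u: "d\<^sup>2 \<le> (t - s)\<^sup>2" by (simp add: power2_commute)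
    have u0: "(t - s)\<^sup>2 > 0" using u d(1) by (smt (verit) zero_less_power)
    have "y / ((t - s)\<^sup>2 + y\<^sup>2) \<le> y / (t - s)\<^sup>2" using y u0 by (intro divide_left_mono) (auto simp: add_pos_nonneg)
    also have "\<dots> \<le> y * (1 + 1 / d\<^sup>2) / ((t - s)\<^sup>2 + 1)"
    proof -
      have "1 \<le> (t - s)\<^sup>2 / d\<^sup>2" using u d(1) by simp
      then have "(t - s)\<^sup>2 + 1 \<le> (1 + 1 / d\<^sup>2) * (t - s)\<^sup>2" by (simp add: distrib_right)
      then have "y * ((t - s)\<^sup>2 + 1) \<le> y * ((1 + 1 / d\<^sup>2) * (t - s)\<^sup>2)" using y by (intro mult_left_mono) auto
      then show ?thesis using u0 by (simp add: divide_le_eq pos_le_divide_eq field_simps add_pos_pos)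
    qed
    finally have "poisson s y t \<le> y * (1 + 1 / d\<^sup>2) * poisson s 1 t" by (simp add: poisson_def)
    moreover have "\<bar>g s - g t\<bar> \<le> 2 * C" using C(1)[of s] C(1)[of t] by linarith
    ultimately have "\<bar>g s - g t\<bar> * poisson s y t \<le> (2 * C) * (y * (1 + 1 / d\<^sup>2) * poisson s 1 t)"
      using C y by (intro mult_mono) (auto simp: poisson_nonneg)
    also have "\<dots> = A * y * poisson s 1 t" by (simp add: A_def)
    also have "\<dots> \<le> e / 2 * poisson s y t + A * y * poisson s 1 t" using e y by (simp add: poisson_nonneg)
    finally show ?thesis using y by (simp add: abs_mult poisson_nonneg)
  qed
  have "\<bar>(\<integral>s. g s * poisson s y t \<partial>lborel) / pi - g t\<bar> \<le> e" for t
  proof -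
    have ip: "integrable lborel (\<lambda>s. poisson s r t)" if "r > 0" for r
      using integrable_poisson[OF that, of t] by (simp add: poisson_sym[of _ r t] cong: Bochner_Integration.integrable_cong)
    have vp: "(\<integral>s. poisson s r t \<partial>lborel) = pi" if "r > 0" for r
      using integral_poisson[OF that, of t] by (simp add: poisson_sym[of _ r t] cong: Bochner_Integration.integral_cong)
    have im: "(\<lambda>s. poisson s r t) \<in> borel_measurable borel" for r unfolding poisson_sym[of _ r t] by measurable
    have idom: "integrable lborel (\<lambda>s. e / 2 * poisson s y t + A * y * poisson s 1 t)"
      using y by (intro Bochner_Integration.integrable_add integrable_mult_right ip) auto
    have igt: "integrable lborel (\<lambda>s. (g s - g t) * poisson s y t)"
    proof (rule Bochner_Integration.integrable_bound[OF idom])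
      show "(\<lambda>s. (g s - g t) * poisson s y t) \<in> borel_measurable lborel" using im by measurable
      show "AE s in lborel. norm ((g s - g t) * poisson s y t) \<le> norm (e / 2 * poisson s y t + A * y * poisson s 1 t)"
        using pw[of _ t] by (intro AE_I2) (smt (verit) real_norm_def)
    qed
    have igp: "integrable lborel (\<lambda>s. g t * poisson s y t)" using ip y by simp
    have "(\<integral>s. g s * poisson s y t \<partial>lborel) = (\<integral>s. (g s - g t) * poisson s y t + g t * poisson s y t \<partial>lborel)"
      by (simp add: algebra_simps)
    also have "\<dots> = (\<integral>s. (g s - g t) * poisson s y t \<partial>lborel) + g t * pi"
      using igt igp y vp by (simp add: Bochner_Integration.integral_add)
    finally have 1: "(\<integral>s. g s * poisson s y t \<partial>lborel) = (\<integral>s. (g s - g t) * poisson s y t \<partial>lborel) + g t * pi" .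
    have "\<bar>\<integral>s. (g s - g t) * poisson s y t \<partial>lborel\<bar> \<le> (\<integral>s. \<bar>(g s - g t) * poisson s y t\<bar> \<partial>lborel)"
      using integral_norm_bound[of lborel "\<lambda>s. (g s - g t) * poisson s y t"] by simp
    also have "\<dots> \<le> (\<integral>s. e / 2 * poisson s y t + A * y * poisson s 1 t \<partial>lborel)"
      using igt idom pw by (intro integral_mono) auto
    also have "\<dots> = e / 2 * pi + A * y * pi" using y ip vp by (simp add: Bochner_Integration.integral_add)
    also have "\<dots> \<le> e * pi" using y mult_right_mono[of "e / 2 + A * y" e pi] by (simp add: distrib_right)
    finally have 2: "\<bar>\<integral>s. (g s - g t) * poisson s y t \<partial>lborel\<bar> \<le> e * pi" .
    have "(\<integral>s. g s * poisson s y t \<partial>lborel) / pi - g t = (\<integral>s. (g s - g t) * poisson s y t \<partial>lborel) / pi"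
      unfolding 1 by (simp add: field_simps)
    then show ?thesis using 2 by (simp add: abs_mult divide_le_eq)
  qed
  then show ?thesis using y by blast
qed

text \<open>Moves the smoothing from the test function to the measure, where only Poisson integrals
  of the measure remain.\<close>

lemma poisson_smoothing_fubini:
  fixes g :: "real \<Rightarrow> real"
  assumes R: "finite_measure R" "sets R = sets borel" and ig: "integrable lborel g" and y: "y > 0"
  shows "(\<integral>t. (\<integral>s. g s * poisson s y t \<partial>lborel) \<partial>R) = (\<integral>s. g s * (\<integral>t. poisson s y t \<partial>R) \<partial>lborel)"
    and "integrable R (\<lambda>t. \<integral>s. g s * poisson s y t \<partial>lborel)"
    and "(\<lambda>s. \<integral>t. poisson s y t \<partial>R) \<in> borel_measurable borel"
    and "\<bar>\<integral>t. poisson s y t \<partial>R\<bar> \<le> measure R UNIV / y"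
proof -
  interpret R: finite_measure R by fact
  interpret pair_sigma_finite lborel R ..
  have [measurable]: "g \<in> borel_measurable borel" using ig by (simp add: borel_measurable_integrable)
  note [measurable_cong] = R(2)
  have [measurable]: "(\<lambda>(s, t). poisson s y t) \<in> borel_measurable (lborel \<Otimes>\<^sub>M R)"
    unfolding poisson_def case_prod_beta by measurable
  have iP: "integrable R (poisson s y)" for s
    using y by (intro R.integrable_const_bound[where B = "1 / y"]) (auto simp: poisson_nonneg poisson_le)
  have Pb: "(\<integral>t. poisson s y t \<partial>R) \<le> measure R UNIV / y" for s
  proof -
    have "(\<integral>t. poisson s y t \<partial>R) \<le> (\<integral>t. 1 / y \<partial>R)" using y iP by (intro integral_mono) (auto simp: poisson_le)
    then show ?thesis using R(2) sets_eq_imp_space_eq[OF R(2)] by simp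
  qed
  have P0: "0 \<le> (\<integral>t. poisson s y t \<partial>R)" for s using y by (intro integral_nonneg_AE) (simp add: poisson_nonneg)
  show "\<bar>\<integral>t. poisson s y t \<partial>R\<bar> \<le> measure R UNIV / y" using Pb P0 by simp
  have mI: "(\<lambda>s. \<integral>t. poisson s y t \<partial>R) \<in> borel_measurable lborel"
    by (rule R.borel_measurable_lebesgue_integral) simp
  then show "(\<lambda>s. \<integral>t. poisson s y t \<partial>R) \<in> borel_measurable borel" by simp
  have int: "integrable (lborel \<Otimes>\<^sub>M R) (\<lambda>(s, t). g s * poisson s y t)"
  proof (rule Fubini_integrable)
    show "integrable lborel (\<lambda>s. \<integral>t. norm (case (s, t) of (s, t) \<Rightarrow> g s * poisson s y t) \<partial>R)"
    proof (rule Bochner_Integration.integrable_bound)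
      show "integrable lborel (\<lambda>s. \<bar>g s\<bar> * (measure R UNIV / y))" using ig by simp
      show "(\<lambda>s. \<integral>t. norm (case (s, t) of (s, t) \<Rightarrow> g s * poisson s y t) \<partial>R) \<in> borel_measurable lborel"
        by (rule R.borel_measurable_lebesgue_integral) (simp add: case_prod_beta)
      show "AE s in lborel. norm (\<integral>t. norm (case (s, t) of (s, t) \<Rightarrow> g s * poisson s y t) \<partial>R) \<le> norm (\<bar>g s\<bar> * (measure R UNIV / y))"
      proof (rule AE_I2)
        fix s
        have "(\<integral>t. norm (case (s, t) of (s, t) \<Rightarrow> g s * poisson s y t) \<partial>R) = \<bar>g s\<bar> * (\<integral>t. poisson s y t \<partial>R)"
          using y by (simp add: abs_mult poisson_nonneg)
        also have "norm \<dots> \<le> norm (\<bar>g s\<bar> * (measure R UNIV / y))"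
          using mult_left_mono[OF Pb, of "\<bar>g s\<bar>" s] P0[of s] y by (simp add: abs_mult)
        finally show "norm (\<integral>t. norm (case (s, t) of (s, t) \<Rightarrow> g s * poisson s y t) \<partial>R) \<le> norm (\<bar>g s\<bar> * (measure R UNIV / y))" .
      qed
    qed
    show "AE s in lborel. integrable R (\<lambda>t. case (s, t) of (s, t) \<Rightarrow> g s * poisson s y t)"
      using iP by simp
  qed (simp add: case_prod_beta)
  show "integrable R (\<lambda>t. \<integral>s. g s * poisson s y t \<partial>lborel)"
    using integrable_snd[OF int] by simp
  have "(\<integral>t. (\<integral>s. g s * poisson s y t \<partial>lborel) \<partial>R) = (\<integral>s. (\<integral>t. g s * poisson s y t \<partial>R) \<partial>lborel)"
    by (rule Fubini_integral[OF int])
  then show "(\<integral>t. (\<integral>s. g s * poisson s y t \<partial>lborel) \<partial>R) = (\<integral>s. g s * (\<integral>t. poisson s y t \<partial>R) \<partial>lborel)" by simp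
qed

text \<open>A compactly supported test function is uniformly close to a superposition of Poisson
  kernels, and the common mass bound makes the error uniform in \<open>n\<close>. For the
  superposition, convergence is dominated convergence in the centre \<open>s\<close>, so no
  compactness of the family of measures is invoked.\<close>

theorem vague_convergence:
  fixes R :: "nat \<Rightarrow> real measure" and M :: "real measure" and g :: "real \<Rightarrow> real"
  assumes R: "\<And>n. finite_measure (R n)" "\<And>n. sets (R n) = sets borel" "\<And>n. measure (R n) UNIV \<le> C"
    and M: "finite_measure M" "sets M = sets borel" "measure M UNIV \<le> C"
    and lim: "\<And>x y. y > 0 \<Longrightarrow> (\<lambda>n. \<integral>t. poisson x y t \<partial>R n) \<longlonglongrightarrow> (\<integral>t. poisson x y t \<partial>M)"
    and g: "continuous_on UNIV g" "\<And>t. \<bar>t\<bar> > K \<Longrightarrow> g t = 0"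
  shows "(\<lambda>n. \<integral>t. g t \<partial>R n) \<longlonglongrightarrow> (\<integral>t. g t \<partial>M)"
proof (rule metric_LIMSEQ_I)
  fix e :: real assume e: "e > 0"
  have C0: "C \<ge> 0" using M(3) measure_nonneg order_trans by blast
  \<comment> \<open>Scaled so that the smoothing error times any mass up to \<open>C\<close> is at
    most \<open>e / 4\<close>, also when \<open>C = 0\<close>.\<close>
  define e' where "e' = e / (4 * (C + 1))"
  have e': "e' > 0" "e' * C \<le> e / 4" using e C0 by (auto simp: e'_def field_simps)
  obtain y where y: "y > 0" and un: "\<And>t. \<bar>(\<integral>s. g s * poisson s y t \<partial>lborel) / pi - g t\<bar> \<le> e'"
    using poisson_smoothing_uniform[OF g e'(1)] by blast
  have ig: "integrable lborel g" by (rule integrable_compact_support[OF g])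
  obtain B where B: "B \<ge> 0" "\<And>t. \<bar>g t\<bar> \<le> B" using integrable_compact_support(2)[OF g] by blast
  have [measurable]: "g \<in> borel_measurable borel" using g(1) by (rule borel_measurable_continuous_onI)
  define G where "G = (\<lambda>t. (\<integral>s. g s * poisson s y t \<partial>lborel))"
  have app: "\<bar>(\<integral>t. G t \<partial>N) / pi - (\<integral>t. g t \<partial>N)\<bar> \<le> e / 4"
    if N: "finite_measure N" "sets N = sets borel" "measure N UNIV \<le> C" for N
  proof -
    interpret finite_measure N by fact
    note [measurable_cong] = N(2)
    have iG: "integrable N G" unfolding G_def by (rule poisson_smoothing_fubini(2)[OF N(1,2) ig y])
    have igN: "integrable N g" using B by (intro integrable_const_bound[where B = B]) auto
    have "(\<integral>t. G t \<partial>N) / pi - (\<integral>t. g t \<partial>N) = (\<integral>t. G t / pi - g t \<partial>N)" using iG igN by simp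
    also have "\<bar>\<dots>\<bar> \<le> (\<integral>t. \<bar>G t / pi - g t\<bar> \<partial>N)"
      using integral_norm_bound[of N "\<lambda>t. G t / pi - g t"] by simp
    also have "\<dots> \<le> (\<integral>t. e' \<partial>N)"
      using iG igN un by (intro integral_mono) (auto simp: G_def)
    also have "\<dots> = e' * measure N UNIV" using sets_eq_imp_space_eq[OF N(2)] by simp
    also have "\<dots> \<le> e' * C" using N(3) e' by (intro mult_left_mono) auto
    finally show ?thesis using e' by linarith
  qed
  have "(\<lambda>n. \<integral>t. G t \<partial>R n) \<longlonglongrightarrow> (\<integral>t. G t \<partial>M)"
    unfolding G_def poisson_smoothing_fubini(1)[OF R(1,2) ig y] poisson_smoothing_fubini(1)[OF M(1,2) ig y]
  proof (rule integral_dominated_convergence)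
    show "integrable lborel (\<lambda>s. \<bar>g s\<bar> * (C / y))" using ig by simp
    show "AE s in lborel. (\<lambda>n. g s * (\<integral>t. poisson s y t \<partial>R n)) \<longlonglongrightarrow> g s * (\<integral>t. poisson s y t \<partial>M)"
      using lim[OF y] by (intro AE_I2 tendsto_intros)
    show "(\<lambda>s. g s * (\<integral>t. poisson s y t \<partial>M)) \<in> borel_measurable lborel"
      using poisson_smoothing_fubini(3)[OF M(1,2) ig y] by measurable
    show "(\<lambda>s. g s * (\<integral>t. poisson s y t \<partial>R n)) \<in> borel_measurable lborel" for n
      using poisson_smoothing_fubini(3)[OF R(1,2) ig y] by measurable
    show "AE s in lborel. norm (g s * (\<integral>t. poisson s y t \<partial>R n)) \<le> \<bar>g s\<bar> * (C / y)" for n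
    proof (rule AE_I2)
      fix s
      have "\<bar>\<integral>t. poisson s y t \<partial>R n\<bar> \<le> measure (R n) UNIV / y" by (rule poisson_smoothing_fubini(4)[OF R(1,2) ig y])
      also have "\<dots> \<le> C / y" using R(3) y by (intro divide_right_mono) auto
      finally show "norm (g s * (\<integral>t. poisson s y t \<partial>R n)) \<le> \<bar>g s\<bar> * (C / y)"
        using mult_left_mono[of _ "C / y" "\<bar>g s\<bar>"] by (simp add: abs_mult)
    qed
  qed
  then have "(\<lambda>n. (\<integral>t. G t \<partial>R n) / pi) \<longlonglongrightarrow> (\<integral>t. G t \<partial>M) / pi" by (intro tendsto_intros) auto
  then obtain n0 where n0: "\<And>n. n \<ge> n0 \<Longrightarrow> \<bar>(\<integral>t. G t \<partial>R n) / pi - (\<integral>t. G t \<partial>M) / pi\<bar> < e / 4"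
    using metric_LIMSEQ_D[of _ _ "e / 4"] e by (fastforce simp: dist_real_def)
  have "dist (\<integral>t. g t \<partial>R n) (\<integral>t. g t \<partial>M) < e" if "n \<ge> n0" for n
    using app[OF R(1,2,3), of n] app[OF M] n0[OF that] e unfolding dist_real_def by linarith
  then show "\<exists>no. \<forall>n\<ge>no. dist (\<integral>t. g t \<partial>R n) (\<integral>t. g t \<partial>M) < e" by blast
qed

section \<open>Densities of vague limits\<close>

text \<open>The tangent to \<open>x powr p\<close> at \<open>x = s\<close> lies below the graph.
  Being affine in \<open>x\<close>, the tangent passes to vague limits, which the power itself does
  not.\<close>

lemma young_powr:
  fixes x s p :: real
  assumes "p > 1" "x \<ge> 0" "s \<ge> 0"
  shows "p * s powr (p - 1) * x \<le> x powr p + (p - 1) * s powr p"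
proof -
  define q where "q = p / (p - 1)"
  have q: "q > 1" "1 / p + 1 / q = 1" using assms by (auto simp: q_def field_simps)
  have "x * s powr (p - 1) \<le> x powr p / p + (s powr (p - 1)) powr q / q"
    using assms q by (intro Youngs_inequality) auto
  also have "(s powr (p - 1)) powr q = s powr p" using assms by (simp add: powr_powr q_def)
  finally have "p * (x * s powr (p - 1)) \<le> p * (x powr p / p + s powr p / q)"
    using assms by (intro mult_left_mono) auto
  also have "p * (x powr p / p + s powr p / q) = x powr p + (p - 1) * s powr p"
    using assms by (simp add: q_def field_simps)
  finally show ?thesis by (simp add: mult_ac)
qed

text \<open>The bounds obtained from a finite \<open>liminf\<close> hold for infinitely many
  \<open>n\<close> only, whereas the test integrals converge along the full sequence; this combines
  the two.\<close>

lemma frequently_limit_le: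
  fixes X :: "nat \<Rightarrow> real"
  assumes "X \<longlonglongrightarrow> l" "\<exists>\<^sub>F n in sequentially. X n \<le> c"
  shows "l \<le> c"
proof (rule ccontr)
  assume "\<not> l \<le> c"
  then have "eventually (\<lambda>n. X n > c) sequentially" using assms(1) by (intro order_tendstoD) auto
  then have "eventually (\<lambda>n. \<not> X n \<le> c) sequentially" by (rule eventually_mono) simp
  then show False using assms(2) by (simp add: frequently_def)
qed

lemma frequently_limit_ge:
  fixes X :: "nat \<Rightarrow> real"
  assumes "X \<longlonglongrightarrow> l" "\<exists>\<^sub>F n in sequentially. c \<le> X n"
  shows "c \<le> l"
  using frequently_limit_le[OF tendsto_minus[OF assms(1)], of "- c"] assms(2) by simp

locale vague_limit =
  fixes h :: "nat \<Rightarrow> real \<Rightarrow> real" and M :: "real measure"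
  assumes h_meas [measurable]: "\<And>n. h n \<in> borel_measurable borel"
    and h_nonneg: "\<And>n t. h n t \<ge> 0"
    and h_int: "\<And>n. integrable lborel (h n)"
    and M_fin: "finite_measure M" and M_sets [measurable_cong]: "sets M = sets borel"
    and conv: "\<And>g K. continuous_on UNIV g \<Longrightarrow> (\<And>t. \<bar>t\<bar> > K \<Longrightarrow> g t = 0) \<Longrightarrow>
      (\<lambda>n. \<integral>t. g t * h n t \<partial>lborel) \<longlonglongrightarrow> (\<integral>t. g t \<partial>M)"
begin

sublocale M: finite_measure M by (rule M_fin)

lemma space_M [simp]: "space M = UNIV" using sets_eq_imp_space_eq[OF M_sets] by simp

text \<open>Vanishing outside the open interval keeps possible atoms of the limit measure at
  \<open>a\<close> and \<open>b\<close> out of all inequalities.\<close>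

definition admissible :: "real \<Rightarrow> real \<Rightarrow> (real \<Rightarrow> real) \<Rightarrow> bool" where
  "admissible a b g \<longleftrightarrow> continuous_on UNIV g \<and> (\<forall>t. g t \<ge> 0) \<and> (\<forall>t. t \<notin> {a<..<b} \<longrightarrow> g t = 0)"

lemma admissible_support: assumes "admissible a b g" "\<bar>t\<bar> > max \<bar>a\<bar> \<bar>b\<bar>" shows "g t = 0"
proof -
  have "t \<notin> {a<..<b}" using assms(2) by auto
  then show ?thesis using assms(1) by (simp add: admissible_def)
qed

lemma admissible_powr:
  assumes "admissible a b g" "q > 0"
  shows "continuous_on UNIV (\<lambda>t. g t powr q)" "\<bar>t\<bar> > max \<bar>a\<bar> \<bar>b\<bar> \<Longrightarrow> g t powr q = 0"
proof -
  show "continuous_on UNIV (\<lambda>t. g t powr q)"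
    by (rule continuous_on_powr') (use assms in \<open>auto simp: admissible_def\<close>)
  show "\<bar>t\<bar> > max \<bar>a\<bar> \<bar>b\<bar> \<Longrightarrow> g t powr q = 0" using admissible_support[OF assms(1), of t] by simp
qed

definition cutoff :: "real set \<Rightarrow> nat \<Rightarrow> real \<Rightarrow> real" where
  "cutoff U k t = min 1 (real k * infdist t (- U))"

text \<open>Continuous functions eventually equal to the indicator of \<open>U\<close> at each
  point. The complement must be nonempty because \<open>infdist\<close> to the empty set is
  \<open>0\<close> by convention.\<close>

lemma cutoff:
  assumes "open U" "- U \<noteq> {}"
  shows "continuous_on UNIV (cutoff U k)" "0 \<le> cutoff U k t" "cutoff U k t \<le> 1"
    "t \<notin> U \<Longrightarrow> cutoff U k t = 0" "t \<in> U \<Longrightarrow> eventually (\<lambda>k. cutoff U k t = 1) sequentially"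
proof -
  show "continuous_on UNIV (cutoff U k)" unfolding cutoff_def
    by (intro continuous_intros)
  show "0 \<le> cutoff U k t" "cutoff U k t \<le> 1" by (auto simp: cutoff_def infdist_nonneg)
  show "t \<notin> U \<Longrightarrow> cutoff U k t = 0" by (simp add: cutoff_def)
  assume "t \<in> U"
  then have "infdist t (- U) > 0"
    using assms in_closed_iff_infdist_zero[of "- U" t] infdist_nonneg[of t "- U"] by (auto simp: closed_Compl less_le)
  moreover obtain k0 where "1 / infdist t (- U) \<le> real k0" using real_arch_simple by blast
  ultimately have "cutoff U k t = 1" if "k \<ge> k0" for k
  proof -
    have "1 / infdist t (- U) \<le> real k" using \<open>1 / _ \<le> real k0\<close> that by linarith
    then have "1 \<le> real k * infdist t (- U)" using \<open>infdist t (- U) > 0\<close> by (simp add: divide_le_eq)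
    then show ?thesis by (simp add: cutoff_def)
  qed
  then show "eventually (\<lambda>k. cutoff U k t = 1) sequentially" unfolding eventually_sequentially by blast
qed

context
  fixes a b p C :: real
  assumes ab: "a < b" and p: "p > 1"
    and freq: "\<exists>\<^sub>F n in sequentially. (\<integral>\<^sup>+t\<in>{a..b}. ennreal (h n t powr p) \<partial>lborel) \<le> ennreal C"
    and C0: "C \<ge> 0"
begin

text \<open>\<open>young_powr\<close> with \<open>s = g t\<close>, integrated: the left side is a
  test integral and so converges. Holding for all admissible \<open>g\<close>, this one inequality
  contains both absolute continuity of the limit and the size of its density.\<close>

lemma limit_inequality:
  assumes g: "admissible a b g"
  shows "(\<integral>t. p * g t powr (p - 1) \<partial>M) \<le> C + (p - 1) * (\<integral>t. g t powr p \<partial>lborel)"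
proof -
  define G where "G = (\<lambda>t. p * g t powr (p - 1))"
  have cG: "continuous_on UNIV G" "\<And>t. \<bar>t\<bar> > max \<bar>a\<bar> \<bar>b\<bar> \<Longrightarrow> G t = 0"
    using admissible_powr[OF g, of "p - 1"] p by (auto simp: G_def intro!: continuous_intros)
  have G0: "G t \<ge> 0" for t using p by (simp add: G_def)
  have [measurable]: "G \<in> borel_measurable borel" using cG(1) by (rule borel_measurable_continuous_onI)
  have [measurable]: "(\<lambda>t. g t powr p) \<in> borel_measurable borel"
    using admissible_powr(1)[OF g, of p] p by (intro borel_measurable_continuous_onI) auto
  obtain B where B: "B \<ge> 0" "\<And>t. \<bar>G t\<bar> \<le> B" using integrable_compact_support(2)[OF cG] by blast
  have ig: "integrable lborel (\<lambda>t. g t powr p)"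
    using admissible_powr[OF g, of p] p by (intro integrable_compact_support(1)[of _ "max \<bar>a\<bar> \<bar>b\<bar>"]) auto
  have iGh: "integrable lborel (\<lambda>t. G t * h n t)" for n
  proof (rule Bochner_Integration.integrable_bound)
    show "integrable lborel (\<lambda>t. B * h n t)" using h_int by simp
    show "AE t in lborel. norm (G t * h n t) \<le> norm (B * h n t)"
      using B h_nonneg[of n] by (intro AE_I2) (simp add: abs_mult mult_right_mono)
  qed measurable
  have step: "(\<integral>t. G t * h n t \<partial>lborel) \<le> C + (p - 1) * (\<integral>t. g t powr p \<partial>lborel)"
    if n: "(\<integral>\<^sup>+t\<in>{a..b}. ennreal (h n t powr p) \<partial>lborel) \<le> ennreal C" for n
  proof -
    have g0: "g t \<ge> 0" "t \<notin> {a<..<b} \<Longrightarrow> g t = 0" for t using g by (auto simp: admissible_def)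
    have "ennreal (\<integral>t. G t * h n t \<partial>lborel) = (\<integral>\<^sup>+t. ennreal (G t * h n t) \<partial>lborel)"
      using iGh G0 h_nonneg by (intro nn_integral_eq_integral[symmetric]) auto
    also have "\<dots> \<le> (\<integral>\<^sup>+t. ennreal (h n t powr p) * indicator {a..b} t + ennreal ((p - 1) * g t powr p) \<partial>lborel)"
    proof (rule nn_integral_mono)
      fix t
      show "ennreal (G t * h n t) \<le> ennreal (h n t powr p) * indicator {a..b} t + ennreal ((p - 1) * g t powr p)"
      proof (cases "t \<in> {a<..<b}")
        case True
        then have "ennreal (h n t powr p) * indicator {a..b} t + ennreal ((p - 1) * g t powr p) = ennreal (h n t powr p + (p - 1) * g t powr p)"
          using p by (simp add: ennreal_plus)
        then show ?thesis using young_powr[OF p h_nonneg g0(1)] by (simp add: G_def ennreal_leI)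
      next
        case False
        then show ?thesis using g0(2)[OF False] p by (simp add: G_def)
      qed
    qed
    also have "\<dots> = (\<integral>\<^sup>+t\<in>{a..b}. ennreal (h n t powr p) \<partial>lborel) + (\<integral>\<^sup>+t. ennreal ((p - 1) * g t powr p) \<partial>lborel)"
      by (intro nn_integral_add) auto
    also have "(\<integral>\<^sup>+t. ennreal ((p - 1) * g t powr p) \<partial>lborel) = ennreal ((p - 1) * (\<integral>t. g t powr p \<partial>lborel))"
      using ig p by (subst nn_integral_eq_integral) auto
    also have "(\<integral>\<^sup>+t\<in>{a..b}. ennreal (h n t powr p) \<partial>lborel) + ennreal ((p - 1) * (\<integral>t. g t powr p \<partial>lborel)) \<le> ennreal C + ennreal ((p - 1) * (\<integral>t. g t powr p \<partial>lborel))"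
      using n by (rule add_right_mono)
    also have "\<dots> = ennreal (C + (p - 1) * (\<integral>t. g t powr p \<partial>lborel))"
      using p C0 by (intro ennreal_plus[symmetric]) (auto intro!: mult_nonneg_nonneg integral_nonneg_AE)
    finally show ?thesis
      using p C0 by (subst (asm) ennreal_le_iff) (auto intro!: add_nonneg_nonneg mult_nonneg_nonneg integral_nonneg_AE)
  qed
  have "(\<lambda>n. \<integral>t. G t * h n t \<partial>lborel) \<longlonglongrightarrow> (\<integral>t. G t \<partial>M)" by (rule conv[OF cG])
  then have "(\<integral>t. G t \<partial>M) \<le> C + (p - 1) * (\<integral>t. g t powr p \<partial>lborel)"
    by (rule frequently_limit_le) (rule frequently_mono[OF _ freq], use step in blast)
  then show ?thesis by (simp add: G_def)
qed

text \<open>Enclose \<open>N\<close> in an open set of Lebesgue measure at most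
  \<open>r powr (- p)\<close> and let \<open>g\<close> increase to \<open>r\<close> times its
  indicator. The right side of \<open>limit_inequality\<close> stays below
  \<open>C + (p - 1)\<close> while the left side is at least
  \<open>p * r powr (p - 1) * measure M N\<close>, which is unbounded in \<open>r\<close> unless
  \<open>N\<close> has mass zero.\<close>

lemma limit_null:
  assumes N: "N \<in> sets borel" "N \<subseteq> {a<..<b}" "emeasure lborel N = 0"
  shows "emeasure M N = 0"
proof -
  have key: "p * r powr (p - 1) * measure M N \<le> C + (p - 1)" if r: "r > 0" for r
  proof -
    have "r powr (- p) > 0" using r by simp
    then obtain U where U: "open U" "N \<subseteq> U" "emeasure lborel (U - N) < ennreal (r powr (- p))"
      using outer_regular_lborel[of N "r powr (- p)"] N(1) by auto
    define V where "V = U \<inter> {a<..<b}"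
    have V: "open V" "N \<subseteq> V" "- V \<noteq> {}" "V \<subseteq> {a<..<b}" using U N by (auto simp: V_def)
    have Vb [measurable]: "V \<in> sets borel" using V by simp
    have "emeasure lborel V \<le> emeasure lborel ((U - N) \<union> N)" using U N by (intro emeasure_mono) (auto simp: V_def)
    also have "\<dots> \<le> emeasure lborel (U - N) + emeasure lborel N" using U N by (intro emeasure_subadditive) auto
    also have "\<dots> \<le> ennreal (r powr (- p))" using U(3) N(3) by simp
    finally have Vm: "emeasure lborel V \<le> ennreal (r powr (- p))" .
    then have Vm': "measure lborel V \<le> r powr (- p)" by (simp add: measure_def enn2real_leI)
    have Vfin: "emeasure lborel V < \<infinity>" using Vm by (simp add: le_less_trans)
    define g where "g = (\<lambda>k t. r * cutoff V k t)"
    have ad: "admissible a b (g k)" for k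
      unfolding admissible_def
    proof (intro conjI allI impI)
      show "continuous_on UNIV (g k)" unfolding g_def by (intro continuous_intros cutoff(1)[OF V(1,3)])
      show "g k t \<ge> 0" for t using cutoff(2)[OF V(1,3)] r by (simp add: g_def)
      fix t assume "t \<notin> {a<..<b}"
      then have "t \<notin> V" using V(4) by blast
      then show "g k t = 0" using cutoff(4)[OF V(1,3)] by (simp add: g_def)
    qed
    have b1: "(\<integral>t. p * g k t powr (p - 1) \<partial>M) \<le> C + (p - 1)" for k
    proof -
      have "(\<integral>t. g k t powr p \<partial>lborel) \<le> (\<integral>t. r powr p * indicator V t \<partial>lborel)"
      proof (rule integral_mono)
        show "integrable lborel (\<lambda>t. g k t powr p)"
          using admissible_powr[OF ad, of p] p by (intro integrable_compact_support(1)[of _ "max \<bar>a\<bar> \<bar>b\<bar>"]) auto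
        show "integrable lborel (\<lambda>t. r powr p * indicator V t)" using Vfin by simp
        fix t
        show "g k t powr p \<le> r powr p * indicator V t"
          using cutoff(2-4)[OF V(1,3), where k = k and t = t] r p
          by (cases "t \<in> V") (auto simp: g_def intro!: powr_mono2 mult_left_le)
      qed
      also have "\<dots> = r powr p * measure lborel V" using Vfin by simp
      also have "\<dots> \<le> r powr p * r powr (- p)" using Vm' by (intro mult_left_mono) auto
      also have "\<dots> = 1" using r by (simp flip: powr_add)
      finally have "(p - 1) * (\<integral>t. g k t powr p \<partial>lborel) \<le> (p - 1) * 1" using p by (intro mult_left_mono) auto
      then have "C + (p - 1) * (\<integral>t. g k t powr p \<partial>lborel) \<le> C + (p - 1)" by simp
      with limit_inequality[OF ad, of k] show ?thesis by (rule order_trans)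
    qed
    have "(\<lambda>k. \<integral>t. p * g k t powr (p - 1) \<partial>M) \<longlonglongrightarrow> (\<integral>t. p * r powr (p - 1) * indicator V t \<partial>M)"
    proof (rule integral_dominated_convergence)
      show "(\<lambda>t. p * r powr (p - 1) * indicator V t) \<in> borel_measurable M" by measurable
      show "(\<lambda>t. p * g k t powr (p - 1)) \<in> borel_measurable M" for k
      proof -
        have "(\<lambda>t. g k t powr (p - 1)) \<in> borel_measurable borel"
          using admissible_powr(1)[OF ad, of "p - 1"] p by (intro borel_measurable_continuous_onI) auto
        then show ?thesis by measurable
      qed
      show "integrable M (\<lambda>t. p * r powr (p - 1))" by simp
      show "AE t in M. norm (p * g k t powr (p - 1)) \<le> p * r powr (p - 1)" for k
      proof (rule AE_I2)
        fix t
        have "g k t powr (p - 1) \<le> r powr (p - 1)"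
          using cutoff(2,3)[OF V(1,3), where k = k and t = t] r p unfolding g_def by (intro powr_mono2) (auto intro!: mult_left_le)
        then show "norm (p * g k t powr (p - 1)) \<le> p * r powr (p - 1)" using p by (simp add: abs_mult)
      qed
      show "AE t in M. (\<lambda>k. p * g k t powr (p - 1)) \<longlonglongrightarrow> p * r powr (p - 1) * indicator V t"
      proof (rule AE_I2)
        fix t
        show "(\<lambda>k. p * g k t powr (p - 1)) \<longlonglongrightarrow> p * r powr (p - 1) * indicator V t"
        proof (cases "t \<in> V")
          case True
          have "eventually (\<lambda>k. p * g k t powr (p - 1) = p * r powr (p - 1) * indicator V t) sequentially"
            using cutoff(5)[OF V(1,3) True] by eventually_elim (use True in \<open>simp add: g_def\<close>)
          then show ?thesis by (rule tendsto_eventually)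
        next
          case False
          then show ?thesis using cutoff(4)[OF V(1,3) False] by (simp add: g_def)
        qed
      qed
    qed
    then have "(\<integral>t. p * r powr (p - 1) * indicator V t \<partial>M) \<le> C + (p - 1)"
      by (rule LIMSEQ_le_const2) (use b1 in blast)
    then have "p * r powr (p - 1) * measure M V \<le> C + (p - 1)" by simp
    moreover have "measure M N \<le> measure M V" using V(2) by (intro M.finite_measure_mono) (auto simp: M_sets)
    then have "p * r powr (p - 1) * measure M N \<le> p * r powr (p - 1) * measure M V"
      using p by (intro mult_left_mono) auto
    ultimately show ?thesis by linarith
  qed
  have "measure M N = 0"
  proof (rule ccontr)
    assume "measure M N \<noteq> 0"
    then have c: "measure M N > 0" by (simp add: less_le)
    \<comment> \<open>Chosen so that the left side of \<open>key\<close> equals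
      \<open>C + p\<close>, one more than allowed.\<close>
    define r where "r = ((C + p) / (p * measure M N)) powr (1 / (p - 1))"
    have pos: "(C + p) / (p * measure M N) > 0" using C0 p c by simp
    then have "r > 0" unfolding r_def using p c C0 by simp
    moreover have "r powr (p - 1) = (C + p) / (p * measure M N)"
      using p pos C0 by (simp add: r_def powr_powr)
    then have "p * r powr (p - 1) * measure M N = C + p" using c p by simp
    ultimately show False using key[of r] by simp
  qed
  then show ?thesis by (simp add: M.emeasure_eq_measure)
qed

text \<open>Let \<open>fr\<close> be the density supplied by \<open>limit_null\<close> and
  Radon-Nikodym, and \<open>G\<close> its truncation at height \<open>k\<close>. The inequality with
  \<open>g = G\<close> and the bound \<open>G \<le> fr\<close> give
  \<open>p * (\<integral> G^p) \<le> C + (p - 1) * (\<integral> G^p)\<close>. Truncation makes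
  \<open>\<integral> G^p\<close> finite, so it can be subtracted; \<open>k\<close> then tends to
  infinity.\<close>

theorem Lp_density: "has_Lp_density_on p {a<..<b} M"
proof -
  let ?I = "{a<..<b}"
  define M1 where "M1 = density M (indicator ?I)"
  have sM1: "sets M1 = sets lborel" by (simp add: M1_def M_sets)
  have eM1: "emeasure M1 A = emeasure M (A \<inter> ?I)" if "A \<in> sets borel" for A
    using that unfolding M1_def by (subst emeasure_density) (auto simp: indicator_inter_arith[symmetric] Int_commute M_sets)
  have "absolutely_continuous lborel M1" unfolding absolutely_continuous_def
  proof
    fix N :: "real set" assume "N \<in> null_sets lborel"
    then have N: "N \<in> sets borel" "emeasure lborel N = 0" by auto
    then have "emeasure lborel (N \<inter> ?I) = 0" using emeasure_mono[of "N \<inter> ?I" N lborel] by simp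
    then have "emeasure M1 N = 0" using N by (subst eM1) (auto intro!: limit_null)
    then show "N \<in> null_sets M1" using N sM1 by auto
  qed
  then obtain f where f: "f \<in> borel_measurable lborel" "density lborel f = M1"
    using sigma_finite_measure.Radon_Nikodym[OF sigma_finite_lborel _ sM1] by blast
  define fr where "fr = (\<lambda>t. enn2real (f t) * indicator ?I t)"
  have [measurable]: "f \<in> borel_measurable borel" using f by simp
  have frm [measurable]: "fr \<in> borel_measurable borel" unfolding fr_def by measurable
  have fr0: "fr t \<ge> 0" for t by (simp add: fr_def)
  have ffin: "AE t in lborel. f t \<noteq> \<infinity>"
  proof (rule nn_integral_noteq_infinite)
    have "(\<integral>\<^sup>+t. f t \<partial>lborel) = emeasure (density lborel f) UNIV" by (subst emeasure_density) auto
    then show "(\<integral>\<^sup>+t. f t \<partial>lborel) \<noteq> \<infinity>" using f(2) eM1[of UNIV] by simp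
  qed (use f in simp)
  have dens: "emeasure M B = (\<integral>\<^sup>+t\<in>B. ennreal (fr t) \<partial>lborel)" if B: "B \<in> sets borel" "B \<subseteq> ?I" for B
  proof -
    have "emeasure M B = emeasure (density lborel f) B" using B f(2) eM1[of B] by (simp add: Int_absorb2)
    also have "\<dots> = (\<integral>\<^sup>+t\<in>B. f t \<partial>lborel)" using B by (subst emeasure_density) auto
    also have "\<dots> = (\<integral>\<^sup>+t\<in>B. ennreal (fr t) \<partial>lborel)"
    proof (rule nn_integral_cong_AE)
      show "AE t in lborel. f t * indicator B t = ennreal (fr t) * indicator B t"
        using ffin by eventually_elim (use B in \<open>auto simp: fr_def indicator_def less_top\<close>)
    qed
    finally show ?thesis .
  qed
  have ifr: "integrable lborel fr"
  proof (rule integrableI_bounded)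
    have "(\<integral>\<^sup>+t. ennreal (norm (fr t)) \<partial>lborel) = (\<integral>\<^sup>+t\<in>?I. ennreal (fr t) \<partial>lborel)"
      by (rule nn_integral_cong) (auto simp: fr_def indicator_def)
    also have "\<dots> = emeasure M ?I" using dens[of ?I] by simp
    finally show "(\<integral>\<^sup>+t. ennreal (norm (fr t)) \<partial>lborel) < \<infinity>" by (simp add: M.emeasure_eq_measure)
  qed simp
  have M1fr: "M1 = density lborel (\<lambda>t. ennreal (fr t))"
  proof (rule measure_eqI)
    fix A assume "A \<in> sets M1"
    then have A: "A \<in> sets borel" using sM1 by simp
    have "emeasure M1 A = (\<integral>\<^sup>+t\<in>A \<inter> ?I. ennreal (fr t) \<partial>lborel)" using A by (simp add: eM1 dens)
    also have "\<dots> = (\<integral>\<^sup>+t\<in>A. ennreal (fr t) \<partial>lborel)"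
      by (rule nn_integral_cong) (auto simp: fr_def indicator_def)
    finally show "emeasure M1 A = emeasure (density lborel (\<lambda>t. ennreal (fr t))) A"
      using A by (simp add: emeasure_density)
  qed (simp add: sM1)
  have intM: "(\<integral>t. u t \<partial>M) = (\<integral>t. fr t * u t \<partial>lborel)"
    if u: "u \<in> borel_measurable borel" "\<And>t. t \<notin> ?I \<Longrightarrow> u t = 0" for u :: "real \<Rightarrow> real"
  proof -
    have "(\<integral>t. u t \<partial>M) = (\<integral>t. indicator ?I t * u t \<partial>M)"
      using u(2) by (intro Bochner_Integration.integral_cong) (auto simp: indicator_def)
    also have "\<dots> = (\<integral>t. u t \<partial>density M (\<lambda>t. ennreal (indicator ?I t)))"
      using u(1) by (subst integral_density) (auto simp: measurable_cong_sets[OF M_sets refl] M_sets)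
    also have "density M (\<lambda>t. ennreal (indicator ?I t)) = M1" by (simp add: M1_def ennreal_indicator)
    also have "(\<integral>t. u t \<partial>M1) = (\<integral>t. fr t * u t \<partial>lborel)"
      unfolding M1fr using u(1) fr0 by (subst integral_density) auto
    finally show ?thesis .
  qed
  have trunc: "(\<integral>\<^sup>+t. ennreal ((min (fr t) (real k)) powr p) \<partial>lborel) \<le> ennreal C" for k :: nat
  proof -
    define G where "G = (\<lambda>t. min (fr t) (real k))"
    have Gm [measurable]: "G \<in> borel_measurable borel" unfolding G_def by measurable
    have G0: "0 \<le> G t" "G t \<le> real k" "G t \<le> fr t" for t using fr0 by (auto simp: G_def)
    \<comment> \<open>\<open>G\<close> is not continuous, hence not admissible. It is an almost
      everywhere limit of continuous functions, which are clipped to \<open>[0, k]\<close> and cut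
      off near the ends of the interval; dominated convergence carries
      \<open>limit_inequality\<close> over to \<open>G\<close>.\<close>
    have "G \<in> borel_measurable lebesgue" using Gm by (simp add: measurable_completion)
    then have "G measurable_on UNIV" by (intro lebesgue_measurable_imp_measurable_on_real) auto
    then obtain Ns gs where Ns: "negligible Ns" and gs: "\<And>n. continuous_on UNIV (gs n)"
      and gl: "\<And>t. t \<notin> Ns \<Longrightarrow> (\<lambda>n. gs n t) \<longlonglongrightarrow> G t"
      unfolding measurable_on_def by auto
    have aeN: "AE t in lborel. t \<notin> Ns"
    proof -
      have "Ns \<in> null_sets lebesgue" using Ns by (simp add: negligible_iff_null_sets)
      then have "AE t in lebesgue. t \<notin> Ns" by (rule AE_not_in)
      then show ?thesis by (simp add: AE_completion_iff)
    qed
    have neI: "- ?I \<noteq> {}" by (metis Compl_eq_Diff_UNIV Diff_eq_empty_iff UNIV_I greaterThanLessThan_iff less_irrefl subsetD)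
    define g where "g = (\<lambda>n t. min (max 0 (gs n t)) (real k * cutoff ?I n t))"
    note cut = cutoff[OF open_greaterThanLessThan neI]
    have ad: "admissible a b (g n)" for n
      unfolding admissible_def
    proof (intro conjI allI impI)
      show "continuous_on UNIV (g n)" unfolding g_def by (intro continuous_intros cut(1) gs)
      show "g n t \<ge> 0" for t using cut(2) by (simp add: g_def)
      fix t assume "t \<notin> ?I"
      then show "g n t = 0" using cut(4) by (simp add: g_def)
    qed
    have gb: "0 \<le> g n t" "g n t \<le> real k" "t \<notin> ?I \<Longrightarrow> g n t = 0" for n t
    proof -
      have "real k * cutoff ?I n t \<le> real k * 1" using cut(3)[of n t] by (intro mult_left_mono) auto
      then show "g n t \<le> real k" by (simp add: g_def)
      show "0 \<le> g n t" "t \<notin> ?I \<Longrightarrow> g n t = 0" using ad[of n] unfolding admissible_def by blast+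
    qed
    have glim: "(\<lambda>n. g n t) \<longlonglongrightarrow> G t" if t: "t \<notin> Ns" for t
    proof (cases "t \<in> ?I")
      case True
      have "(\<lambda>n. min (max 0 (gs n t)) (real k * 1)) \<longlonglongrightarrow> min (max 0 (G t)) (real k * 1)"
        by (intro tendsto_intros gl t)
      also have "min (max 0 (G t)) (real k * 1) = G t" using G0[of t] by simp
      finally show ?thesis
      proof (rule Lim_transform_eventually)
        show "eventually (\<lambda>n. min (max 0 (gs n t)) (real k * 1) = g n t) sequentially"
          using cut(5)[OF True] by eventually_elim (simp add: g_def)
      qed
    next
      case False
      then show ?thesis using gb(3)[OF False] G0[of t] by (simp add: G_def fr_def)
    qed
    have powr_lim: "(\<lambda>n. g n t powr q) \<longlonglongrightarrow> G t powr q" if "t \<notin> Ns" "q > 0" for t q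
      using glim[OF that(1)] that(2) gb(1) by (intro tendsto_powr' tendsto_intros) auto
    have gm: "(\<lambda>t. g n t powr q) \<in> borel_measurable borel" if "q > 0" for n q
      using admissible_powr(1)[OF ad that] by (intro borel_measurable_continuous_onI) auto
    have L1: "(\<lambda>n. \<integral>t. p * g n t powr (p - 1) \<partial>M) \<longlonglongrightarrow> (\<integral>t. fr t * (p * G t powr (p - 1)) \<partial>lborel)"
    proof -
      have "(\<integral>t. p * g n t powr (p - 1) \<partial>M) = (\<integral>t. fr t * (p * g n t powr (p - 1)) \<partial>lborel)" for n
        using gm[of "p - 1" n] p gb(3)[of _ n] by (intro intM) auto
      moreover have "(\<lambda>n. \<integral>t. fr t * (p * g n t powr (p - 1)) \<partial>lborel) \<longlonglongrightarrow> (\<integral>t. fr t * (p * G t powr (p - 1)) \<partial>lborel)"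
      proof (rule integral_dominated_convergence)
        show "integrable lborel (\<lambda>t. fr t * (p * real k powr (p - 1)))" using ifr by simp
        show "(\<lambda>t. fr t * (p * g n t powr (p - 1))) \<in> borel_measurable lborel" for n
        proof -
          have [measurable]: "(\<lambda>t. g n t powr (p - 1)) \<in> borel_measurable borel" using gm[of "p - 1" n] p by simp
          show ?thesis by measurable
        qed
        show "(\<lambda>t. fr t * (p * G t powr (p - 1))) \<in> borel_measurable lborel" by measurable
        show "AE t in lborel. (\<lambda>n. fr t * (p * g n t powr (p - 1))) \<longlonglongrightarrow> fr t * (p * G t powr (p - 1))"
          using aeN by eventually_elim (intro tendsto_mult tendsto_const powr_lim, use p in auto)
        show "AE t in lborel. norm (fr t * (p * g n t powr (p - 1))) \<le> fr t * (p * real k powr (p - 1))" for n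
        proof (rule AE_I2)
          fix t
          have "g n t powr (p - 1) \<le> real k powr (p - 1)" using gb p by (intro powr_mono2) auto
          then show "norm (fr t * (p * g n t powr (p - 1))) \<le> fr t * (p * real k powr (p - 1))"
            using p fr0[of t] by (simp add: abs_mult mult_left_mono)
        qed
      qed
      ultimately show ?thesis by simp
    qed
    have iGp: "integrable lborel (\<lambda>t. real k powr p * indicator ?I t)"
      using ab by (intro integrable_mult_right integrable_real_indicator) auto
    have L2: "(\<lambda>n. \<integral>t. g n t powr p \<partial>lborel) \<longlonglongrightarrow> (\<integral>t. G t powr p \<partial>lborel)"
    proof (rule integral_dominated_convergence[OF _ _ iGp])
      show "(\<lambda>t. G t powr p) \<in> borel_measurable lborel" by measurable
      show "(\<lambda>t. g n t powr p) \<in> borel_measurable lborel" for n using gm[of p n] p by simp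
      show "AE t in lborel. (\<lambda>n. g n t powr p) \<longlonglongrightarrow> G t powr p"
        using aeN by eventually_elim (use powr_lim p in auto)
      show "AE t in lborel. norm (g n t powr p) \<le> real k powr p * indicator ?I t" for n
      proof (rule AE_I2)
        fix t show "norm (g n t powr p) \<le> real k powr p * indicator ?I t"
          using gb[where n = n and t = t] p by (cases "t \<in> ?I") (auto intro!: powr_mono2)
      qed
    qed
    have "(\<integral>t. fr t * (p * G t powr (p - 1)) \<partial>lborel) \<le> C + (p - 1) * (\<integral>t. G t powr p \<partial>lborel)"
      by (rule LIMSEQ_le[OF L1 tendsto_add[OF tendsto_const tendsto_mult[OF tendsto_const L2]]])
        (use limit_inequality[OF ad] in blast)
    moreover have Gpb: "G t powr p \<le> real k powr p * indicator ?I t" for t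
      using G0[of t] p by (cases "t \<in> ?I") (auto intro!: powr_mono2 simp: G_def fr_def)
    then have iG: "integrable lborel (\<lambda>t. G t powr p)"
      by (intro Bochner_Integration.integrable_bound[OF iGp]) (auto intro!: AE_I2)
    moreover have "(\<integral>t. p * G t powr p \<partial>lborel) \<le> (\<integral>t. fr t * (p * G t powr (p - 1)) \<partial>lborel)"
    proof (rule integral_mono)
      show "integrable lborel (\<lambda>t. fr t * (p * G t powr (p - 1)))"
      proof (rule Bochner_Integration.integrable_bound)
        show "integrable lborel (\<lambda>t. fr t * (p * real k powr (p - 1)))" using ifr by simp
        show "AE t in lborel. norm (fr t * (p * G t powr (p - 1))) \<le> norm (fr t * (p * real k powr (p - 1)))"
        proof (rule AE_I2)
          fix t
          have "G t powr (p - 1) \<le> real k powr (p - 1)" using G0 p by (intro powr_mono2) auto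
          then show "norm (fr t * (p * G t powr (p - 1))) \<le> norm (fr t * (p * real k powr (p - 1)))"
            using p fr0[of t] by (simp add: abs_mult mult_left_mono)
        qed
      qed measurable
      show "integrable lborel (\<lambda>t. p * G t powr p)" using iG by simp
      fix t
      have "G t powr p = G t * G t powr (p - 1)"
        using G0(1)[of t] p by (cases "G t = 0") (auto simp: powr_mult_base)
      also have "\<dots> \<le> fr t * G t powr (p - 1)" using G0(3)[of t] by (intro mult_right_mono) auto
      finally show "p * G t powr p \<le> fr t * (p * G t powr (p - 1))" using p by (simp add: mult_left_mono mult.left_commute)
    qed
    ultimately have "p * (\<integral>t. G t powr p \<partial>lborel) \<le> C + (p - 1) * (\<integral>t. G t powr p \<partial>lborel)" by simp
    then have "(\<integral>t. G t powr p \<partial>lborel) \<le> C" by (simp add: algebra_simps)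
    then have "(\<integral>\<^sup>+t. ennreal (G t powr p) \<partial>lborel) \<le> ennreal C"
      using iG by (subst nn_integral_eq_integral) (auto intro!: ennreal_leI)
    then show ?thesis by (simp add: G_def)
  qed
  have "(\<integral>\<^sup>+t. ennreal (fr t powr p) \<partial>lborel) = (\<integral>\<^sup>+t. (SUP k :: nat. ennreal ((min (fr t) (real k)) powr p)) \<partial>lborel)"
  proof (rule nn_integral_cong)
    fix t
    show "ennreal (fr t powr p) = (SUP k :: nat. ennreal ((min (fr t) (real k)) powr p))"
    proof (rule antisym)
      obtain k :: nat where "fr t \<le> real k" using real_arch_simple by blast
      then have "ennreal (fr t powr p) = ennreal ((min (fr t) (real k)) powr p)" by simp
      then show "ennreal (fr t powr p) \<le> (SUP k :: nat. ennreal ((min (fr t) (real k)) powr p))"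
        by (simp only:) (rule SUP_upper, simp)
      show "(SUP k :: nat. ennreal ((min (fr t) (real k)) powr p)) \<le> ennreal (fr t powr p)"
        using fr0[of t] p by (intro SUP_least ennreal_leI powr_mono2) auto
    qed
  qed
  also have "\<dots> = (SUP k :: nat. \<integral>\<^sup>+t. ennreal ((min (fr t) (real k)) powr p) \<partial>lborel)"
  proof (rule nn_integral_monotone_convergence_SUP)
    show "incseq (\<lambda>(k :: nat) t. ennreal ((min (fr t) (real k)) powr p))"
      using fr0 p by (auto simp: incseq_def le_fun_def intro!: ennreal_leI powr_mono2)
  qed measurable
  also have "\<dots> \<le> ennreal C" by (intro SUP_least trunc)
  finally have fin: "(\<integral>\<^sup>+t. ennreal (fr t powr p) \<partial>lborel) \<le> ennreal C" .
  have "(\<integral>\<^sup>+t\<in>?I. ennreal (fr t powr p) \<partial>lborel) \<le> (\<integral>\<^sup>+t. ennreal (fr t powr p) \<partial>lborel)"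
    by (rule nn_integral_mono) (auto simp: indicator_def)
  also have "\<dots> \<le> ennreal C" by (rule fin)
  finally have "(\<integral>\<^sup>+t\<in>?I. ennreal (fr t powr p) \<partial>lborel) < \<infinity>" by (simp add: le_less_trans)
  then show ?thesis unfolding has_Lp_density_on_def
    using frm fr0 dens by (intro exI[of _ fr]) auto
qed

end

text \<open>The integrand in the hypothesis is affine in \<open>h n\<close>, so a lower bound for
  \<open>\<integral> h n\<close> over the middle third of the interval follows for infinitely many
  \<open>n\<close> and passes to the limit, provided \<open>m\<close> is large enough for
  \<open>2 * m\<close> times the length to beat the constant \<open>C\<close>.\<close>

theorem limit_positive:
  assumes cd: "a \<le> c" "c < d" "d \<le> b" and k: "kappa > 0" and C0: "C \<ge> 0"
    and freq: "\<exists>\<^sub>F n in sequentially. \<forall>m\<ge>2.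
      (\<integral>\<^sup>+t\<in>{a..b}. ennreal (2 * m - kappa * m\<^sup>2 * h n t) \<partial>lborel) \<le> ennreal C"
  shows "emeasure M {c<..<d} > 0"
proof -
  define w where "w = (d - c) / 3"
  have w: "w > 0" using cd by (simp add: w_def)
  define g where "g = (\<lambda>t. max 0 (min 1 (min (t - c) (d - t) / w)))"
  have cg: "continuous_on UNIV g" unfolding g_def using w by (intro continuous_intros) auto
  have g01: "0 \<le> g t" "g t \<le> 1" for t by (auto simp: g_def)
  have gout: "g t = 0" if "t \<notin> {c<..<d}" for t
  proof -
    have "min (t - c) (d - t) / w \<le> 0" using that w by (auto simp: divide_le_0_iff)
    then show ?thesis by (simp add: g_def)
  qed
  have gin: "g t = 1" if "t \<in> {c + w..d - w}" for t
  proof -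
    have "min (t - c) (d - t) / w \<ge> 1" using that w by (auto simp: le_divide_eq)
    then show ?thesis by (simp add: g_def)
  qed
  \<comment> \<open>Half of \<open>2 * m * w\<close> already absorbs \<open>C\<close>; the other
    half is left as the lower bound. The summand \<open>2\<close> secures
    \<open>m \<ge> 2\<close>.\<close>
  define m where "m = (C + 1) / w + 2"
  have m: "m \<ge> 2" "m * w \<ge> C + 1" using w C0 by (auto simp: m_def field_simps)
  define I where "I = {c + w..d - w}"
  have mI: "emeasure lborel I = ennreal w" using w by (simp add: I_def w_def field_simps)
  have iI1: "integrable lborel (indicator I :: real \<Rightarrow> real)"
    using mI by (intro integrable_real_indicator) (auto simp: I_def)
  have step: "(m * w) / (kappa * m\<^sup>2) \<le> (\<integral>t. g t * h n t \<partial>lborel)"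
    if n: "(\<integral>\<^sup>+t\<in>{a..b}. ennreal (2 * m - kappa * m\<^sup>2 * h n t) \<partial>lborel) \<le> ennreal C" for n
  proof -
    have iI: "integrable lborel (\<lambda>t. indicator I t * h n t)"
      using integrable_mult_indicator[OF _ h_int, of I n] by (simp add: I_def)
    have "(\<integral>t. indicator I t * (2 * m - kappa * m\<^sup>2 * h n t) \<partial>lborel) \<le> C"
    proof -
      have i: "integrable lborel (\<lambda>t. indicator I t * (2 * m - kappa * m\<^sup>2 * h n t))"
      proof -
        have "integrable lborel (\<lambda>t. indicator I t * (2 * m) - kappa * m\<^sup>2 * (indicator I t * h n t))"
          using iI iI1 by (intro Bochner_Integration.integrable_diff) auto
        then show ?thesis by (simp add: algebra_simps)
      qed
      \<comment> \<open>\<open>ennreal\<close> sends negative values to \<open>0\<close>, so the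
        hypothesis bounds the integral of the positive part, which dominates the signed integral
        over \<open>I\<close>.\<close>
      have "ennreal (\<integral>t. indicator I t * (2 * m - kappa * m\<^sup>2 * h n t) \<partial>lborel) \<le> (\<integral>\<^sup>+t. ennreal (indicator I t * (2 * m - kappa * m\<^sup>2 * h n t)) \<partial>lborel)"
      proof -
        let ?f = "\<lambda>t. indicator I t * (2 * m - kappa * m\<^sup>2 * h n t)"
        have "(\<integral>t. ?f t \<partial>lborel) \<le> (\<integral>t. max 0 (?f t) \<partial>lborel)" using i by (intro integral_mono integrable_max) auto
        then have "ennreal (\<integral>t. ?f t \<partial>lborel) \<le> ennreal (\<integral>t. max 0 (?f t) \<partial>lborel)" by (rule ennreal_leI)
        also have "\<dots> = (\<integral>\<^sup>+t. ennreal (max 0 (?f t)) \<partial>lborel)"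
          using i by (intro nn_integral_eq_integral[symmetric] integrable_max) auto
        also have "\<dots> = (\<integral>\<^sup>+t. ennreal (?f t) \<partial>lborel)"
          by (rule nn_integral_cong) (simp add: ennreal_max_0)
        finally show ?thesis .
      qed
      also have "\<dots> \<le> (\<integral>\<^sup>+t\<in>{a..b}. ennreal (2 * m - kappa * m\<^sup>2 * h n t) \<partial>lborel)"
        using cd w by (intro nn_integral_mono) (auto simp: indicator_def I_def)
      also have "\<dots> \<le> ennreal C" by (rule n)
      finally show ?thesis using C0 by (simp add: ennreal_le_iff)
    qed
    moreover have "(\<integral>t. indicator I t * (2 * m - kappa * m\<^sup>2 * h n t) \<partial>lborel) = 2 * m * w - kappa * m\<^sup>2 * (\<integral>t. indicator I t * h n t \<partial>lborel)"
    proof -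
      have "(\<integral>t. indicator I t * (2 * m - kappa * m\<^sup>2 * h n t) \<partial>lborel) = (\<integral>t. 2 * m * indicator I t - kappa * m\<^sup>2 * (indicator I t * h n t) \<partial>lborel)"
        by (rule Bochner_Integration.integral_cong) (auto simp: algebra_simps)
      also have "\<dots> = (\<integral>t. 2 * m * indicator I t \<partial>lborel) - (\<integral>t. kappa * m\<^sup>2 * (indicator I t * h n t) \<partial>lborel)"
        using iI mI by (intro Bochner_Integration.integral_diff) (auto simp: I_def)
      also have "(\<integral>t. 2 * m * indicator I t \<partial>lborel) = 2 * m * w" using mI w by (simp add: measure_def)
      finally show ?thesis by simp
    qed
    ultimately have "m * w \<le> kappa * m\<^sup>2 * (\<integral>t. indicator I t * h n t \<partial>lborel)" using m by linarith
    moreover have "kappa * m\<^sup>2 > 0" using k m by simp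
    ultimately have "(m * w) / (kappa * m\<^sup>2) \<le> (\<integral>t. indicator I t * h n t \<partial>lborel)" by (simp add: pos_divide_le_eq mult.commute)
    also have "\<dots> \<le> (\<integral>t. g t * h n t \<partial>lborel)"
    proof (rule integral_mono[OF iI])
      have [measurable]: "g \<in> borel_measurable borel" using cg by (rule borel_measurable_continuous_onI)
      show "integrable lborel (\<lambda>t. g t * h n t)"
        using g01 h_nonneg[of n] by (intro Bochner_Integration.integrable_bound[OF h_int[of n]])
          (auto intro!: AE_I2 simp: abs_mult mult_left_le_one_le)
      show "indicator I t * h n t \<le> g t * h n t" for t
        using gin[of t] g01(1)[of t] h_nonneg[of n t] by (auto simp: I_def indicator_def)
    qed
    finally show ?thesis .
  qed
  have "(\<lambda>n. \<integral>t. g t * h n t \<partial>lborel) \<longlonglongrightarrow> (\<integral>t. g t \<partial>M)"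
  proof (rule conv[OF cg, of "max \<bar>c\<bar> \<bar>d\<bar>"])
    show "g t = 0" if "\<bar>t\<bar> > max \<bar>c\<bar> \<bar>d\<bar>" for t by (rule gout) (use that in auto)
  qed
  then have "(m * w) / (kappa * m\<^sup>2) \<le> (\<integral>t. g t \<partial>M)"
    by (rule frequently_limit_ge) (rule frequently_mono[OF _ freq], use step m in blast)
  moreover have "(m * w) / (kappa * m\<^sup>2) > 0" using m w k by simp
  moreover have "(\<integral>t. g t \<partial>M) \<le> (\<integral>t. indicator {c<..<d} t \<partial>M)"
  proof (rule integral_mono)
    have [measurable]: "g \<in> borel_measurable borel" using cg by (rule borel_measurable_continuous_onI)
    show "integrable M g" using g01 by (intro M.integrable_const_bound[where B = 1]) auto
    show "integrable M (indicator {c<..<d} :: real \<Rightarrow> real)" by (simp add: M_sets less_top[symmetric])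
    show "g t \<le> indicator {c<..<d} t" for t using gout[of t] g01[of t] by (auto simp: indicator_def)
  qed
  ultimately have "measure M {c<..<d} > 0" by simp
  then show ?thesis by (simp add: M.emeasure_eq_measure)
qed

end

section \<open>The hopping operator\<close>

lemma fn_sum [simp]: "fn (sum f A) a = (\<Sum>i\<in>A. fn (f i) a)"
  by (induction A rule: infinite_finite_induct) auto

definition finsup :: "'a l2 set" where "finsup = {x. finite {a. fn x a \<noteq> 0}}"

lemma finsup_expand:
  assumes "finite F" "\<And>a. a \<notin> F \<Longrightarrow> fn x a = 0"
  shows "x = (\<Sum>a\<in>F. scaleC (fn x a) (delta_l2 a))"
proof (rule l2_eqI)
  fix b
  have "(\<Sum>a\<in>F. fn x a * (if b = a then 1 else 0)) = (\<Sum>a\<in>F. if b = a then fn x a else 0)"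
    by (intro sum.cong) auto
  also have "\<dots> = fn x b" using assms by (simp add: sum.delta')
  finally show "fn x b = fn (\<Sum>a\<in>F. scaleC (fn x a) (delta_l2 a)) b" by simp
qed

lemma csubspace_closure: assumes "csubspace S" shows "csubspace (closure S)"
proof -
  have "span S = S" using assms by (simp add: csubspace_def)
  moreover have "csubspace (closure (span S))"
    using assms by (intro csubspace_closure_span) (auto simp: csubspace_def)
  ultimately show ?thesis by (simp only:)
qed

lemma finsup_csubspace: "csubspace (finsup :: 'a l2 set)"
  unfolding csubspace_def real_vector.subspace_def
proof (intro conjI ballI allI)
  show "(0 :: 'a l2) \<in> finsup" by (simp add: finsup_def)
  fix x :: "'a l2" assume x: "x \<in> finsup"
  show "scaleR c x \<in> finsup" for c using x unfolding finsup_def by (auto elim: rev_finite_subset)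
  show "scaleC c x \<in> finsup" for c using x unfolding finsup_def by (auto elim: rev_finite_subset)
  fix y :: "'a l2" assume y: "y \<in> finsup"
  have "{a. fn (x + y) a \<noteq> 0} \<subseteq> {a. fn x a \<noteq> 0} \<union> {a. fn y a \<noteq> 0}" by auto
  then show "x + y \<in> finsup" using x y unfolding finsup_def by (auto intro: finite_subset)
qed

lemma fn_minus_fun: "(\<lambda>a. fn x a - fn y a) = fn (x - y)" by auto

context shell_hopping
begin

lemma herm: "cnj (h x y) = h y x" by (metis hermitian)

lemma finite_col: "finite {x. h x y \<noteq> 0}"
proof -
  have "{x. h x y \<noteq> 0} = {x. h y x \<noteq> 0}" using herm by (metis complex_cnj_zero_iff)
  then show ?thesis using locally_finite[of y] by simp
qed

definition hcol :: "'a \<Rightarrow> 'a l2" where "hcol y = mk (\<lambda>x. h x y)"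

lemma fn_hcol [simp]: "fn (hcol y) x = h x y"
  by (simp add: hcol_def fn_mk ell2_finite finite_col)

text \<open>Each value of the formal action is a pairing with a finitely supported column, so its
  linearity on all of \<open>l2\<close> comes from \<open>cinner\<close>.\<close>

lemma hop_eq_cinner: "hop h (fn x) y = cinner (hcol y) x"
proof -
  have "cinner (hcol y) x = (\<Sum>a\<in>{a. h y a \<noteq> 0}. cnj (h a y) * fn x a)"
    using herm[of y] by (subst cinner_finite_support[OF locally_finite[of y]]) (auto, metis complex_cnj_zero)
  then show ?thesis by (simp add: hop_def herm)
qed

definition Dom :: "'a l2 set" where "Dom = {x. hop h (fn x) \<in> ell2}"
definition T :: "'a l2 \<Rightarrow> 'a l2" where "T x = mk (hop h (fn x))"

lemma fn_T: "x \<in> Dom \<Longrightarrow> fn (T x) = hop h (fn x)" by (simp add: T_def Dom_def fn_mk)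

lemma Dom_I: assumes "\<And>a. hop h (fn x) a = fn w a" shows "x \<in> Dom" "T x = w"
proof -
  have "hop h (fn x) = fn w" using assms by auto
  then show "x \<in> Dom" "T x = w" by (simp_all add: Dom_def T_def fn_inverse)
qed

lemma Dom_add: assumes "x \<in> Dom" "y \<in> Dom" shows "x + y \<in> Dom" "T (x + y) = T x + T y"
  using Dom_I[of "x + y" "T x + T y"] assms by (simp_all add: fn_T hop_eq_cinner cinner_add_right)

lemma Dom_scaleC: assumes "x \<in> Dom" shows "scaleC c x \<in> Dom" "T (scaleC c x) = scaleC c (T x)"
  using Dom_I[of "scaleC c x" "scaleC c (T x)"] assms by (simp_all add: fn_T hop_eq_cinner cinner_scaleC_right)

lemma Dom_diff: assumes "x \<in> Dom" "y \<in> Dom" shows "x - y \<in> Dom" "T (x - y) = T x - T y"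
  using Dom_I[of "x - y" "T x - T y"] assms by (simp_all add: fn_T hop_eq_cinner cinner_diff_right)

lemma Dom_zero: "0 \<in> Dom" "T 0 = 0"
  using Dom_I[of 0 0] by (simp_all add: hop_eq_cinner)

lemma delta_Dom: "delta_l2 y \<in> Dom" "T (delta_l2 y) = hcol y"
proof -
  have "hop h (fn (delta_l2 y)) a = fn (hcol y) a" for a
    by (simp add: hop_eq_cinner) (subst cinner_commute, simp add: cinner_delta herm)
  then show "delta_l2 y \<in> Dom" "T (delta_l2 y) = hcol y" using Dom_I by blast+
qed

lemma Dom_sum:
  "(\<And>i. i \<in> F \<Longrightarrow> f i \<in> Dom) \<Longrightarrow> sum f F \<in> Dom \<and> T (sum f F) = (\<Sum>i\<in>F. T (f i))"
  by (induction F rule: infinite_finite_induct) (auto simp: Dom_add Dom_zero)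

lemma finsup_Dom: assumes "x \<in> finsup"
  shows "x \<in> Dom" "T x = (\<Sum>a | fn x a \<noteq> 0. scaleC (fn x a) (hcol a))"
proof -
  let ?F = "{a. fn x a \<noteq> 0}"
  have x: "x = (\<Sum>a\<in>?F. scaleC (fn x a) (delta_l2 a))"
    using assms by (intro finsup_expand) (auto simp: finsup_def)
  have "(\<Sum>a\<in>?F. scaleC (fn x a) (delta_l2 a)) \<in> Dom \<and>
     T (\<Sum>a\<in>?F. scaleC (fn x a) (delta_l2 a)) = (\<Sum>a\<in>?F. T (scaleC (fn x a) (delta_l2 a)))"
    by (rule Dom_sum) (simp add: Dom_scaleC delta_Dom)
  then show "x \<in> Dom" "T x = (\<Sum>a\<in>?F. scaleC (fn x a) (hcol a))"
    using x by (simp_all add: Dom_scaleC delta_Dom)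
qed

lemma T_finsup_sym: assumes "x \<in> Dom" "y \<in> finsup" shows "cinner x (T y) = cinner (T x) y"
proof -
  have "cinner x (T y) = (\<Sum>a | fn y a \<noteq> 0. fn y a * cinner x (hcol a))"
    using assms finsup_Dom(2) by (simp add: cinner_sum_right cinner_scaleC_right)
  also have "\<dots> = (\<Sum>a | fn y a \<noteq> 0. cnj (fn (T x) a) * fn y a)"
  proof (rule sum.cong)
    fix a
    have "fn (T x) a = cinner (hcol a) x" using assms by (simp add: fn_T hop_eq_cinner)
    then have "cnj (fn (T x) a) = cinner x (hcol a)" by (metis cinner_commute)
    then show "fn y a * cinner x (hcol a) = cnj (fn (T x) a) * fn y a" by simp
  qed simp
  also have "\<dots> = cinner (T x) y"
    using assms by (intro cinner_finite_support[symmetric]) (auto simp: finsup_def)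
  finally show ?thesis .
qed

lemma hop_min_eq: "hop_min h = {(fn x, fn (T x)) | x. x \<in> finsup}"
proof -
  have "\<exists>x. \<psi> = fn x \<and> x \<in> finsup" if "finite {a. \<psi> a \<noteq> 0}" for \<psi> :: "'a \<Rightarrow> complex"
    using that by (intro exI[of _ "mk \<psi>"]) (simp add: fn_mk ell2_finite finsup_def)
  then show ?thesis unfolding hop_min_def using finsup_Dom(1) fn_T by (fastforce simp: finsup_def)
qed

text \<open>Testing the adjoint relation on the unit vectors already identifies the image with the
  formal action, so the adjoint is the operator on its natural domain.\<close>

lemma hop_op_eq: "hop_op h = {(fn x, fn (T x)) | x. x \<in> Dom}"
proof (intro equalityI subsetI)
  fix p assume "p \<in> hop_op h"
  then obtain \<phi> \<eta> where p: "p = (\<phi>, \<eta>)" "\<phi> \<in> ell2" "\<eta> \<in> ell2"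
    and adj: "\<And>x. x \<in> finsup \<Longrightarrow> ell2_inner \<phi> (fn (T x)) = ell2_inner \<eta> (fn x)"
    unfolding hop_op_def op_adjoint_def hop_min_eq by clarsimp blast
  define x where "x = mk \<phi>"
  define w where "w = mk \<eta>"
  have f: "fn x = \<phi>" "fn w = \<eta>" using p by (simp_all add: x_def w_def fn_mk)
  have "hop h (fn x) a = fn w a" for a
  proof -
    have "cinner x (T (delta_l2 a)) = cinner w (delta_l2 a)"
      using adj[of "delta_l2 a"] unfolding cinner_def f by (simp add: finsup_def)
    then show ?thesis using delta_Dom(2)[of a] by (metis cinner_commute cinner_delta hop_eq_cinner)
  qed
  then have "x \<in> Dom" "T x = w" using Dom_I by blast+
  then show "p \<in> {(fn x, fn (T x)) | x. x \<in> Dom}" using f p(1) by force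
next
  fix p assume "p \<in> {(fn x, fn (T x)) | x. x \<in> Dom}"
  then show "p \<in> hop_op h"
    unfolding hop_op_def op_adjoint_def hop_min_eq using T_finsup_sym by (auto simp: cinner_def)
qed

lemma op_closure_hop_min_iff:
  "(fn x, fn w) \<in> op_closure (hop_min h) \<longleftrightarrow> (\<forall>e>0. \<exists>f\<in>finsup. norm (x - f) < e \<and> norm (w - T f) < e)"
proof -
  have "(\<exists>(\<psi>, \<xi>)\<in>{(fn x, fn (T x)) | x. x \<in> finsup}. Q \<psi> \<xi>) \<longleftrightarrow> (\<exists>x\<in>finsup. Q (fn x) (fn (T x)))" for Q
    by auto
  then show ?thesis unfolding op_closure_def hop_min_eq by (simp add: norm_ell2 fn_minus_fun)
qed

end

locale sa_hopping = shell_hopping +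
  assumes esa: "essentially_self_adjoint (hop_min h)"
begin

text \<open>Taking the closure does not change the adjoint, by continuity of the form. Essential
  self-adjointness then makes the natural-domain operator the closure of \<open>hop_min h\<close>,
  that is, finitely supported vectors form a core.\<close>

lemma hop_op_closure: "hop_op h = op_closure (hop_min h)"
proof
  have sa: "op_adjoint (op_closure (hop_min h)) = op_closure (hop_min h)"
    using esa by (simp add: essentially_self_adjoint_def)
  have "hop_min h \<subseteq> op_closure (hop_min h)"
  proof
    fix p assume "p \<in> hop_min h"
    then obtain x where "p = (fn x, fn (T x))" "x \<in> finsup" unfolding hop_min_eq by auto
    then show "p \<in> op_closure (hop_min h)" using op_closure_hop_min_iff[of x "T x"] by force
  qed
  then have "op_adjoint (op_closure (hop_min h)) \<subseteq> op_adjoint (hop_min h)"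
    unfolding op_adjoint_def by blast
  then show "op_closure (hop_min h) \<subseteq> hop_op h" unfolding sa hop_op_def .
  have "hop_op h \<subseteq> op_adjoint (op_closure (hop_min h))"
  proof
    fix p assume "p \<in> hop_op h"
    then obtain x where x: "p = (fn x, fn (T x))" "x \<in> Dom" unfolding hop_op_eq by auto
    have "cinner x w = cinner (T x) y" if yw: "(fn y, fn w) \<in> op_closure (hop_min h)" for y w
    proof -
      have "\<exists>f. f \<in> finsup \<and> norm (y - f) < 1 / real (Suc n) \<and> norm (w - T f) < 1 / real (Suc n)" for n
        using yw unfolding op_closure_hop_min_iff by (metis of_nat_0_less_iff zero_less_Suc zero_less_divide_1_iff)
      then obtain f where f: "\<And>n. f n \<in> finsup" "\<And>n. norm (y - f n) < 1 / real (Suc n)" "\<And>n. norm (w - T (f n)) < 1 / real (Suc n)"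
        by metis
      have lim: "g \<longlonglongrightarrow> l" if "\<And>n. norm (l - g n) < 1 / real (Suc n)" for g and l :: "'a l2"
      proof (rule LIM_zero_cancel, rule Lim_null_comparison)
        show "\<forall>\<^sub>F n in sequentially. norm (g n - l) \<le> 1 / real (Suc n)"
          using that by (intro always_eventually allI) (metis less_imp_le norm_minus_commute)
        show "(\<lambda>n. 1 / real (Suc n)) \<longlonglongrightarrow> 0" using LIMSEQ_inverse_real_of_nat by (simp add: inverse_eq_divide)
      qed
      have "(\<lambda>n. cinner x (T (f n))) \<longlonglongrightarrow> cinner x w" by (intro tendsto_cinner tendsto_const lim f(3))
      moreover have "(\<lambda>n. cinner (T x) (f n)) \<longlonglongrightarrow> cinner (T x) y" by (intro tendsto_cinner tendsto_const lim f(2))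
      ultimately show ?thesis using T_finsup_sym[OF x(2) f(1)] LIMSEQ_unique by simp
    qed
    moreover have "\<exists>y w. q = (fn y, fn w)" if qc: "q \<in> op_closure (hop_min h)" for q
    proof -
      obtain a b where "q = (a, b)" "a \<in> ell2" "b \<in> ell2" using qc unfolding op_closure_def by auto
      then have "q = (fn (mk a), fn (mk b))" by (simp add: fn_mk)
      then show ?thesis by blast
    qed
    ultimately show "p \<in> op_adjoint (op_closure (hop_min h))"
      unfolding op_adjoint_def x(1) by (fastforce simp: cinner_def)
  qed
  then show "hop_op h \<subseteq> op_closure (hop_min h)" unfolding sa .
qed

lemma T_sym: assumes "x \<in> Dom" "y \<in> Dom" shows "cinner x (T y) = cinner (T x) y"
proof -
  have "(fn x, fn (T x)) \<in> op_adjoint (op_closure (hop_min h))"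
    using assms esa hop_op_closure unfolding essentially_self_adjoint_def hop_op_eq by auto
  moreover have "(fn y, fn (T y)) \<in> op_closure (hop_min h)"
    using assms unfolding hop_op_closure[symmetric] hop_op_eq by auto
  ultimately show ?thesis unfolding op_adjoint_def cinner_def by auto
qed

lemma closure_Dom:
  assumes "\<And>e. e > 0 \<Longrightarrow> \<exists>f\<in>finsup. norm (x - f) < e \<and> norm (w - T f) < e"
  shows "x \<in> Dom" "T x = w"
proof -
  have "(fn x, fn w) \<in> hop_op h" unfolding hop_op_closure op_closure_hop_min_iff using assms by blast
  then have "x \<in> Dom \<and> T x = w" unfolding hop_op_eq by (auto simp: fn_inject)
  then show "x \<in> Dom" "T x = w" by auto
qed

lemma Dom_approx:
  assumes "x \<in> Dom" "e > 0"
  shows "\<exists>f\<in>finsup. norm (x - f) < e \<and> norm (T x - T f) < e"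
proof -
  have "(fn x, fn (T x)) \<in> op_closure (hop_min h)" using assms(1) hop_op_closure hop_op_eq by auto
  then show ?thesis using assms(2) op_closure_hop_min_iff by blast
qed

lemma form_real: assumes "x \<in> Dom" shows "Im (cinner x (T x)) = 0"
  using T_sym[OF assms assms] cinner_commute[of x "T x"] by (simp add: complex_eq_iff)

lemma resolvent_bound: assumes "x \<in> Dom" shows "\<bar>Im z\<bar> * norm x \<le> norm (T x - scaleC z x)"
proof (cases "x = 0")
  case False
  have "\<bar>Im z\<bar> * norm x * norm x = \<bar>Im (cinner x (T x - scaleC z x))\<bar>"
    using form_real[OF assms] by (simp add: cinner_simps cinner_norm power2_eq_square abs_mult flip: of_real_mult)
  also have "\<dots> \<le> norm x * norm (T x - scaleC z x)"
    using abs_Im_le_cmod norm_cinner_le order_trans by blast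
  finally show ?thesis using False by simp
qed simp

text \<open>The range of \<open>T - z\<close> on finitely supported vectors is dense: a vector
  orthogonal to it is an eigenvector for the nonreal value \<open>cnj z\<close>, against the reality
  of the form. By \<open>resolvent_bound\<close>, preimages of a convergent sequence are Cauchy, and
  the core property puts their limit into the domain.\<close>

theorem resolvent_exists:
  assumes z: "Im z \<noteq> 0"
  shows "\<exists>x\<in>Dom. T x - scaleC z x = v"
proof -
  define L where "L = (\<lambda>f. T f - scaleC z f)"
  define R0 where "R0 = L ` finsup"
  have L: "L (x + y) = L x + L y" "L (scaleC c x) = scaleC c (L x)" "L (x - y) = L x - L y" "L 0 = 0"
    if "x \<in> Dom" "y \<in> Dom" for x y c
    using that by (simp_all add: L_def Dom_add Dom_scaleC Dom_diff Dom_zero scaleC_add_right scaleC_diff_right mult.commute algebra_simps)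
  have fs: "x + y \<in> finsup" "scaleC c x \<in> finsup" "scaleR r x \<in> finsup"
    if "x \<in> finsup" "y \<in> finsup" for x y :: "'a l2" and c r
    using finsup_csubspace[where 'a = 'a] that unfolding csubspace_def by (auto simp: subspace_add subspace_scale subspace_0)
  have "csubspace R0" unfolding csubspace_def real_vector.subspace_def
  proof (intro conjI ballI allI)
    have "L 0 = 0" "(0 :: 'a l2) \<in> finsup" by (simp_all add: L_def Dom_zero finsup_def)
    then show "0 \<in> R0" unfolding R0_def by (metis image_eqI)
    fix x assume "x \<in> R0"
    then obtain f where f: "f \<in> finsup" "x = L f" unfolding R0_def by blast
    show "scaleC c x \<in> R0" for c
      using f L(2)[of f f c] fs(2)[of f f c] finsup_Dom(1) unfolding R0_def by (metis image_eqI)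
    then show "scaleR c x \<in> R0" for c by (simp add: scaleR_l2_def)
    fix y assume "y \<in> R0"
    then obtain g where g: "g \<in> finsup" "y = L g" unfolding R0_def by blast
    show "x + y \<in> R0"
      using f g L(1)[of f g] fs(1)[of f g] finsup_Dom(1) unfolding R0_def by (metis image_eqI)
  qed
  then have K: "csubspace (closure R0)" "closed (closure R0)" by (simp_all add: csubspace_closure)
  define w where "w = v - orth_proj (closure R0) v"
  have orth: "cinner k w = 0" if "k \<in> closure R0" for k using orth_proj(2)[OF K that] by (simp add: w_def)
  \<comment> \<open>Orthogonality to \<open>(T - z)\<close> applied to the unit vector at
    \<open>a\<close>, read off coordinate by coordinate.\<close>
  have "hop h (fn w) a = fn (scaleC (cnj z) w) a" for a
  proof -
    have "L (delta_l2 a) \<in> closure R0" unfolding R0_def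
      by (rule subsetD[OF closure_subset]) (auto simp: finsup_def)
    from orth[OF this] show ?thesis
      by (simp add: L_def delta_Dom cinner_simps cinner_delta hop_eq_cinner)
  qed
  from Dom_I[OF this] have "w \<in> Dom" "T w = scaleC (cnj z) w" by auto
  with form_real[of w] have "Im (cnj z) * (norm w)\<^sup>2 = 0" by (simp add: cinner_simps cinner_norm)
  then have "w = 0" using z by simp
  then have "v = orth_proj (closure R0) v" by (simp add: w_def)
  then have "v \<in> closure R0" using orth_proj(1)[OF K] by metis
  then obtain X where X: "\<forall>n. X n \<in> R0" "X \<longlonglongrightarrow> v" unfolding closure_sequential by blast
  then have "\<forall>n. \<exists>f. f \<in> finsup \<and> X n = L f" unfolding R0_def by blast
  then obtain f where f: "\<And>n. f n \<in> finsup" "\<And>n. X n = L (f n)" by metis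
  have "Cauchy f"
  proof (rule metric_CauchyI)
    fix e :: real assume "e > 0"
    then have "e * \<bar>Im z\<bar> > 0" using z by simp
    then obtain M where M: "\<And>m n. m \<ge> M \<Longrightarrow> n \<ge> M \<Longrightarrow> dist (X m) (X n) < e * \<bar>Im z\<bar>"
      using LIMSEQ_imp_Cauchy[OF X(2)] metric_CauchyD by blast
    have "dist (f m) (f n) < e" if "m \<ge> M" "n \<ge> M" for m n
    proof -
      have Dm: "f m \<in> Dom" "f n \<in> Dom" using f(1) finsup_Dom(1) by blast+
      have "\<bar>Im z\<bar> * norm (f m - f n) \<le> norm (L (f m - f n))"
        unfolding L_def by (rule resolvent_bound[OF Dom_diff(1)[OF Dm]])
      also have "\<dots> = dist (X m) (X n)" using L(3)[OF Dm] f(2) by (simp add: dist_norm)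
      also have "\<dots> < e * \<bar>Im z\<bar>" by (rule M[OF that])
      finally show ?thesis using z by (simp add: dist_norm mult.commute)
    qed
    then show "\<exists>M. \<forall>m\<ge>M. \<forall>n\<ge>M. dist (f m) (f n) < e" by blast
  qed
  then obtain x where x: "f \<longlonglongrightarrow> x" using Cauchy_convergent convergent_def by blast
  have "(\<lambda>n. X n + scaleC z (f n)) \<longlonglongrightarrow> v + scaleC z x" by (intro tendsto_add X(2) tendsto_scaleC x)
  then have Tf: "(\<lambda>n. T (f n)) \<longlonglongrightarrow> v + scaleC z x" by (simp add: f(2) L_def)
  have app: "\<exists>g\<in>finsup. norm (x - g) < e \<and> norm ((v + scaleC z x) - T g) < e" if "e > 0" for e
  proof -
    have "eventually (\<lambda>n. norm (x - f n) < e) sequentially" "eventually (\<lambda>n. norm ((v + scaleC z x) - T (f n)) < e) sequentially"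
      using tendstoD[OF x that] tendstoD[OF Tf that] by (auto simp: dist_norm norm_minus_commute)
    then have "eventually (\<lambda>n. norm (x - f n) < e \<and> norm ((v + scaleC z x) - T (f n)) < e) sequentially" by (rule eventually_conj)
    then show ?thesis
      using f(1) by (auto simp: eventually_sequentially)
  qed
  show ?thesis using closure_Dom[OF app] by (intro bexI[of _ x]) simp_all
qed

end

section \<open>Projection-valued measures carried over to the type \<open>l2\<close>\<close>

definition lift_proj :: "(real set \<Rightarrow> ('a \<Rightarrow> complex) \<Rightarrow> ('a \<Rightarrow> complex)) \<Rightarrow> real set \<Rightarrow> 'a l2 \<Rightarrow> 'a l2" where
  "lift_proj E B x = mk (E B (fn x))"

lemma pvm_lift_proj:
  assumes "projection_valued_measure E"
  shows "pvm (lift_proj E)" "B \<in> sets borel \<Longrightarrow> fn (lift_proj E B x) = E B (fn x)"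
proof -
  have pr: "ell2_projection (E B)" if "B \<in> sets borel" for B using assms that by (simp add: projection_valued_measure_def)
  have f: "fn (lift_proj E B x) = E B (fn x)" if "B \<in> sets borel" for B x
    using pr[OF that] by (simp add: lift_proj_def ell2_projection_def fn_mk)
  then show "B \<in> sets borel \<Longrightarrow> fn (lift_proj E B x) = E B (fn x)" .
  have lin: "E B (\<lambda>a. c * fn x a + fn y a) = (\<lambda>a. c * E B (fn x) a + E B (fn y) a)" if "B \<in> sets borel" for B c x y
    using pr[OF that] fn_ell2[of x] fn_ell2[of y] unfolding ell2_projection_def by blast
  show "pvm (lift_proj E)"
  proof
    fix B :: "real set" and x y and c assume B: "B \<in> sets borel"
    show add: "lift_proj E B (x + y) = lift_proj E B x + lift_proj E B y" for x y
    proof (rule l2_eqI)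
      have "fn (x + y) = (\<lambda>a. 1 * fn x a + fn y a)" by auto
      then show "fn (lift_proj E B (x + y)) a = fn (lift_proj E B x + lift_proj E B y) a" for a
        using lin[OF B, of 1 x y] by (simp add: f[OF B])
    qed
    have z: "lift_proj E B 0 = 0" using add[of 0 0] by simp
    show "lift_proj E B (scaleC c x) = scaleC c (lift_proj E B x)"
    proof (rule l2_eqI)
      have "fn (scaleC c x) = (\<lambda>a. c * fn x a + fn 0 a)" by auto
      moreover have "E B (fn 0) a = 0" for a using f[OF B, of 0] z by (metis fn_zero)
      ultimately show "fn (lift_proj E B (scaleC c x)) a = fn (scaleC c (lift_proj E B x)) a" for a
        using lin[OF B, of c x 0] by (simp add: f[OF B])
    qed
    show "lift_proj E B (lift_proj E B x) = lift_proj E B x"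
      using pr[OF B] fn_ell2[of x] by (simp add: lift_proj_def ell2_projection_def fn_mk)
    show "cinner (lift_proj E B x) y = cinner x (lift_proj E B y)"
      using pr[OF B] fn_ell2[of x] fn_ell2[of y] unfolding cinner_def f[OF B] ell2_projection_def by blast
  next
    fix x show "lift_proj E UNIV x = x"
      using assms by (simp add: lift_proj_def projection_valued_measure_def fn_inverse)
  next
    fix C :: "nat \<Rightarrow> real set" and x assume C: "range C \<subseteq> sets borel" "disjoint_family C"
    have "(\<lambda>n. ell2_norm (\<lambda>a. E (\<Union>i. C i) (fn x) a - (\<Sum>i<n. E (C i) (fn x) a))) \<longlonglongrightarrow> 0"
      using assms C fn_ell2[of x] unfolding projection_valued_measure_def by blast
    moreover have "(\<lambda>a. E (\<Union>i. C i) (fn x) a - (\<Sum>i<n. E (C i) (fn x) a)) = fn (lift_proj E (\<Union>i. C i) x - (\<Sum>i<n. lift_proj E (C i) x))" for n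
      using C(1) by (auto simp: f range_subsetD)
    ultimately have "(\<lambda>n. norm (lift_proj E (\<Union>i. C i) x - (\<Sum>i<n. lift_proj E (C i) x))) \<longlonglongrightarrow> 0"
      by (simp add: norm_ell2)
    then show "(\<lambda>i. lift_proj E (C i) x) sums lift_proj E (\<Union>i. C i) x"
      unfolding sums_def by (subst tendsto_dist_iff) (simp add: dist_norm norm_minus_commute)
  qed
qed

lemma spectral_measure_mu:
  assumes "projection_valued_measure E"
  shows "spectral_measure E (fn x) = pvm.mu (lift_proj E) x"
proof -
  interpret pvm "lift_proj E" by (rule pvm_lift_proj(1)[OF assms])
  have "Re (ell2_inner (fn x) (E B (fn x))) = (norm (lift_proj E B x))\<^sup>2" if "B \<in> sets borel" for B
    unfolding norm_P[OF that] by (simp add: inner_l2_def cinner_def pvm_lift_proj(2)[OF assms that])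
  then show ?thesis unfolding spectral_measure_def mu_def
    by (intro measure_of_eq) (auto simp: sets.sigma_sets_eq[of borel, simplified])
qed

context sa_hopping
begin

lemma spectral_op_lift:
  assumes E: "spectral_resolution (hop_op h) E"
  shows "spectral_op (lift_proj E) Dom T"
proof -
  have pv: "projection_valued_measure E" using E by (simp add: spectral_resolution_def)
  interpret pvm "lift_proj E" by (rule pvm_lift_proj(1)[OF pv])
  show ?thesis
  proof
    fix x y
    have "Domain (hop_op h) = {\<psi> \<in> ell2. (\<integral>\<^sup>+ l. ennreal (l\<^sup>2) \<partial>spectral_measure E \<psi>) < \<infinity>}"
      using E by (simp add: spectral_resolution_def)
    moreover have "Domain (hop_op h) = fn ` Dom" unfolding hop_op_eq by auto
    ultimately have "fn x \<in> fn ` Dom \<longleftrightarrow> (\<integral>\<^sup>+ l. ennreal (l\<^sup>2) \<partial>mu x) < \<infinity>"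
      by (auto simp: spectral_measure_mu[OF pv, symmetric])
    then show "x \<in> Dom \<longleftrightarrow> (\<integral>\<^sup>+ l. ennreal (l\<^sup>2) \<partial>mu x) < \<infinity>" using fn_inject by auto
    show "x \<in> Dom \<Longrightarrow> cinner x (T x) = complex_of_real (\<integral>l. l \<partial>mu x)"
      using E unfolding spectral_resolution_def hop_op_eq spectral_measure_mu[OF pv, symmetric] cinner_def by blast
    show "(\<And>x. x \<in> Dom \<Longrightarrow> cinner x y = 0) \<Longrightarrow> y = 0"
      using delta_Dom(1) by (intro l2_eqI) (metis cinner_delta fn_zero)
  qed (auto simp: Dom_add Dom_scaleC T_sym)
qed

end

section \<open>Resolvents in finite volume\<close>

definition supp_in :: "'a set \<Rightarrow> 'a l2 set" where "supp_in G = {x. \<forall>a. a \<notin> G \<longrightarrow> fn x a = 0}"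

lemma supp_in_eqI:
  assumes "x \<in> supp_in G" "y \<in> supp_in G" "\<And>a. a \<in> G \<Longrightarrow> fn x a = fn y a"
  shows "x = y"
proof (rule l2_eqI)
  fix a show "fn x a = fn y a"
    by (cases "a \<in> G") (use assms in \<open>simp_all add: supp_in_def\<close>)
qed

lemma supp_in_closed_ops [simp]:
  "x \<in> supp_in G \<Longrightarrow> y \<in> supp_in G \<Longrightarrow> x + y \<in> supp_in G"
  "x \<in> supp_in G \<Longrightarrow> y \<in> supp_in G \<Longrightarrow> x - y \<in> supp_in G"
  "x \<in> supp_in G \<Longrightarrow> scaleC c x \<in> supp_in G"
  "0 \<in> supp_in G"
  by (simp_all add: supp_in_def)

lemma supp_in_sum [simp]: "(\<And>i. i \<in> A \<Longrightarrow> f i \<in> supp_in G) \<Longrightarrow> sum f A \<in> supp_in G"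
  by (simp add: supp_in_def)

lemma supp_in_finsup: "finite G \<Longrightarrow> supp_in G \<subseteq> finsup"
  unfolding supp_in_def finsup_def by (auto elim: rev_finite_subset)

lemma holomorphic_det:
  fixes M :: "complex \<Rightarrow> complex mat"
  assumes M: "\<And>z. M z \<in> carrier_mat n n"
    and h: "\<And>i j. i < n \<Longrightarrow> j < n \<Longrightarrow> (\<lambda>z. M z $$ (i, j)) holomorphic_on S"
  shows "(\<lambda>z. det (M z)) holomorphic_on S"
proof -
  have "(\<lambda>z. det (M z)) = (\<lambda>z. \<Sum>p\<in>{p. p permutes {0..<n}}. signof p * (\<Prod>i = 0..<n. M z $$ (i, p i)))"
    using det_def'[OF M] by auto
  moreover have "(\<lambda>z. \<Sum>p\<in>{p. p permutes {0..<n}}. signof p * (\<Prod>i = 0..<n. M z $$ (i, p i))) holomorphic_on S"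
  proof (intro holomorphic_intros h)
    fix p i assume "p \<in> {p. p permutes {0..<n}}" "i \<in> {0..<n}"
    then show "i < n" "p i < n" using permutes_in_image[of p "{0..<n}" i] by auto
  qed
  ultimately show ?thesis by simp
qed

lemma holomorphic_adj_mat:
  fixes M :: "complex \<Rightarrow> complex mat"
  assumes M: "\<And>z. M z \<in> carrier_mat n n"
    and h: "\<And>i j. i < n \<Longrightarrow> j < n \<Longrightarrow> (\<lambda>z. M z $$ (i, j)) holomorphic_on S"
    and ij: "i < n" "j < n"
  shows "(\<lambda>z. adj_mat (M z) $$ (i, j)) holomorphic_on S"
proof -
  have "(\<lambda>z. adj_mat (M z) $$ (i, j)) = (\<lambda>z. (-1) ^ (j + i) * det (mat_delete (M z) j i))"
  proof
    fix z show "adj_mat (M z) $$ (i, j) = (-1) ^ (j + i) * det (mat_delete (M z) j i)"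
      using M[of z] ij by (simp add: adj_mat_def cofactor_def carrier_matD[OF M[of z]])
  qed
  moreover have "(\<lambda>z. det (mat_delete (M z) j i)) holomorphic_on S"
  proof (rule holomorphic_det[where n = "n - 1"])
    show "mat_delete (M z) j i \<in> carrier_mat (n - 1) (n - 1)" for z
      using M[of z] ij by (simp add: mat_delete_def)
    fix i' j' assume ij': "i' < n - 1" "j' < n - 1"
    have "(\<lambda>z. mat_delete (M z) j i $$ (i', j')) = (\<lambda>z. M z $$ (if i' < j then i' else Suc i', if j' < i then j' else Suc j'))"
    proof
      fix z show "mat_delete (M z) j i $$ (i', j') = M z $$ (if i' < j then i' else Suc i', if j' < i then j' else Suc j')"
        using ij' by (simp add: mat_delete_def carrier_matD[OF M[of z]])
    qed
    moreover have "(\<lambda>z. M z $$ (if i' < j then i' else Suc i', if j' < i then j' else Suc j')) holomorphic_on S"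
      using ij' by (intro h) auto
    ultimately show "(\<lambda>z. mat_delete (M z) j i $$ (i', j')) holomorphic_on S" by simp
  qed
  ultimately show ?thesis by (simp add: holomorphic_on_mult)
qed

lemma smult_mat_mult_vec:
  "A \<in> carrier_mat n m \<Longrightarrow> v \<in> carrier_vec m \<Longrightarrow> (c \<cdot>\<^sub>m A) *\<^sub>v v = c \<cdot>\<^sub>v (A *\<^sub>v (v :: 'b :: comm_ring vec))"
  by (intro eq_vecI) (auto simp: scalar_prod_def sum_distrib_left mult.assoc)

text \<open>The dictionary between functions supported on a finite list of sites and column vectors,
  through which determinants and adjugates become available for operators.\<close>

locale site_list =
  fixes xs :: "'a list"
  assumes distinct: "distinct xs"
begin

definition tv :: "'a l2 \<Rightarrow> complex vec" where "tv x = vec (length xs) (\<lambda>i. fn x (xs ! i))"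
definition lv :: "complex vec \<Rightarrow> 'a l2" where
  "lv v = (\<Sum>i<length xs. scaleC (vec_index v i) (delta_l2 (xs ! i)))"
definition op_mat :: "('a l2 \<Rightarrow> 'a l2) \<Rightarrow> complex mat" where
  "op_mat L = mat (length xs) (length xs) (\<lambda>(i, j). fn (L (delta_l2 (xs ! j))) (xs ! i))"

lemma tv_dim [simp]: "tv x \<in> carrier_vec (length xs)" "dim_vec (tv x) = length xs"
  by (simp_all add: tv_def)

lemma op_mat_carrier [simp]: "op_mat L \<in> carrier_mat (length xs) (length xs)" by (simp add: op_mat_def)

lemma fn_lv: "i < length xs \<Longrightarrow> fn (lv v) (xs ! i) = vec_index v i"
proof -
  assume i: "i < length xs"
  have "fn (lv v) (xs ! i) = (\<Sum>j<length xs. if j = i then vec_index v j else 0)"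
    unfolding lv_def fn_sum using i distinct by (intro sum.cong) (auto simp: nth_eq_iff_index_eq)
  then show ?thesis using i by simp
qed

lemma lv_supp: "lv v \<in> supp_in (set xs)"
  unfolding lv_def by (intro supp_in_sum) (auto simp: supp_in_def)

lemma tv_lv: "v \<in> carrier_vec (length xs) \<Longrightarrow> tv (lv v) = v"
  by (intro eq_vecI) (auto simp: tv_def fn_lv)

lemma lv_tv: assumes "x \<in> supp_in (set xs)" shows "lv (tv x) = x"
proof (rule supp_in_eqI[OF lv_supp assms])
  fix a assume "a \<in> set xs"
  then obtain i where "i < length xs" "a = xs ! i" by (metis in_set_conv_nth)
  then show "fn (lv (tv x)) a = fn x a" by (simp add: fn_lv tv_def)
qed

lemma tv_inj: "x \<in> supp_in (set xs) \<Longrightarrow> y \<in> supp_in (set xs) \<Longrightarrow> tv x = tv y \<Longrightarrow> x = y"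
  by (metis lv_tv)

lemma cinner_tv:
  assumes "x \<in> supp_in (set xs)"
  shows "cinner x y = (\<Sum>i<length xs. cnj (vec_index (tv x) i) * vec_index (tv y) i)"
proof -
  have "cinner x y = (\<Sum>a\<in>set xs. cnj (fn x a) * fn y a)"
    using assms by (intro cinner_finite_support) (auto simp: supp_in_def)
  also have "\<dots> = (\<Sum>i<length xs. cnj (fn x (xs ! i)) * fn y (xs ! i))"
    using bij_betw_nth[OF distinct refl refl] by (intro sum.reindex_bij_betw[symmetric]) 
  finally show ?thesis by (simp add: tv_def)
qed

context
  fixes L :: "'a l2 \<Rightarrow> 'a l2"
  assumes L_add: "\<And>x y. L (x + y) = L x + L y" and L_scale: "\<And>c x. L (scaleC c x) = scaleC c (L x)"
    and L_supp: "\<And>x. x \<in> supp_in (set xs) \<Longrightarrow> L x \<in> supp_in (set xs)"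
begin

lemma L_sum: "L (sum f A) = (\<Sum>i\<in>A. L (f i))" if "finite A"
  using that
proof (induction A)
  case empty show ?case using L_scale[of 0 0] by simp
qed (simp add: L_add)

lemma tv_op: assumes "x \<in> supp_in (set xs)" shows "tv (L x) = op_mat L *\<^sub>v tv x"
proof (rule eq_vecI)
  fix i assume "i < dim_vec (op_mat L *\<^sub>v tv x)"
  then have i: "i < length xs" by (simp add: op_mat_def)
  have "L x = L (lv (tv x))" using lv_tv[OF assms] by simp
  also have "\<dots> = (\<Sum>j<length xs. scaleC (vec_index (tv x) j) (L (delta_l2 (xs ! j))))"
    unfolding lv_def by (simp add: L_sum L_scale)
  finally show "vec_index (tv (L x)) i = vec_index (op_mat L *\<^sub>v tv x) i"
    using i by (simp add: tv_def op_mat_def scalar_prod_def mult.commute lessThan_atLeast0)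
qed (simp add: op_mat_def)

lemma tv_shift:
  assumes "x \<in> supp_in (set xs)"
  shows "tv (L x - scaleC z x) = char_matrix (op_mat L) z *\<^sub>v tv x"
proof -
  let ?A = "op_mat L"
  have d: "dim_row ?A = length xs" by (simp add: op_mat_def)
  have "char_matrix ?A z *\<^sub>v tv x = ?A *\<^sub>v tv x + (((-z) \<cdot>\<^sub>m 1\<^sub>m (length xs)) *\<^sub>v tv x)"
    unfolding char_matrix_def d by (intro add_mult_distrib_mat_vec[where nr = "length xs" and nc = "length xs"]) auto
  also have "((-z) \<cdot>\<^sub>m 1\<^sub>m (length xs)) *\<^sub>v tv x = (-z) \<cdot>\<^sub>v tv x"
    using smult_mat_mult_vec[of "1\<^sub>m (length xs)" "length xs" "length xs" "tv x" "-z"] by simp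
  also have "?A *\<^sub>v tv x = tv (L x)" using tv_op[OF assms] by simp
  also have "tv (L x) + (-z) \<cdot>\<^sub>v tv x = tv (L x - scaleC z x)"
    by (intro eq_vecI) (auto simp: tv_def)
  finally show ?thesis by simp
qed

text \<open>\<open>Z\<close> is the zero set of the characteristic determinant, hence finite and
  made of eigenvalues. Off \<open>Z\<close>, Cramer's rule writes the solution with cofactors
  divided by the determinant, which gives existence and holomorphy in \<open>z\<close> together. No
  symmetry is assumed, so the result covers the dissipative operator as well.\<close>

lemma finite_resolvent:
  "\<exists>Z. finite Z \<and> (\<forall>z\<in>Z. \<exists>x\<in>supp_in (set xs). x \<noteq> 0 \<and> L x = scaleC z x) \<and>
    (\<forall>z. z \<notin> Z \<longrightarrow> det (char_matrix (op_mat L) z) \<noteq> 0) \<and>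
    (\<forall>w\<in>supp_in (set xs). \<exists>\<psi>. (\<forall>z. z \<notin> Z \<longrightarrow> \<psi> z \<in> supp_in (set xs) \<and> L (\<psi> z) - scaleC z (\<psi> z) = w) \<and>
      (\<forall>u. (\<lambda>z. cinner u (\<psi> z)) holomorphic_on (- Z)))"
proof -
  let ?A = "op_mat L" and ?N = "length xs"
  define Z where "Z = {z. det (char_matrix ?A z) = 0}"
  have Zev: "z \<in> Z \<longleftrightarrow> eigenvalue ?A z" for z using eigenvalue_det[of ?A ?N z] by (simp add: Z_def)
  have fin: "finite Z"
  proof -
    have "Z = {z. poly (char_poly ?A) z = 0}" using Zev eigenvalue_root_char_poly[of ?A ?N] by auto
    moreover have "char_poly ?A \<noteq> 0" using degree_monic_char_poly[of ?A ?N] by auto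
    ultimately show ?thesis by (simp add: poly_roots_finite)
  qed
  have ev: "\<exists>x\<in>supp_in (set xs). x \<noteq> 0 \<and> L x = scaleC z x" if zZ: "z \<in> Z" for z
  proof -
    obtain v where v: "v \<in> carrier_vec ?N" "v \<noteq> 0\<^sub>v ?N" "?A *\<^sub>v v = z \<cdot>\<^sub>v v"
      using zZ carrier_matD(1)[OF op_mat_carrier[of L]] unfolding Zev eigenvalue_def eigenvector_def by metis
    have tvl: "tv (lv v) = v" using v(1) by (rule tv_lv)
    have "tv 0 = 0\<^sub>v ?N" by (intro eq_vecI) (auto simp: tv_def)
    then have "lv v \<noteq> 0" using tvl v(2) by metis
    moreover have "L (lv v) = scaleC z (lv v)"
    proof (rule tv_inj)
      have "tv (scaleC z (lv v)) = z \<cdot>\<^sub>v tv (lv v)" by (intro eq_vecI) (auto simp: tv_def)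
      then show "tv (L (lv v)) = tv (scaleC z (lv v))" using tv_op[OF lv_supp] v(3) tvl by simp
    qed (simp_all add: L_supp lv_supp)
    ultimately show ?thesis using lv_supp by blast
  qed
  have res: "\<exists>\<psi>. (\<forall>z. z \<notin> Z \<longrightarrow> \<psi> z \<in> supp_in (set xs) \<and> L (\<psi> z) - scaleC z (\<psi> z) = w) \<and>
      (\<forall>u. (\<lambda>z. cinner u (\<psi> z)) holomorphic_on (- Z))" if w: "w \<in> supp_in (set xs)" for w
  proof -
    define C where "C = char_matrix ?A"
    have C: "C z \<in> carrier_mat ?N ?N" for z by (simp add: C_def)
    have hC: "(\<lambda>z. C z $$ (i, j)) holomorphic_on S" if "i < ?N" "j < ?N" for i j S
    proof -
      have "(\<lambda>z. C z $$ (i, j)) = (\<lambda>z. ?A $$ (i, j) + - z * (if i = j then 1 else 0))"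
        using that by (auto simp: C_def char_matrix_def op_mat_def)
      then show ?thesis by (simp only:) (intro holomorphic_intros)
    qed
    define q where "q = (\<lambda>z. (1 / det (C z)) \<cdot>\<^sub>v (adj_mat (C z) *\<^sub>v tv w))"
    define \<psi> where "\<psi> = (\<lambda>z. lv (q z))"
    have qc: "q z \<in> carrier_vec ?N" for z unfolding q_def using adj_mat(1)[OF C[of z]] by auto
    have "L (\<psi> z) - scaleC z (\<psi> z) = w" if "z \<notin> Z" for z
    proof (rule tv_inj)
      have ac: "adj_mat (C z) *\<^sub>v tv w \<in> carrier_vec ?N"
        by (rule mult_mat_vec_carrier[OF adj_mat(1)[OF C] tv_dim(1)])
      have dn: "det (C z) \<noteq> 0" using that by (simp add: Z_def C_def)
      have "tv (L (\<psi> z) - scaleC z (\<psi> z)) = C z *\<^sub>v q z"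
        unfolding \<psi>_def C_def by (subst tv_shift[OF lv_supp]) (simp add: tv_lv qc)
      also have "\<dots> = (1 / det (C z)) \<cdot>\<^sub>v (C z *\<^sub>v (adj_mat (C z) *\<^sub>v tv w))"
        unfolding q_def by (rule mult_mat_vec[OF C ac])
      also have "C z *\<^sub>v (adj_mat (C z) *\<^sub>v tv w) = (C z * adj_mat (C z)) *\<^sub>v tv w"
        by (rule assoc_mult_mat_vec[symmetric, OF C adj_mat(1)[OF C] tv_dim(1)])
      also have "\<dots> = det (C z) \<cdot>\<^sub>v tv w"
        unfolding adj_mat(2)[OF C] using smult_mat_mult_vec[of "1\<^sub>m ?N" ?N ?N "tv w"] by simp
      also have "(1 / det (C z)) \<cdot>\<^sub>v (det (C z) \<cdot>\<^sub>v tv w) = tv w" using dn by (simp add: smult_smult_assoc)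
      finally show "tv (L (\<psi> z) - scaleC z (\<psi> z)) = tv w" .
    qed (simp_all add: L_supp lv_supp \<psi>_def w)
    moreover have "(\<lambda>z. cinner u (\<psi> z)) holomorphic_on (- Z)" for u
    proof -
      have "cinner u (\<psi> z) = (\<Sum>i<?N. (1 / det (C z) * (\<Sum>j<?N. adj_mat (C z) $$ (i, j) * vec_index (tv w) j)) * cinner u (delta_l2 (xs ! i)))" for z
      proof -
        have "vec_index (q z) i = 1 / det (C z) * (\<Sum>j<?N. adj_mat (C z) $$ (i, j) * vec_index (tv w) j)" if "i < ?N" for i
          using that adj_mat(1)[OF C[of z]] by (simp add: q_def scalar_prod_def lessThan_atLeast0)
        then show ?thesis unfolding \<psi>_def lv_def by (simp add: cinner_sum_right cinner_scaleC_right)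
      qed
      moreover have "(\<lambda>z. \<Sum>i<?N. (1 / det (C z) * (\<Sum>j<?N. adj_mat (C z) $$ (i, j) * vec_index (tv w) j)) * cinner u (delta_l2 (xs ! i))) holomorphic_on (- Z)"
        by (intro holomorphic_intros holomorphic_det[OF C hC] holomorphic_adj_mat[OF C hC]) (auto simp: Z_def C_def)
      ultimately show ?thesis by simp
    qed
    ultimately show ?thesis by (intro exI[of _ \<psi>]) (auto simp: \<psi>_def lv_supp)
  qed
  show ?thesis using fin ev res by (intro exI[of _ Z]) (auto simp: Z_def)
qed

end
end

section \<open>Matrices of full rank\<close>

lemma full_col_rank_injective:
  assumes A: "A \<in> carrier_mat n nc" and rk: "mrank A = nc"
    and v: "v \<in> carrier_vec nc" "A *\<^sub>v v = 0\<^sub>v n"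
  shows "v = 0\<^sub>v nc"
proof (rule ccontr)
  interpret vec_space "TYPE(complex)" n .
  have rk': "rank A = nc" using rk A by (simp add: mrank_def)
  obtain S where S: "maximal S (\<lambda>T. T \<subseteq> set (cols A) \<and> lin_indpt T)"
    using maximal_exists_superset[of "set (cols A)" "\<lambda>T. T \<subseteq> set (cols A) \<and> lin_indpt T" "{}"] by (auto simp: finite_lin_indpt2)
  \<comment> \<open>Linear independence concerns the set of columns, so coinciding columns have to
    be excluded before a kernel vector can be turned into a dependence.\<close>
  have "card S = nc" using rank_card_indpt[OF A S] rk' by simp
  moreover have "S \<subseteq> set (cols A)" using S by (simp add: maximal_def)
  ultimately have "nc \<le> card (set (cols A))" by (metis List.finite_set card_mono)
  moreover have "length (cols A) = nc" using A by simp
  ultimately have d: "distinct (cols A)" by (intro card_distinct) (metis card_length le_antisym)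
  assume "v \<noteq> 0\<^sub>v nc"
  then have "lin_dep (set (cols A))" using lin_depI[OF A v(1) _ v(2) d] by simp
  then show False using full_rank_lin_indpt[OF A rk' d] by simp
qed

text \<open>The columns span the whole space; a vector orthogonal to all of them is orthogonal to
  itself.\<close>

lemma full_row_rank_injective:
  assumes A: "A \<in> carrier_mat n nc" and rk: "mrank A = n"
    and y: "\<And>j. j < nc \<Longrightarrow> (\<Sum>i<n. cnj (y i) * A $$ (i, j)) = 0" and i: "i < n"
  shows "y i = 0"
proof -
  interpret vec_space "TYPE(complex)" n .
  have rk': "rank A = n" using rk A by (simp add: mrank_def)
  have cA: "set (cols A) \<subseteq> carrier_vec n" using cols_dim A by blast
  obtain S where S: "maximal S (\<lambda>T. T \<subseteq> set (cols A) \<and> lin_indpt T)"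
    using maximal_exists_superset[of "set (cols A)" "\<lambda>T. T \<subseteq> set (cols A) \<and> lin_indpt T" "{}"] by (auto simp: finite_lin_indpt2)
  have cS: "card S = n" using rank_card_indpt[OF A S] rk' by simp
  have SA: "S \<subseteq> set (cols A)" "lin_indpt S" using S by (auto simp: maximal_def)
  have fS: "finite S" using SA(1) finite_subset by blast
  have "basis S" using fS cS SA cA by (intro dim_li_is_basis) (auto simp: dim_is_n)
  then have sp: "carrier_vec n \<subseteq> span S" unfolding basis_def by simp
  define w where "w = vec n y"
  have "w \<in> span S" using sp by (auto simp: w_def)
  then obtain a where a: "w = lincomb a S" using finite_in_span[OF fS, of w] SA(1) cA by blast
  have orth: "(\<Sum>i<n. cnj (y i) * vec_index s i) = 0" if sS: "s \<in> S" for s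
  proof -
    obtain j where "j < nc" "s = col A j" using sS SA(1) A by (auto simp: cols_def)
    then show ?thesis using y[of j] A by simp
  qed
  have "(\<Sum>i<n. cnj (y i) * y i) = (\<Sum>i<n. cnj (y i) * vec_index (lincomb a S) i)"
    unfolding a[symmetric] w_def by simp
  also have "\<dots> = (\<Sum>i<n. \<Sum>s\<in>S. a s * (cnj (y i) * vec_index s i))"
    using SA(1) cA by (intro sum.cong) (auto simp: lincomb_index sum_distrib_left mult.left_commute)
  also have "\<dots> = (\<Sum>s\<in>S. a s * (\<Sum>i<n. cnj (y i) * vec_index s i))"
    by (subst sum.swap) (simp add: sum_distrib_left)
  also have "\<dots> = 0" using orth by simp
  finally have "complex_of_real (\<Sum>i<n. (cmod (y i))\<^sup>2) = 0"
    unfolding of_real_sum complex_norm_square by (simp add: mult.commute)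
  then have "(\<Sum>i<n. (cmod (y i))\<^sup>2) = 0" by (simp only: of_real_eq_0_iff)
  then show ?thesis using i by (simp add: sum_nonneg_eq_0_iff)
qed

lemma mat_adjoint_index:
  fixes A :: "complex mat"
  assumes "i < dim_col A" "j < dim_row A"
  shows "mat_adjoint A $$ (i, j) = cnj (A $$ (j, i))"
  using assms by (simp add: mat_adjoint_def mat_of_rows_def cols_def conjugate_vec_def)

lemma mat_adjoint_carrier: "A \<in> carrier_mat n m \<Longrightarrow> mat_adjoint (A :: complex mat) \<in> carrier_mat m n"
  by (auto simp: mat_adjoint_def)

section \<open>Truncation to finitely many shells\<close>

locale factored_hopping = sa_hopping shell h for shell :: "nat \<Rightarrow> 'a list" and h +
  fixes Ups Phi :: "nat \<Rightarrow> complex mat"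
  assumes factorization: "hop_factorization shell h Ups Phi"
begin

abbreviation "s n \<equiv> length (shell n)"
abbreviation "r n \<equiv> hop_rank shell h n"

definition emb :: "nat \<Rightarrow> complex vec \<Rightarrow> 'a l2" where
  "emb n v = mk (\<lambda>x. \<Sum>i<s n. if shell n ! i = x then vec_index v i else 0)"

lemma fn_emb_raw: "fn (emb n v) x = (\<Sum>i<s n. if shell n ! i = x then vec_index v i else 0)"
proof -
  have "{x. (\<Sum>i<s n. if shell n ! i = x then vec_index v i else 0) \<noteq> 0} \<subseteq> set (shell n)"
  proof
    fix x assume x: "x \<in> {x. (\<Sum>i<s n. if shell n ! i = x then vec_index v i else 0) \<noteq> 0}"
    show "x \<in> set (shell n)"
    proof (rule ccontr)
      assume "x \<notin> set (shell n)"
      then have "\<forall>i<s n. shell n ! i \<noteq> x" using nth_mem by blast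
      then have "(\<Sum>i<s n. if shell n ! i = x then vec_index v i else 0) = 0" by (intro sum.neutral) auto
      then show False using x by simp
    qed
  qed
  then have "finite {x. (\<Sum>i<s n. if shell n ! i = x then vec_index v i else 0) \<noteq> 0}" by (rule finite_subset) simp
  then show ?thesis by (simp add: emb_def fn_mk ell2_finite)
qed

lemma fn_emb: "i < s n \<Longrightarrow> fn (emb n v) (shell n ! i) = vec_index v i"
proof -
  assume i: "i < s n"
  have "fn (emb n v) (shell n ! i) = (\<Sum>j<s n. if j = i then vec_index v j else 0)"
    unfolding fn_emb_raw using i shell_distinct[of n] by (intro sum.cong) (auto simp: nth_eq_iff_index_eq)
  then show ?thesis using i by simp
qed

lemma emb_supp: "emb n v \<in> supp_in (set (shell n))"
  unfolding supp_in_def by (auto simp: fn_emb_raw intro!: sum.neutral)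

definition ups :: "nat \<Rightarrow> nat \<Rightarrow> 'a l2" where "ups n k = emb n (col (Ups n) k)"
definition phi :: "nat \<Rightarrow> nat \<Rightarrow> 'a l2" where "phi n k = emb n (col (Phi n) k)"

lemma Ups_carrier: "Ups n \<in> carrier_mat (s n) (r n)" and Phi_carrier: "Phi n \<in> carrier_mat (s n) (r (Suc n))"
  using factorization unfolding hop_factorization_def by blast+

lemma fn_ups: "i < s n \<Longrightarrow> k < r n \<Longrightarrow> fn (ups n k) (shell n ! i) = Ups n $$ (i, k)"
  using Ups_carrier[of n] by (simp add: ups_def fn_emb)

lemma fn_phi: "i < s n \<Longrightarrow> k < r (Suc n) \<Longrightarrow> fn (phi n k) (shell n ! i) = Phi n $$ (i, k)"
  using Phi_carrier[of n] by (simp add: phi_def fn_emb)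

lemma ups_supp: "ups n k \<in> supp_in (set (shell n))" and phi_supp: "phi n k \<in> supp_in (set (shell n))"
  by (simp_all add: ups_def phi_def emb_supp)

lemma hop_cross:
  assumes "a \<in> set (shell (Suc n))" "b \<in> set (shell n)"
  shows "h a b = - (\<Sum>k<r (Suc n). fn (ups (Suc n) k) a * cnj (fn (phi n k) b))"
proof -
  obtain i j where ij: "i < s (Suc n)" "a = shell (Suc n) ! i" "j < s n" "b = shell n ! j"
    using assms by (metis in_set_conv_nth)
  note U = Ups_carrier[of "Suc n"] and P = Phi_carrier[of n]
  have "h a b = hop_down shell h n $$ (i, j)" using ij by (simp add: hop_down_def)
  also have "hop_down shell h n = - (Ups (Suc n) * mat_adjoint (Phi n))"
    using factorization unfolding hop_factorization_def by blast
  also have "\<dots> $$ (i, j) = - (\<Sum>k<r (Suc n). Ups (Suc n) $$ (i, k) * cnj (Phi n $$ (j, k)))"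
    using ij U P mat_adjoint_carrier[OF P]
    by (simp add: scalar_prod_def lessThan_atLeast0 mat_adjoint_index carrier_matD)
  also have "\<dots> = - (\<Sum>k<r (Suc n). fn (ups (Suc n) k) a * cnj (fn (phi n k) b))"
    using ij by (simp add: fn_ups fn_phi)
  finally show ?thesis .
qed

definition block :: "nat \<Rightarrow> nat \<Rightarrow> 'a set" where "block m n = set (sites shell m n)"

lemma block_eq: "block m n = (\<Union>j\<in>{m..n}. set (shell j))"
  by (auto simp: block_def sites_def less_Suc_eq_le simp del: upt_Suc)

lemma finite_block [simp]: "finite (block m n)" by (simp add: block_def)

lemma shell_ex: obtains j where "a \<in> set (shell j)"
  using shell_cover by blast

lemma shell_unique: "a \<in> set (shell j) \<Longrightarrow> a \<in> set (shell k) \<Longrightarrow> j = k"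
  using shell_disjoint by blast

lemma block_iff: "a \<in> set (shell j) \<Longrightarrow> a \<in> block m n \<longleftrightarrow> m \<le> j \<and> j \<le> n"
  by (auto simp: block_eq dest: shell_unique)

lemma supp_shell_block: "m \<le> j \<Longrightarrow> j \<le> n \<Longrightarrow> supp_in (set (shell j)) \<subseteq> supp_in (block m n)"
  unfolding supp_in_def using block_iff by blast

lemma supp_block_Dom: "x \<in> supp_in (block m n) \<Longrightarrow> x \<in> finsup \<and> x \<in> Dom"
  using supp_in_finsup[OF finite_block] finsup_Dom(1) by blast

lemma hop_supp:
  assumes "x \<in> supp_in G" "finite G"
  shows "hop h (fn x) a = (\<Sum>b\<in>G. h a b * fn x b)"
proof -
  have "hop h (fn x) a = (\<Sum>b\<in>{b. h a b \<noteq> 0} \<union> G. h a b * fn x b)"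
    unfolding hop_def using assms locally_finite[of a] by (intro sum.mono_neutral_left) (auto simp: supp_in_def)
  also have "\<dots> = (\<Sum>b\<in>G. h a b * fn x b)"
    using assms locally_finite[of a] by (intro sum.mono_neutral_right) (auto simp: supp_in_def)
  finally show ?thesis .
qed

text \<open>Only the last shell of the block reaches the next one, so what leaks out of the block is
  governed by the amplitudes \<open>cinner (phi n k) x\<close> alone.\<close>

lemma hop_outside_next:
  assumes x: "x \<in> supp_in (block m n)" and a: "a \<in> set (shell (Suc n))" and mn: "m \<le> n"
  shows "hop h (fn x) a = - (\<Sum>k<r (Suc n). fn (ups (Suc n) k) a * cinner (phi n k) x)"
proof -
  have "hop h (fn x) a = (\<Sum>b\<in>block m n. h a b * fn x b)" by (rule hop_supp[OF x]) simp
  also have "\<dots> = (\<Sum>b\<in>set (shell n). h a b * fn x b)"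
  proof (rule sum.mono_neutral_right)
    show "set (shell n) \<subseteq> block m n" using mn by (auto simp: block_eq)
    show "\<forall>b\<in>block m n - set (shell n). h a b * fn x b = 0"
    proof
      fix b assume b: "b \<in> block m n - set (shell n)"
      then obtain j where j: "b \<in> set (shell j)" "j \<le> n" by (auto simp: block_eq)
      then have "j \<noteq> n" using b by auto
      then have "h a b = 0" using shell_range[OF a j(1)] j(2) by auto
      then show "h a b * fn x b = 0" by simp
    qed
  qed simp
  also have "\<dots> = (\<Sum>b\<in>set (shell n). \<Sum>k<r (Suc n). - (fn (ups (Suc n) k) a * (cnj (fn (phi n k) b) * fn x b)))"
    using hop_cross[OF a] by (intro sum.cong) (auto simp: sum_distrib_right sum_negf mult.assoc)
  also have "\<dots> = (\<Sum>k<r (Suc n). - (fn (ups (Suc n) k) a * (\<Sum>b\<in>set (shell n). cnj (fn (phi n k) b) * fn x b)))"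
    by (subst sum.swap) (simp add: sum_distrib_left sum_negf)
  also have "\<dots> = - (\<Sum>k<r (Suc n). fn (ups (Suc n) k) a * cinner (phi n k) x)"
  proof -
    have "cinner (phi n k) x = (\<Sum>b\<in>set (shell n). cnj (fn (phi n k) b) * fn x b)" for k
      using phi_supp[of n k] by (intro cinner_finite_support) (auto simp: supp_in_def)
    then show ?thesis by (simp add: sum_negf)
  qed
  finally show ?thesis .
qed

lemma hop_outside_far:
  assumes x: "x \<in> supp_in (block m n)" and a: "a \<in> set (shell j)" and j: "j \<ge> n + 2"
  shows "hop h (fn x) a = 0"
proof -
  have "h a b = 0" if "b \<in> block m n" for b
    using that shell_range[OF a] j by (fastforce simp: block_eq)
  then show ?thesis using hop_supp[OF x finite_block] by simp
qed

text \<open>Full column rank of the \<open>Ups\<close> factor: if nothing leaks to the next shell,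
  then every outgoing amplitude is zero.\<close>

lemma ups_independent:
  assumes "\<And>a. a \<in> set (shell (Suc n)) \<Longrightarrow> (\<Sum>k<r (Suc n). fn (ups (Suc n) k) a * c k) = 0" "k < r (Suc n)"
  shows "c k = 0"
proof -
  have "vec (r (Suc n)) c = 0\<^sub>v (r (Suc n))"
  proof (rule full_col_rank_injective[OF Ups_carrier])
    show "mrank (Ups (Suc n)) = r (Suc n)" using factorization unfolding hop_factorization_def by blast
    show "Ups (Suc n) *\<^sub>v vec (r (Suc n)) c = 0\<^sub>v (s (Suc n))"
    proof (rule eq_vecI)
      fix i assume "i < dim_vec (0\<^sub>v (s (Suc n)))"
      then have i: "i < s (Suc n)" by simp
      then show "vec_index (Ups (Suc n) *\<^sub>v vec (r (Suc n)) c) i = vec_index (0\<^sub>v (s (Suc n))) i"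
        using assms(1)[of "shell (Suc n) ! i"] Ups_carrier[of "Suc n"]
        by (simp add: scalar_prod_def lessThan_atLeast0 fn_ups carrier_matD)
    qed (use Ups_carrier[of "Suc n"] in simp)
  qed simp
  then show ?thesis using assms(2) by (metis index_vec index_zero_vec(1))
qed

text \<open>Restricting on both sides gives an everywhere defined map that is the matrix compression
  on \<open>supp_in G\<close> and zero off \<open>G\<close>.\<close>

definition Hc :: "'a set \<Rightarrow> 'a l2 \<Rightarrow> 'a l2" where "Hc G x = restr G (T (restr G x))"

lemma restr_supp: "restr G x \<in> supp_in G" by (simp add: supp_in_def)
lemma restr_id: "x \<in> supp_in G \<Longrightarrow> restr G x = x" unfolding supp_in_def by (intro l2_eqI) auto
lemma restr_add: "restr G (x + y) = restr G x + restr G y" by (rule l2_eqI) simp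
lemma restr_scaleC: "restr G (scaleC c x) = scaleC c (restr G x)" by (rule l2_eqI) simp

lemma restr_sym: assumes "finite G" shows "cinner (restr G x) y = cinner x (restr G y)"
  using assms by (simp add: cinner_finite_support[of G])

context
  fixes G :: "'a set" assumes G: "finite G"
begin

lemma restr_finsup: "restr G x \<in> finsup" "restr G x \<in> Dom"
  using supp_in_finsup[OF G] restr_supp finsup_Dom(1) by blast+

lemma Hc_supp: "Hc G x \<in> supp_in G" by (simp add: Hc_def restr_supp)
lemma Hc_add: "Hc G (x + y) = Hc G x + Hc G y" by (simp add: Hc_def restr_add Dom_add restr_finsup)
lemma Hc_scaleC: "Hc G (scaleC c x) = scaleC c (Hc G x)" by (simp add: Hc_def restr_scaleC Dom_scaleC restr_finsup)
lemma Hc_diff: "Hc G (x - y) = Hc G x - Hc G y"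
  unfolding diff_conv_add_uminus uminus_l2_scaleC Hc_add Hc_scaleC ..
lemma Hc_sum: "finite A \<Longrightarrow> Hc G (sum f A) = (\<Sum>i\<in>A. Hc G (f i))"
proof (induction A rule: finite_induct)
  case empty show ?case using Hc_scaleC[of 0 0] by simp
qed (simp add: Hc_add)

lemma Hc_sym: "cinner x (Hc G y) = cinner (Hc G x) y"
proof -
  have "cinner x (Hc G y) = cinner (restr G x) (T (restr G y))" using G by (simp add: Hc_def restr_sym)
  also have "\<dots> = cinner (T (restr G x)) (restr G y)" by (intro T_finsup_sym restr_finsup)
  also have "\<dots> = cinner (Hc G x) y" using G by (simp add: Hc_def restr_sym)
  finally show ?thesis .
qed

lemma Hc_real: "Im (cinner x (Hc G x)) = 0"
  using Hc_sym[of x x] cinner_commute[of x "Hc G x"] by (simp add: complex_eq_iff)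

lemma fn_Hc: "a \<in> G \<Longrightarrow> fn (Hc G x) a = (\<Sum>b\<in>G. h a b * fn x b)"
  using hop_supp[OF restr_supp[of G x] G, of a] by (simp add: Hc_def fn_T restr_finsup)

lemma Hc_bound: "\<exists>C\<ge>0. \<forall>x. norm (Hc G x) \<le> C * norm x"
proof -
  define C where "C = (\<Sum>a\<in>G. norm (Hc G (delta_l2 a)))"
  have "norm (Hc G x) \<le> C * norm x" for x
  proof -
    have "Hc G x = Hc G (restr G x)" unfolding Hc_def by (simp add: restr_id restr_supp)
    also have "restr G x = (\<Sum>a\<in>G. scaleC (fn (restr G x) a) (delta_l2 a))"
      using G by (intro finsup_expand) auto
    also have "Hc G \<dots> = (\<Sum>a\<in>G. scaleC (fn (restr G x) a) (Hc G (delta_l2 a)))"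
      using G by (simp add: Hc_sum Hc_scaleC)
    also have "norm \<dots> \<le> (\<Sum>a\<in>G. norm x * norm (Hc G (delta_l2 a)))"
      by (intro order_trans[OF norm_sum] sum_mono) (auto intro!: mult_right_mono simp: norm_fn_le)
    finally show ?thesis by (simp add: C_def sum_distrib_left mult.commute)
  qed
  moreover have "C \<ge> 0" by (simp add: C_def sum_nonneg)
  ultimately show ?thesis by blast
qed

lemma continuous_Hc: "continuous_on S (Hc G)"
proof -
  obtain C where "\<And>x. norm (Hc G x) \<le> norm x * C" using Hc_bound by (metis mult.commute)
  then have "bounded_linear (Hc G)"
    by (intro bounded_linear_intro) (auto simp: Hc_add scaleR_l2_def Hc_scaleC)
  then show ?thesis by (rule linear_continuous_on)
qed

end

text \<open>One extra shell is enough since hopping has range one.\<close>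

lemma Hc_eq_T: assumes "x \<in> supp_in (block 0 n)" shows "Hc (block 0 (Suc n)) x = T x"
proof (rule l2_eqI)
  fix a
  have sub: "supp_in (block 0 n) \<subseteq> supp_in (block 0 (Suc n))"
    unfolding supp_in_def block_eq by fastforce
  then have x: "x \<in> supp_in (block 0 (Suc n))" using assms by blast
  have D: "x \<in> Dom" using supp_block_Dom[OF assms] by simp
  obtain j where j: "a \<in> set (shell j)" by (rule shell_ex)
  show "fn (Hc (block 0 (Suc n)) x) a = fn (T x) a"
  proof (cases "j \<le> Suc n")
    case True
    then show ?thesis using block_iff[OF j, of 0 "Suc n"] by (simp add: Hc_def restr_id[OF x])
  next
    case False
    then have "hop h (fn x) a = 0" by (intro hop_outside_far[OF assms j]) auto
    then show ?thesis using block_iff[OF j, of 0 "Suc n"] False D by (simp add: Hc_def fn_T)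
  qed
qed

end

context factored_hopping
begin

abbreviation "Gn n \<equiv> block 0 n"

lemma distinct_sites: "distinct (sites shell m n)"
  unfolding sites_def
proof (intro distinct_concat)
  have "inj_on shell {m..<Suc n}"
    by (rule inj_onI) (metis shell_disjoint shell_nonempty set_empty inf.idem)
  then show "distinct (map shell [m..<Suc n])" by (simp add: distinct_map del: upt_Suc)
  show "distinct ys" if "ys \<in> set (map shell [m..<Suc n])" for ys using that shell_distinct by auto
  show "set ys \<inter> set zs = {}" if "ys \<in> set (map shell [m..<Suc n])" "zs \<in> set (map shell [m..<Suc n])" "ys \<noteq> zs" for ys zs
  proof -
    have "ys \<in> range shell" "zs \<in> range shell" using that by auto
    then obtain j k where jk: "ys = shell j" "zs = shell k" by blast
    have "j \<noteq> k" using that(3) jk by auto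
    then show ?thesis unfolding jk by (rule shell_disjoint)
  qed
qed

definition eigv :: "nat \<Rightarrow> 'a l2 set" where
  "eigv n = {e \<in> supp_in (Gn n). \<exists>l :: real. T e = scaleR l e}"

text \<open>The span is finite-dimensional; taking its closure supplies the closedness required by
  \<open>orth_proj\<close> without a dimension argument.\<close>

definition K :: "nat \<Rightarrow> 'a l2 set" where "K n = closure (span (eigv n))"
definition Q :: "nat \<Rightarrow> 'a l2 \<Rightarrow> 'a l2" where "Q n x = orth_proj (K n) x"

lemma eigv_scaleC: "e \<in> eigv n \<Longrightarrow> scaleC c e \<in> eigv n"
  unfolding eigv_def using supp_block_Dom by (auto simp: Dom_scaleC scaleC_scaleR)

lemma K_sub: "csubspace (K n)" "closed (K n)" "eigv n \<subseteq> K n"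
  unfolding K_def using csubspace_closure_span[OF eigv_scaleC] span_superset closure_subset by blast+

lemma K_subset:
  assumes "subspace X" "closed X" "eigv n \<subseteq> X"
  shows "K n \<subseteq> X"
  unfolding K_def by (intro closure_minimal span_minimal assms)

lemma K_ops: "x \<in> K n \<Longrightarrow> y \<in> K n \<Longrightarrow> x + y \<in> K n" "x \<in> K n \<Longrightarrow> y \<in> K n \<Longrightarrow> x - y \<in> K n" "x \<in> K n \<Longrightarrow> scaleC c x \<in> K n"
  using K_sub(1)[of n] unfolding csubspace_def by (auto simp: subspace_add subspace_diff)

lemma Q_K: "Q n x \<in> K n" and Q_orth: "k \<in> K n \<Longrightarrow> cinner k (x - Q n x) = 0"
  using orth_proj[OF K_sub(1,2)] by (simp_all add: Q_def)

lemma Q_eqI: "q \<in> K n \<Longrightarrow> (\<And>k. k \<in> K n \<Longrightarrow> cinner k (x - q) = 0) \<Longrightarrow> Q n x = q"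
  unfolding Q_def by (rule orth_proj_unique[OF K_sub(1,2)])

lemma Q_id: "x \<in> K n \<Longrightarrow> Q n x = x" by (rule Q_eqI) auto

lemma Q_add: "Q n (x + y) = Q n x + Q n y"
proof (rule Q_eqI)
  show "cinner k (x + y - (Q n x + Q n y)) = 0" if "k \<in> K n" for k
    using Q_orth[OF that, of x] Q_orth[OF that, of y] by (simp add: cinner_simps)
qed (simp add: K_ops Q_K)

lemma Q_scaleC: "Q n (scaleC c x) = scaleC c (Q n x)"
proof (rule Q_eqI)
  show "cinner k (scaleC c x - scaleC c (Q n x)) = 0" if "k \<in> K n" for k
    using Q_orth[OF that, of x] by (simp add: cinner_simps algebra_simps)
qed (simp add: K_ops Q_K)

lemma cinner_Q: "cinner x (Q n x) = complex_of_real ((norm (Q n x))\<^sup>2)"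
proof -
  have "cinner (Q n x) (x - Q n x) = 0" by (rule Q_orth[OF Q_K])
  then have "cinner (Q n x) x = cinner (Q n x) (Q n x)" by (simp add: cinner_simps)
  then have "cinner x (Q n x) = cnj (cinner (Q n x) (Q n x))" by (metis cinner_commute)
  then show ?thesis by (simp add: cinner_norm)
qed

lemma norm_minus_Q: "norm (x - Q n x) \<le> norm x"
proof -
  have "inner (Q n x) (x - Q n x) = 0" using Q_orth[OF Q_K, of n x x] by (simp add: inner_l2_def)
  then have "(norm x)\<^sup>2 = (norm (Q n x))\<^sup>2 + (norm (x - Q n x))\<^sup>2"
    using norm_add_power2[of "Q n x" "x - Q n x"] by simp
  then have "(norm (x - Q n x))\<^sup>2 \<le> (norm x)\<^sup>2" by (metis le_add_same_cancel2 zero_le_power2)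
  then show ?thesis by (rule power2_le_imp_le) simp
qed

lemma K_supp: "K n \<subseteq> supp_in (Gn n)"
proof (rule K_subset)
  show "subspace (supp_in (Gn n) :: 'a l2 set)"
    unfolding real_vector.subspace_def by (auto simp: supp_in_def)
  have "supp_in (Gn n) = (\<Inter>a\<in>- Gn n. {x. fn x a = 0})" by (auto simp: supp_in_def)
  moreover have "closed {x :: 'a l2. fn x a = 0}" for a
    by (intro closed_Collect_eq continuous_fn continuous_intros)
  ultimately show "closed (supp_in (Gn n) :: 'a l2 set)" by auto
qed (auto simp: eigv_def)

text \<open>Inside the block \<open>T\<close> and the compression agree, beyond the next shell both
  sides vanish, and on the next shell \<open>T e\<close> is a combination of independent columns
  with the outgoing amplitudes as coefficients. So an eigenvector of the compression is one of
  \<open>T\<close> exactly when its amplitudes vanish.\<close>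

lemma phi_orth_iff:
  assumes e: "e \<in> supp_in (Gn n)"
  shows "T e = scaleC l e \<longleftrightarrow> Hc (Gn n) e = scaleC l e \<and> (\<forall>k<r (Suc n). cinner (phi n k) e = 0)"
proof
  have D: "e \<in> Dom" using supp_block_Dom[OF e] by simp
  {
    assume te: "T e = scaleC l e"
    have "Hc (Gn n) e = scaleC l e"
      unfolding Hc_def restr_id[OF e] te using e by (simp add: restr_id)
    moreover have "cinner (phi n k) e = 0" if "k < r (Suc n)" for k
    proof (rule ups_independent[where c = "\<lambda>k. cinner (phi n k) e", OF _ that])
      fix a assume a: "a \<in> set (shell (Suc n))"
      then have "a \<notin> Gn n" using block_iff[OF a, of 0 n] by simp
      then have "fn (T e) a = 0" using e te by (simp add: supp_in_def)
      then show "(\<Sum>k<r (Suc n). fn (ups (Suc n) k) a * cinner (phi n k) e) = 0"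
        using hop_outside_next[OF e a] D by (simp add: fn_T)
    qed
    ultimately show "Hc (Gn n) e = scaleC l e \<and> (\<forall>k<r (Suc n). cinner (phi n k) e = 0)" by blast
  }
  assume he: "Hc (Gn n) e = scaleC l e \<and> (\<forall>k<r (Suc n). cinner (phi n k) e = 0)"
  show "T e = scaleC l e"
  proof (rule l2_eqI)
    fix a
    obtain j where j: "a \<in> set (shell j)" by (rule shell_ex)
    consider "j \<le> n" | "j = Suc n" | "j \<ge> n + 2" by linarith
    then show "fn (T e) a = fn (scaleC l e) a"
    proof cases
      case 1
      then have "a \<in> Gn n" using block_iff[OF j, of 0 n] by simp
      then have "fn (T e) a = fn (Hc (Gn n) e) a" by (simp add: Hc_def restr_id[OF e])
      then show ?thesis using he by simp
    next
      case 2
      then have "a \<notin> Gn n" using block_iff[OF j, of 0 n] by simp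
      moreover have "fn (T e) a = 0" using hop_outside_next[OF e, of a] j 2 he D by (simp add: fn_T)
      ultimately show ?thesis using e by (simp add: supp_in_def)
    next
      case 3
      then have "a \<notin> Gn n" using block_iff[OF j, of 0 n] by simp
      moreover have "fn (T e) a = 0" using hop_outside_far[OF e j 3] D by (simp add: fn_T)
      ultimately show ?thesis using e by (simp add: supp_in_def)
    qed
  qed
qed

lemma eigvD:
  assumes "e \<in> eigv n"
  obtains l :: real where "T e = scaleR l e" "Hc (Gn n) e = scaleR l e" "\<And>k. k < r (Suc n) \<Longrightarrow> cinner (phi n k) e = 0"
proof -
  obtain l :: real where e: "e \<in> supp_in (Gn n)" "T e = scaleR l e" using assms by (auto simp: eigv_def)
  then show thesis using that[of l] phi_orth_iff[OF e(1), of "complex_of_real l"] by (simp add: scaleC_of_real)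
qed

lemma subspace_orth: "subspace {x. cinner y x = 0}"
  unfolding real_vector.subspace_def by (auto simp: cinner_add_right scaleR_l2_def cinner_scaleC_right)

lemma closed_orth: "closed {x. cinner y x = 0}"
  by (intro closed_Collect_eq continuous_cinner_right continuous_intros)

lemma K_phi: assumes "x \<in> K n" "k < r (Suc n)" shows "cinner (phi n k) x = 0"
proof -
  have "eigv n \<subseteq> {x. cinner (phi n k) x = 0}" using eigvD assms(2) by blast
  then have "K n \<subseteq> {x. cinner (phi n k) x = 0}" by (intro K_subset subspace_orth closed_orth)
  then show ?thesis using assms(1) by blast
qed

lemma K_Hc: assumes "x \<in> K n" shows "Hc (Gn n) x \<in> K n"
proof -
  have "K n \<subseteq> Hc (Gn n) -` K n"
  proof (rule K_subset)
    show "subspace (Hc (Gn n) -` K n)"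
      unfolding real_vector.subspace_def
      using K_sub(1)[of n] Hc_scaleC[OF finite_block, of 0 n 0 0]
      by (auto simp: Hc_add scaleR_l2_def Hc_scaleC K_ops csubspace_def subspace_0)
    show "closed (Hc (Gn n) -` K n)"
      by (rule closed_vimage[OF K_sub(2) continuous_Hc[OF finite_block]])
    show "eigv n \<subseteq> Hc (Gn n) -` K n"
    proof
      fix e assume e: "e \<in> eigv n"
      then obtain l :: real where "Hc (Gn n) e = scaleR l e" by (rule eigvD)
      then show "e \<in> Hc (Gn n) -` K n" using e K_sub(3)[of n] K_ops(3)[of e n "of_real l"] by (auto simp: scaleC_of_real)
    qed
  qed
  then show ?thesis using assms by blast
qed

subsection \<open>The dissipative operator\<close>

text \<open>The term with \<open>phi\<close> couples the last shell to free channels. The term with \<open>Q\<close> does not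
  act on the vectors of interest; it only moves the eigenvalues of the finitely supported
  eigenvectors off the real axis, so that the resolvent extends across it.\<close>

definition bnd :: "nat \<Rightarrow> 'a l2 \<Rightarrow> 'a l2" where
  "bnd n x = (\<Sum>k<r (Suc n). scaleC (cinner (phi n k) x) (phi n k))"

definition bq :: "nat \<Rightarrow> 'a l2 \<Rightarrow> real" where
  "bq n x = (\<Sum>k<r (Suc n). (cmod (cinner (phi n k) x))\<^sup>2)"

definition Ad :: "nat \<Rightarrow> 'a l2 \<Rightarrow> 'a l2" where
  "Ad n x = Hc (Gn n) x - scaleC \<i> (bnd n x) - scaleC \<i> (Q n x)"

lemma bq_nonneg: "bq n x \<ge> 0" by (simp add: bq_def sum_nonneg)

lemma cinner_bnd: "cinner x (bnd n x) = complex_of_real (bq n x)"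
proof -
  have "cinner x (bnd n x) = (\<Sum>k<r (Suc n). cinner (phi n k) x * cnj (cinner (phi n k) x))"
    unfolding bnd_def by (simp add: cinner_simps) (metis cinner_commute)
  then show ?thesis by (simp only: bq_def of_real_sum complex_norm_square)
qed

lemma phi_supp_G: "phi n k \<in> supp_in (Gn n)" using supp_shell_block[of 0 n n] phi_supp by auto

lemma bnd_supp: "bnd n x \<in> supp_in (Gn n)" unfolding bnd_def by (intro supp_in_sum supp_in_closed_ops phi_supp_G)

lemma Ad_supp: "Ad n x \<in> supp_in (Gn n)"
  unfolding Ad_def using K_supp Q_K by (intro supp_in_closed_ops Hc_supp bnd_supp) auto

lemma Ad_add: "Ad n (x + y) = Ad n x + Ad n y"
  unfolding Ad_def bnd_def
  by (simp add: Hc_add cinner_add_right scaleC_add_left scaleC_add_right sum.distrib Q_add algebra_simps)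

lemma Ad_scaleC: "Ad n (scaleC c x) = scaleC c (Ad n x)"
proof -
  have "bnd n (scaleC c x) = scaleC c (bnd n x)"
    unfolding bnd_def by (rule l2_eqI) (simp add: cinner_scaleC_right sum_distrib_left mult.assoc)
  then show ?thesis unfolding Ad_def
    by (simp add: Hc_scaleC Q_scaleC scaleC_diff_right mult.commute)
qed

text \<open>Energy balance: the Hermitian part has a real form and drops out, while each dissipative
  term enters with its own nonnegative form.\<close>

lemma Ad_energy: "Im (cinner x (Ad n x - scaleC z x)) = - bq n x - (norm (Q n x))\<^sup>2 - Im z * (norm x)\<^sup>2"
proof -
  have "cinner x (Ad n x - scaleC z x) = cinner x (Hc (Gn n) x) - \<i> * of_real (bq n x) - \<i> * of_real ((norm (Q n x))\<^sup>2) - z * of_real ((norm x)\<^sup>2)"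
    unfolding Ad_def by (simp add: cinner_simps cinner_bnd cinner_Q cinner_norm)
  then show ?thesis using Hc_real[OF finite_block, of x 0 n] by simp
qed

text \<open>For \<open>Im z \<ge> 0\<close> all three nonnegative terms of the energy balance
  vanish. At real \<open>z\<close> the amplitudes are then zero, so \<open>x\<close> is a finitely
  supported eigenvector of \<open>T\<close> and lies in \<open>K n\<close>, whereas its projection
  to \<open>K n\<close> is zero.\<close>

lemma Ad_no_eigenvalue:
  assumes x: "x \<in> supp_in (Gn n)" "Ad n x = scaleC z x" and z: "Im z \<ge> 0"
  shows "x = 0"
proof -
  have "0 = - bq n x - (norm (Q n x))\<^sup>2 - Im z * (norm x)\<^sup>2" using Ad_energy[of x n z] x by simp
  moreover have "Im z * (norm x)\<^sup>2 \<ge> 0" using z by simp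
  ultimately have 0: "bq n x = 0" "Q n x = 0" "Im z * (norm x)\<^sup>2 = 0"
    using bq_nonneg[of n x] zero_le_power2[of "norm (Q n x)"] by (smt (verit) power2_eq_square mult_eq_0_iff norm_eq_zero)+
  show ?thesis
  proof (cases "Im z = 0")
    case False then show ?thesis using 0(3) by simp
  next
    case True
    then have zr: "z = complex_of_real (Re z)" by (simp add: complex_eq_iff)
    have c0: "\<forall>k<r (Suc n). cinner (phi n k) x = 0"
      using 0(1) unfolding bq_def by (simp add: sum_nonneg_eq_0_iff)
    then have "bnd n x = 0" unfolding bnd_def by simp
    then have "Hc (Gn n) x = scaleC z x" using x(2) 0(2) unfolding Ad_def by simp
    then have "T x = scaleC z x" using phi_orth_iff[OF x(1)] c0 by blast
    then have "x \<in> eigv n" using x(1) zr unfolding eigv_def by (metis (mono_tags, lifting) mem_Collect_eq scaleC_of_real)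
    then show ?thesis using K_sub(3) Q_id 0(2) by (metis subsetD)
  qed
qed

text \<open>Makes the resolvent bounded for large spectral parameter, as
  \<open>poisson_formula\<close> requires.\<close>

lemma Ad_bound: "\<exists>C\<ge>0. \<forall>x. norm (Ad n x) \<le> C * norm x"
proof -
  obtain C where C: "C \<ge> 0" "\<And>x. norm (Hc (Gn n) x) \<le> C * norm x" using Hc_bound[OF finite_block] by blast
  define B where "B = (\<Sum>k<r (Suc n). norm (phi n k) * norm (phi n k))"
  have "norm (Ad n x) \<le> (C + B + 1) * norm x" for x
  proof -
    have "norm (bnd n x) \<le> (\<Sum>k<r (Suc n). norm (phi n k) * norm x * norm (phi n k))"
      unfolding bnd_def by (intro order_trans[OF norm_sum] sum_mono) (auto intro!: mult_right_mono norm_cinner_le)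
    also have "\<dots> = B * norm x" by (simp add: B_def sum_distrib_left mult_ac sum_distrib_right)
    finally have b: "norm (bnd n x) \<le> B * norm x" .
    have "norm (Q n x) \<le> norm x"
    proof -
      have "cmod (cinner x (Q n x)) \<le> norm x * norm (Q n x)" by (rule norm_cinner_le)
      moreover have "cmod (cinner x (Q n x)) = norm (Q n x) * norm (Q n x)"
        by (simp add: cinner_Q power2_eq_square norm_mult)
      ultimately have "norm (Q n x) * norm (Q n x) \<le> norm x * norm (Q n x)" by simp
      then show ?thesis by (cases "Q n x = 0") auto
    qed
    moreover have "norm (Ad n x) \<le> norm (Hc (Gn n) x) + norm (bnd n x) + norm (Q n x)"
      unfolding Ad_def using norm_triangle_ineq4[of "Hc (Gn n) x - scaleC \<i> (bnd n x)" "scaleC \<i> (Q n x)"]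
        norm_triangle_ineq4[of "Hc (Gn n) x" "scaleC \<i> (bnd n x)"] by simp
    ultimately show ?thesis using C(2)[of x] b by (simp add: distrib_right)
  qed
  moreover have "B \<ge> 0" by (simp add: B_def sum_nonneg)
  ultimately show ?thesis using C(1) by (intro exI[of _ "C + B + 1"]) auto
qed

definition v :: "'a l2" where "v = ups 0 0"

lemma v_supp: "v \<in> supp_in (Gn n)"
  unfolding v_def using supp_shell_block[of 0 0 n] ups_supp by auto

definition v1 :: "nat \<Rightarrow> 'a l2" where "v1 n = v - Q n v"

lemma v1_supp: "v1 n \<in> supp_in (Gn n)"
  unfolding v1_def by (rule supp_in_closed_ops(2)[OF v_supp subsetD[OF K_supp Q_K]])

lemma v1_orth: "k \<in> K n \<Longrightarrow> cinner k (v1 n) = 0" by (simp add: v1_def Q_orth)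

text \<open>\<open>K n\<close> is invariant under the compression and invisible to the channels, so
  pairing the equation with \<open>e = Q n x\<close> leaves a homogeneous equation whose imaginary
  part is \<open>(1 + Im z) * (norm e)^2 = 0\<close>. The artificial damping therefore never acts on
  the solutions considered.\<close>

lemma Q_resolvent_zero:
  assumes x: "Ad n x - scaleC z x = v1 n" and z: "Im z \<ge> 0"
  shows "Q n x = 0"
proof -
  define e where "e = Q n x"
  have eK: "e \<in> K n" by (simp add: e_def Q_K)
  have HK: "Hc (Gn n) e \<in> K n" by (rule K_Hc[OF eK])
  have p: "cinner k x = cinner k e" if "k \<in> K n" for k
    using Q_orth[OF that, of x] by (simp add: e_def cinner_diff_right)
  have "cinner e (bnd n x) = 0"
    unfolding bnd_def by (simp add: cinner_simps) (metis (no_types, lifting) K_phi cinner_commute complex_cnj_zero eK lessThan_iff mult_zero_right sum.neutral)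
  moreover have "cinner e (Hc (Gn n) x) = cinner e (Hc (Gn n) e)"
    using p[OF HK] Hc_sym[OF finite_block] by metis
  moreover have "cinner e (Q n x) = complex_of_real ((norm e)\<^sup>2)" by (simp add: e_def cinner_norm)
  moreover have "cinner e x = complex_of_real ((norm e)\<^sup>2)" using p[OF eK] by (simp add: cinner_norm)
  moreover have "cinner e (Ad n x - scaleC z x) = 0" using x v1_orth[OF eK] by simp
  ultimately have "cinner e (Hc (Gn n) e) - \<i> * complex_of_real ((norm e)\<^sup>2) - z * complex_of_real ((norm e)\<^sup>2) = 0"
    unfolding Ad_def by (simp add: cinner_simps)
  then have "Im (cinner e (Hc (Gn n) e) - \<i> * complex_of_real ((norm e)\<^sup>2) - z * complex_of_real ((norm e)\<^sup>2)) = 0" by (simp only: zero_complex.sel)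
  then have "(1 + Im z) * (norm e)\<^sup>2 = 0"
    using Hc_real[OF finite_block, of e 0 n] by (simp add: distrib_right)
  then show ?thesis using z by (simp add: e_def)
qed

text \<open>Finitely many eigenvalues, all strictly below the real axis, leave a strip below the
  axis free of them; holomorphy there is what the contour argument needs.\<close>

lemma psi_exists:
  "\<exists>e>0. \<exists>\<psi>. (\<forall>z. Im z > - e \<longrightarrow> \<psi> z \<in> supp_in (Gn n) \<and> Ad n (\<psi> z) - scaleC z (\<psi> z) = v1 n) \<and>
    (\<lambda>z. cinner (v1 n) (\<psi> z)) holomorphic_on {z. Im z > - e}"
proof -
  interpret site_list "sites shell 0 n" by unfold_locales (rule distinct_sites)
  have G: "set (sites shell 0 n) = Gn n" by (simp add: block_def)
  have AS: "Ad n x \<in> supp_in (set (sites shell 0 n))" for x by (simp only: G Ad_supp)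
  note fr = finite_resolvent[of "Ad n", OF Ad_add Ad_scaleC AS, unfolded G]
  from fr obtain Z where Z: "finite Z" and ev: "\<forall>z\<in>Z. \<exists>x\<in>supp_in (Gn n). x \<noteq> 0 \<and> Ad n x = scaleC z x"
    and res: "\<forall>w\<in>supp_in (Gn n). \<exists>\<psi>. (\<forall>z. z \<notin> Z \<longrightarrow> \<psi> z \<in> supp_in (Gn n) \<and> Ad n (\<psi> z) - scaleC z (\<psi> z) = w) \<and>
      (\<forall>u. (\<lambda>z. cinner u (\<psi> z)) holomorphic_on (- Z))"
    by (elim exE conjE)
  have Zneg: "Im z < 0" if "z \<in> Z" for z
    using bspec[OF ev that] Ad_no_eigenvalue by (meson not_le)
  from bspec[OF res v1_supp[of n]] obtain \<psi> where \<psi>0: "\<forall>z. z \<notin> Z \<longrightarrow> \<psi> z \<in> supp_in (Gn n) \<and> Ad n (\<psi> z) - scaleC z (\<psi> z) = v1 n"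
    "\<forall>u. (\<lambda>z. cinner u (\<psi> z)) holomorphic_on (- Z)" by (elim exE conjE)
  have \<psi>: "(\<lambda>z. cinner (v1 n) (\<psi> z)) holomorphic_on (- Z)" using \<psi>0(2) by (rule spec)
  define e where "e = Min (insert 1 ((\<lambda>z. - Im z) ` Z))"
  have e0: "e > 0" unfolding e_def using Z Zneg by (subst Min_gr_iff) auto
  have notZ: "z \<notin> Z" if "Im z > - e" for z
  proof
    assume "z \<in> Z"
    then have "e \<le> - Im z" unfolding e_def using Z by (intro Min_le) auto
    then show False using that by simp
  qed
  have "(\<lambda>z. cinner (v1 n) (\<psi> z)) holomorphic_on {z. Im z > - e}"
    using \<psi> by (rule holomorphic_on_subset) (use notZ in auto)
  moreover have "\<forall>z. Im z > - e \<longrightarrow> \<psi> z \<in> supp_in (Gn n) \<and> Ad n (\<psi> z) - scaleC z (\<psi> z) = v1 n"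
    using notZ \<psi>0(1) by blast
  ultimately show ?thesis using e0 by (intro exI[of _ e] exI[of _ \<psi>] conjI)
qed

text \<open>\<open>hn n\<close> is \<open>pi\<close> times the density of the \<open>n\<close>-th approximating measure; the informal text writes
  it as the squared norm of \<open>(1 + \<delta>\<^sup>2)\<^sup>-\<^sup>1\<^sup>/\<^sup>2 \<gamma>\<close>.\<close>

definition psi :: "nat \<Rightarrow> complex \<Rightarrow> 'a l2" where
  "psi n z = (SOME x. x \<in> supp_in (Gn n) \<and> Ad n x - scaleC z x = v1 n)"

definition hn :: "nat \<Rightarrow> real \<Rightarrow> real" where "hn n t = bq n (psi n (complex_of_real t))"

lemma psi: assumes "Im z \<ge> 0" shows "psi n z \<in> supp_in (Gn n)" "Ad n (psi n z) - scaleC z (psi n z) = v1 n"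
proof -
  obtain e \<psi> where "e > 0" and *: "\<And>z. Im z > - e \<Longrightarrow> \<psi> z \<in> supp_in (Gn n) \<and> Ad n (\<psi> z) - scaleC z (\<psi> z) = v1 n"
    using psi_exists[of n] by blast
  then have "Im z > - e" using assms by linarith
  then have "\<exists>x. x \<in> supp_in (Gn n) \<and> Ad n x - scaleC z x = v1 n" using * by blast
  from someI_ex[OF this] show "psi n z \<in> supp_in (Gn n)" "Ad n (psi n z) - scaleC z (psi n z) = v1 n"
    unfolding psi_def by blast+
qed

lemma psi_unique:
  assumes "Im z \<ge> 0" "x \<in> supp_in (Gn n)" "Ad n x - scaleC z x = v1 n"
  shows "x = psi n z"
proof -
  have "Ad n (x - psi n z) = scaleC z (x - psi n z)"
  proof -
    have "Ad n (x - psi n z) = Ad n (x + scaleC (-1) (psi n z))" by (simp flip: uminus_l2_scaleC)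
    also have "\<dots> = Ad n x - Ad n (psi n z)" unfolding Ad_add Ad_scaleC by (simp flip: uminus_l2_scaleC)
    also have "\<dots> = scaleC z (x - psi n z)" using psi(2)[OF assms(1), of n] assms(3) by (simp add: scaleC_diff_right algebra_simps)
    finally show ?thesis .
  qed
  then have "x - psi n z = 0"
    using assms psi(1) by (intro Ad_no_eigenvalue[of _ n z]) auto
  then show ?thesis by simp
qed

lemma psi_Q: "Im z \<ge> 0 \<Longrightarrow> Q n (psi n z) = 0" using psi(2) Q_resolvent_zero by blast

lemma Im_psi: assumes "Im z \<ge> 0"
  shows "Im (cinner (v1 n) (psi n z)) = bq n (psi n z) + Im z * (norm (psi n z))\<^sup>2"
proof -
  have "Im (cinner (psi n z) (v1 n)) = - bq n (psi n z) - Im z * (norm (psi n z))\<^sup>2"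
    using Ad_energy[of "psi n z" n z] psi(2)[OF assms, of n] psi_Q[OF assms, of n] by simp
  then show ?thesis by (subst cinner_commute) simp
qed

lemma psi_bound: assumes "Im z > 0" shows "Im z * norm (psi n z) \<le> norm (v1 n)"
proof (cases "psi n z = 0")
  case False
  have "Im z * (norm (psi n z))\<^sup>2 \<le> Im (cinner (v1 n) (psi n z))" using assms bq_nonneg by (simp add: Im_psi)
  also have "\<dots> \<le> norm (v1 n) * norm (psi n z)"
    using abs_Im_le_cmod[of "cinner (v1 n) (psi n z)"] norm_cinner_le[of "v1 n" "psi n z"] by linarith
  finally show ?thesis using False by (simp add: power2_eq_square)
qed simp

lemma hn_nonneg: "hn n t \<ge> 0" by (simp add: hn_def bq_nonneg)

text \<open>Apply \<open>poisson_formula\<close> to \<open>F z = cinner (v1 n) (psi n z)\<close>: by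
  \<open>Im_psi\<close> its imaginary part at real points is \<open>hn n\<close>, and positivity of
  \<open>hn n\<close> supplies the remaining hypothesis.\<close>

lemma hn_poisson:
  "continuous_on UNIV (hn n)"
  "y > 0 \<Longrightarrow> (\<integral>\<^sup>+t. ennreal (poisson x y t * hn n t) \<partial>lborel) = ennreal (pi * Im (cinner (v1 n) (psi n (Complex x y))))"
proof -
  from psi_exists[of n] obtain e \<psi> where e: "e > 0"
    and \<psi>0: "\<forall>z. Im z > - e \<longrightarrow> \<psi> z \<in> supp_in (Gn n) \<and> Ad n (\<psi> z) - scaleC z (\<psi> z) = v1 n"
    and hol: "(\<lambda>z. cinner (v1 n) (\<psi> z)) holomorphic_on {z. Im z > - e}"
    by (elim exE conjE)
  note \<psi> = \<psi>0[rule_format]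
  define F where "F = (\<lambda>z. cinner (v1 n) (\<psi> z))"
  have eq: "\<psi> z = psi n z" if "Im z \<ge> 0" for z
  proof -
    have z: "Im z > - e" using that e by linarith
    show ?thesis by (rule psi_unique[OF that conjunct1[OF \<psi>[OF z]] conjunct2[OF \<psi>[OF z]]])
  qed
  have hF: "hn n t = Im (F (complex_of_real t))" for t
    unfolding F_def hn_def by (subst eq) (simp_all add: Im_psi)
  have "continuous_on UNIV (\<lambda>t. F (complex_of_real t))"
    using e unfolding F_def by (intro continuous_on_compose2[OF holomorphic_on_imp_continuous_on[OF hol]] continuous_intros) auto
  then show "continuous_on UNIV (hn n)" unfolding hF by (intro continuous_intros)
  obtain C where C: "C \<ge> 0" "\<And>x. norm (Ad n x) \<le> C * norm x" using Ad_bound by blast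
  assume y: "y > 0"
  \<comment> \<open>From the equation,
    \<open>(cmod w - C) * norm (psi n w) \<le> norm (v1 n)\<close>, and the factor is at least
    \<open>1\<close> here.\<close>
  have bF: "cmod (F w) \<le> (norm (v1 n))\<^sup>2" if w: "Im w \<ge> 0" "cmod w \<ge> C + 1" for w
  proof -
    have "cmod w * norm (psi n w) - C * norm (psi n w) \<le> norm (v1 n)"
    proof -
      have "norm (scaleC w (psi n w) - Ad n (psi n w)) = norm (v1 n)"
        using psi(2)[OF w(1), of n] by (metis norm_minus_commute)
      then show ?thesis
        using norm_triangle_ineq2[of "scaleC w (psi n w)" "Ad n (psi n w)"] C(2)[of "psi n w"] by simp
    qed
    moreover have "norm (psi n w) \<le> (cmod w - C) * norm (psi n w)"
      using w(2) mult_right_mono[of 1 "cmod w - C" "norm (psi n w)"] by simp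
    ultimately have "norm (psi n w) \<le> norm (v1 n)" by (simp add: left_diff_distrib)
    then have "norm (v1 n) * norm (psi n w) \<le> norm (v1 n) * norm (v1 n)" by (intro mult_left_mono) auto
    then show ?thesis using norm_cinner_le[of "v1 n" "psi n w"] by (simp add: F_def eq[OF w(1)] power2_eq_square)
  qed
  have holF: "F holomorphic_on {z. Im z > - e}" using hol unfolding F_def .
  have posF: "Im (F (complex_of_real t)) \<ge> 0" for t using hn_nonneg[of n t] by (simp only: hF)
  have "(\<integral>\<^sup>+t. ennreal (poisson x y t * Im (F (complex_of_real t))) \<partial>lborel) = ennreal (pi * Im (F (Complex x y)))"
    by (rule poisson_formula[OF e holF bF posF y])
  then show "(\<integral>\<^sup>+t. ennreal (poisson x y t * hn n t) \<partial>lborel) = ennreal (pi * Im (cinner (v1 n) (psi n (Complex x y))))"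
    using y by (simp add: hF F_def eq)
qed

text \<open>\<open>y * poisson 0 y t\<close> tends to \<open>1\<close> as \<open>y\<close> grows,
  while \<open>y * Im F\<close> on the imaginary axis is bounded by \<open>(norm v)^2\<close>
  through \<open>psi_bound\<close>; Fatou's lemma gives the bound on the total mass, uniform in
  \<open>n\<close>.\<close>

lemma hn_mass: "(\<integral>\<^sup>+t. ennreal (hn n t) \<partial>lborel) \<le> ennreal (pi * (norm v)\<^sup>2)"
proof -
  have [measurable]: "hn n \<in> borel_measurable borel" by (rule borel_measurable_continuous_onI[OF hn_poisson(1)])
  have bnd: "(\<integral>\<^sup>+t. ennreal (y * poisson 0 y t * hn n t) \<partial>lborel) \<le> ennreal (pi * (norm v)\<^sup>2)" if y: "y > 0" for y
  proof -
    let ?z = "Complex 0 y"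
    have "(\<integral>\<^sup>+t. ennreal (y * poisson 0 y t * hn n t) \<partial>lborel) = ennreal y * (\<integral>\<^sup>+t. ennreal (poisson 0 y t * hn n t) \<partial>lborel)"
      using y by (subst nn_integral_cmult[symmetric]) (auto simp: mult.assoc ennreal_mult hn_nonneg poisson_nonneg)
    also have "\<dots> = ennreal (pi * (y * Im (cinner (v1 n) (psi n ?z))))"
      using y Im_psi[of ?z n] bq_nonneg[of n "psi n ?z"]
      by (simp add: hn_poisson(2)[OF y] ennreal_mult[symmetric] mult.left_commute)
    also have "\<dots> \<le> ennreal (pi * (norm v)\<^sup>2)"
    proof (intro ennreal_leI mult_left_mono)
      have "Im (cinner (v1 n) (psi n ?z)) \<le> norm (v1 n) * norm (psi n ?z)"
        using abs_Im_le_cmod[of "cinner (v1 n) (psi n ?z)"] norm_cinner_le[of "v1 n" "psi n ?z"] by linarith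
      then have "y * Im (cinner (v1 n) (psi n ?z)) \<le> norm (v1 n) * (y * norm (psi n ?z))"
        using mult_left_mono[of _ _ y] y by (fastforce simp: mult.left_commute)
      also have "\<dots> \<le> norm (v1 n) * norm (v1 n)" using psi_bound[of ?z n] y by (intro mult_left_mono) auto
      also have "\<dots> \<le> norm v * norm v" unfolding v1_def by (intro mult_mono norm_minus_Q) auto
      finally show "y * Im (cinner (v1 n) (psi n ?z)) \<le> (norm v)\<^sup>2" by (simp add: power2_eq_square)
    qed simp
    finally show ?thesis .
  qed
  have "(\<integral>\<^sup>+t. ennreal (hn n t) \<partial>lborel) = (\<integral>\<^sup>+t. liminf (\<lambda>k. ennreal (real (Suc k) * poisson 0 (real (Suc k)) t * hn n t)) \<partial>lborel)"
  proof (rule nn_integral_cong)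
    fix t
    have "(\<lambda>k. real (Suc k) * poisson 0 (real (Suc k)) t) \<longlonglongrightarrow> 1"
      unfolding poisson_def by real_asymp
    then have "(\<lambda>k. real (Suc k) * poisson 0 (real (Suc k)) t * hn n t) \<longlonglongrightarrow> 1 * hn n t" by (intro tendsto_intros)
    then have "(\<lambda>k. ennreal (real (Suc k) * poisson 0 (real (Suc k)) t * hn n t)) \<longlonglongrightarrow> ennreal (hn n t)" by (simp add: tendsto_ennrealI)
    then show "ennreal (hn n t) = liminf (\<lambda>k. ennreal (real (Suc k) * poisson 0 (real (Suc k)) t * hn n t))"
      by (intro lim_imp_Liminf[symmetric]) auto
  qed
  also have "\<dots> \<le> liminf (\<lambda>k. \<integral>\<^sup>+t. ennreal (real (Suc k) * poisson 0 (real (Suc k)) t * hn n t) \<partial>lborel)"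
    by (rule nn_integral_liminf) measurable
  also have "\<dots> \<le> liminf (\<lambda>k :: nat. ennreal (pi * (norm v)\<^sup>2))"
    by (intro Liminf_mono always_eventually allI bnd) simp
  also have "\<dots> = ennreal (pi * (norm v)\<^sup>2)" by (simp add: Liminf_const)
  finally show ?thesis .
qed

subsection \<open>Convergence of the approximating resolvents\<close>

definition eig :: "'a l2 set" where "eig = {e \<in> finsup. \<exists>l :: real. T e = scaleR l e}"
definition Kinf :: "'a l2 set" where "Kinf = closure (span eig)"
definition vinf :: "'a l2" where "vinf = v - orth_proj Kinf v"

lemma Gn_mono: "m \<le> n \<Longrightarrow> Gn m \<subseteq> Gn n" unfolding block_eq by (rule UN_mono) auto

lemma supp_Gn_mono: "m \<le> n \<Longrightarrow> supp_in (Gn m) \<subseteq> supp_in (Gn n)"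
  unfolding supp_in_def using Gn_mono by blast

lemma finsup_supp: assumes "x \<in> finsup" shows "\<exists>n. x \<in> supp_in (Gn n)"
proof -
  define j where "j = (\<lambda>a. SOME j. a \<in> set (shell j))"
  have j: "a \<in> set (shell (j a))" for a unfolding j_def using shell_ex[of a] by (metis someI_ex)
  define n where "n = Max (insert 0 (j ` {a. fn x a \<noteq> 0}))"
  have "a \<in> Gn n" if "fn x a \<noteq> 0" for a
  proof -
    have "j a \<le> n" unfolding n_def using that assms by (intro Max_ge) (auto simp: finsup_def)
    then show ?thesis using block_iff[OF j[of a], of 0 n] by simp
  qed
  then show ?thesis unfolding supp_in_def by blast
qed

lemma eig_scaleC: "e \<in> eig \<Longrightarrow> scaleC c e \<in> eig"
  unfolding eig_def using finsup_csubspace[where 'a = 'a] finsup_Dom(1)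
  by (auto simp: csubspace_def Dom_scaleC scaleC_scaleR)

lemma Kinf: "csubspace Kinf" "closed Kinf" "eig \<subseteq> Kinf"
  unfolding Kinf_def using csubspace_closure_span[OF eig_scaleC] span_superset closure_subset by blast+

lemma eigv_eig: "eigv n \<subseteq> eig"
  unfolding eigv_def eig_def using supp_block_Dom by blast

lemma eigv_mono: "m \<le> n \<Longrightarrow> eigv m \<subseteq> eigv n"
  unfolding eigv_def using supp_Gn_mono by blast

lemma span_eig_eigv: assumes "x \<in> span eig" shows "\<exists>n. x \<in> span (eigv n)"
  using assms
proof (induction rule: span_induct_alt)
  case base show ?case using span_zero by blast
next
  case (step c e y)
  then obtain n where n: "y \<in> span (eigv n)" by blast
  obtain m where "e \<in> supp_in (Gn m)" using step finsup_supp by (auto simp: eig_def)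
  then have "e \<in> eigv m" using step by (auto simp: eigv_def eig_def)
  then have "e \<in> span (eigv (max m n))" "y \<in> span (eigv (max m n))"
    using eigv_mono[of m "max m n"] eigv_mono[of n "max m n"] n span_mono span_base by (metis max.cobounded1 subsetD, metis max.cobounded2 subsetD)
  then show ?case by (intro exI[of _ "max m n"] span_add span_scale)
qed

lemma K_Kinf: "K n \<subseteq> Kinf" unfolding K_def Kinf_def by (intro closure_mono span_mono eigv_eig)

text \<open>The spaces \<open>K n\<close> increase to a dense subset of \<open>Kinf\<close>, and
  \<open>Q n v\<close> is the best approximation in \<open>K n\<close> of the projection of
  \<open>v\<close> to \<open>Kinf\<close>.\<close>

lemma v1_limit: "v1 \<longlonglongrightarrow> vinf"
proof (rule metric_LIMSEQ_I)
  fix e :: real assume "e > 0"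
  define q where "q = orth_proj Kinf v"
  have q: "q \<in> Kinf" "\<And>k. k \<in> Kinf \<Longrightarrow> cinner k (v - q) = 0" using orth_proj[OF Kinf(1,2)] by (simp_all add: q_def)
  obtain y where y: "y \<in> span eig" "dist y q < e" using q(1) \<open>e > 0\<close> unfolding Kinf_def closure_approachable by blast
  obtain N where N: "y \<in> span (eigv N)" using span_eig_eigv[OF y(1)] by blast
  have "dist (v1 n) vinf < e" if "n \<ge> N" for n
  proof -
    have yK: "y \<in> K n" using N span_mono[OF eigv_mono[OF that]] closure_subset unfolding K_def by blast
    have "cinner (Q n v - y) (q - Q n v) = 0"
    proof -
      have k: "Q n v - y \<in> K n" by (simp add: K_ops Q_K yK)
      have "cinner (Q n v - y) (v - Q n v) = 0" by (rule Q_orth[OF k])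
      moreover have "cinner (Q n v - y) (v - q) = 0" using k K_Kinf q(2) by blast
      ultimately show ?thesis by (simp add: cinner_diff_right)
    qed
    then have "inner (Q n v - y) (q - Q n v) = 0" by (simp add: inner_l2_def)
    then have "(norm (q - y))\<^sup>2 = (norm (q - Q n v))\<^sup>2 + (norm (Q n v - y))\<^sup>2"
      using norm_add_power2[of "q - Q n v" "Q n v - y"] by (simp add: inner_commute)
    then have "(norm (q - Q n v))\<^sup>2 \<le> (norm (q - y))\<^sup>2" by (metis le_add_same_cancel1 zero_le_power2)
    then have "norm (q - Q n v) \<le> norm (q - y)" by (rule power2_le_imp_le) simp
    then show ?thesis using y(2) by (simp add: dist_norm v1_def vinf_def q_def norm_minus_commute)
  qed
  then show "\<exists>no. \<forall>n\<ge>no. dist (v1 n) vinf < e" by blast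
qed

text \<open>Approximate \<open>f\<close> in graph norm by a finitely supported \<open>g\<close>.
  Once \<open>n\<close> is past the support of \<open>g\<close>, neither the truncation nor the
  channels affect \<open>g\<close>, so \<open>psi n z - g\<close> solves the truncated equation with
  a small right-hand side, and dissipativity bounds it after division by
  \<open>Im z\<close>.\<close>

lemma psi_limit:
  assumes y: "Im z > 0" and f: "f \<in> Dom" "T f - scaleC z f = vinf"
  shows "(\<lambda>n. psi n z) \<longlonglongrightarrow> f"
proof (rule metric_LIMSEQ_I)
  fix e :: real assume e: "e > 0"
  \<comment> \<open>The right-hand side will be at most \<open>e * Im z / 4\<close> from
    \<open>v1 n\<close> plus \<open>(1 + cmod z) * d\<close> from the graph-norm error, together no
    more than \<open>e * Im z / 2\<close>.\<close>
  define d where "d = min (e / 2) (e * Im z / (4 * (1 + cmod z)))"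
  have d: "d > 0" "d \<le> e / 2" "(1 + cmod z) * d \<le> e * Im z / 4"
  proof -
    have c: "1 + cmod z > 0" by (smt (verit) norm_ge_zero)
    show "d > 0" unfolding d_def using e y c by simp
    show "d \<le> e / 2" unfolding d_def by (rule min.cobounded1)
    have "d \<le> e * Im z / (4 * (1 + cmod z))" unfolding d_def by (rule min.cobounded2)
    then have "d * (4 * (1 + cmod z)) \<le> e * Im z" using c by (simp add: pos_le_divide_eq)
    then show "(1 + cmod z) * d \<le> e * Im z / 4" by (simp add: algebra_simps)
  qed
  obtain g where g: "g \<in> finsup" "norm (f - g) < d" "norm (T f - T g) < d" using Dom_approx[OF f(1) d(1)] by blast
  obtain N where N: "g \<in> supp_in (Gn N)" using finsup_supp[OF g(1)] by blast
  have "e * Im z / 4 > 0" using e y by simp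
  then obtain N' where N': "\<And>n. n \<ge> N' \<Longrightarrow> dist (v1 n) vinf < e * Im z / 4" using metric_LIMSEQ_D[OF v1_limit] by blast
  \<comment> \<open>\<open>Suc N\<close> and not \<open>N\<close>: the last shell must miss the
    support of \<open>g\<close>, so that \<open>g\<close> has no outgoing amplitudes and the
    compression acts on it like \<open>T\<close>.\<close>
  have "dist (psi n z) f < e" if n: "n \<ge> max (Suc N) N'" for n
  proof -
    obtain m where m: "n = Suc m" "m \<ge> N" using n by (cases n) auto
    have gm: "g \<in> supp_in (Gn m)" using N supp_Gn_mono[OF m(2)] by blast
    have gn: "g \<in> supp_in (Gn n)" using gm supp_Gn_mono[of m n] m by auto
    have "Hc (Gn n) g = T g" using Hc_eq_T[OF gm] m by simp
    have "cinner (phi n k) g = 0" for k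
    proof -
      have "cinner (phi n k) g = (\<Sum>a\<in>{}. cnj (fn (phi n k) a) * fn g a)"
      proof (rule cinner_finite_support)
        fix a :: 'a
        obtain j where j: "a \<in> set (shell j)" by (rule shell_ex)
        show "fn (phi n k) a = 0 \<or> fn g a = 0"
        proof (cases "j = n")
          case True
          then have "a \<notin> Gn m" using block_iff[OF j, of 0 m] m by simp
          then show ?thesis using gm by (simp add: supp_in_def)
        next
          case False
          then have "a \<notin> set (shell n)" using shell_unique[OF j] by blast
          then show ?thesis using phi_supp[of n k] by (simp add: supp_in_def)
        qed
      qed simp
      then show ?thesis by simp
    qed
    then have "bnd n g = 0" by (simp add: bnd_def)
    define x where "x = psi n z - g"
    have eq: "Hc (Gn n) x - scaleC \<i> (bnd n x) - scaleC z x = v1 n - (T g - scaleC z g)"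
    proof -
      have bx: "bnd n x = bnd n (psi n z)"
        unfolding x_def bnd_def using \<open>\<And>k. cinner (phi n k) g = 0\<close> by (simp add: cinner_diff_right)
      have "v1 n = Hc (Gn n) (psi n z) - scaleC \<i> (bnd n (psi n z)) - scaleC z (psi n z)"
        using psi(2)[of z n] psi_Q[of z n] y unfolding Ad_def by simp
      then show ?thesis unfolding bx using \<open>Hc (Gn n) g = T g\<close>
        by (simp add: x_def Hc_diff scaleC_diff_right algebra_simps)
    qed
    have "Im z * (norm x)\<^sup>2 \<le> norm x * norm (v1 n - (T g - scaleC z g))"
    proof -
      have "Im (cinner x (Hc (Gn n) x - scaleC \<i> (bnd n x) - scaleC z x)) = - bq n x - Im z * (norm x)\<^sup>2"
        using Hc_real[OF finite_block, of x 0 n] by (simp add: cinner_simps cinner_bnd cinner_norm flip: of_real_power)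
      then have "Im z * (norm x)\<^sup>2 \<le> \<bar>Im (cinner x (v1 n - (T g - scaleC z g)))\<bar>"
        unfolding eq using bq_nonneg[of n x] by linarith
      also have "\<dots> \<le> norm x * norm (v1 n - (T g - scaleC z g))" using abs_Im_le_cmod norm_cinner_le order_trans by blast
      finally show ?thesis .
    qed
    then have b: "Im z * norm x \<le> norm (v1 n - (T g - scaleC z g))"
      by (cases "x = 0") (auto simp: power2_eq_square)
    have vg: "v1 n - (T g - scaleC z g) = (v1 n - vinf) + ((T f - T g) - scaleC z (f - g))"
      using f(2) by (simp add: scaleC_diff_right algebra_simps)
    have "norm (v1 n - (T g - scaleC z g)) \<le> norm (v1 n - vinf) + (norm (T f - T g) + norm (scaleC z (f - g)))"
      using norm_triangle_ineq[of "v1 n - vinf" "(T f - T g) - scaleC z (f - g)"] norm_triangle_ineq4[of "T f - T g" "scaleC z (f - g)"]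
      unfolding vg by linarith
    also have "\<dots> < e * Im z / 4 + (d + cmod z * d)"
    proof -
      have "norm (scaleC z (f - g)) \<le> cmod z * d" using g(2) by (simp add: mult_left_mono)
      moreover have "norm (v1 n - vinf) < e * Im z / 4" using N'[of n] n by (simp add: dist_norm)
      ultimately show ?thesis using g(3) by linarith
    qed
    also have "\<dots> \<le> e * Im z / 2" using d(3) by (simp add: distrib_right)
    finally have "Im z * norm x < Im z * (e / 2)" using b by (simp add: mult.commute)
    then have "norm x < e / 2" using y by simp
    then show ?thesis using g(2) d(2) norm_triangle_ineq[of "psi n z - g" "g - f"] by (simp add: dist_norm x_def norm_minus_commute)
  qed
  then show "\<exists>no. \<forall>n\<ge>no. dist (psi n z) f < e" by blast
qed

end

section \<open>Boundary resolvent data\<close>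

lemma mrank_pos:
  assumes A: "A \<in> carrier_mat n nc" and ij: "i < n" "j < nc" "A $$ (i, j) \<noteq> 0"
  shows "mrank A \<ge> 1"
proof -
  interpret vec_space "TYPE(complex)" n .
  let ?c = "col A j"
  have c: "?c \<in> carrier_vec n" using A by auto
  define C where "C = mat_of_cols n [?c]"
  have C: "C \<in> carrier_mat n 1" unfolding C_def using mat_of_cols_carrier(1)[of n "[?c]"] by simp
  have cols: "cols C = [?c]" unfolding C_def using c by (intro cols_mat_of_cols) auto
  have "lin_indpt {?c}"
  proof (rule notI)
    assume "lin_dep {?c}"
    then have ld: "lin_dep (set (cols C))" unfolding cols by simp
    have dc: "distinct (cols C)" unfolding cols by simp
    obtain v where v: "v \<in> carrier_vec 1" "v \<noteq> 0\<^sub>v 1" "C *\<^sub>v v = 0\<^sub>v n" by (rule lin_depE[OF C ld dc])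
    have "vec_index (C *\<^sub>v v) i = A $$ (i, j) * vec_index v 0"
      using v(1) ij A C by (simp add: scalar_prod_def C_def mat_of_cols_index)
    then have "vec_index v 0 = 0" using v(3) ij by simp
    then have "v = 0\<^sub>v 1" using v(1) by (intro eq_vecI) auto
    then show False using v(2) by simp
  qed
  moreover have "{?c} \<subseteq> set (cols A)" using A ij by (auto simp: cols_def)
  ultimately have "card {?c} \<le> rank A" by (intro rank_ge_card_indpt[OF A])
  then show ?thesis using A by (simp add: mrank_def)
qed

context factored_hopping
begin

text \<open>The columns of \<open>boundary_cols\<close>, viewed as functions: first those of
  \<open>Ups m\<close>, then those of \<open>Phi n\<close>.\<close>

definition bvec :: "nat \<Rightarrow> nat \<Rightarrow> nat \<Rightarrow> 'a l2" where
  "bvec m n j = (if j < r m then ups m j else phi n (j - r m))"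

definition evs :: "nat \<Rightarrow> nat \<Rightarrow> complex set" where
  "evs m n = {z. \<exists>x\<in>supp_in (block m n). x \<noteq> 0 \<and> Hc (block m n) x = scaleC z x}"

definition res :: "nat \<Rightarrow> nat \<Rightarrow> complex \<Rightarrow> 'a l2 \<Rightarrow> 'a l2" where
  "res m n z w = (SOME x. x \<in> supp_in (block m n) \<and> Hc (block m n) x - scaleC z x = w)"

lemma resolvent_family:
  "finite (evs m n)"
  "w \<in> supp_in (block m n) \<Longrightarrow> \<exists>\<psi>. (\<forall>z. z \<notin> evs m n \<longrightarrow> \<psi> z \<in> supp_in (block m n) \<and> Hc (block m n) (\<psi> z) - scaleC z (\<psi> z) = w) \<and>
      (\<forall>u. (\<lambda>z. cinner u (\<psi> z)) holomorphic_on (- evs m n))"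
  "z \<notin> evs m n \<Longrightarrow> det (char_matrix (site_list.op_mat (sites shell m n) (Hc (block m n))) z) \<noteq> 0"
proof -
  interpret site_list "sites shell m n" by unfold_locales (rule distinct_sites)
  have G: "set (sites shell m n) = block m n" by (simp add: block_def)
  note fr = finite_resolvent[of "Hc (block m n)", OF Hc_add[OF finite_block] Hc_scaleC[OF finite_block], unfolded G, OF Hc_supp[OF finite_block]]
  from fr obtain Z where Z: "finite Z" and ev: "\<forall>z\<in>Z. \<exists>x\<in>supp_in (block m n). x \<noteq> 0 \<and> Hc (block m n) x = scaleC z x"
    and dt: "\<forall>z. z \<notin> Z \<longrightarrow> det (char_matrix (op_mat (Hc (block m n))) z) \<noteq> 0"
    and rs: "\<forall>w\<in>supp_in (block m n). \<exists>\<psi>. (\<forall>z. z \<notin> Z \<longrightarrow> \<psi> z \<in> supp_in (block m n) \<and> Hc (block m n) (\<psi> z) - scaleC z (\<psi> z) = w) \<and>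
      (\<forall>u. (\<lambda>z. cinner u (\<psi> z)) holomorphic_on (- Z))"
    by (elim exE conjE)
  have "z \<in> Z" if z: "z \<in> evs m n" for z
  proof (rule ccontr)
    assume nz: "z \<notin> Z"
    obtain x where x: "x \<in> supp_in (block m n)" "x \<noteq> 0" "Hc (block m n) x = scaleC z x" using z by (auto simp: evs_def)
    have "tv (Hc (block m n) x - scaleC z x) = char_matrix (op_mat (Hc (block m n))) z *\<^sub>v tv x"
      by (rule tv_shift[OF Hc_add[OF finite_block] Hc_scaleC[OF finite_block]]) (simp_all add: G x Hc_supp)
    moreover have "tv 0 = 0\<^sub>v (length (sites shell m n))" by (intro eq_vecI) (auto simp: tv_def)
    ultimately have 0: "char_matrix (op_mat (Hc (block m n))) z *\<^sub>v tv x = 0\<^sub>v (length (sites shell m n))" using x(3) by simp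
    have "tv x \<noteq> 0\<^sub>v (length (sites shell m n))"
    proof
      assume "tv x = 0\<^sub>v (length (sites shell m n))"
      then have "x = 0" using tv_inj[of x 0] x(1) \<open>tv 0 = _\<close> by (simp add: G)
      then show False using x(2) by simp
    qed
    then have "det (char_matrix (op_mat (Hc (block m n))) z) = 0"
      using 0 tv_dim(1)[of x] by (subst det_0_iff_vec_prod_zero_field[OF char_matrix_closed[OF op_mat_carrier]]) blast
    then show False using dt nz by blast
  qed
  moreover have "z \<in> evs m n" if "z \<in> Z" for z using bspec[OF ev that] by (auto simp: evs_def)
  ultimately have ZE: "Z = evs m n" by blast
  show "finite (evs m n)" using Z ZE by simp
  show "w \<in> supp_in (block m n) \<Longrightarrow> \<exists>\<psi>. (\<forall>z. z \<notin> evs m n \<longrightarrow> \<psi> z \<in> supp_in (block m n) \<and> Hc (block m n) (\<psi> z) - scaleC z (\<psi> z) = w) \<and>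
      (\<forall>u. (\<lambda>z. cinner u (\<psi> z)) holomorphic_on (- evs m n))" using bspec[OF rs] unfolding ZE by blast
  show "z \<notin> evs m n \<Longrightarrow> det (char_matrix (op_mat (Hc (block m n))) z) \<noteq> 0" using dt ZE by blast
qed

lemma res:
  assumes "z \<notin> evs m n" "w \<in> supp_in (block m n)"
  shows "res m n z w \<in> supp_in (block m n)" "Hc (block m n) (res m n z w) - scaleC z (res m n z w) = w"
proof -
  have "\<exists>x. x \<in> supp_in (block m n) \<and> Hc (block m n) x - scaleC z x = w" using resolvent_family(2)[OF assms(2)] assms(1) by blast
  from someI_ex[OF this] show "res m n z w \<in> supp_in (block m n)" "Hc (block m n) (res m n z w) - scaleC z (res m n z w) = w"
    unfolding res_def by blast+
qed

lemma res_unique: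
  assumes "z \<notin> evs m n" "x \<in> supp_in (block m n)" "Hc (block m n) x - scaleC z x = w"
  shows "res m n z w = x"
proof -
  have w: "w \<in> supp_in (block m n)" using assms(2,3) Hc_supp[OF finite_block] supp_in_closed_ops by metis
  have "Hc (block m n) (res m n z w - x) = scaleC z (res m n z w - x)"
    using res(2)[OF assms(1) w] assms(3) by (simp add: Hc_diff scaleC_diff_right algebra_simps)
  moreover have "res m n z w - x \<in> supp_in (block m n)" using res(1)[OF assms(1) w] assms(2) by simp
  ultimately have "res m n z w - x = 0" using assms(1) by (auto simp: evs_def)
  then show ?thesis by simp
qed

lemma res_scale_sum:
  assumes "z \<notin> evs m n" "finite A" "\<And>i. i \<in> A \<Longrightarrow> w i \<in> supp_in (block m n)"
  shows "res m n z (\<Sum>i\<in>A. scaleC (c i) (w i)) = (\<Sum>i\<in>A. scaleC (c i) (res m n z (w i)))"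
proof (rule res_unique[OF assms(1)])
  show "(\<Sum>i\<in>A. scaleC (c i) (res m n z (w i))) \<in> supp_in (block m n)" using res(1) assms by simp
  have "Hc (block m n) (\<Sum>i\<in>A. scaleC (c i) (res m n z (w i))) - scaleC z (\<Sum>i\<in>A. scaleC (c i) (res m n z (w i))) =
     (\<Sum>i\<in>A. scaleC (c i) (Hc (block m n) (res m n z (w i)) - scaleC z (res m n z (w i))))"
  proof -
    have "scaleC z (\<Sum>i\<in>A. scaleC (c i) (res m n z (w i))) = (\<Sum>i\<in>A. scaleC (c i) (scaleC z (res m n z (w i))))"
      by (rule l2_eqI) (simp add: sum_distrib_left mult_ac)
    then show ?thesis using assms(2) by (simp add: Hc_sum Hc_scaleC scaleC_diff_right sum_subtractf)
  qed
  also have "\<dots> = (\<Sum>i\<in>A. scaleC (c i) (w i))" using res(2) assms by simp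
  finally show "Hc (block m n) (\<Sum>i\<in>A. scaleC (c i) (res m n z (w i))) - scaleC z (\<Sum>i\<in>A. scaleC (c i) (res m n z (w i))) = (\<Sum>i\<in>A. scaleC (c i) (w i))" .
qed

lemma res_sym:
  assumes "complex_of_real t \<notin> evs m n" "x \<in> supp_in (block m n)" "y \<in> supp_in (block m n)"
  shows "cinner x (res m n t y) = cinner (res m n t x) y"
proof -
  let ?X = "res m n t x" and ?Y = "res m n t y"
  have "cinner x ?Y = cinner (Hc (block m n) ?X - scaleC t ?X) ?Y" using res(2)[OF assms(1,2)] by simp
  also have "\<dots> = cinner ?X (Hc (block m n) ?Y - scaleC t ?Y)"
    using Hc_sym[OF finite_block, of ?X m n ?Y] by (simp add: cinner_simps)
  also have "\<dots> = cinner ?X y" using res(2)[OF assms(1,3)] by simp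
  finally show ?thesis .
qed

lemma bvec_supp: assumes "m \<le> n" shows "bvec m n j \<in> supp_in (block m n)"
  using assms ups_supp[of m j] phi_supp[of n "j - r m"] supp_shell_block[of m m n] supp_shell_block[of m n n]
  unfolding bvec_def by auto

lemma boundary_cols_tv:
  assumes mn: "m \<le> n" and j: "j < r m + r (Suc n)"
  shows "col (boundary_cols shell Ups Phi m n) j = site_list.tv (sites shell m n) (bvec m n j)"
    and "boundary_cols shell Ups Phi m n \<in> carrier_mat (length (sites shell m n)) (r m + r (Suc n))"
proof -
  interpret site_list "sites shell m n" by unfold_locales (rule distinct_sites)
  define N where "N = length (sites shell m n)"
  have s1: "sites shell m n = shell m @ sites shell (Suc m) n"
    using mn by (simp add: sites_def upt_conv_Cons del: upt_Suc)
  have s2: "sites shell m n = concat (map shell [m..<n]) @ shell n" using mn by (simp add: sites_def)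
  have N1: "N = s m + length (sites shell (Suc m) n)" using arg_cong[OF s1, of length] by (simp add: N_def)
  have N2: "N = length (concat (map shell [m..<n])) + s n" using arg_cong[OF s2, of length] by (simp add: N_def del: length_concat)
  note U = Ups_carrier[of m] and P = Phi_carrier[of n]
  define A1 where "A1 = Ups m @\<^sub>r 0\<^sub>m (N - s m) (dim_col (Ups m))"
  define A2 where "A2 = 0\<^sub>m (N - s n) (dim_col (Phi n)) @\<^sub>r Phi n"
  have A1: "A1 \<in> carrier_mat N (r m)" unfolding A1_def using U N1 carrier_append_rows[OF U, of "0\<^sub>m (N - s m) (dim_col (Ups m))" "N - s m"] by simp
  have A2: "A2 \<in> carrier_mat N (r (Suc n))" unfolding A2_def using P N2 carrier_append_rows[of "0\<^sub>m (N - s n) (dim_col (Phi n))" "N - s n" "r (Suc n)", OF _ P] by simp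
  have bc: "boundary_cols shell Ups Phi m n = mat_of_cols N (cols A1 @ cols A2)"
    by (simp add: boundary_cols_def Let_def N_def A1_def A2_def)
  have len: "length (cols A1 @ cols A2) = r m + r (Suc n)" using A1 A2 by simp
  show carr: "boundary_cols shell Ups Phi m n \<in> carrier_mat (length (sites shell m n)) (r m + r (Suc n))"
    unfolding bc using mat_of_cols_carrier(1)[of N "cols A1 @ cols A2"] len N_def by simp
  show "col (boundary_cols shell Ups Phi m n) j = tv (bvec m n j)"
  proof (rule eq_vecI)
    fix a assume "a < dim_vec (tv (bvec m n j))"
    then have a: "a < N" by (simp add: N_def)
    have "vec_index (col (boundary_cols shell Ups Phi m n) j) a = vec_index ((cols A1 @ cols A2) ! j) a"
      using carr a j len unfolding N_def[symmetric] by (simp add: bc mat_of_cols_index)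
    also have "\<dots> = fn (bvec m n j) (sites shell m n ! a)"
    proof (cases "j < r m")
      case True
      then have "vec_index ((cols A1 @ cols A2) ! j) a = A1 $$ (a, j)" using A1 a by (simp add: nth_append)
      also have "\<dots> = (if a < s m then Ups m $$ (a, j) else 0)"
        using True a U N1 unfolding A1_def append_rows_def by (subst index_mat_four_block) auto
      also have "\<dots> = fn (ups m j) (sites shell m n ! a)"
      proof (cases "a < s m")
        case am: True
        then show ?thesis using True by (simp add: s1 nth_append fn_ups)
      next
        case False
        then have "sites shell m n ! a \<in> set (sites shell (Suc m) n)" using a N1 by (simp add: s1 nth_append)
        then have "sites shell m n ! a \<notin> set (shell m)" using distinct_sites[of m n] unfolding s1 by auto
        then show ?thesis using False ups_supp[of m j] by (simp add: supp_in_def)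
      qed
      finally show ?thesis using True by (simp add: bvec_def)
    next
      case False
      define k where "k = j - r m"
      have k: "k < r (Suc n)" using False j by (simp add: k_def)
      have "vec_index ((cols A1 @ cols A2) ! j) a = A2 $$ (a, k)" using A1 A2 a False k by (simp add: nth_append k_def)
      also have "\<dots> = (if a < N - s n then 0 else Phi n $$ (a - (N - s n), k))"
        using k a P N2 unfolding A2_def append_rows_def by (subst index_mat_four_block) auto
      also have "\<dots> = fn (phi n k) (sites shell m n ! a)"
      proof (cases "a < N - s n")
        case True
        then have al: "a < length (concat (map shell [m..<n]))" using N2 by simp
        then have "sites shell m n ! a \<in> set (concat (map shell [m..<n]))" unfolding s2 nth_append by (simp only: if_True nth_mem)
        then have "sites shell m n ! a \<notin> set (shell n)" using distinct_sites[of m n] unfolding s2 by auto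
        then show ?thesis using True phi_supp[of n k] by (simp add: supp_in_def)
      next
        case ge: False
        then have "sites shell m n ! a = shell n ! (a - (N - s n))" using N2 by (simp add: s2 nth_append del: length_concat)
        moreover have "a - (N - s n) < s n" using ge a N2 by linarith
        ultimately show ?thesis using ge k by (simp add: fn_phi)
      qed
      finally show ?thesis using False by (simp add: bvec_def k_def)
    qed
    finally show "vec_index (col (boundary_cols shell Ups Phi m n) j) a = vec_index (tv (bvec m n j)) a"
      using a by (simp add: tv_def N_def)
  qed (use carr in simp)
qed

text \<open>The passage from matrix inverses to solutions of the truncated equation; everything
  afterwards is phrased with \<open>res\<close>.\<close>

lemma raw_eq:
  assumes mn: "m \<le> n" and z: "z \<notin> evs m n" and i: "i < r m + r (Suc n)" and j: "j < r m + r (Suc n)"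
  shows "boundary_resolvent_raw shell h Ups Phi m n z $$ (i, j) = cinner (bvec m n i) (res m n z (bvec m n j))"
proof -
  interpret site_list "sites shell m n" by unfold_locales (rule distinct_sites)
  let ?H = "Hc (block m n)" and ?N = "length (sites shell m n)"
  have G: "set (sites shell m n) = block m n" by (simp add: block_def)
  define F where "F = boundary_cols shell Ups Phi m n"
  have F: "F \<in> carrier_mat ?N (r m + r (Suc n))" unfolding F_def by (rule boundary_cols_tv(2)[OF mn j])
  define M where "M = hop_compression shell h m n - z \<cdot>\<^sub>m 1\<^sub>m ?N"
  have M_eq: "M = char_matrix (op_mat ?H) z"
  proof (rule eq_matI)
    fix a b assume "a < dim_row (char_matrix (op_mat ?H) z)" "b < dim_col (char_matrix (op_mat ?H) z)"
    then have ab: "a < ?N" "b < ?N" by (auto simp: op_mat_def char_matrix_def)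
    have "sites shell m n ! a \<in> block m n" using ab G by (metis nth_mem)
    moreover have "sites shell m n ! b \<in> block m n" using ab G by (metis nth_mem)
    ultimately have "fn (?H (delta_l2 (sites shell m n ! b))) (sites shell m n ! a) = h (sites shell m n ! a) (sites shell m n ! b)"
      by (simp add: fn_Hc if_distrib[of "(*) _"] sum.delta cong: if_cong)
    then show "M $$ (a, b) = char_matrix (op_mat ?H) z $$ (a, b)"
      using ab by (simp add: M_def hop_compression_def Let_def char_matrix_def op_mat_def)
  qed (auto simp: M_def hop_compression_def Let_def op_mat_def char_matrix_def)
  have Mc: "M \<in> carrier_mat ?N ?N" unfolding M_eq by simp
  have "det M \<noteq> 0" using resolvent_family(3)[OF z] by (simp add: M_eq)
  then have "mat_inverse M \<noteq> None" using mat_inverse(1)[OF Mc, where b = "()"] det_non_zero_imp_unit[OF Mc, where b = "()"] by blast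
  then obtain B where "mat_inverse M = Some B" by auto
  then have B: "the (mat_inverse M) = B" "B * M = 1\<^sub>m ?N" "B \<in> carrier_mat ?N ?N" using mat_inverse(2)[OF Mc] by auto
  define X where "X = res m n z (bvec m n j)"
  have X: "X \<in> supp_in (block m n)" "?H X - scaleC z X = bvec m n j"
    unfolding X_def using res[OF z bvec_supp[OF mn]] by auto
  have "M *\<^sub>v tv X = tv (bvec m n j)"
    unfolding M_eq X(2)[symmetric]
    by (rule tv_shift[symmetric, OF Hc_add[OF finite_block] Hc_scaleC[OF finite_block]]) (simp_all add: G X Hc_supp)
  then have "B *\<^sub>v tv (bvec m n j) = (B * M) *\<^sub>v tv X"
    using assoc_mult_mat_vec[OF B(3) Mc tv_dim(1)[of X]] by simp
  then have BX: "B *\<^sub>v col F j = tv X" unfolding F_def boundary_cols_tv(1)[OF mn j] using B(2) by simp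
  have Fa: "mat_adjoint F \<in> carrier_mat (r m + r (Suc n)) ?N" by (rule mat_adjoint_carrier[OF F])
  have "boundary_resolvent_raw shell h Ups Phi m n z = mat_adjoint F * B * F"
    unfolding boundary_resolvent_raw_def Let_def F_def[symmetric] M_def[symmetric] B(1) ..
  also have "\<dots> = mat_adjoint F * (B * F)" by (rule assoc_mult_mat[OF Fa B(3) F])
  also have "\<dots> $$ (i, j) = row (mat_adjoint F) i \<bullet> col (B * F) j" using Fa F B(3) i j by simp
  also have "col (B * F) j = tv X" using BX col_mult2[OF B(3) F j] by simp
  also have "row (mat_adjoint F) i \<bullet> tv X = (\<Sum>a<?N. cnj (vec_index (tv (bvec m n i)) a) * vec_index (tv X) a)"
  proof -
    have "vec_index (row (mat_adjoint F) i) a = cnj (vec_index (tv (bvec m n i)) a)" if "a < ?N" for a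
    proof -
      have "vec_index (row (mat_adjoint F) i) a = cnj (vec_index (col F i) a)"
        using F Fa i that by (simp add: mat_adjoint_index)
      then show ?thesis unfolding F_def boundary_cols_tv(1)[OF mn i] .
    qed
    then show ?thesis by (simp add: scalar_prod_def lessThan_atLeast0)
  qed
  also have "\<dots> = cinner (bvec m n i) X" using bvec_supp[OF mn] by (intro cinner_tv[symmetric]) (simp add: G)
  finally show ?thesis by (simp add: X_def)
qed

text \<open>Off the eigenvalues of the compression the raw entries are already analytic, so
  \<open>remove_sings\<close> leaves them unchanged there.\<close>

lemma boundary_resolvent_eq:
  assumes mn: "m \<le> n" and z: "z \<notin> evs m n" and i: "i < r m + r (Suc n)" and j: "j < r m + r (Suc n)"
  shows "boundary_resolvent shell h Ups Phi m n z $$ (i, j) = cinner (bvec m n i) (res m n z (bvec m n j))"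
    and "(\<lambda>w. boundary_resolvent shell h Ups Phi m n w $$ (i, j)) analytic_on {z}"
proof -
  have op: "open (- evs m n)" by (intro open_Compl finite_imp_closed resolvent_family(1))
  from resolvent_family(2)[OF bvec_supp[OF mn, of j]] obtain \<psi> where
    \<psi>: "\<forall>z. z \<notin> evs m n \<longrightarrow> \<psi> z \<in> supp_in (block m n) \<and> Hc (block m n) (\<psi> z) - scaleC z (\<psi> z) = bvec m n j"
    and hol: "\<forall>u. (\<lambda>z. cinner u (\<psi> z)) holomorphic_on (- evs m n)" by (elim exE conjE)
  define f where "f = (\<lambda>w. boundary_resolvent_raw shell h Ups Phi m n w $$ (i, j))"
  have f: "f w = cinner (bvec m n i) (\<psi> w)" if "w \<notin> evs m n" for w
  proof -
    have "res m n w (bvec m n j) = \<psi> w" using \<psi> that by (intro res_unique) auto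
    then show ?thesis using raw_eq[OF mn that i j] by (simp add: f_def)
  qed
  have "f holomorphic_on (- evs m n)" using hol by (subst holomorphic_cong[OF refl f]) auto
  then have an: "f analytic_on {w}" if "w \<notin> evs m n" for w
    using that op by (auto simp: analytic_at)
  have br: "boundary_resolvent shell h Ups Phi m n w $$ (i, j) = remove_sings f w" for w
    using i j by (simp add: boundary_resolvent_def Let_def f_def)
  have eq: "boundary_resolvent shell h Ups Phi m n w $$ (i, j) = f w" if "w \<notin> evs m n" for w
    using an[OF that] by (simp add: br)
  show "boundary_resolvent shell h Ups Phi m n z $$ (i, j) = cinner (bvec m n i) (res m n z (bvec m n j))"
    using eq[OF z] raw_eq[OF mn z i j] by (simp add: f_def)
  have "(\<lambda>w. boundary_resolvent shell h Ups Phi m n w $$ (i, j)) holomorphic_on (- evs m n)"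
    using \<open>f holomorphic_on _\<close> by (subst holomorphic_cong[OF refl eq]) auto
  then show "(\<lambda>w. boundary_resolvent shell h Ups Phi m n w $$ (i, j)) analytic_on {z}"
    using z op by (auto simp: analytic_at)
qed

lemma singular_set_evs: assumes mn: "m \<le> n" shows "singular_set shell h Ups Phi m n \<subseteq> evs m n"
proof
  fix z assume "z \<in> singular_set shell h Ups Phi m n"
  then obtain i j where "i < r m + r (Suc n)" "j < r m + r (Suc n)"
    "\<not> (\<lambda>w. boundary_resolvent shell h Ups Phi m n w $$ (i, j)) analytic_on {z}"
    unfolding singular_set_def Let_def by blast
  then show "z \<in> evs m n" using boundary_resolvent_eq(2)[OF mn, of z i j] by blast
qed

lemma beta_eq:
  assumes "m \<le> n" "complex_of_real t \<notin> evs m n" "i < r m" "k < r (Suc n)"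
  shows "beta shell h Ups Phi m n t $$ (i, k) = cinner (ups m i) (res m n t (phi n k))"
  using assms by (simp add: beta_def boundary_resolvent_eq(1) bvec_def)

lemma gamma_eq:
  assumes "m \<le> n" "complex_of_real t \<notin> evs m n" "i < r m" "k < r (Suc n)"
  shows "gamma shell h Ups Phi m n t $$ (k, i) = cinner (phi n k) (res m n t (ups m i))"
  using assms by (simp add: gamma_def boundary_resolvent_eq(1) bvec_def)

lemma delta_eq:
  assumes "m \<le> n" "complex_of_real t \<notin> evs m n" "l < r (Suc n)" "k < r (Suc n)"
  shows "delta shell h Ups Phi m n t $$ (k, l) = cinner (phi n k) (res m n t (phi n l))"
  using assms by (simp add: delta_def boundary_resolvent_eq(1) bvec_def)

lemma alpha_eq:
  assumes "m \<le> n" "z \<notin> evs m n" "i < r m" "j < r m"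
  shows "boundary_resolvent shell h Ups Phi m n z $$ (i, j) = cinner (ups m i) (res m n z (ups m j))"
  using assms by (simp add: boundary_resolvent_eq(1) bvec_def)

lemma block_supp_shell: "ups m i \<in> supp_in (block m n)" "phi n k \<in> supp_in (block m n)" if "m \<le> n"
  using that ups_supp[of m i] phi_supp[of n k] supp_shell_block[of m m n] supp_shell_block[of m n n] by auto

lemma beta_gamma:
  assumes "m \<le> n" "complex_of_real t \<notin> evs m n" "i < r m" "k < r (Suc n)"
  shows "beta shell h Ups Phi m n t $$ (i, k) = cnj (cinner (phi n k) (res m n t (ups m i)))"
  unfolding beta_eq[OF assms] using res_sym[OF assms(2) block_supp_shell(1)[OF assms(1), of i] block_supp_shell(2)[OF assms(1), of k]]
  by (metis cinner_commute)

lemma r0 [simp]: "r 0 = 1" by (simp add: hop_rank_def)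

subsection \<open>Generic nonvanishing of the off-diagonal block\<close>

text \<open>Suppose all amplitudes at the outermost shell vanish. The part of the solution on that
  shell is the one-shell resolvent driven by the amplitudes arriving from inside; full row rank of
  the one-shell \<open>beta\<close> forces these to be zero. The solution then lives on the smaller
  block and solves the equation there, against the induction hypothesis.\<close>

lemma gamma_nonzero:
  assumes "\<And>k. k \<le> n \<Longrightarrow> complex_of_real t \<notin> evs 0 k \<and> complex_of_real t \<notin> evs k k \<and>
      mrank (beta shell h Ups Phi k k t) = r k"
  shows "\<exists>k<r (Suc n). cinner (phi n k) (res 0 n t v) \<noteq> 0"
  using assms
proof (induction n)
  case 0
  show ?case
  proof (rule ccontr)
    assume "\<not> ?thesis"
    then have 0: "cinner (phi 0 k) (res 0 0 t v) = 0" if "k < r (Suc 0)" for k using that by blast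
    have bc: "beta shell h Ups Phi 0 0 t \<in> carrier_mat (r 0) (r (Suc 0))" by (simp add: beta_def)
    have "(1 :: complex) = 0"
    proof (rule full_row_rank_injective[OF bc, where y = "\<lambda>_. 1" and i = 0])
      show "mrank (beta shell h Ups Phi 0 0 t) = r 0" using "0.prems" by blast
      show "(\<Sum>i<r 0. cnj 1 * beta shell h Ups Phi 0 0 t $$ (i, j)) = 0" if "j < r (Suc 0)" for j
        using beta_gamma[of 0 0 t 0 j] 0[OF that] "0.prems"[of 0] that by (simp add: v_def)
    qed simp
    then show False by simp
  qed
next
  case (Suc n)
  let ?n = "Suc n"
  show ?case
  proof (rule ccontr)
    assume "\<not> ?thesis"
    then have 0: "cinner (phi ?n k) (res 0 ?n t v) = 0" if "k < r (Suc ?n)" for k using that by blast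
    have ne: "complex_of_real t \<notin> evs 0 ?n" "complex_of_real t \<notin> evs ?n ?n" "mrank (beta shell h Ups Phi ?n ?n t) = r ?n"
      using Suc.prems by blast+
    have ne': "complex_of_real t \<notin> evs 0 n" using Suc.prems[of n] by simp
    define X where "X = res 0 ?n t v"
    have X: "X \<in> supp_in (Gn ?n)" "Hc (Gn ?n) X - scaleC t X = v" unfolding X_def using res[OF ne(1) v_supp] by auto
    define Y where "Y = restr (block ?n ?n) X"
    define c where "c = (\<lambda>j. cinner (phi n j) X)"
    have Gs: "Gn ?n = Gn n \<union> block ?n ?n" "Gn n \<inter> block ?n ?n = {}"
      by (auto simp: block_eq le_Suc_eq dest: shell_unique)
    have bs: "block ?n ?n = set (shell ?n)" by (simp add: block_eq)
    have cX: "c j = cinner (phi n j) (restr (Gn n) X)" for j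
      unfolding c_def using restr_sym[of "Gn n" "phi n j" X] restr_id[OF phi_supp_G[of n j]] by simp
    \<comment> \<open>On the last shell the compression splits into the one-shell operator and the
      input from inside, which depends on \<open>X\<close> only through the amplitudes
      \<open>c\<close>.\<close>
    have hopn: "fn (Hc (Gn ?n) X) a = fn (Hc (block ?n ?n) Y) a - (\<Sum>j<r ?n. fn (ups ?n j) a * c j)" if a: "a \<in> block ?n ?n" for a
    proof -
      have "fn (Hc (Gn ?n) X) a = (\<Sum>b\<in>Gn n. h a b * fn X b) + (\<Sum>b\<in>block ?n ?n. h a b * fn X b)"
        using a Gs by (simp add: fn_Hc sum.union_disjoint)
      also have "(\<Sum>b\<in>block ?n ?n. h a b * fn X b) = fn (Hc (block ?n ?n) Y) a" using a by (simp add: fn_Hc Y_def)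
      also have "(\<Sum>b\<in>Gn n. h a b * fn X b) = hop h (fn (restr (Gn n) X)) a"
        by (subst hop_supp[OF restr_supp[of "Gn n"]]) auto
      also have "\<dots> = - (\<Sum>j<r ?n. fn (ups ?n j) a * c j)"
        unfolding cX using a bs by (intro hop_outside_next[OF restr_supp]) auto
      finally show ?thesis by simp
    qed
    have Ys: "Y \<in> supp_in (block ?n ?n)" by (simp add: Y_def restr_supp)
    have Yeq: "Hc (block ?n ?n) Y - scaleC t Y = (\<Sum>j<r ?n. scaleC (c j) (ups ?n j))"
    proof (rule supp_in_eqI[of _ "block ?n ?n"])
      show "Hc (block ?n ?n) Y - scaleC t Y \<in> supp_in (block ?n ?n)" using Ys by (simp add: Hc_supp)
      show "(\<Sum>j<r ?n. scaleC (c j) (ups ?n j)) \<in> supp_in (block ?n ?n)" using ups_supp[of ?n] by (simp add: bs)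
      fix a assume a: "a \<in> block ?n ?n"
      have v0: "fn v a = 0"
      proof -
        have "a \<notin> Gn 0" using a shell_disjoint[of ?n 0] by (auto simp: block_eq)
        then show ?thesis using v_supp[of 0] by (simp add: supp_in_def)
      qed
      have ve: "fn v a = fn (Hc (Gn ?n) X) a - complex_of_real t * fn X a" using X(2) by (metis fn_minus fn_scaleC)
      show "fn (Hc (block ?n ?n) Y - scaleC t Y) a = fn (\<Sum>j<r ?n. scaleC (c j) (ups ?n j)) a"
      proof -
        have S: "(\<Sum>j<r ?n. c j * fn (ups ?n j) a) = (\<Sum>j<r ?n. fn (ups ?n j) a * c j)" by (simp add: mult.commute)
        have Ya: "fn Y a = fn X a" using a by (simp add: Y_def)
        have "fn (Hc (block ?n ?n) Y) a - complex_of_real t * fn X a = (\<Sum>j<r ?n. fn (ups ?n j) a * c j)"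
          using v0 ve hopn[OF a] by (simp add: algebra_simps)
        then show ?thesis by (simp add: S Ya)
      qed
    qed
    have Yres: "Y = (\<Sum>j<r ?n. scaleC (c j) (res ?n ?n t (ups ?n j)))"
      using res_unique[OF ne(2) Ys Yeq] res_scale_sum[OF ne(2), of "{..<r ?n}" "ups ?n" c] block_supp_shell(1)[of ?n ?n] by simp
    have c0: "c j = 0" if j: "j < r ?n" for j
    proof -
      have bc: "beta shell h Ups Phi ?n ?n t \<in> carrier_mat (r ?n) (r (Suc ?n))" by (simp add: beta_def)
      show ?thesis
      proof (rule full_row_rank_injective[OF bc ne(3) _ j])
        fix k assume k: "k < r (Suc ?n)"
        have "cinner (phi ?n k) X = cinner (phi ?n k) Y"
          unfolding Y_def using restr_sym[of "block ?n ?n" "phi ?n k" X] restr_id[OF block_supp_shell(2)[of ?n ?n k]] by simp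
        then have "cinner (phi ?n k) Y = 0" using 0[OF k] by (simp add: X_def)
        then have "(\<Sum>j<r ?n. c j * cinner (phi ?n k) (res ?n ?n t (ups ?n j))) = 0"
          unfolding Yres by (simp add: cinner_sum_right cinner_scaleC_right)
        then have "cnj (\<Sum>j<r ?n. c j * cinner (phi ?n k) (res ?n ?n t (ups ?n j))) = 0" by simp
        then show "(\<Sum>i<r ?n. cnj (c i) * beta shell h Ups Phi ?n ?n t $$ (i, k)) = 0"
          using beta_gamma[OF le_refl ne(2) _ k] by simp
      qed
    qed
    then have "Y = 0" unfolding Yres by simp
    then have Y0: "fn Y a = 0" for a by simp
    have "fn X a = 0" if a: "a \<notin> Gn n" for a
    proof (cases "a \<in> block ?n ?n")
      case True
      then show ?thesis using Y0[of a] by (simp add: Y_def)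
    next
      case False
      then have "a \<notin> Gn ?n" using a Gs(1) by blast
      then show ?thesis using X(1) by (simp add: supp_in_def)
    qed
    \<comment> \<open>With nothing on the last shell, \<open>X\<close> is the solution for the
      smaller block, and its amplitudes there are the numbers \<open>c j\<close>, all zero.\<close>
    then have Xn: "X \<in> supp_in (Gn n)" by (simp add: supp_in_def)
    have "Hc (Gn n) X - scaleC t X = v"
    proof (rule supp_in_eqI[of _ "Gn n"])
      show "Hc (Gn n) X - scaleC t X \<in> supp_in (Gn n)" using Xn by (simp add: Hc_supp)
      show "v \<in> supp_in (Gn n)" by (rule v_supp)
      fix a assume a: "a \<in> Gn n"
      have "fn (Hc (Gn ?n) X) a = fn (Hc (Gn n) X) a"
      proof -
        have "X \<in> supp_in (Gn ?n)" by (rule X(1))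
        then show ?thesis using a Gs(1) Xn by (simp add: Hc_def restr_id)
      qed
      then show "fn (Hc (Gn n) X - scaleC t X) a = fn v a" using X(2) by (metis fn_minus)
    qed
    then have "res 0 n t v = X" by (intro res_unique[OF ne' Xn])
    moreover have "\<exists>k<r (Suc n). cinner (phi n k) (res 0 n t v) \<noteq> 0" using Suc by auto
    ultimately show False using c0 by (auto simp: c_def)
  qed
qed

lemma ae_not_finite_complex: assumes "finite Z" shows "AE t in lborel. complex_of_real t \<notin> Z"
proof -
  have "finite {t. complex_of_real t \<in> Z}"
    using finite_vimageI[OF assms, of complex_of_real] by (simp add: vimage_def inj_on_def)
  then have "{t. complex_of_real t \<in> Z} \<in> null_sets lborel" by (intro finite_imp_null_set_lborel)
  then have "AE t in lborel. t \<notin> {t. complex_of_real t \<in> Z}" by (rule AE_not_in)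
  then show ?thesis by simp
qed

text \<open>Since \<open>r 0 = 1\<close>, the matrix \<open>beta\<close> from shell \<open>0\<close>
  is a single row and has full rank as soon as one entry is nonzero. Countably many null sets are
  discarded, one for each shell condition.\<close>

lemma ae_regular:
  assumes A2: "\<forall>n. AE l in lborel. mrank (beta shell h Ups Phi n n (complex_of_real l)) = r n"
  shows "AE t in lborel. complex_of_real t \<notin> evs 0 n \<and> complex_of_real t \<notin> exceptional_set shell h Ups Phi 0 n"
proof -
  have "AE t in lborel. \<forall>k. complex_of_real t \<notin> evs 0 k \<and> complex_of_real t \<notin> evs k k \<and>
      mrank (beta shell h Ups Phi k k t) = r k"
    using ae_not_finite_complex[OF resolvent_family(1)] A2
    by (simp add: AE_all_countable)
  then show ?thesis
  proof eventually_elim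
    case (elim t)
    have e: "complex_of_real t \<notin> evs 0 n" using elim by blast
    obtain k where k: "k < r (Suc n)" "cinner (phi n k) (res 0 n t v) \<noteq> 0" using gamma_nonzero[of n t] elim by blast
    have "beta shell h Ups Phi 0 n t $$ (0, k) \<noteq> 0" using beta_gamma[of 0 n t 0 k] e k by (simp add: v_def)
    then have "mrank (beta shell h Ups Phi 0 n t) \<ge> 1"
      using k by (intro mrank_pos[of _ 1 "r (Suc n)" 0 k]) (auto simp: beta_def)
    then show ?case using e singular_set_evs[of 0 n] by (auto simp: exceptional_set_def)
  qed
qed

subsection \<open>Transfer matrices control the density\<close>

text \<open>This is \<open>(1 - i \<delta>) x0 = \<gamma>\<close>. The coupling term is moved to the
  right-hand side and the undamped resolvent applied; subtracting \<open>Q n v\<close> from the root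
  vector does not change the outgoing amplitudes.\<close>

lemma x0_equation:
  assumes t: "complex_of_real t \<notin> evs 0 n" and k: "k < r (Suc n)"
  defines "x0 \<equiv> \<lambda>k. cinner (phi n k) (psi n (complex_of_real t))"
  shows "x0 k = cinner (phi n k) (res 0 n t v) + \<i> * (\<Sum>l<r (Suc n). x0 l * cinner (phi n k) (res 0 n t (phi n l)))"
proof -
  let ?X = "psi n (complex_of_real t)" and ?H = "Hc (Gn n)"
  have X: "?X \<in> supp_in (Gn n)" "Ad n ?X - scaleC t ?X = v1 n" "Q n ?X = 0"
    using psi[of "complex_of_real t" n] psi_Q[of "complex_of_real t" n] by simp_all
  define Y where "Y = res 0 n t (Q n v)"
  have QvS: "Q n v \<in> supp_in (Gn n)" using K_supp Q_K by blast
  have ps: "phi n l \<in> supp_in (Gn n)" for l by (rule phi_supp_G)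
  \<comment> \<open>An eigenvector in \<open>eigv n\<close> is orthogonal to \<open>phi n k\<close>,
    hence by symmetry to the resolvent of \<open>phi n k\<close>; this passes to all of
    \<open>K n\<close> and in particular to \<open>Q n v\<close>.\<close>
  have Yo: "cinner (phi n k) Y = 0"
  proof -
    have "cinner (res 0 n t (phi n k)) e = 0" if e: "e \<in> eigv n" for e
    proof -
      obtain l :: real where l: "?H e = scaleR l e" "cinner (phi n k) e = 0" using eigvD[OF e] k by metis
      have es: "e \<in> supp_in (Gn n)" using e by (simp add: eigv_def)
      let ?R = "res 0 n t (phi n k)"
      have "0 = cinner (?H ?R - scaleC t ?R) e" using res(2)[OF t ps[of k]] l(2) by simp
      also have "\<dots> = cinner ?R (?H e) - complex_of_real t * cinner ?R e"
        using Hc_sym[OF finite_block, of ?R 0 n e] by (simp add: cinner_simps)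
      also have "\<dots> = complex_of_real (l - t) * cinner ?R e" by (simp add: l(1) scaleR_l2_def cinner_scaleC_right algebra_simps)
      finally have "l = t \<or> cinner ?R e = 0" by auto
      moreover have "e = 0" if "l = t"
        using t es l(1) that unfolding evs_def by (auto simp: scaleC_of_real)
      ultimately show ?thesis by auto
    qed
    then have "eigv n \<subseteq> {x. cinner (res 0 n t (phi n k)) x = 0}" by blast
    then have "K n \<subseteq> {x. cinner (res 0 n t (phi n k)) x = 0}" by (intro K_subset subspace_orth closed_orth)
    then have "cinner (res 0 n t (phi n k)) (Q n v) = 0" using Q_K by blast
    then show ?thesis using res_sym[OF t ps QvS, of k] by (simp add: Y_def)
  qed
  define W where "W = (\<Sum>l<r (Suc n). scaleC (x0 l) (phi n l))"
  have Wb: "W = bnd n ?X" by (simp add: W_def bnd_def x0_def)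
  have "?H ?X - scaleC t ?X = v1 n + scaleC \<i> W" using X(2) unfolding Ad_def X(3) Wb by (simp add: algebra_simps)
  then have eqX: "?H ?X - scaleC t ?X = v - Q n v + scaleC \<i> W" by (simp add: v1_def)
  have RW: "res 0 n t W = (\<Sum>l<r (Suc n). scaleC (x0 l) (res 0 n t (phi n l)))"
    unfolding W_def by (intro res_scale_sum[OF t]) (auto intro: ps)
  have Ws: "W \<in> supp_in (Gn n)" unfolding Wb by (rule bnd_supp)
  define Z where "Z = res 0 n t v - Y + scaleC \<i> (res 0 n t W)"
  note rv = res[OF t v_supp] and rY = res[OF t QvS, folded Y_def] and rW = res[OF t Ws]
  have "Z \<in> supp_in (Gn n)" using rv(1) rY(1) rW(1) by (simp add: Z_def)
  moreover have "?H Z - scaleC t Z = v - Q n v + scaleC \<i> W"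
  proof -
    have "?H Z - scaleC t Z = (?H (res 0 n t v) - scaleC t (res 0 n t v)) - (?H Y - scaleC t Y) + scaleC \<i> (?H (res 0 n t W) - scaleC t (res 0 n t W))"
      by (simp add: Z_def Hc_add Hc_diff Hc_scaleC scaleC_add_right scaleC_diff_right mult.commute algebra_simps)
    then show ?thesis using rv(2) rY(2) rW(2) by simp
  qed
  ultimately have "Z = ?X" using res_unique[OF t, of Z] res_unique[OF t X(1) eqX] by simp
  then have "x0 k = cinner (phi n k) Z" by (simp add: x0_def)
  also have "\<dots> = cinner (phi n k) (res 0 n t v) + \<i> * (\<Sum>l<r (Suc n). x0 l * cinner (phi n k) (res 0 n t (phi n l)))"
    unfolding Z_def RW by (simp add: cinner_simps Yo)
  finally show ?thesis .
qed

end

section \<open>Cayley transform inequalities for Hermitian matrices\<close>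

lemma hermitian_form_real:
  fixes d :: "nat \<Rightarrow> nat \<Rightarrow> complex"
  assumes "\<And>k l. k < m \<Longrightarrow> l < m \<Longrightarrow> d k l = cnj (d l k)"
  shows "Im (\<Sum>k<m. \<Sum>l<m. cnj (e k) * (d k l * e l)) = 0"
proof -
  have hc: "cnj (d k l) = d l k" if "k < m" "l < m" for k l using assms[OF that(2,1)] by simp
  have "cnj (\<Sum>k<m. \<Sum>l<m. cnj (e k) * (d k l * e l)) = (\<Sum>k<m. \<Sum>l<m. e k * (cnj (d k l) * cnj (e l)))" by simp
  also have "\<dots> = (\<Sum>k<m. \<Sum>l<m. cnj (e l) * (d l k * e k))"
    by (intro sum.cong) (auto simp: hc mult_ac)
  also have "\<dots> = (\<Sum>k<m. \<Sum>l<m. cnj (e k) * (d k l * e l))" by (rule sum.swap)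
  finally have "Im (cnj (\<Sum>k<m. \<Sum>l<m. cnj (e k) * (d k l * e l))) = Im (\<Sum>k<m. \<Sum>l<m. cnj (e k) * (d k l * e l))"
    by (simp only:)
  then show ?thesis unfolding cnj.sel by linarith
qed

text \<open>Splitting \<open>y - d x\<close> as \<open>(1 - i d) a + (1 + i d) b\<close> and using that \<open>(1 - i d)\<close> and \<open>(1 + i d)\<close>
  differ by a unitary factor.\<close>

lemma cayley_upper:
  fixes d :: "nat \<Rightarrow> nat \<Rightarrow> complex" and x0 x y :: "nat \<Rightarrow> complex"
  assumes herm: "\<And>k l. k < m \<Longrightarrow> l < m \<Longrightarrow> d k l = cnj (d l k)"
    and eq: "\<And>k. k < m \<Longrightarrow> x0 k - \<i> * (\<Sum>l<m. d k l * x0 l) = y k - (\<Sum>l<m. d k l * x l)"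
  shows "(\<Sum>k<m. (cmod (x0 k))\<^sup>2) \<le> (\<Sum>k<m. (cmod (x k))\<^sup>2) + (\<Sum>k<m. (cmod (y k))\<^sup>2)"
proof -
  define a where "a = (\<lambda>k. (y k - \<i> * x k) / 2)"
  define b where "b = (\<lambda>k. (y k + \<i> * x k) / 2)"
  define c where "c = (\<lambda>k. x0 k - a k)"
  define e where "e = (\<lambda>k. c k + b k)"
  \<comment> \<open>Equivalently \<open>(1 - i d) c = (1 + i d) b\<close>. As \<open>d\<close> is
    Hermitian, the form of \<open>i d\<close> at \<open>e = c + b\<close> is purely imaginary,
    whence \<open>c\<close> and \<open>b\<close> have equal norm.\<close>
  have cb: "c k - b k = \<i> * (\<Sum>l<m. d k l * e l)" if "k < m" for k
  proof -
    have "e l = x0 l + \<i> * x l" for l by (simp add: e_def c_def a_def b_def field_simps)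
    then have "\<i> * (\<Sum>l<m. d k l * e l) = (\<Sum>l<m. \<i> * (d k l * x0 l) - d k l * x l)"
      unfolding sum_distrib_left by (intro sum.cong) (auto simp: algebra_simps)
    also have "\<dots> = \<i> * (\<Sum>l<m. d k l * x0 l) - (\<Sum>l<m. d k l * x l)"
      by (simp add: sum_subtractf sum_distrib_left)
    also have "\<dots> = x0 k - y k" using eq[OF that] by (simp add: algebra_simps)
    also have "\<dots> = c k - b k" by (simp add: c_def a_def b_def field_simps)
    finally show ?thesis by simp
  qed
  have "(\<Sum>k<m. cnj (e k) * (c k - b k)) = \<i> * (\<Sum>k<m. \<Sum>l<m. cnj (e k) * (d k l * e l))"
    by (simp add: cb sum_distrib_left mult.left_commute)
  then have "Re (\<Sum>k<m. cnj (e k) * (c k - b k)) = 0"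
    using hermitian_form_real[OF herm, where e = e and m = m] by simp
  then have "(\<Sum>k<m. Re (cnj (e k) * (c k - b k))) = 0" by (simp only: Re_sum)
  moreover have "Re (cnj (e k) * (c k - b k)) = (cmod (c k))\<^sup>2 - (cmod (b k))\<^sup>2" for k
    unfolding cmod_power2 by (simp add: e_def algebra_simps power2_eq_square)
  ultimately have cb2: "(\<Sum>k<m. (cmod (c k))\<^sup>2) = (\<Sum>k<m. (cmod (b k))\<^sup>2)" by (simp only: sum_subtractf)
  have "(cmod (x0 k))\<^sup>2 \<le> 2 * (cmod (a k))\<^sup>2 + 2 * (cmod (c k))\<^sup>2" for k
  proof -
    have "(cmod (x0 k))\<^sup>2 \<le> (cmod (a k) + cmod (c k))\<^sup>2"
      using norm_triangle_ineq[of "a k" "c k"] by (intro power_mono) (auto simp: c_def)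
    also have "\<dots> \<le> 2 * (cmod (a k))\<^sup>2 + 2 * (cmod (c k))\<^sup>2"
      using sum_squares_bound[of "cmod (a k)" "cmod (c k)"] by (simp add: power2_sum)
    finally show ?thesis .
  qed
  then have "(\<Sum>k<m. (cmod (x0 k))\<^sup>2) \<le> (\<Sum>k<m. 2 * (cmod (a k))\<^sup>2 + 2 * (cmod (c k))\<^sup>2)" by (intro sum_mono)
  also have "\<dots> = (\<Sum>k<m. 2 * (cmod (a k))\<^sup>2 + 2 * (cmod (b k))\<^sup>2)"
    using cb2 by (simp add: sum.distrib flip: sum_distrib_left)
  \<comment> \<open>Parallelogram identity: \<open>a\<close> and \<open>b\<close> are half the
    difference and half the sum of \<open>y\<close> and \<open>i x\<close>.\<close>
  also have "\<dots> = (\<Sum>k<m. (cmod (x k))\<^sup>2 + (cmod (y k))\<^sup>2)"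
  proof (rule sum.cong)
    fix k show "2 * (cmod (a k))\<^sup>2 + 2 * (cmod (b k))\<^sup>2 = (cmod (x k))\<^sup>2 + (cmod (y k))\<^sup>2"
      unfolding a_def b_def cmod_power2 by (simp add: power2_eq_square field_simps)
  qed simp
  finally show ?thesis by (simp add: sum.distrib)
qed

text \<open>Inserting \<open>g = (1 - i d) x0\<close> and moving \<open>d\<close> to the other side
  turns the normalisation into \<open>1 = <x0, (1 + i d) B>\<close>; Cauchy-Schwarz then applies,
  and the factor \<open>2\<close> separates \<open>B\<close> from \<open>d B\<close>.\<close>

lemma cayley_lower:
  fixes d :: "nat \<Rightarrow> nat \<Rightarrow> complex" and x0 g B :: "nat \<Rightarrow> complex"
  assumes herm: "\<And>k l. k < m \<Longrightarrow> l < m \<Longrightarrow> d k l = cnj (d l k)"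
    and eq: "\<And>k. k < m \<Longrightarrow> x0 k - \<i> * (\<Sum>l<m. d k l * x0 l) = g k"
    and one: "(\<Sum>k<m. cnj (g k) * B k) = 1"
  shows "1 \<le> 2 * (\<Sum>k<m. (cmod (x0 k))\<^sup>2) * ((\<Sum>k<m. (cmod (B k))\<^sup>2) + (\<Sum>k<m. (cmod (\<Sum>l<m. d k l * B l))\<^sup>2))"
proof -
  define DB where "DB = (\<lambda>k. \<Sum>l<m. d k l * B l)"
  have hc: "cnj (d k l) = d l k" if "k < m" "l < m" for k l using herm[OF that(2,1)] by simp
  have "(\<Sum>k<m. (\<Sum>l<m. cnj (d k l) * cnj (x0 l)) * B k) = (\<Sum>k<m. \<Sum>l<m. cnj (x0 l) * (d l k * B k))"
    unfolding sum_distrib_right by (intro sum.cong refl) (auto simp: hc mult_ac)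
  also have "\<dots> = (\<Sum>l<m. \<Sum>k<m. cnj (x0 l) * (d l k * B k))" by (rule sum.swap)
  also have "\<dots> = (\<Sum>l<m. cnj (x0 l) * DB l)" by (simp add: DB_def sum_distrib_left)
  finally have s: "(\<Sum>k<m. (\<Sum>l<m. cnj (d k l) * cnj (x0 l)) * B k) = (\<Sum>l<m. cnj (x0 l) * DB l)" .
  define SS where "SS = (\<lambda>k. \<Sum>l<m. d k l * x0 l)"
  have s': "(\<Sum>k<m. cnj (SS k) * B k) = (\<Sum>l<m. cnj (x0 l) * DB l)" using s by (simp add: SS_def)
  have "1 = (\<Sum>k<m. cnj (x0 k - \<i> * SS k) * B k)" using eq one by (simp add: SS_def)
  also have "\<dots> = (\<Sum>k<m. cnj (x0 k) * B k + \<i> * (cnj (SS k) * B k))"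
    by (intro sum.cong) (auto simp: algebra_simps)
  also have "\<dots> = (\<Sum>k<m. cnj (x0 k) * B k) + \<i> * (\<Sum>k<m. cnj (SS k) * B k)"
    by (simp add: sum.distrib sum_distrib_left)
  also have "\<dots> = (\<Sum>k<m. cnj (x0 k) * (B k + \<i> * DB k))"
    unfolding s' by (simp add: distrib_left sum.distrib sum_distrib_left mult.left_commute)
  finally have "1 = cmod (\<Sum>k<m. cnj (x0 k) * (B k + \<i> * DB k))" by (metis norm_one)
  also have "\<dots> \<le> (\<Sum>k<m. cmod (x0 k) * cmod (B k + \<i> * DB k))"
    by (intro order_trans[OF norm_sum] sum_mono) (simp add: norm_mult)
  finally have "1\<^sup>2 \<le> (\<Sum>k<m. cmod (x0 k) * cmod (B k + \<i> * DB k))\<^sup>2" by (intro power_mono) auto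
  also have "\<dots> \<le> (\<Sum>k<m. (cmod (x0 k))\<^sup>2) * (\<Sum>k<m. (cmod (B k + \<i> * DB k))\<^sup>2)"
    by (rule Cauchy_Schwarz_ineq_sum)
  also have "\<dots> \<le> (\<Sum>k<m. (cmod (x0 k))\<^sup>2) * (\<Sum>k<m. 2 * (cmod (B k))\<^sup>2 + 2 * (cmod (DB k))\<^sup>2)"
  proof (intro mult_left_mono sum_mono)
    fix k
    have "(cmod (B k + \<i> * DB k))\<^sup>2 \<le> (cmod (B k) + cmod (DB k))\<^sup>2"
      using norm_triangle_ineq[of "B k" "\<i> * DB k"] by (intro power_mono) (auto simp: norm_mult)
    also have "\<dots> \<le> 2 * (cmod (B k))\<^sup>2 + 2 * (cmod (DB k))\<^sup>2"
      using sum_squares_bound[of "cmod (B k)" "cmod (DB k)"] by (simp add: power2_sum)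
    finally show "(cmod (B k + \<i> * DB k))\<^sup>2 \<le> 2 * (cmod (B k))\<^sup>2 + 2 * (cmod (DB k))\<^sup>2" .
  qed (simp add: sum_nonneg)
  also have "(\<Sum>k<m. 2 * (cmod (B k))\<^sup>2 + 2 * (cmod (DB k))\<^sup>2) = 2 * ((\<Sum>k<m. (cmod (B k))\<^sup>2) + (\<Sum>k<m. (cmod (DB k))\<^sup>2))"
    unfolding distrib_left sum.distrib sum_distrib_left ..
  finally show ?thesis unfolding DB_def by (simp only: one_power2 mult.assoc mult.left_commute[of _ 2])
qed

lemma vec_l2norm_power2: "(vec_l2norm w)\<^sup>2 = (\<Sum>i<dim_vec w. (cmod (vec_index w i))\<^sup>2)"
  by (simp add: vec_l2norm_def sum_nonneg)

lemma vec_l2norm_nonneg: "vec_l2norm w \<ge> 0" by (simp add: vec_l2norm_def sum_nonneg)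

text \<open>A real \<open>Sup\<close> controls its members only when the set is bounded above; the
  sum of the moduli of the entries is a crude bound.\<close>

lemma vec_l2norm_le_opnorm:
  assumes "v \<in> carrier_vec (dim_col A)" "vec_l2norm v \<le> 1"
  shows "vec_l2norm (A *\<^sub>v v) \<le> mat_opnorm A"
proof -
  have "vec_l2norm (A *\<^sub>v v) \<le> (\<Sum>i<dim_row A. \<Sum>j<dim_col A. cmod (A $$ (i, j)))"
    if v: "v \<in> carrier_vec (dim_col A)" "vec_l2norm v \<le> 1" for v
  proof -
    have vj: "cmod (vec_index v j) \<le> 1" if j: "j < dim_col A" for j
    proof -
      have "(cmod (vec_index v j))\<^sup>2 \<le> (\<Sum>i<dim_vec v. (cmod (vec_index v i))\<^sup>2)"
        using j v(1) by (intro member_le_sum) auto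
      also have "\<dots> \<le> 1\<^sup>2" unfolding vec_l2norm_power2[symmetric] using v(2) vec_l2norm_nonneg by (intro power_mono) auto
      finally show ?thesis by (rule power2_le_imp_le) simp
    qed
    have "vec_l2norm (A *\<^sub>v v) \<le> (\<Sum>i<dim_row A. cmod (vec_index (A *\<^sub>v v) i))"
      using L2_set_le_sum[of "{..<dim_row A}" "\<lambda>i. cmod (vec_index (A *\<^sub>v v) i)"] by (simp add: vec_l2norm_def L2_set_def)
    also have "\<dots> \<le> (\<Sum>i<dim_row A. \<Sum>j<dim_col A. cmod (A $$ (i, j)))"
    proof (rule sum_mono)
      fix i assume "i \<in> {..<dim_row A}"
      then have "vec_index (A *\<^sub>v v) i = (\<Sum>j<dim_col A. A $$ (i, j) * vec_index v j)"
        using v(1) by (simp add: scalar_prod_def lessThan_atLeast0)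
      also have "cmod \<dots> \<le> (\<Sum>j<dim_col A. cmod (A $$ (i, j)))"
        by (intro order_trans[OF norm_sum] sum_mono) (auto simp: norm_mult intro!: mult_left_le vj)
      finally show "cmod (vec_index (A *\<^sub>v v) i) \<le> (\<Sum>j<dim_col A. cmod (A $$ (i, j)))" .
    qed
    finally show ?thesis .
  qed
  then have "bdd_above {vec_l2norm (A *\<^sub>v v) | v. v \<in> carrier_vec (dim_col A) \<and> vec_l2norm v \<le> 1}"
    by (intro bdd_aboveI) blast
  then show ?thesis unfolding mat_opnorm_def using assms by (intro cSup_upper) auto
qed

lemma vec_l2norm_unit: "vec_l2norm (vec_of_list [1, 0]) = 1" "vec_l2norm (vec_of_list [0, 1]) = 1"
  unfolding vec_l2norm_def by (simp_all add: lessThan_Suc)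

context factored_hopping
begin

text \<open>Applied to \<open>(u, 1)\<close>, a transfer matrix yields
  \<open>(x, \<gamma> + \<delta> x)\<close> with \<open>x = u B - b\<close>, so
  \<open>y - \<delta> x = \<gamma> = (1 - i \<delta>) x0\<close> and \<open>cayley_upper\<close>
  applies for any \<open>u\<close>. Its first column is \<open>(B, \<delta> B)\<close>, and
  \<open>\<beta> B = 1\<close> says that \<open>\<gamma>\<close> paired with \<open>B\<close> is
  \<open>1\<close>, the normalisation in \<open>cayley_lower\<close>.\<close>

lemma transfer_bounds:
  assumes t: "complex_of_real t \<notin> evs 0 n" and M: "M \<in> transfer_set shell h Ups Phi 0 n (complex_of_real t)"
  shows "hn n t \<le> (vec_l2norm (M *\<^sub>v vec_of_list [u, 1]))\<^sup>2"
    and "1 \<le> 2 * hn n t * (vec_l2norm (M *\<^sub>v vec_of_list [1, 0]))\<^sup>2"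
    and "dim_col M = 2"
proof -
  let ?m = "r (Suc n)"
  define x0 where "x0 = (\<lambda>k. cinner (phi n k) (psi n (complex_of_real t)))"
  define gm where "gm = (\<lambda>k. cinner (phi n k) (res 0 n t v))"
  define d where "d = (\<lambda>k l. cinner (phi n k) (res 0 n t (phi n l)))"
  let ?D = "delta shell h Ups Phi 0 n t" and ?C = "gamma shell h Ups Phi 0 n t" and ?Be = "beta shell h Ups Phi 0 n t"
  have Dc: "?D \<in> carrier_mat ?m ?m" by (simp add: delta_def)
  have Cc: "?C \<in> carrier_mat ?m 1" by (simp add: gamma_def)
  have Bec: "?Be \<in> carrier_mat 1 ?m" by (simp add: beta_def)
  have D: "?D $$ (k, l) = d k l" if "k < ?m" "l < ?m" for k l using delta_eq[OF _ t that(2,1)] by (simp add: d_def)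
  have C: "?C $$ (k, 0) = gm k" if "k < ?m" for k using gamma_eq[OF _ t _ that, of 0] by (simp add: gm_def v_def)
  have Be: "?Be $$ (0, k) = cnj (gm k)" if "k < ?m" for k using beta_gamma[OF _ t _ that, of 0] by (simp add: gm_def v_def)
  have herm: "d k l = cnj (d l k)" for k l
    unfolding d_def using res_sym[OF t phi_supp_G phi_supp_G, of k l] by (metis cinner_commute)
  have x0eq: "x0 k - \<i> * (\<Sum>l<?m. d k l * x0 l) = gm k" if "k < ?m" for k
    using x0_equation[OF t that] by (simp add: x0_def gm_def d_def mult.commute)
  have hnx: "hn n t = (\<Sum>k<?m. (cmod (x0 k))\<^sup>2)" by (simp add: hn_def bq_def x0_def)
  obtain B b where Bb: "B \<in> carrier_mat ?m 1" "b \<in> carrier_mat ?m 1" "?Be * B = 1\<^sub>m 1"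
    and M_eq: "M = four_block_mat B (- b) (?D * B) (?C - ?D * b)"
    using M by (auto simp: transfer_set_def)
  have DB: "?D * B \<in> carrier_mat ?m 1" "?D * b \<in> carrier_mat ?m 1" using Dc Bb by auto
  have Mc: "M \<in> carrier_mat (?m + ?m) 2"
  proof -
    have "M \<in> carrier_mat (?m + ?m) (1 + 1)" unfolding M_eq by (rule four_block_carrier_mat[OF Bb(1) minus_carrier_mat[OF DB(2)]])
    then show ?thesis by (simp add: numeral_2_eq_2)
  qed
  then show "dim_col M = 2" by simp
  have DBi: "(?D * A) $$ (k, 0) = (\<Sum>l<?m. d k l * A $$ (l, 0))" if "k < ?m" "A \<in> carrier_mat ?m 1" for A k
    using that Dc D by (simp add: scalar_prod_def lessThan_atLeast0)
  have idx: "M $$ (k, 0) = B $$ (k, 0)" "M $$ (k, 1) = - b $$ (k, 0)"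
     "M $$ (?m + k, 0) = (\<Sum>l<?m. d k l * B $$ (l, 0))" "M $$ (?m + k, 1) = gm k - (\<Sum>l<?m. d k l * b $$ (l, 0))" if "k < ?m" for k
  proof -
    have "M $$ (?m + k, 0) = (?D * B) $$ (k, 0)" "M $$ (?m + k, 1) = (?C - ?D * b) $$ (k, 0)"
      unfolding M_eq using that Bb DB Cc Dc by (auto simp del: index_mult_mat(1))
    moreover have "(?C - ?D * b) $$ (k, 0) = ?C $$ (k, 0) - (?D * b) $$ (k, 0)"
      using that DB(2) by (intro index_minus_mat) auto
    ultimately show "M $$ (?m + k, 0) = (\<Sum>l<?m. d k l * B $$ (l, 0))" "M $$ (?m + k, 1) = gm k - (\<Sum>l<?m. d k l * b $$ (l, 0))"
      using DBi[OF that Bb(1)] DBi[OF that Bb(2)] C[OF that] by simp_all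
    show "M $$ (k, 0) = B $$ (k, 0)" "M $$ (k, 1) = - b $$ (k, 0)"
      unfolding M_eq using that Bb DB Cc Dc by (auto simp del: index_mult_mat(1))
  qed
  have mv: "vec_index (M *\<^sub>v vec_of_list [p, q]) i = M $$ (i, 0) * p + M $$ (i, 1) * q" if "i < ?m + ?m" for i p q
  proof -
    have "vec_index (M *\<^sub>v vec_of_list [p, q]) i = (\<Sum>j\<in>{0..<2}. M $$ (i, j) * vec_index (vec_of_list [p, q]) j)"
      using that Mc by (simp add: scalar_prod_def numeral_2_eq_2)
    then show ?thesis by (simp add: numeral_2_eq_2 vec_of_list_index)
  qed
  have nrm: "(vec_l2norm (M *\<^sub>v vec_of_list [p, q]))\<^sup>2 =
      (\<Sum>k<?m. (cmod (M $$ (k, 0) * p + M $$ (k, 1) * q))\<^sup>2) + (\<Sum>k<?m. (cmod (M $$ (?m + k, 0) * p + M $$ (?m + k, 1) * q))\<^sup>2)" for p q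
  proof -
    have "(vec_l2norm (M *\<^sub>v vec_of_list [p, q]))\<^sup>2 = (\<Sum>i<?m + ?m. (cmod (M $$ (i, 0) * p + M $$ (i, 1) * q))\<^sup>2)"
      unfolding vec_l2norm_power2 using Mc mv by (intro sum.cong) auto
    also have "\<dots> = (\<Sum>i<?m. (cmod (M $$ (i, 0) * p + M $$ (i, 1) * q))\<^sup>2) + (\<Sum>i=?m..<?m + ?m. (cmod (M $$ (i, 0) * p + M $$ (i, 1) * q))\<^sup>2)"
      by (simp add: lessThan_atLeast0 sum.atLeastLessThan_concat)
    also have "(\<Sum>i=?m..<?m + ?m. (cmod (M $$ (i, 0) * p + M $$ (i, 1) * q))\<^sup>2) = (\<Sum>k<?m. (cmod (M $$ (?m + k, 0) * p + M $$ (?m + k, 1) * q))\<^sup>2)"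
      using sum.shift_bounds_nat_ivl[of "\<lambda>i. (cmod (M $$ (i, 0) * p + M $$ (i, 1) * q))\<^sup>2" 0 ?m ?m]
      by (simp add: lessThan_atLeast0 add.commute)
    finally show ?thesis .
  qed
  define x where "x = (\<lambda>k. M $$ (k, 0) * u + M $$ (k, 1) * 1)"
  define y where "y = (\<lambda>k. M $$ (?m + k, 0) * u + M $$ (?m + k, 1) * 1)"
  have "y k = gm k + (\<Sum>l<?m. d k l * x l)" if "k < ?m" for k
  proof -
    have "(\<Sum>l<?m. d k l * x l) = (\<Sum>l<?m. d k l * B $$ (l, 0) * u - d k l * b $$ (l, 0))"
      by (intro sum.cong) (auto simp: x_def idx idx[unfolded One_nat_def] algebra_simps)
    also have "\<dots> = (\<Sum>l<?m. d k l * B $$ (l, 0)) * u - (\<Sum>l<?m. d k l * b $$ (l, 0))"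
      by (simp add: sum_subtractf sum_distrib_right)
    finally show ?thesis using that by (simp add: y_def idx idx[unfolded One_nat_def])
  qed
  then have "(\<Sum>k<?m. (cmod (x0 k))\<^sup>2) \<le> (\<Sum>k<?m. (cmod (x k))\<^sup>2) + (\<Sum>k<?m. (cmod (y k))\<^sup>2)"
    using x0eq by (intro cayley_upper[of ?m d]) (auto intro: herm)
  then show "hn n t \<le> (vec_l2norm (M *\<^sub>v vec_of_list [u, 1]))\<^sup>2" unfolding hnx nrm x_def y_def .
  have "(\<Sum>k<?m. cnj (gm k) * B $$ (k, 0)) = (?Be * B) $$ (0, 0)"
    using Bec Bb(1) Be by (simp add: scalar_prod_def lessThan_atLeast0)
  then have "(\<Sum>k<?m. cnj (gm k) * B $$ (k, 0)) = 1" using Bb(3) by simp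
  from cayley_lower[OF herm x0eq this]
  show "1 \<le> 2 * hn n t * (vec_l2norm (M *\<^sub>v vec_of_list [1, 0]))\<^sup>2"
    unfolding hnx nrm by (simp add: idx idx[unfolded One_nat_def])
qed

text \<open>Let \<open>f\<close> be the resolvent entry at the root vector. An eigenvector
  overlapping with \<open>v\<close> forces \<open>y * cmod (f (l + i y))\<close> to stay above a
  positive constant as \<open>y\<close> tends to \<open>0\<close>, which is impossible if
  \<open>f\<close> is analytic at \<open>l\<close>. The eigenvector fits into all large blocks, so
  \<open>l\<close> is a pole for all large \<open>n\<close>.\<close>

lemma eigenvalue_in_L:
  assumes e: "e \<in> eig" "T e = scaleR l e" and ov: "cinner e v \<noteq> 0"
  shows "l \<in> liminf_singular_set shell h Ups Phi"
proof -
  obtain m where em: "e \<in> supp_in (Gn m)" using e finsup_supp by (auto simp: eig_def)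
  have "complex_of_real l \<in> singular_set shell h Ups Phi 0 n" if n: "n \<ge> m" for n
  proof (rule ccontr)
    assume ns: "complex_of_real l \<notin> singular_set shell h Ups Phi 0 n"
    have es: "e \<in> supp_in (Gn n)" using em supp_Gn_mono[OF n] by blast
    define f where "f = (\<lambda>w. boundary_resolvent shell h Ups Phi 0 n w $$ (0, 0))"
    have "f analytic_on {complex_of_real l}"
      using ns unfolding singular_set_def Let_def f_def by auto
    then have cont: "isCont f (complex_of_real l)" by (rule analytic_at_imp_isCont)
    have He: "Hc (Gn n) e = scaleC l e" using phi_orth_iff[OF es, of l] e(2) by (simp add: scaleC_of_real)
    have low: "(cmod (cinner e v))\<^sup>2 \<le> (norm e)\<^sup>2 * (y * cmod (f (Complex l y)))" if y: "y > 0" for y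
    proof -
      let ?w = "Complex l y"
      have w: "?w \<notin> evs 0 n"
      proof
        assume "?w \<in> evs 0 n"
        then obtain x where x: "x \<noteq> 0" "Hc (Gn n) x = scaleC ?w x" by (auto simp: evs_def)
        have "Im (cinner x (Hc (Gn n) x)) = y * (norm x)\<^sup>2" unfolding x(2) by (simp add: cinner_simps cinner_norm)
        then show False using Hc_real[OF finite_block, of x 0 n] y x(1) by simp
      qed
      define X where "X = res 0 n ?w v"
      have X: "Hc (Gn n) X - scaleC ?w X = v" unfolding X_def by (rule res(2)[OF w v_supp])
      have fX: "f ?w = cinner v X" using alpha_eq[of 0 n ?w 0 0] w by (simp add: f_def X_def v_def)
      have "Im (cinner X (Hc (Gn n) X - scaleC ?w X)) = - y * (norm X)\<^sup>2"
        using Hc_real[OF finite_block, of X 0 n] by (simp add: cinner_simps cinner_norm)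
      then have "Im (cinner v X) = y * (norm X)\<^sup>2" unfolding X by (subst cinner_commute) simp
      then have fy: "y * (norm X)\<^sup>2 \<le> cmod (f ?w)" unfolding fX using abs_Im_le_cmod[of "cinner v X"] by linarith
      have "cinner e v = cinner e (Hc (Gn n) X - scaleC ?w X)" by (simp add: X)
      also have "\<dots> = (complex_of_real l - ?w) * cinner e X"
        using Hc_sym[OF finite_block, of e 0 n X] by (simp add: cinner_simps He algebra_simps)
      also have "complex_of_real l - ?w = - \<i> * y" by (simp add: complex_eq_iff)
      finally have "cmod (cinner e v) = y * cmod (cinner e X)" using y by (simp add: norm_mult)
      also have "\<dots> \<le> y * (norm e * norm X)" using y by (intro mult_left_mono norm_cinner_le) auto
      finally have "(cmod (cinner e v))\<^sup>2 \<le> (y * (norm e * norm X))\<^sup>2" by (intro power_mono) auto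
      also have "\<dots> = (norm e)\<^sup>2 * (y * (y * (norm X)\<^sup>2))" by (simp add: power2_eq_square)
      also have "\<dots> \<le> (norm e)\<^sup>2 * (y * cmod (f ?w))" using y fy by (intro mult_left_mono) auto
      finally show ?thesis .
    qed
    have "(\<lambda>k. Complex l (1 / real (Suc k))) \<longlonglongrightarrow> Complex l 0"
      by (intro tendsto_Complex tendsto_const) (use LIMSEQ_inverse_real_of_nat in \<open>simp add: inverse_eq_divide\<close>)
    then have "(\<lambda>k. f (Complex l (1 / real (Suc k)))) \<longlonglongrightarrow> f (complex_of_real l)"
      using cont isCont_tendsto_compose by (fastforce simp: complex_of_real_def)
    then have "(\<lambda>k. (norm e)\<^sup>2 * (1 / real (Suc k) * cmod (f (Complex l (1 / real (Suc k)))))) \<longlonglongrightarrow> (norm e)\<^sup>2 * (0 * cmod (f (complex_of_real l)))"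
      by (intro tendsto_intros) (use LIMSEQ_inverse_real_of_nat in \<open>simp add: inverse_eq_divide\<close>)
    then have "(cmod (cinner e v))\<^sup>2 \<le> (norm e)\<^sup>2 * (0 * cmod (f (complex_of_real l)))"
      by (rule LIMSEQ_le_const) (intro exI[of _ 0] allI impI low, simp)
    then show False using ov by simp
  qed
  then show ?thesis unfolding liminf_singular_set_def by blast
qed

text \<open>A countable, hence measurable, set that contains both \<open>liminf_singular_set\<close>
  and every eigenvalue with a finitely supported eigenvector.\<close>

definition Lam :: "real set" where "Lam = (\<Union>n. {l. complex_of_real l \<in> evs 0 n})"

lemma countable_Lam: "countable Lam"
proof -
  have "finite {l. complex_of_real l \<in> evs 0 n}" for n
    using finite_vimageI[OF resolvent_family(1), of complex_of_real] by (simp add: vimage_def inj_on_def)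
  then show ?thesis unfolding Lam_def by (intro countable_UN) (auto intro: countable_finite)
qed

lemma L_Lam: "liminf_singular_set shell h Ups Phi \<subseteq> Lam"
  unfolding liminf_singular_set_def Lam_def using singular_set_evs[of 0] by blast

lemma eig_Lam: assumes "e \<in> eig" "T e = scaleR l e" "e \<noteq> 0" shows "l \<in> Lam"
proof -
  obtain m where em: "e \<in> supp_in (Gn m)" using assms finsup_supp by (auto simp: eig_def)
  then have "Hc (Gn m) e = scaleC l e" using phi_orth_iff[OF em, of l] assms by (simp add: scaleC_of_real)
  then have "complex_of_real l \<in> evs 0 m" using em assms(3) by (auto simp: evs_def)
  then show ?thesis by (auto simp: Lam_def)
qed

end

section \<open>Spectral projections of eigenvectors and approximate eigenvectors\<close>

lemma bounded_linear_closure_span: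
  assumes f: "bounded_linear f" and K: "subspace K" "closed K" and S: "\<And>e. e \<in> S \<Longrightarrow> f e \<in> K"
    and x: "x \<in> closure (span S)"
  shows "f x \<in> K"
proof -
  interpret f: bounded_linear f by (rule f)
  have "subspace {x. f x \<in> K}"
    using K(1) by (auto simp: real_vector.subspace_def f.zero f.add f.scaleR)
  then have "span S \<subseteq> {x. f x \<in> K}" by (rule span_minimal[rotated]) (use S in auto)
  moreover have "closed {x. f x \<in> K}"
    using continuous_closed_vimage[OF K(2), of f] f.isCont[where g = "\<lambda>x. x"] by (simp add: vimage_def)
  ultimately show ?thesis using x closure_minimal by blast
qed

lemma closed_cinner_zero: "closed {x. cinner x w = 0}"
proof -
  have "{x. cinner x w = 0} = {x. cinner w x = 0}" by (metis (mono_tags) cinner_commute complex_cnj_zero)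
  moreover have "closed {x. cinner w x = 0}" by (intro closed_Collect_eq continuous_cinner_right continuous_on_const)
  ultimately show ?thesis by (simp only:)
qed

lemma cinner_zero_closure:
  assumes "\<And>k. k \<in> S \<Longrightarrow> cinner k w = 0" "x \<in> closure S"
  shows "cinner x w = 0"
  using closure_minimal[of S "{x. cinner x w = 0}"] closed_cinner_zero assms by blast

context pvm
begin

lemma norm_P_le: assumes "B \<in> sets borel" shows "norm (P B x) \<le> norm x"
proof -
  have "norm (P B x) * norm (P B x) \<le> norm x * norm (P B x)"
    using norm_P[OF assms, of x] norm_cauchy_schwarz[of x "P B x"] by (simp add: power2_eq_square)
  then show ?thesis by (cases "P B x = 0") auto
qed

lemma bounded_linear_P: assumes "B \<in> sets borel" shows "bounded_linear (P B)"
proof (rule bounded_linear_intro[where K = 1])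
  show "P B (scaleR r x) = scaleR r (P B x)" for r x
    using P_scaleC[OF assms, of "complex_of_real r" x] by (simp add: scaleC_of_real)
qed (use assms in \<open>auto simp: P_add norm_P_le\<close>)

lemma emeasure_mu_add_orthogonal:
  assumes B: "B \<in> sets borel" and xy: "inner (P B x) y = 0"
  shows "emeasure (mu (x + y)) B = emeasure (mu x) B + emeasure (mu y) B"
proof -
  have "inner (P B x) (P B y) = 0" using xy P_inner[OF B, of "P B x" y] B by (simp add: P_idem)
  then show ?thesis using B by (simp add: emeasure_mu P_add norm_add_power2 ennreal_plus)
qed

lemma absolutely_continuous_mu_P:
  assumes "absolutely_continuous lborel (mu x)" "B \<in> sets borel"
  shows "absolutely_continuous lborel (mu (P B x))"
  unfolding absolutely_continuous_def
proof
  fix A :: "real set" assume A: "A \<in> null_sets lborel"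
  then have Ab: "A \<in> sets borel" by auto
  have "A \<in> null_sets (mu x)" using assms(1) A by (auto simp: absolutely_continuous_def)
  then have "P A x = 0" using Ab by (auto simp: P_eq_zero_iff)
  then have "P A (P B x) = 0" using P_Int[OF Ab assms(2)] P_Int[OF assms(2) Ab] P_zero[OF assms(2)] by (metis inf_commute)
  then show "A \<in> null_sets (mu (P B x))" using Ab by (auto simp: P_eq_zero_iff)
qed

end

context spectral_op
begin

text \<open>\<open>T x - l x = 0\<close> has measure zero, which by \<open>mu_resolvent\<close> is
  \<open>|t - l|^2\<close> times the measure of \<open>x\<close>; so that measure is carried by the
  single point \<open>l\<close>.\<close>

lemma P_eigenvector:
  assumes x: "x \<in> D" "T x = scaleR l x" and B: "B \<in> sets borel"
  shows "P B x = (if l \<in> B then x else 0)"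
proof -
  have "mu (T x - scaleC (complex_of_real l) x) = density (mu x) (\<lambda>t. ennreal ((cmod (t - complex_of_real l))\<^sup>2))"
    by (rule mu_resolvent[OF x(1)])
  then have "density (mu x) (\<lambda>t. ennreal ((cmod (t - complex_of_real l))\<^sup>2)) = mu 0" using x(2) by (simp add: scaleC_of_real)
  then have "emeasure (density (mu x) (\<lambda>t. ennreal ((cmod (t - complex_of_real l))\<^sup>2))) UNIV = 0"
    by (simp add: emeasure_mu_UNIV)
  then have "(\<integral>\<^sup>+t. ennreal ((cmod (t - complex_of_real l))\<^sup>2) \<partial>mu x) = 0" by (subst (asm) emeasure_density) auto
  then have "AE t in mu x. ennreal ((cmod (t - complex_of_real l))\<^sup>2) = 0" by (subst (asm) nn_integral_0_iff_AE) auto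
  then have "AE t in mu x. t \<notin> - {l}" by eventually_elim auto
  then have "- {l} \<in> null_sets (mu x)" by (subst AE_iff_null_sets) auto
  then have "emeasure (mu x) (- {l}) = 0" by auto
  then have z: "P (- {l}) x = 0" by (subst P_eq_zero_iff) auto
  have zz: "P C x = 0" if C: "C \<in> sets borel" "l \<notin> C" for C
  proof -
    have "C \<inter> - {l} = C" using C(2) by auto
    then show ?thesis using P_Int[OF C(1), of "- {l}" x] z P_zero[OF C(1)] by auto
  qed
  show ?thesis using zz[OF B] zz[of "- B"] P_split[OF B, of x] B by (auto simp: borel_comp)
qed

lemma window_approximate_eigenvector:
  assumes B: "B \<in> sets borel" "B \<subseteq> {l - e..l + e}" and x: "P B x = x" and e: "e \<ge> 0"
  shows "x \<in> D" "norm (T x - scaleR l x) \<le> e * norm x"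
proof -
  have B': "B \<subseteq> {-(\<bar>l\<bar> + e)..\<bar>l\<bar> + e}" by (rule order_trans[OF B(2)]) auto
  show "x \<in> D" using P_bounded_D[OF B(1) B', of x] x by simp
  have "P (- B) x = 0" using P_disjoint[of "- B" B x] B(1) x by (auto simp: borel_comp)
  then have "emeasure (mu x) (- B) = 0" using B(1) by (subst P_eq_zero_iff[symmetric]) (auto simp: borel_comp)
  then have ae: "AE t in mu x. t \<in> B" using B(1) by (intro AE_I[where N = "- B"]) (auto simp: borel_comp)
  have "ennreal ((norm (T x - scaleC (complex_of_real l) x))\<^sup>2) = (\<integral>\<^sup>+t. ennreal ((cmod (t - complex_of_real l))\<^sup>2) \<partial>mu x)"
    by (rule resolvent_norm_window[OF x B(1) B'])
  also have "\<dots> \<le> (\<integral>\<^sup>+t. ennreal (e\<^sup>2) \<partial>mu x)"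
  proof (rule nn_integral_mono_AE)
    show "AE t in mu x. ennreal ((cmod (t - complex_of_real l))\<^sup>2) \<le> ennreal (e\<^sup>2)"
      using ae
    proof eventually_elim
      case (elim t)
      then have "t \<in> {l - e..l + e}" using B(2) by blast
      then have "\<bar>t - l\<bar> \<le> e" by (simp add: abs_le_iff)
      then have "cmod (complex_of_real t - complex_of_real l) \<le> e" by (simp flip: of_real_diff)
      then show ?case by (intro ennreal_leI power_mono) auto
    qed
  qed
  also have "\<dots> = ennreal ((e * norm x)\<^sup>2)" by (simp add: emeasure_mu_UNIV power_mult_distrib ennreal_mult)
  finally have "(norm (T x - scaleR l x))\<^sup>2 \<le> (e * norm x)\<^sup>2" by (simp add: scaleC_of_real)
  then show "norm (T x - scaleR l x) \<le> e * norm x" by (rule power2_le_imp_le) (use e in simp)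
qed

lemma absolutely_continuous_mu_T:
  assumes "x \<in> D" "absolutely_continuous lborel (mu x)"
  shows "absolutely_continuous lborel (mu (T x))"
proof -
  have "mu (T x) = density (mu x) (\<lambda>t. ennreal ((cmod (t - 0))\<^sup>2))" using mu_resolvent[OF assms(1), of 0] by simp
  moreover have "absolutely_continuous (mu x) (density (mu x) (\<lambda>t. ennreal ((cmod (t - 0))\<^sup>2)))"
    by (rule absolutely_continuousI_density) simp
  ultimately show ?thesis using assms(2) by (auto simp: absolutely_continuous_def)
qed

end

text \<open>The singular part is carried by a Lebesgue null set \<open>N\<close> of maximal mass:
  any null set disjoint from \<open>N\<close> has mass zero, since adding it would exceed the
  maximum. Uniqueness is part of the work because \<open>ac_part\<close> is a definite
  description.\<close>

lemma ac_part_eq: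
  assumes "finite_measure M" and sM: "sets M = sets borel"
  obtains N where "N \<in> null_sets lborel" "ac_part M = density M (indicator (- N))"
    "absolutely_continuous lborel (ac_part M)"
proof -
  interpret finite_measure M by fact
  note [measurable_cong] = sM
  let ?X = "measure M ` null_sets (lborel :: real measure)"
  have bdd: "bdd_above ?X" by (intro bdd_aboveI[of _ "measure M (space M)"]) (auto intro: bounded_measure)
  have ne: "?X \<noteq> {}" by blast
  \<comment> \<open>Masses of null sets approaching the supremum; the countable union of the sets is
    again null and attains it.\<close>
  obtain xs where xs: "\<And>n :: nat. xs n \<in> ?X" "xs \<longlonglongrightarrow> Sup ?X"
    using closure_sequential[of "Sup ?X" ?X] closure_contains_Sup[OF ne bdd] by blast
  from xs(1) have "\<forall>n. \<exists>N. N \<in> null_sets lborel \<and> xs n = measure M N" by blast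
  then obtain Ns where Ns: "\<And>n. Ns n \<in> null_sets (lborel :: real measure)" "\<And>n. xs n = measure M (Ns n)" by metis
  define N where "N = (\<Union>n. Ns n)"
  have N: "N \<in> null_sets lborel" unfolding N_def using Ns(1) by blast
  then have Nb: "N \<in> sets borel" by auto
  have "measure M N \<ge> xs n" for n unfolding Ns(2) N_def
    using Nb by (intro finite_measure_mono) (auto simp: sM N_def)
  then have sup: "Sup ?X \<le> measure M N" using xs(2) by (intro LIMSEQ_le_const2[OF xs(2)]) auto
  have null: "emeasure M B = 0" if B: "B \<in> null_sets lborel" "B \<inter> N = {}" for B
  proof -
    have Bb: "B \<in> sets borel" using B by auto
    have "N \<union> B \<in> null_sets lborel" using N B by auto
    then have "measure M (N \<union> B) \<le> Sup ?X" using bdd by (intro cSup_upper) auto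
    moreover have "measure M (N \<union> B) = measure M N + measure M B"
      using B(2) Bb Nb by (intro finite_measure_Union) (auto simp: sM)
    ultimately have "measure M B \<le> 0" using sup by simp
    then show ?thesis by (simp add: emeasure_eq_measure measure_nonneg antisym)
  qed
  define A where "A = density M (indicator (- N))"
  have sA: "sets A = sets borel" by (simp add: A_def sM)
  have eA: "emeasure A B = emeasure M (B - N)" if "B \<in> sets borel" for B
    unfolding A_def using that Nb by (simp add: emeasure_density sM flip: indicator_inter_arith) (simp add: Diff_eq Int_commute sM borel_comp)
  have acA: "absolutely_continuous lborel A"
    unfolding absolutely_continuous_def
  proof
    fix B :: "real set" assume B: "B \<in> null_sets lborel"
    then have "B - N \<in> null_sets lborel" using N by auto
    then have "emeasure M (B - N) = 0" by (rule null) auto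
    then show "B \<in> null_sets A" using eA[of B] B by (auto simp: null_sets_def sA)
  qed
  have "ac_part M = A"
    unfolding ac_part_def
  proof (rule the_equality)
    define L where "L = density M (indicator N)"
    have eL: "emeasure L B = emeasure M (B \<inter> N)" if "B \<in> sets borel" for B
      unfolding L_def using that Nb by (simp add: emeasure_density sM flip: indicator_inter_arith) (simp add: Int_commute sM)
    have "singular_lborel L" unfolding singular_lborel_def
    proof (rule bexI[OF _ N])
      have "(UNIV - N) \<inter> N = {}" by auto
      then show "emeasure L (UNIV - N) = 0" using eL[of "UNIV - N"] Nb by simp
    qed
    moreover have "emeasure M B = emeasure A B + emeasure L B" if "B \<in> sets borel" for B
      unfolding eA[OF that] eL[OF that] using that Nb by (subst plus_emeasure) (auto simp: sM intro!: arg_cong[where f = "emeasure M"])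
    ultimately show "sets A = sets borel \<and> absolutely_continuous lborel A \<and>
      (\<exists>L. sets L = sets borel \<and> singular_lborel L \<and> (\<forall>B\<in>sets borel. emeasure M B = emeasure A B + emeasure L B))"
      using sA acA by (intro conjI exI[of _ L]) (auto simp: L_def sM)
  next
    fix K assume "sets K = sets borel \<and> absolutely_continuous lborel K \<and>
      (\<exists>L. sets L = sets borel \<and> singular_lborel L \<and> (\<forall>B\<in>sets borel. emeasure M B = emeasure K B + emeasure L B))"
    then obtain L where K: "sets K = sets borel" "absolutely_continuous lborel K" and sL: "sets L = sets borel" "singular_lborel L"
      and sum: "\<And>B. B \<in> sets borel \<Longrightarrow> emeasure M B = emeasure K B + emeasure L B" by blast
    obtain N' where N': "N' \<in> null_sets lborel" "emeasure L (UNIV - N') = 0" using sL(2) by (auto simp: singular_lborel_def)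
    then have N'b: "N' \<in> sets borel" by auto
    \<comment> \<open>Away from the two null sets that carry the singular parts, both candidates
      coincide with \<open>M\<close>; on those sets both vanish.\<close>
    have "emeasure K B = emeasure A B" if B: "B \<in> sets borel" for B
    proof -
      have nN: "N \<union> N' \<in> null_sets lborel" using N N' by auto
      then have "N \<union> N' \<in> null_sets K" using K(2) by (auto simp: absolutely_continuous_def)
      then have "emeasure K B = emeasure K (B - (N \<union> N'))" using B by (intro emeasure_Diff_null_set[symmetric]) (auto simp: K(1))
      also have "emeasure L (B - (N \<union> N')) \<le> emeasure L (UNIV - N')"
        using B Nb N'b by (intro emeasure_mono) (auto simp: sL(1))
      then have "emeasure K (B - (N \<union> N')) = emeasure M (B - (N \<union> N'))" using sum[of "B - (N \<union> N')"] N'(2) B Nb N'b by auto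
      also have "\<dots> = emeasure A (B - N')" using eA[of "B - N'"] B N'b by (simp add: set_diff_eq Un_def conj_commute conj_left_commute)
      also have "\<dots> = emeasure A B" using acA N' B sA by (intro emeasure_Diff_null_set) (auto simp: absolutely_continuous_def)
      finally show ?thesis .
    qed
    then show "K = A" by (intro measure_eqI) (auto simp: K(1) sA)
  qed
  then show thesis using that[OF N] acA by (simp add: A_def)
qed

lemma ell2_closure_fn: "ell2_closure (fn ` S) = fn ` closure S"
proof (intro equalityI subsetI)
  fix \<psi> assume "\<psi> \<in> ell2_closure (fn ` S)"
  then have p: "\<psi> \<in> ell2" "\<And>e. e > 0 \<Longrightarrow> \<exists>y\<in>S. ell2_norm (\<lambda>a. \<psi> a - fn y a) < e" by (auto simp: ell2_closure_def)
  have "\<exists>y\<in>S. dist y (mk \<psi>) < e" if "e > 0" for e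
  proof -
    obtain y where "y \<in> S" "ell2_norm (\<lambda>a. \<psi> a - fn y a) < e" using p(2)[OF \<open>e > 0\<close>] by blast
    moreover have "(\<lambda>a. \<psi> a - fn y a) = fn (mk \<psi> - y)" using p(1) by (auto simp: fn_mk)
    ultimately show ?thesis by (auto simp: norm_ell2[symmetric] dist_norm norm_minus_commute)
  qed
  then have "mk \<psi> \<in> closure S" by (simp add: closure_approachable)
  then show "\<psi> \<in> fn ` closure S" using p(1) by (metis fn_mk imageI)
next
  fix \<psi> assume "\<psi> \<in> fn ` closure S"
  then obtain x where x: "\<psi> = fn x" "x \<in> closure S" by blast
  have "\<exists>y\<in>S. ell2_norm (\<lambda>a. fn x a - fn y a) < e" if "e > 0" for e
  proof -
    obtain y where "y \<in> S" "dist y x < e" using x(2) \<open>e > 0\<close> by (auto simp: closure_approachable)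
    then show ?thesis by (auto simp: fn_minus_fun norm_ell2[symmetric] dist_norm norm_minus_commute)
  qed
  then show "\<psi> \<in> ell2_closure (fn ` S)" using fn_ell2[of x] unfolding ell2_closure_def x(1) by blast
qed

lemma ell2_proj_fn:
  assumes "csubspace K" "closed K"
  shows "ell2_proj (fn ` K) (fn x) = fn (orth_proj K x)"
  unfolding ell2_proj_def
proof (rule the_equality)
  show "fn (orth_proj K x) \<in> fn ` K \<and> (\<forall>k\<in>fn ` K. ell2_inner k (\<lambda>a. fn x a - fn (orth_proj K x) a) = 0)"
    using orth_proj[OF assms] by (auto simp: fn_minus_fun cinner_def[symmetric])
next
  fix w assume "w \<in> fn ` K \<and> (\<forall>k\<in>fn ` K. ell2_inner k (\<lambda>a. fn x a - w a) = 0)"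
  then obtain y where y: "w = fn y" "y \<in> K" and "\<forall>k\<in>fn ` K. ell2_inner k (\<lambda>a. fn x a - fn y a) = 0" by blast
  then have "cinner k (x - y) = 0" if "k \<in> K" for k using that by (auto simp: fn_minus_fun cinner_def)
  then have "orth_proj K x = y" using y(2) by (intro orth_proj_unique[OF assms])
  then show "w = fn (orth_proj K x)" using y(1) by simp
qed

section \<open>Splitting the root vector along the finitely supported eigenvectors\<close>

locale spectral_hopping = factored_hopping shell h Ups Phi for shell :: "nat \<Rightarrow> 'a list" and h Ups Phi +
  fixes E :: "real set \<Rightarrow> ('a \<Rightarrow> complex) \<Rightarrow> ('a \<Rightarrow> complex)"
  assumes E: "spectral_resolution (hop_op h) E"
begin

sublocale S: spectral_op "lift_proj E" Dom T by (rule spectral_op_lift[OF E])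

abbreviation "P \<equiv> lift_proj E"

lemma spectral_measure_fn: "spectral_measure E (fn x) = S.mu x"
  using E by (intro spectral_measure_mu) (simp add: spectral_resolution_def)

lemma root_vector_fn: "root_vector shell Ups = fn v"
  unfolding root_vector_def embed_root_def v_def ups_def fn_emb_raw ..

text \<open>The component of the root vector whose spectral measure turns out to be the point
  measure; the measure of the complement \<open>vinf\<close> is then the difference measure.\<close>

definition q :: "'a l2" where "q = orth_proj Kinf v"
definition eigl :: "real \<Rightarrow> 'a l2 set" where "eigl l = {e \<in> finsup. T e = scaleR l e}"

lemma q: "q \<in> Kinf" "k \<in> Kinf \<Longrightarrow> cinner k vinf = 0" "v = q + vinf"
  using orth_proj[OF Kinf(1,2)] by (auto simp: q_def vinf_def)

lemma eigl_eig: "eigl l \<subseteq> eig" by (auto simp: eigl_def eig_def)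

lemma eigl_csubspace: "csubspace (eigl l)"
proof -
  have "T 0 = 0" by (rule Dom_I(2)) (simp add: hop_def)
  then have 0: "0 \<in> eigl l" using finsup_csubspace[where 'a = 'a] by (auto simp: eigl_def csubspace_def subspace_0)
  have add: "x + y \<in> eigl l" if "x \<in> eigl l" "y \<in> eigl l" for x y
    using that finsup_csubspace[where 'a = 'a] finsup_Dom(1)
    by (auto simp: eigl_def csubspace_def subspace_add Dom_add scaleR_add_right)
  have sc: "scaleC c x \<in> eigl l" if "x \<in> eigl l" for c x
    using that finsup_csubspace[where 'a = 'a] finsup_Dom(1)
    by (auto simp: eigl_def csubspace_def Dom_scaleC scaleC_scaleR)
  have "scaleR c x \<in> eigl l" if "x \<in> eigl l" for c x
    using sc[OF that, of "complex_of_real c"] by (simp add: scaleC_of_real)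
  then show ?thesis using 0 add sc by (auto simp: csubspace_def real_vector.subspace_def)
qed

lemma P_eigl: assumes "e \<in> eigl l" "B \<in> sets borel" shows "P B e = (if l \<in> B then e else 0)"
  using assms finsup_Dom(1) by (intro S.P_eigenvector) (auto simp: eigl_def)

lemma eig_cases: assumes "e \<in> eig" obtains l where "e \<in> eigl l" using assms by (auto simp: eig_def eigl_def)

lemma P_Kinf:
  assumes B: "B \<in> sets borel" and x: "x \<in> Kinf"
  shows "P B x \<in> Kinf"
proof (rule bounded_linear_closure_span[OF S.bounded_linear_P[OF B]])
  show "subspace Kinf" "closed Kinf" using Kinf by (auto simp: csubspace_def)
  show "x \<in> closure (span eig)" using x by (simp add: Kinf_def)
  fix e assume e: "e \<in> eig"
  then obtain l where l: "e \<in> eigl l" by (rule eig_cases)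
  show "P B e \<in> Kinf" using P_eigl[OF l B] e Kinf(3) \<open>subspace Kinf\<close> by (auto simp: subspace_0)
qed

lemma P_singleton_Kinf:
  assumes x: "x \<in> Kinf"
  shows "P {l} x \<in> closure (eigl l)"
proof (rule bounded_linear_closure_span[OF S.bounded_linear_P])
  have "csubspace (closure (eigl l))" by (rule csubspace_closure[OF eigl_csubspace])
  then show sub: "subspace (closure (eigl l))" by (simp add: csubspace_def)
  show "x \<in> closure (span eig)" using x by (simp add: Kinf_def)
  fix e assume e: "e \<in> eig"
  then obtain k where k: "e \<in> eigl k" by (rule eig_cases)
  show "P {l} e \<in> closure (eigl l)" using P_eigl[OF k, of "{l}"] k closure_subset[of "eigl l"] subspace_0[OF sub] by (auto split: if_splits)
qed simp_all

text \<open>On \<open>Kinf\<close> the spectral measure lives on the countable set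
  \<open>Lam\<close> and is therefore pure point.\<close>

lemma P_Lam_Kinf: assumes x: "x \<in> Kinf" shows "P (- Lam) x = 0"
proof -
  have Lb: "- Lam \<in> sets borel" using countable_Lam by (intro borel_comp) (auto intro: sets.countable)
  have "P (- Lam) x \<in> {0}"
  proof (rule bounded_linear_closure_span[OF S.bounded_linear_P[OF Lb]])
    show "x \<in> closure (span eig)" using x by (simp add: Kinf_def)
    fix e assume e: "e \<in> eig"
    then obtain k where k: "e \<in> eigl k" by (rule eig_cases)
    have "e = 0 \<or> k \<in> Lam" using eig_Lam[OF e, of k] k by (auto simp: eigl_def)
    then show "P (- Lam) e \<in> {0}" using P_eigl[OF k Lb] by auto
  qed (simp_all add: real_vector.subspace_def)
  then show ?thesis by simp
qed

text \<open>The projections leave \<open>Kinf\<close> invariant and \<open>vinf\<close> is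
  orthogonal to it, so the measure of the sum has no cross term.\<close>

lemma mu_split: assumes B: "B \<in> sets borel" shows "emeasure (S.mu v) B = emeasure (S.mu q) B + emeasure (S.mu vinf) B"
proof -
  have "cinner (P B q) vinf = 0" by (rule q(2)[OF P_Kinf[OF B q(1)]])
  then have "inner (P B q) vinf = 0" by (metis Re_cinner zero_complex.simps(1))
  then show ?thesis using S.emeasure_mu_add_orthogonal[OF B] q(3) by metis
qed

text \<open>The full eigenspace at \<open>l\<close> may also contain eigenvectors of infinite
  support. Applying \<open>P {l}\<close> to \<open>q\<close> and not to \<open>v\<close> keeps only
  the part generated by the finitely supported ones.\<close>

lemma eigl_proj: "orth_proj (closure (eigl l)) v = P {l} q"
proof (rule orth_proj_unique)
  show "csubspace (closure (eigl l))" by (rule csubspace_closure[OF eigl_csubspace])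
  show "P {l} q \<in> closure (eigl l)" by (rule P_singleton_Kinf[OF q(1)])
  have 0: "cinner k (v - P {l} q) = 0" if k: "k \<in> eigl l" for k
  proof -
    have "k \<in> Kinf" using k eigl_eig Kinf(3) by blast
    then have "cinner k vinf = 0" by (rule q(2))
    moreover have "cinner k (P {l} q) = cinner k q"
      using S.P_sym[of "{l}" k q] P_eigl[OF k, of "{l}"] by simp
    ultimately show ?thesis by (simp add: q(3) cinner_simps)
  qed
  show "cinner k (v - P {l} q) = 0" if "k \<in> closure (eigl l)" for k
    by (rule cinner_zero_closure[OF 0 that])
qed simp

lemma eigl_proj_zero:
  assumes "l \<notin> liminf_singular_set shell h Ups Phi"
  shows "P {l} q = 0"
proof -
  have "cinner k v = 0" if "k \<in> eigl l" for k
    using eigenvalue_in_L[of k l] assms that eigl_eig by (auto simp: eigl_def)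
  then have "cinner k (v - 0) = 0" if "k \<in> closure (eigl l)" for k
    using cinner_zero_closure[OF _ that] by simp
  moreover have cs: "csubspace (closure (eigl l))" by (rule csubspace_closure[OF eigl_csubspace])
  moreover have "0 \<in> closure (eigl l)" using cs by (simp add: csubspace_def subspace_0)
  ultimately have "orth_proj (closure (eigl l)) v = 0" by (intro orth_proj_unique) auto
  then show ?thesis by (simp add: eigl_proj)
qed

lemma finite_eigenvectors_fn: "finite_eigenvectors h l = fn ` eigl l"
proof (intro equalityI subsetI)
  fix \<psi> assume "\<psi> \<in> finite_eigenvectors h l"
  then have p: "finite {x. \<psi> x \<noteq> 0}" "hop h \<psi> = (\<lambda>x. complex_of_real l * \<psi> x)" by (auto simp: finite_eigenvectors_def)
  have "\<psi> \<in> ell2" using p(1) by (rule ell2_finite)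
  then have f: "fn (mk \<psi>) = \<psi>" by (rule fn_mk)
  have "T (mk \<psi>) = scaleR l (mk \<psi>)" by (rule Dom_I(2)) (simp add: f p(2))
  then have "mk \<psi> \<in> eigl l" using p(1) f by (simp add: eigl_def finsup_def)
  then show "\<psi> \<in> fn ` eigl l" using f by (metis imageI)
next
  fix \<psi> assume "\<psi> \<in> fn ` eigl l"
  then obtain e where e: "\<psi> = fn e" "e \<in> finsup" "T e = scaleR l e" by (auto simp: eigl_def)
  have "hop h (fn e) = fn (scaleR l e)" using fn_T[OF finsup_Dom(1)[OF e(2)]] e(3) by simp
  then show "\<psi> \<in> finite_eigenvectors h l" using e by (auto simp: finite_eigenvectors_def finsup_def)
qed

text \<open>By \<open>eigl_proj\<close> the weight of the point measure at \<open>l\<close> is the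
  mass of \<open>{l}\<close> under the measure of \<open>q\<close>; as that measure is carried by a
  countable set, the point masses determine it.\<close>

lemma emeasure_nu:
  assumes B: "B \<in> sets borel"
  shows "emeasure (finite_point_measure h (fn v)) B = emeasure (S.mu q) B"
    and "B \<inter> liminf_singular_set shell h Ups Phi = {} \<Longrightarrow> emeasure (finite_point_measure h (fn v)) B = 0"
proof -
  define f where "f = (\<lambda>l. ennreal ((ell2_norm (ell2_proj (ell2_closure (finite_eigenvectors h l)) (fn v)))\<^sup>2))"
  have cs: "csubspace (closure (eigl l))" for l by (rule csubspace_closure[OF eigl_csubspace])
  have "f l = ennreal ((norm (P {l} q))\<^sup>2)" for l
    unfolding f_def finite_eigenvectors_fn ell2_closure_fn ell2_proj_fn[OF cs closed_closure] eigl_proj norm_ell2 ..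
  then have f: "f l = emeasure (S.mu q) {l}" for l by (simp add: S.emeasure_mu)
  have "emeasure (finite_point_measure h (fn v)) B = emeasure (point_measure UNIV f) B"
    unfolding finite_point_measure_def f_def[symmetric] using B
    by (subst emeasure_distr) (auto simp: measurable_def sets_point_measure space_point_measure)
  also have "\<dots> = (\<integral>\<^sup>+l. f l * indicator B l \<partial>count_space UNIV)"
    unfolding point_measure_def by (subst emeasure_density) auto
  finally have nu: "emeasure (finite_point_measure h (fn v)) B = (\<integral>\<^sup>+l. f l * indicator B l \<partial>count_space UNIV)" .
  have z: "f l = 0" if "l \<notin> liminf_singular_set shell h Ups Phi" for l
    using eigl_proj_zero[OF that] by (simp add: f S.emeasure_mu)
  \<comment> \<open>The weights vanish off \<open>liminf_singular_set\<close>, so the sum over all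
    reals is one over a countable set.\<close>
  have "(\<integral>\<^sup>+l. f l * indicator B l \<partial>count_space UNIV) = (\<integral>\<^sup>+l. f l \<partial>count_space (Lam \<inter> B))"
    unfolding nn_integral_count_space_indicator[of "Lam \<inter> B" f, simplified] using z L_Lam
    by (intro nn_integral_cong) (auto split: split_indicator)
  also have "\<dots> = (\<integral>\<^sup>+l. emeasure (S.mu q) {l} \<partial>count_space (Lam \<inter> B))" by (simp add: f)
  also have "\<dots> = emeasure (S.mu q) (Lam \<inter> B)"
    using countable_Lam by (intro emeasure_countable_singleton[symmetric]) auto
  also have "\<dots> = emeasure (S.mu q) B"
  proof (rule emeasure_eq_AE)
    have Lb: "Lam \<in> sets borel" using countable_Lam by (auto intro: sets.countable)
    have "- Lam \<in> null_sets (S.mu q)"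
      using S.P_eq_zero_iff[of "- Lam" q] P_Lam_Kinf[OF q(1)] Lb by (auto simp: null_sets_def borel_comp)
    then show "AE l in S.mu q. l \<in> Lam \<inter> B \<longleftrightarrow> l \<in> B" by (rule AE_I') auto
    show "Lam \<inter> B \<in> sets (S.mu q)" "B \<in> sets (S.mu q)" using Lb B by auto
  qed
  finally show "emeasure (finite_point_measure h (fn v)) B = emeasure (S.mu q) B" using nu by simp
  show "emeasure (finite_point_measure h (fn v)) B = 0" if "B \<inter> liminf_singular_set shell h Ups Phi = {}"
  proof -
    have "f l * indicator B l = 0" for l using z[of l] that by (auto split: split_indicator)
    then have "(\<lambda>l. f l * indicator B l) = (\<lambda>l. 0)" by (rule ext)
    then show ?thesis unfolding nu by (simp only: nn_integral_const mult_zero_left)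
  qed
qed

lemma finite_point_measure_sets [simp]: "sets (finite_point_measure h w) = sets borel"
  by (simp add: finite_point_measure_def)

lemma diff_measure_nu: "diff_measure (S.mu v) (finite_point_measure h (fn v)) = S.mu vinf"
proof (rule measure_eqI)
  have fin: "finite_measure (finite_point_measure h (fn v))"
    using emeasure_nu(1)[of UNIV] by (intro finite_measureI) (simp add: finite_point_measure_def S.emeasure_mu)
  show s: "sets (diff_measure (S.mu v) (finite_point_measure h (fn v))) = sets (S.mu vinf)" by simp
  fix B assume "B \<in> sets (diff_measure (S.mu v) (finite_point_measure h (fn v)))"
  then have B: "B \<in> sets borel" by simp
  have "emeasure (diff_measure (S.mu v) (finite_point_measure h (fn v))) B =
      emeasure (S.mu v) B - emeasure (finite_point_measure h (fn v)) B"
    using B mu_split emeasure_nu(1) by (intro emeasure_diff_measure[OF S.finite_measure_mu fin]) auto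
  also have "\<dots> = emeasure (S.mu vinf) B"
    unfolding mu_split[OF B] emeasure_nu(1)[OF B] by (simp add: S.emeasure_mu[OF B] ennreal_minus flip: ennreal_plus)
  finally show "emeasure (diff_measure (S.mu v) (finite_point_measure h (fn v))) B = emeasure (S.mu vinf) B" .
qed

end

section \<open>From transfer matrix integrals to the limit measure\<close>

lemma liminf_finite_frequently:
  fixes X :: "nat \<Rightarrow> ennreal"
  assumes "liminf X < \<infinity>"
  obtains C where "C \<ge> 0" "\<exists>\<^sub>F n in sequentially. X n \<le> ennreal C"
proof -
  obtain c where c: "liminf X = ennreal c" "c \<ge> 0" using assms by (cases "liminf X" rule: ennreal_cases) auto
  have "\<exists>\<^sub>F n in sequentially. X n \<le> ennreal (c + 1)"
  proof (rule ccontr)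
    assume "\<not> ?thesis"
    then have "\<forall>\<^sub>F n in sequentially. ennreal (c + 1) \<le> X n"
      unfolding not_frequently by (rule eventually_mono) auto
    then have "ennreal (c + 1) \<le> ennreal c" using Liminf_bounded c(1) by metis
    then show False using c(2) by simp
  qed
  then show thesis using that[of "c + 1"] c(2) by simp
qed

lemma Lp_density_null:
  assumes "has_Lp_density_on p X M" "B \<in> null_sets lborel" "B \<subseteq> X"
  shows "emeasure M B = 0"
proof -
  obtain f :: "real \<Rightarrow> real" where f: "f \<in> borel_measurable borel"
      "\<And>B. B \<in> sets borel \<Longrightarrow> B \<subseteq> X \<Longrightarrow> emeasure M B = (\<integral>\<^sup>+ x\<in>B. ennreal (f x) \<partial>lborel)"
    using assms(1) unfolding has_Lp_density_on_def by blast
  have "emeasure M B = (\<integral>\<^sup>+ x\<in>B. ennreal (f x) \<partial>lborel)" using assms by (intro f(2)) auto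
  also have "\<dots> = 0" by (rule nn_integral_null_set[OF assms(2)])
  finally show ?thesis .
qed

lemma powr_twice: "x \<ge> 0 \<Longrightarrow> (x\<^sup>2) powr p = x powr (2 * p)" for x :: real
  by (cases "x = 0") (auto simp: powr_powr simp flip: powr_numeral)

text \<open>With \<open>x = N^2\<close>, the hypothesis gives \<open>1 / x \<le> 2 * H\<close>, and
  \<open>(m - x)^2 \<ge> 0\<close> gives \<open>2 * m - m^2 / x \<le> x\<close>. For
  \<open>x \<ge> 1\<close> this is at most \<open>x powr p\<close>; for \<open>x < 1\<close> the
  condition \<open>m \<ge> 2\<close> makes the left side nonpositive.\<close>

lemma transfer_am_gm:
  fixes H N m p :: real
  assumes H: "1 \<le> 2 * H * N\<^sup>2" and N: "N \<ge> 0" and m: "m \<ge> 2" and p: "p > 1"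
  shows "2 * m - 2 * m\<^sup>2 * H \<le> N powr (2 * p)"
proof -
  have N0: "N\<^sup>2 > 0" using H by (cases "N = 0") auto
  have "m\<^sup>2 / N\<^sup>2 \<le> 2 * m\<^sup>2 * H"
    using mult_left_mono[OF H, of "m\<^sup>2"] N0 by (simp add: pos_divide_le_eq mult_ac)
  then have 1: "2 * m - 2 * m\<^sup>2 * H \<le> 2 * m - m\<^sup>2 / N\<^sup>2" by simp
  show ?thesis
  proof (cases "N\<^sup>2 \<ge> 1")
    case True
    have "(2 * m - m\<^sup>2 / N\<^sup>2) * N\<^sup>2 \<le> N\<^sup>2 * N\<^sup>2"
      using N0 sum_squares_bound[of m "N\<^sup>2"] by (simp add: left_diff_distrib power2_eq_square)
    then have "2 * m - m\<^sup>2 / N\<^sup>2 \<le> N\<^sup>2" by (rule mult_right_le_imp_le[OF _ N0])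
    also have "\<dots> = (N\<^sup>2) powr 1" by simp
    also have "\<dots> \<le> (N\<^sup>2) powr p" using True p by (intro powr_mono) auto
    finally show ?thesis using 1 N by (simp add: powr_twice)
  next
    case False
    have "m * 2 \<le> m * m" using m by (intro mult_left_mono) auto
    moreover have "m\<^sup>2 \<le> m\<^sup>2 / N\<^sup>2" using False N0 by (simp add: pos_le_divide_eq mult_left_le)
    ultimately have "2 * m - 2 * m\<^sup>2 * H \<le> 0" using 1 by (simp add: power2_eq_square)
    then show ?thesis using powr_ge_zero order_trans by blast
  qed
qed

context spectral_hopping
begin

lemma hn_measurable [measurable]: "hn n \<in> borel_measurable borel"
  by (rule borel_measurable_continuous_onI[OF hn_poisson(1)])

lemma hn_integrable: "integrable lborel (\<lambda>t. hn n t / pi)" "(\<integral>t. hn n t / pi \<partial>lborel) \<le> (norm v)\<^sup>2"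
proof -
  have le: "(\<integral>\<^sup>+t. ennreal (hn n t) \<partial>lborel) \<le> ennreal (pi * (norm v)\<^sup>2)" by (rule hn_mass)
  then have "(\<integral>\<^sup>+t. ennreal (hn n t) \<partial>lborel) < \<infinity>" using ennreal_less_top le_less_trans by (metis infinity_ennreal_def)
  then have i: "integrable lborel (hn n)" by (intro integrableI_nonneg) (auto simp: hn_nonneg)
  then show "integrable lborel (\<lambda>t. hn n t / pi)" by simp
  have "(\<integral>t. hn n t \<partial>lborel) \<le> pi * (norm v)\<^sup>2"
    using le nn_integral_eq_integral[OF i] by (simp add: hn_nonneg)
  then show "(\<integral>t. hn n t / pi \<partial>lborel) \<le> (norm v)\<^sup>2" by (simp add: pos_divide_le_eq mult.commute)
qed

text \<open>The density \<open>|t - z|^2\<close> relating the measure of \<open>vinf\<close> to that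
  of its resolvent \<open>f\<close> cancels the denominator of the Poisson kernel and leaves the
  constant \<open>y\<close>.\<close>

lemma poisson_vinf:
  assumes y: "y > 0" and f: "f \<in> Dom" "T f - scaleC (Complex x y) f = vinf"
  shows "(\<integral>t. poisson x y t \<partial>S.mu vinf) = y * (norm f)\<^sup>2"
proof -
  have d: "S.mu vinf = density (S.mu f) (\<lambda>t. ennreal ((cmod (complex_of_real t - Complex x y))\<^sup>2))"
    using S.mu_resolvent[OF f(1), of "Complex x y"] f(2) by simp
  have "(\<integral>\<^sup>+t. ennreal (poisson x y t) \<partial>S.mu vinf) =
      (\<integral>\<^sup>+t. ennreal ((cmod (complex_of_real t - Complex x y))\<^sup>2) * ennreal (poisson x y t) \<partial>S.mu f)"
    unfolding d by (rule nn_integral_density) auto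
  also have "\<dots> = (\<integral>\<^sup>+t. ennreal y \<partial>S.mu f)"
  proof (rule nn_integral_cong)
    fix t
    have "(cmod (complex_of_real t - Complex x y))\<^sup>2 * poisson x y t = y"
      using poisson_denom_pos[OF y, of t x] unfolding cmod_power2 poisson_def by simp
    then show "ennreal ((cmod (complex_of_real t - Complex x y))\<^sup>2) * ennreal (poisson x y t) = ennreal y"
      using poisson_nonneg[OF y] by (simp flip: ennreal_mult)
  qed
  also have "\<dots> = ennreal (y * (norm f)\<^sup>2)" using y by (simp add: S.emeasure_mu_UNIV ennreal_mult)
  finally show ?thesis using y poisson_nonneg[OF y] by (subst integral_eq_nn_integral) auto
qed

lemma poisson_limit:
  assumes y: "y > 0"
  shows "(\<lambda>n. \<integral>t. hn n t / pi * poisson x y t \<partial>lborel) \<longlonglongrightarrow> (\<integral>t. poisson x y t \<partial>S.mu vinf)"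
proof -
  let ?z = "Complex x y"
  obtain f where f: "f \<in> Dom" "T f - scaleC ?z f = vinf" using resolvent_exists[of ?z vinf] y by auto
  have "Im (cinner vinf f) = y * (norm f)\<^sup>2"
  proof -
    have "Im (cinner (T f) f) = 0" using form_real[OF f(1)] T_sym[OF f(1) f(1)] by simp
    then show ?thesis unfolding f(2)[symmetric] by (simp add: cinner_simps cinner_norm)
  qed
  moreover have "(\<lambda>n. Im (cinner (v1 n) (psi n ?z))) \<longlonglongrightarrow> Im (cinner vinf f)"
    by (intro tendsto_Im tendsto_cinner v1_limit psi_limit f) (use y in simp)
  \<comment> \<open>\<open>ennreal\<close> clips at \<open>0\<close>, so the limit is taken for the
    clipped expression.\<close>
  ultimately have "(\<lambda>n. max 0 (Im (cinner (v1 n) (psi n ?z)))) \<longlonglongrightarrow> max 0 (y * (norm f)\<^sup>2)"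
    by (intro tendsto_max tendsto_const) simp
  moreover have "(\<integral>t. hn n t / pi * poisson x y t \<partial>lborel) = max 0 (Im (cinner (v1 n) (psi n ?z)))" for n
  proof -
    have "(\<integral>t. poisson x y t * hn n t \<partial>lborel) = enn2real (ennreal (pi * Im (cinner (v1 n) (psi n ?z))))"
      unfolding hn_poisson(2)[OF y, symmetric]
      using y by (intro integral_eq_nn_integral) (auto simp: hn_nonneg poisson_nonneg)
    also have "\<dots> = pi * max 0 (Im (cinner (v1 n) (psi n ?z)))"
      by (cases "Im (cinner (v1 n) (psi n ?z)) \<ge> 0") (auto simp: max_def mult_le_0_iff zero_le_mult_iff ennreal_neg)
    also have "(\<integral>t. poisson x y t * hn n t \<partial>lborel) = pi * (\<integral>t. hn n t / pi * poisson x y t \<partial>lborel)"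
      by (subst integral_mult_right_zero[symmetric]) (simp add: mult.commute)
    finally show ?thesis by simp
  qed
  ultimately show ?thesis using y by (simp add: poisson_vinf[OF y f])
qed

sublocale V: vague_limit "\<lambda>n t. hn n t / pi" "S.mu vinf"
proof (rule vague_limit.intro)
  show "(\<lambda>n. \<integral>t. g t * (hn n t / pi) \<partial>lborel) \<longlonglongrightarrow> (\<integral>t. g t \<partial>S.mu vinf)"
    if g: "continuous_on UNIV g" "\<And>t. \<bar>t\<bar> > K \<Longrightarrow> g t = 0" for g K
  proof -
    define R where "R = (\<lambda>n. density lborel (\<lambda>t. ennreal (hn n t / pi)))"
    have eR: "emeasure (R n) UNIV = ennreal (\<integral>t. hn n t / pi \<partial>lborel)" for n
      unfolding R_def using hn_integrable(1)[of n] by (subst emeasure_density) (auto simp: nn_integral_eq_integral hn_nonneg)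
    have gm [measurable]: "g \<in> borel_measurable borel" by (rule borel_measurable_continuous_onI[OF g(1)])
    have "(\<lambda>n. \<integral>t. g t \<partial>R n) \<longlonglongrightarrow> (\<integral>t. g t \<partial>S.mu vinf)"
    proof (rule vague_convergence[where C = "(norm v)\<^sup>2" and K = K])
      show "finite_measure (R n)" for n using eR[of n] by (intro finite_measureI) (simp add: R_def)
      show "sets (R n) = sets borel" for n by (simp add: R_def)
      show "measure (R n) UNIV \<le> (norm v)\<^sup>2" for n
        unfolding measure_def eR using hn_integrable(2)[of n] by (simp add: hn_nonneg)
      show "finite_measure (S.mu vinf)" "sets (S.mu vinf) = sets borel" by simp_all
      have "emeasure (S.mu vinf) UNIV \<le> emeasure (S.mu v) UNIV" using mu_split[of UNIV] by simp
      then have "(norm vinf)\<^sup>2 \<le> (norm v)\<^sup>2" by (simp add: S.emeasure_mu_UNIV)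
      then show "measure (S.mu vinf) UNIV \<le> (norm v)\<^sup>2" by (simp add: S.measure_mu S.P_UNIV)
      show "(\<lambda>n. \<integral>t. poisson x y t \<partial>R n) \<longlonglongrightarrow> (\<integral>t. poisson x y t \<partial>S.mu vinf)" if "y > 0" for x y
        using poisson_limit[OF that, of x] unfolding R_def by (simp add: integral_real_density hn_nonneg)
    qed (use g in auto)
    then show ?thesis unfolding R_def by (simp add: integral_real_density hn_nonneg mult.commute)
  qed
qed (simp_all add: hn_nonneg hn_integrable(1))

text \<open>The hypotheses integrate over regular points with respect to \<open>lebesgue\<close>,
  the limit argument over all of \<open>{a..b}\<close> with respect to \<open>lborel\<close>; by
  \<open>ae_regular\<close> the two domains differ by a null set.\<close>

lemma density_le_transfer_integral:
  assumes A2: "\<forall>n. AE l in lborel. mrank (beta shell h Ups Phi n n (complex_of_real l)) = r n"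
    and le: "\<And>t. complex_of_real t \<notin> evs 0 n \<Longrightarrow> t \<in> regular_points shell h Ups Phi a b n \<Longrightarrow> g t \<le> G t"
  shows "(\<integral>\<^sup>+t\<in>{a..b}. ennreal (g t) \<partial>lborel) \<le> (\<integral>\<^sup>+t\<in>regular_points shell h Ups Phi a b n. ennreal (G t) \<partial>lebesgue)"
proof -
  have "(\<integral>\<^sup>+t\<in>{a..b}. ennreal (g t) \<partial>lborel) = (\<integral>\<^sup>+t\<in>{a..b}. ennreal (g t) \<partial>lebesgue)"
    by (rule nn_integral_completion[symmetric])
  also have "\<dots> \<le> (\<integral>\<^sup>+t\<in>regular_points shell h Ups Phi a b n. ennreal (G t) \<partial>lebesgue)"
  proof (rule nn_integral_mono_AE)
    have "AE t in lebesgue. complex_of_real t \<notin> evs 0 n \<and> complex_of_real t \<notin> exceptional_set shell h Ups Phi 0 n"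
      by (rule AE_completion[OF ae_regular[OF A2]])
    then show "AE t in lebesgue. ennreal (g t) * indicator {a..b} t \<le> ennreal (G t) * indicator (regular_points shell h Ups Phi a b n) t"
    proof eventually_elim
      case (elim t)
      then show ?case using le[of t] by (auto simp: regular_points_def split: split_indicator intro: ennreal_leI)
    qed
  qed
  finally show ?thesis .
qed

lemma transfer_selectionD:
  "transfer_selection shell h Ups Phi a b M \<Longrightarrow> t \<in> regular_points shell h Ups Phi a b n \<Longrightarrow>
    M n t \<in> transfer_set shell h Ups Phi 0 n (complex_of_real t)"
  by (auto simp: transfer_selection_def)

text \<open>Common to both statements: \<open>N\<close> is the norm of the transferred vector in one
  and the operator norm in the other. Away from \<open>liminf_singular_set\<close> the point measure
  vanishes, so there the measure of \<open>v\<close> inherits absolute continuity from that of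
  \<open>vinf\<close>.\<close>

lemma Lp_from_bound:
  assumes A2: "\<forall>n. AE l in lborel. mrank (beta shell h Ups Phi n n (complex_of_real l)) = r n"
    and p: "p > 1" and ab: "a < b"
    and N: "\<And>n t. complex_of_real t \<notin> evs 0 n \<Longrightarrow> t \<in> regular_points shell h Ups Phi a b n \<Longrightarrow> hn n t \<le> (N n t)\<^sup>2 \<and> N n t \<ge> 0"
    and fin: "liminf (\<lambda>n. \<integral>\<^sup>+ l\<in>regular_points shell h Ups Phi a b n. ennreal (N n l powr (2 * p)) \<partial>lebesgue) < \<infinity>"
  shows "has_Lp_density_on p {a<..<b} (S.mu vinf)"
    and "purely_ac_on ({a<..<b} - liminf_singular_set shell h Ups Phi) (S.mu v)"
proof -
  obtain C where C: "C \<ge> 0"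
    "\<exists>\<^sub>F n in sequentially. (\<integral>\<^sup>+ l\<in>regular_points shell h Ups Phi a b n. ennreal (N n l powr (2 * p)) \<partial>lebesgue) \<le> ennreal C"
    using liminf_finite_frequently[OF fin] by blast
  have le: "(\<integral>\<^sup>+t\<in>{a..b}. ennreal ((hn n t / pi) powr p) \<partial>lborel) \<le>
      (\<integral>\<^sup>+ l\<in>regular_points shell h Ups Phi a b n. ennreal (N n l powr (2 * p)) \<partial>lebesgue)" for n
  proof (rule density_le_transfer_integral[OF A2])
    fix t assume t: "complex_of_real t \<notin> evs 0 n" "t \<in> regular_points shell h Ups Phi a b n"
    have "hn n t / pi \<le> hn n t / 1" using hn_nonneg pi_ge_two by (intro divide_left_mono) auto
    then have "hn n t / pi \<le> (N n t)\<^sup>2" using N[OF t] by simp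
    then have "(hn n t / pi) powr p \<le> ((N n t)\<^sup>2) powr p" using hn_nonneg p by (intro powr_mono2) auto
    then show "(hn n t / pi) powr p \<le> N n t powr (2 * p)" using N[OF t] by (simp add: powr_twice)
  qed
  have "\<exists>\<^sub>F n in sequentially. (\<integral>\<^sup>+t\<in>{a..b}. ennreal ((hn n t / pi) powr p) \<partial>lborel) \<le> ennreal C"
    using C(2) by (rule frequently_elim1) (use le order_trans in blast)
  then show Lp: "has_Lp_density_on p {a<..<b} (S.mu vinf)" using V.Lp_density ab p C(1) by blast
  show "purely_ac_on ({a<..<b} - liminf_singular_set shell h Ups Phi) (S.mu v)"
    unfolding purely_ac_on_def
  proof (intro ballI impI)
    fix B :: "real set" assume B: "B \<in> sets borel" "B \<subseteq> {a<..<b} - liminf_singular_set shell h Ups Phi" "emeasure lborel B = 0"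
    have "emeasure (S.mu vinf) B = 0"
      using B by (intro Lp_density_null[OF Lp]) (auto simp: null_sets_def)
    moreover have "emeasure (S.mu q) B = 0" using emeasure_nu[OF B(1)] B(2) by (metis Diff_disjoint disjoint_iff subset_iff)
    ultimately show "emeasure (S.mu v) B = 0" by (simp add: mu_split[OF B(1)])
  qed
qed

end

context spectral_hopping
begin

lemma transfer_opnorm:
  assumes t: "complex_of_real t \<notin> evs 0 n" and M: "M \<in> transfer_set shell h Ups Phi 0 n (complex_of_real t)"
  shows "mat_opnorm M \<ge> 0" "hn n t \<le> (mat_opnorm M)\<^sup>2" "1 \<le> 2 * hn n t * (mat_opnorm M)\<^sup>2"
proof -
  have c: "vec_of_list [x, y] \<in> carrier_vec (dim_col M)" for x y
    by (rule carrier_vecI) (simp add: transfer_bounds(3)[OF t M])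
  have le: "vec_l2norm (M *\<^sub>v vec_of_list [0, 1]) \<le> mat_opnorm M" "vec_l2norm (M *\<^sub>v vec_of_list [1, 0]) \<le> mat_opnorm M"
    by (rule vec_l2norm_le_opnorm[OF c eq_refl[OF vec_l2norm_unit(2)]],
        rule vec_l2norm_le_opnorm[OF c eq_refl[OF vec_l2norm_unit(1)]])
  show "mat_opnorm M \<ge> 0" using le(1) vec_l2norm_nonneg order_trans by blast
  \<comment> \<open>The choice \<open>u = 0\<close>.\<close>
  have "hn n t \<le> (vec_l2norm (M *\<^sub>v vec_of_list [0, 1]))\<^sup>2" by (rule transfer_bounds(1)[OF t M])
  also have "\<dots> \<le> (mat_opnorm M)\<^sup>2" by (rule power_mono[OF le(1) vec_l2norm_nonneg])
  finally show "hn n t \<le> (mat_opnorm M)\<^sup>2" .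
  have "1 \<le> 2 * hn n t * (vec_l2norm (M *\<^sub>v vec_of_list [1, 0]))\<^sup>2" by (rule transfer_bounds(2)[OF t M])
  also have "\<dots> \<le> 2 * hn n t * (mat_opnorm M)\<^sup>2"
    using hn_nonneg by (intro mult_left_mono power_mono le(2) vec_l2norm_nonneg) auto
  finally show "1 \<le> 2 * hn n t * (mat_opnorm M)\<^sup>2" .
qed

text \<open>Approximate eigenvectors contradict the boundedness clause in
  \<open>op_spectrum\<close>. The image must be in \<open>X\<close> too, because the definition
  intersects the graph with \<open>X \<times> X\<close>.\<close>

lemma spectrum_approximate:
  assumes "\<And>e. e > 0 \<Longrightarrow> \<exists>x\<in>Dom. x \<noteq> 0 \<and> fn x \<in> X \<and> fn (T x) \<in> X \<and> norm (T x - scaleR l x) \<le> e * norm x"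
  shows "complex_of_real l \<in> op_spectrum X (hop_op h)"
proof (rule ccontr)
  assume "complex_of_real l \<notin> op_spectrum X (hop_op h)"
  then obtain C where C: "\<And>\<psi> \<xi>. (\<psi>, \<xi>) \<in> hop_op h \<Longrightarrow> \<psi> \<in> X \<Longrightarrow> \<xi> \<in> X \<Longrightarrow>
      ell2_norm \<psi> \<le> C * ell2_norm (\<lambda>x. \<xi> x - complex_of_real l * \<psi> x)"
    unfolding op_spectrum_def by fast
  define e where "e = 1 / (2 * (\<bar>C\<bar> + 1))"
  have "e > 0" by (simp add: e_def)
  then obtain x where x: "x \<in> Dom" "x \<noteq> 0" "fn x \<in> X" "fn (T x) \<in> X" "norm (T x - scaleR l x) \<le> e * norm x"
    using assms by blast
  have "(fn x, fn (T x)) \<in> hop_op h" using x(1) by (auto simp: hop_op_eq)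
  then have "ell2_norm (fn x) \<le> C * ell2_norm (\<lambda>a. fn (T x) a - complex_of_real l * fn x a)" using C x by blast
  moreover have "(\<lambda>a. fn (T x) a - complex_of_real l * fn x a) = fn (T x - scaleR l x)" by auto
  ultimately have "norm x \<le> C * norm (T x - scaleR l x)" by (simp only: norm_ell2)
  also have "\<dots> \<le> \<bar>C\<bar> * (e * norm x)" using x(5) by (intro mult_mono) auto
  also have "\<dots> = (\<bar>C\<bar> * e) * norm x" by simp
  also have "\<dots> < 1 * norm x" using x(2) by (intro mult_strict_right_mono) (auto simp: e_def)
  finally show False by simp
qed

text \<open>Removing a null set from a spectral measure is the action of a spectral projection, so
  the absolutely continuous part is again the measure of a vector.\<close>

lemma ac_part_mu:
  obtains N where "N \<in> null_sets lborel" "ac_part (S.mu x) = S.mu (P (- N) x)"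
    "absolutely_continuous lborel (S.mu (P (- N) x))"
proof -
  obtain N where N: "N \<in> null_sets lborel" "ac_part (S.mu x) = density (S.mu x) (indicator (- N))"
    "absolutely_continuous lborel (ac_part (S.mu x))"
    by (rule ac_part_eq[OF S.finite_measure_mu S.sets_mu])
  then have "- N \<in> sets borel" by (auto intro: borel_comp)
  then have "ac_part (S.mu x) = S.mu (P (- N) x)" using N(2) S.mu_P by simp
  then show thesis using that N by simp
qed

text \<open>Localise the absolutely continuous component of \<open>w\<close> to the window of radius
  \<open>e\<close> around \<open>l\<close>: the support condition makes it nonzero, the window makes
  it almost an eigenvector, and absolute continuity survives both the projection and
  \<open>T\<close>.\<close>

lemma ac_approximate_eigenvectors:
  assumes l: "l \<in> measure_support (ac_part (S.mu w))" and e: "e > 0"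
  shows "\<exists>x\<in>Dom. x \<noteq> 0 \<and> fn x \<in> ac_subspace E \<and> fn (T x) \<in> ac_subspace E \<and> norm (T x - scaleR l x) \<le> e * norm x"
proof -
  obtain N where N: "ac_part (S.mu w) = S.mu (P (- N) w)" "absolutely_continuous lborel (S.mu (P (- N) w))"
    by (rule ac_part_mu)
  define B where "B = {l - e<..<l + e}"
  have B: "B \<in> sets borel" "B \<subseteq> {l - e..l + e}" by (auto simp: B_def)
  define x where "x = P B (P (- N) w)"
  have "open B \<and> l \<in> B" using e by (simp add: B_def)
  then have "emeasure (S.mu (P (- N) w)) B > 0" using l unfolding N(1) measure_support_def by blast
  then have x0: "x \<noteq> 0" using S.P_eq_zero_iff[OF B(1), of "P (- N) w"] by (auto simp: x_def)
  have "P B x = x" unfolding x_def by (rule S.P_idem[OF B(1)])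
  note x = S.window_approximate_eigenvector[OF B this less_imp_le[OF e]]
  have ac: "absolutely_continuous lborel (S.mu x)" unfolding x_def by (rule S.absolutely_continuous_mu_P[OF N(2) B(1)])
  then have "fn x \<in> ac_subspace E" by (simp add: ac_subspace_def spectral_measure_fn fn_ell2)
  moreover have "fn (T x) \<in> ac_subspace E"
    using S.absolutely_continuous_mu_T[OF x(1) ac] by (simp add: ac_subspace_def spectral_measure_fn fn_ell2)
  ultimately show ?thesis using x x0 by blast
qed

lemma ac_support_subset_spectra:
  "measure_support (ac_part (S.mu w)) \<subseteq> ac_spectrum (hop_op h) E"
  "measure_support (ac_part (S.mu w)) \<subseteq> real_spectrum (hop_op h)"
proof -
  show "measure_support (ac_part (S.mu w)) \<subseteq> ac_spectrum (hop_op h) E"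
    unfolding ac_spectrum_def using spectrum_approximate ac_approximate_eigenvectors by blast
  have "ac_subspace E \<subseteq> ell2" by (auto simp: ac_subspace_def)
  then show "measure_support (ac_part (S.mu w)) \<subseteq> real_spectrum (hop_op h)"
    unfolding real_spectrum_def using ac_approximate_eigenvectors
    by (intro subsetI CollectI spectrum_approximate) blast
qed

lemma transfer_bounded_positive:
  assumes A2: "\<forall>n. AE l in lborel. mrank (beta shell h Ups Phi n n (complex_of_real l)) = r n"
    and p: "p > 1" and M: "transfer_selection shell h Ups Phi a b M"
    and fin: "liminf (\<lambda>n. \<integral>\<^sup>+ l\<in>regular_points shell h Ups Phi a b n. ennreal (mat_opnorm (M n l) powr (2 * p)) \<partial>lebesgue) < \<infinity>"
    and cd: "a \<le> c" "c < d" "d \<le> b"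
  shows "emeasure (S.mu vinf) {c<..<d} > 0"
proof -
  obtain C where C: "C \<ge> 0"
    "\<exists>\<^sub>F n in sequentially. (\<integral>\<^sup>+ l\<in>regular_points shell h Ups Phi a b n. ennreal (mat_opnorm (M n l) powr (2 * p)) \<partial>lebesgue) \<le> ennreal C"
    using liminf_finite_frequently[OF fin] by blast
  have le: "(\<integral>\<^sup>+t\<in>{a..b}. ennreal (2 * m - 2 * pi * m\<^sup>2 * (hn n t / pi)) \<partial>lborel) \<le>
      (\<integral>\<^sup>+ l\<in>regular_points shell h Ups Phi a b n. ennreal (mat_opnorm (M n l) powr (2 * p)) \<partial>lebesgue)" if m: "m \<ge> 2" for m n
  proof (rule density_le_transfer_integral[OF A2])
    fix t assume t: "complex_of_real t \<notin> evs 0 n" "t \<in> regular_points shell h Ups Phi a b n"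
    note bd = transfer_opnorm[OF t(1) transfer_selectionD[OF M t(2)]]
    show "2 * m - 2 * pi * m\<^sup>2 * (hn n t / pi) \<le> mat_opnorm (M n t) powr (2 * p)"
      using transfer_am_gm[OF bd(3,1) m p] by simp
  qed
  have "\<exists>\<^sub>F n in sequentially. \<forall>m\<ge>2. (\<integral>\<^sup>+t\<in>{a..b}. ennreal (2 * m - 2 * pi * m\<^sup>2 * (hn n t / pi)) \<partial>lborel) \<le> ennreal C"
    using C(2) by (rule frequently_elim1) (use le order_trans in blast)
  \<comment> \<open>\<open>kappa = 2 * pi\<close> combines the \<open>2\<close> of
    \<open>transfer_am_gm\<close> with the normalisation \<open>hn n / pi\<close>.\<close>
  then show ?thesis by (intro V.limit_positive[OF cd _ C(1), where kappa = "2 * pi"]) simp_all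
qed

text \<open>The measure of \<open>vinf\<close> charges every subinterval and ignores null sets, so
  the measure of \<open>v\<close> charges every subinterval minus a null set. The null set is taken
  to be the carrier of the singular part for the support, and the countable singular set for the
  positive mass.\<close>

lemma transfer_bounded_support:
  assumes Lp: "has_Lp_density_on p {a<..<b} (S.mu vinf)" and ab: "a < b"
    and pos: "\<And>c d. a \<le> c \<Longrightarrow> c < d \<Longrightarrow> d \<le> b \<Longrightarrow> emeasure (S.mu vinf) {c<..<d} > 0"
  shows "{a..b} \<subseteq> measure_support (ac_part (S.mu v))"
    and "0 < emeasure (S.mu v) ({a<..<b} - liminf_singular_set shell h Ups Phi)"
proof -
  have diff: "emeasure (S.mu v) ({c<..<d} - N) > 0" if cd: "a \<le> c" "c < d" "d \<le> b" and N: "N \<in> null_sets lborel" for c d N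
  proof -
    have Nb: "N \<in> sets borel" using N by auto
    have "N \<inter> {c<..<d} \<in> null_sets lborel" using N by (intro null_set_Int2) auto
    then have "emeasure (S.mu vinf) (N \<inter> {c<..<d}) = 0" using cd by (intro Lp_density_null[OF Lp]) auto
    then have "emeasure (S.mu vinf) ({c<..<d} - N \<inter> {c<..<d}) = emeasure (S.mu vinf) {c<..<d}"
      using Nb by (intro emeasure_Diff_null_set) (auto simp: null_sets_def)
    also have "{c<..<d} - N \<inter> {c<..<d} = {c<..<d} - N" by auto
    finally show ?thesis using pos[OF cd] mu_split[of "{c<..<d} - N"] Nb by (simp add: add_pos_nonneg add_nonneg_pos)
  qed
  have "countable (liminf_singular_set shell h Ups Phi)" using countable_Lam L_Lam by (rule countable_subset[rotated])
  then show "0 < emeasure (S.mu v) ({a<..<b} - liminf_singular_set shell h Ups Phi)"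
    using diff[of a b] ab by (intro diff) (auto intro: countable_imp_null_set_lborel)
  obtain N where N: "N \<in> null_sets lborel" "ac_part (S.mu v) = S.mu (P (- N) v)"
    by (rule ac_part_mu)
  have Nb: "N \<in> sets borel" using N by auto
  show "{a..b} \<subseteq> measure_support (ac_part (S.mu v))"
    unfolding measure_support_def
  proof (intro subsetI CollectI allI impI)
    fix l U assume l: "l \<in> {a..b}" and U: "open U \<and> l \<in> U"
    then obtain e where e: "e > 0" "\<And>y. dist y l < e \<Longrightarrow> y \<in> U" unfolding open_dist by blast
    \<comment> \<open>Clamping to \<open>{a..b}\<close> leaves a nonempty open interval also at the
      end points, which therefore belong to the support.\<close>
    define c where "c = max a (l - e)"
    define d where "d = min b (l + e)"
    have cd: "a \<le> c" "c < d" "d \<le> b" using l e(1) ab by (auto simp: c_def d_def)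
    have sub: "{c<..<d} \<subseteq> U" by (rule subsetI, rule e(2)) (auto simp: c_def d_def dist_real_def abs_less_iff)
    have "0 < emeasure (S.mu v) ({c<..<d} - N)" by (rule diff[OF cd N(1)])
    also have "\<dots> = emeasure (S.mu (P (- N) v)) {c<..<d}"
      using Nb S.P_Int[of "{c<..<d}" "- N" v] by (simp add: S.emeasure_mu Diff_eq borel_comp)
    also have "\<dots> \<le> emeasure (S.mu (P (- N) v)) U" using sub U by (intro emeasure_mono) auto
    finally show "0 < emeasure (ac_part (S.mu v)) U" by (simp add: N(2))
  qed
qed

end

text \<open>Dominance of \<open>\<nu>\<close> by \<open>\<mu>\<close> is stated first because it
  makes \<open>diff_measure \<mu> \<nu>\<close> a genuine difference of measures. That there is
  spectrum off \<open>L\<close> is expressed in two ways: by positive mass of \<open>\<mu>\<close>,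
  and by a point of the spectrum of the operator.\<close>

theorem theorem4:
  fixes shell :: "nat \<Rightarrow> 'a list"
    and h :: "'a \<Rightarrow> 'a \<Rightarrow> complex"
    and \<Upsilon> \<Phi> :: "nat \<Rightarrow> complex mat"
    and E :: "real set \<Rightarrow> ('a \<Rightarrow> complex) \<Rightarrow> ('a \<Rightarrow> complex)"
    and \<mu> \<nu> :: "real measure"
    and L :: "real set"
  assumes "shell_hopping shell h"
    and "hop_factorization shell h \<Upsilon> \<Phi>"
    and "essentially_self_adjoint (hop_min h)"
    and A1: "\<forall>n. hop_rank shell h n \<le> hop_rank shell h (Suc n)"
    and A2: "\<forall>n. AE l in lborel.
      mrank (beta shell h \<Upsilon> \<Phi> n n (complex_of_real l)) = hop_rank shell h n"
    and E: "spectral_resolution (hop_op h) E"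
    and \<mu>: "\<mu> = spectral_measure E (root_vector shell \<Upsilon>)"
    and \<nu>: "\<nu> = finite_point_measure h (root_vector shell \<Upsilon>)"
    and L: "L = liminf_singular_set shell h \<Upsilon> \<Phi>"
  shows "(\<forall>B\<in>sets borel. emeasure \<nu> B \<le> emeasure \<mu> B) \<and>
    (\<forall>p a b T u.
      1 < p \<longrightarrow> a < b \<longrightarrow>
      transfer_selection shell h \<Upsilon> \<Phi> a b T \<longrightarrow>
      (\<forall>n. u n \<in> borel_measurable (restrict_space lebesgue {a..b})) \<longrightarrow>
      liminf (\<lambda>n. \<integral>\<^sup>+ l\<in>regular_points shell h \<Upsilon> \<Phi> a b n.
        ennreal (vec_l2norm (T n l *\<^sub>v vec_of_list [u n l, 1]) powr (2 * p)) \<partial>lebesgue) < \<infinity> \<longrightarrow>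
      has_Lp_density_on p {a<..<b} (diff_measure \<mu> \<nu>) \<and>
      purely_ac_on ({a<..<b} - L) \<mu>) \<and>
    (\<forall>p a b T.
      1 < p \<longrightarrow> a < b \<longrightarrow>
      transfer_selection shell h \<Upsilon> \<Phi> a b T \<longrightarrow>
      liminf (\<lambda>n. \<integral>\<^sup>+ l\<in>regular_points shell h \<Upsilon> \<Phi> a b n.
        ennreal (mat_opnorm (T n l) powr (2 * p)) \<partial>lebesgue) < \<infinity> \<longrightarrow>
      {a..b} \<subseteq> measure_support (ac_part \<mu>) \<and>
      measure_support (ac_part \<mu>) \<subseteq> ac_spectrum (hop_op h) E \<and>
      has_Lp_density_on p {a<..<b} (diff_measure \<mu> \<nu>) \<and>
      purely_ac_on ({a<..<b} - L) \<mu> \<and>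
      0 < emeasure \<mu> ({a<..<b} - L) \<and>
      ({a<..<b} - L) \<inter> real_spectrum (hop_op h) \<noteq> {})"
proof -
  interpret spectral_hopping shell h \<Upsilon> \<Phi> E
    using assms by (intro spectral_hopping.intro factored_hopping.intro sa_hopping.intro
      sa_hopping_axioms.intro factored_hopping_axioms.intro spectral_hopping_axioms.intro)
  have mu: "\<mu> = S.mu v" and nu: "\<nu> = finite_point_measure h (fn v)"
    by (simp_all add: \<mu> \<nu> root_vector_fn spectral_measure_fn)
  have diff: "diff_measure \<mu> \<nu> = S.mu vinf" unfolding mu nu by (rule diff_measure_nu)
  show ?thesis
  proof (intro conjI allI impI ballI)
    fix B :: "real set" assume "B \<in> sets borel"
    then show "emeasure \<nu> B \<le> emeasure \<mu> B" by (simp add: mu nu emeasure_nu(1) mu_split)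
  next
    fix p a b :: real and T u
    assume *: "1 < p" "a < b" and T: "transfer_selection shell h \<Upsilon> \<Phi> a b T"
      and fin: "liminf (\<lambda>n. \<integral>\<^sup>+ l\<in>regular_points shell h \<Upsilon> \<Phi> a b n.
        ennreal (vec_l2norm (T n l *\<^sub>v vec_of_list [u n l, 1]) powr (2 * p)) \<partial>lebesgue) < \<infinity>"
    have "hn n t \<le> (vec_l2norm (T n t *\<^sub>v vec_of_list [u n t, 1]))\<^sup>2 \<and> vec_l2norm (T n t *\<^sub>v vec_of_list [u n t, 1]) \<ge> 0"
      if t: "complex_of_real t \<notin> evs 0 n" "t \<in> regular_points shell h \<Upsilon> \<Phi> a b n" for n t
      using transfer_bounds(1)[OF t(1) transfer_selectionD[OF T t(2)]] vec_l2norm_nonneg by blast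
    note b = Lp_from_bound[OF A2 * this fin]
    show "has_Lp_density_on p {a<..<b} (diff_measure \<mu> \<nu>)" unfolding diff by (rule b)
    show "purely_ac_on ({a<..<b} - L) \<mu>" unfolding mu L by (rule b)
  next
    fix p a b :: real and T
    assume *: "1 < p" "a < b" and T: "transfer_selection shell h \<Upsilon> \<Phi> a b T"
      and fin: "liminf (\<lambda>n. \<integral>\<^sup>+ l\<in>regular_points shell h \<Upsilon> \<Phi> a b n.
        ennreal (mat_opnorm (T n l) powr (2 * p)) \<partial>lebesgue) < \<infinity>"
    have "hn n t \<le> (mat_opnorm (T n t))\<^sup>2 \<and> mat_opnorm (T n t) \<ge> 0"
      if t: "complex_of_real t \<notin> evs 0 n" "t \<in> regular_points shell h \<Upsilon> \<Phi> a b n" for n t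
      using transfer_opnorm[OF t(1) transfer_selectionD[OF T t(2)]] by blast
    note b = Lp_from_bound[OF A2 * this fin]
    note s = transfer_bounded_support[OF b(1) *(2) transfer_bounded_positive[OF A2 *(1) T fin]]
    show "has_Lp_density_on p {a<..<b} (diff_measure \<mu> \<nu>)" unfolding diff by (rule b)
    show "purely_ac_on ({a<..<b} - L) \<mu>" unfolding mu L by (rule b)
    show "{a..b} \<subseteq> measure_support (ac_part \<mu>)" unfolding mu by (rule s)
    show "measure_support (ac_part \<mu>) \<subseteq> ac_spectrum (hop_op h) E" unfolding mu by (rule ac_support_subset_spectra)
    show pos: "0 < emeasure \<mu> ({a<..<b} - L)" unfolding mu L by (rule s)
    \<comment> \<open>Positive mass rules out an empty set, and the whole open interval lies in the
      spectrum through the support inclusion.\<close>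
    then have "{a<..<b} - L \<noteq> {}" by (metis emeasure_empty less_irrefl)
    moreover have "{a<..<b} \<subseteq> real_spectrum (hop_op h)"
      using s(1) ac_support_subset_spectra(2)[of v] greaterThanLessThan_subseteq_atLeastAtMost_iff[of a b a b] by blast
    ultimately show "({a<..<b} - L) \<inter> real_spectrum (hop_op h) \<noteq> {}" by blast
  qed
qed

end
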